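(* Let $n\in\mathbb N$, $\delta\in\{0,1\}$ and $\mathbf G\in\{F_{n,\delta},G_n,H_n\}$. Then, for each nonzero prime ideal $\mathfrak p$ of $\mathcal O$, with $q=|\mathcal O:\mathfrak p|$ and $\mathfrak o=\mathcal O_{\mathfrak p}$, $$\mathcal Z^{\mathrm{irr}}_{\mathbf G(\mathfrak o)}(s_1,s_2)=\frac{1}{1-q^{\bar a(\mathbf G,n)-s_2}}\sum_{I\subseteq[n-1]_0}f_{\mathbf G,I}(q^{-1})\prod_{i\in I}\frac{q^{\bar a(\mathbf G,i)-(n-i)s_1-s_2}}{1-q^{\bar a(\mathbf G,i)-(n-i)s_1-s_2}},$$ where, for $I=\{i_1<\dots<i_l\}\subseteq[n-1]_0$ and $i\in[n]_0$: - for $\mathbf G=F_{n,\delta}$: $f_{\mathbf G,I}(X)=\binom nI_{X^2}(X^{2(i_1+\delta)+1};X^2)_{n-i_1}$ and $\bar a(\mathbf G,i)=\binom{2n+\delta}2-\binom{2i+\delta}2+2i+\delta$; - for $\mathbf G=G_n$: $f_{\mathbf G,I}(X)=\binom nI_X(X^{i_1+1};X)_{n-i_1}$ and $\bar a(\mathbf G,i)=n^2-i^2+2i$; - for $\mathbf G=H_n$: $f_{\mathbf G,I}(X)=\Bigl(\prod_{j=1}^l(X^2;X^2)^{-1}_{\lfloor\mu_j/2\rfloor}\Bigr)(X^{i_1+1};X)_{n-i_1}$ and $\bar a(\mathbf G,i)=\binom{n+1}2-\binom{i+1}2+2i$.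
   Context: Combinatorial notation. $[n]=\{1,\dots,n\}$, $[n]_0=\{0,1,\dots,n\}$. $(\underline n)_X=1-X^n$, $(\underline n)_X!=(\underline n)_X(\underline{n-1})_X\cdots(\underline 1)_X$, and for integers $a\ge b\ge0$, $\binom ab_X=\frac{(\underline a)_X!}{(\underline b)_X!(\underline{a-b})_X!}$. For $I=\{i_1<\dots<i_l\}\subseteq[n-1]_0$ put $i_0=0$, $i_{l+1}=n$, $\mu_j=i_{j+1}-i_j$ for $0\le j\le l$, and $\binom nI_X=\binom n{i_l}_X\binom{i_l}{i_{l-1}}_X\cdots\binom{i_2}{i_1}_X$. $(X;Y)_m=\prod_{i=0}^{m-1}(1-XY^i)$. For $I=\varnothing$ ($l=0$) one has $i_1=n$ and all products are empty, so $f_{\mathbf G,\varnothing}=1$. Arithmetic notation. $K$ is a number field with ring of integers $\mathcal O$. For a nonzero prime ideal $\mathfrak p$ of $\mathcal O$, $\mathfrak o=\mathcal O_{\mathfrak p}$ is the completion of $\mathcal O$ at $\mathfrak p$; its maximal ideal is again denoted $\mathfrak p$. Lie lattices. For $n\in\mathbb N=\{1,2,\dots\}$ and $\delta\in\{0,1\}$ let $\mathcal F_{n,\delta},\mathcal G_n,\mathcal H_n$ be the free $\mathbb Z$-modules, with class-$2$ nilpotent Lie bracket, with the following bases and relations (all brackets of basis elements not determined by the given ones through antisymmetry are zero; in particular all $y_{ij}$ are central): - $\mathcal F_{n,\delta}$: basis $x_k$ ($1\le k\le 2n+\delta$), $y_{ij}$ ($1\le i<j\le 2n+\delta$); $[x_i,x_j]=y_{ij}$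 for $i<j$. - $\mathcal G_n$: basis $x_k$ ($1\le k\le 2n$), $y_{ij}$ ($1\le i,j\le n$); $[x_i,x_{n+j}]=y_{ij}$. - $\mathcal H_n$: basis $x_k$ ($1\le k\le 2n$), $y_{ij}$ ($1\le i\le j\le n$); $[x_i,x_{n+j}]=[x_j,x_{n+i}]=y_{ij}$ for $i\le j$. Group schemes. For $\Lambda\in\{\mathcal F_{n,\delta},\mathcal G_n,\mathcal H_n\}$, the associated unipotent group scheme over $\mathcal O$ is denoted $F_{n,\delta}$, $G_n$, $H_n$, respectively. For a commutative $\mathcal O$-algebra $R$, its group of $R$-points is the set $\Lambda\otimes_{\mathbb Z}R$ with multiplication $g*h=g+h+\beta(g,h)$, where $\beta$ is the $R$-bilinear map with $\beta(x_i,x_j)=[x_i,x_j]$ if $i>j$, $\beta(x_i,x_j)=0$ if $i\le j$, and $\beta=0$ if one argument is some $y_{ij}$. (Thus group commutators are given by the Lie bracket.) Zeta functions. For a finite group $G$, let $r_m(G)$ be the number of isomorphism classes of $m$-dimensional irreducible complex representations of $G$, and $\zeta^{\mathrm{irr}}_G(s)=\sum_{m\ge1}r_m(G)m^{-s}$. Then $$\mathcal Z^{\mathrm{irr}}_{\mathbf G(\mathfrak o)}(s_1,s_2)=\sum_{N=0}^\infty\zeta^{\mathrm{irr}}_{\mathbf G(\mathfrak o/\mathfrak p^N)}(s_1)\,q^{-Ns_2},$$ for complex variables $s_1,s_2$ with sufficiently large real parts (where the series converges). *)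

theory Defs
  imports
    "HOL-Analysis.Analysis"
    "HOL-Algebra.QuotRing"
    "HOL-Algebra.Ideal_Product"
    "Jordan_Normal_Form.VS_Connect"
begin

section \<open>Combinatorial notation\<close>

definition gauss :: "nat \<Rightarrow> 'a::field \<Rightarrow> 'a" where
  "gauss a x = 1 - x ^ a"

definition gauss_fact :: "nat \<Rightarrow> 'a::field \<Rightarrow> 'a" where
  "gauss_fact a x = (\<Prod>k=1..a. gauss k x)"

definition gauss_binom :: "nat \<Rightarrow> nat \<Rightarrow> 'a::field \<Rightarrow> 'a" where
  "gauss_binom a b x = gauss_fact a x / (gauss_fact b x * gauss_fact (a - b) x)"

definition qpoch :: "'a::field \<Rightarrow> 'a \<Rightarrow> nat \<Rightarrow> 'a" where
  "qpoch x y m = (\<Prod>i<m. 1 - x * y ^ i)"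

text \<open>For \<open>I = {i\<^sub>1 < \<dots> < i\<^sub>l}\<close>, \<open>idx n I j\<close> is \<open>i\<^sub>j\<close>, with \<open>i\<^sub>0 = 0\<close> and \<open>i\<^sub>j = n\<close> for
  \<open>j = l + 1\<close>; in particular \<open>idx n {} 1 = n\<close>.\<close>

definition idx :: "nat \<Rightarrow> nat set \<Rightarrow> nat \<Rightarrow> nat" where
  "idx n I j = (if j = 0 then 0 else if j \<le> card I then sorted_list_of_set I ! (j - 1) else n)"

definition gap :: "nat \<Rightarrow> nat set \<Rightarrow> nat \<Rightarrow> nat" where
  "gap n I j = idx n I (j + 1) - idx n I j"

definition gauss_multinom :: "nat \<Rightarrow> nat set \<Rightarrow> 'a::field \<Rightarrow> 'a" where
  "gauss_multinom n I x = (\<Prod>j=1..card I. gauss_binom (idx n I (j + 1)) (idx n I j) x)"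


section \<open>The Lie lattices\<close>

datatype lattice_type = FType nat | GType | HType

datatype basis_elt = BX nat | BY nat nat

fun num_x :: "lattice_type \<Rightarrow> nat \<Rightarrow> nat" where
  "num_x (FType d) n = 2 * n + d"
| "num_x GType n = 2 * n"
| "num_x HType n = 2 * n"

fun y_indices :: "lattice_type \<Rightarrow> nat \<Rightarrow> (nat \<times> nat) set" where
  "y_indices (FType d) n = {(i, j). 1 \<le> i \<and> i < j \<and> j \<le> 2 * n + d}"
| "y_indices GType n = {(i, j). 1 \<le> i \<and> i \<le> n \<and> 1 \<le> j \<and> j \<le> n}"
| "y_indices HType n = {(i, j). 1 \<le> i \<and> i \<le> j \<and> j \<le> n}"

definition lattice_basis :: "lattice_type \<Rightarrow> nat \<Rightarrow> basis_elt set" where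
  "lattice_basis T n = BX ` {1..num_x T n} \<union> (\<lambda>(i, j). BY i j) ` y_indices T n"

text \<open>Elements of the lattice are represented by their coordinate functions with respect to
  \<open>lattice_basis\<close>.\<close>

definition unit_coord :: "basis_elt \<Rightarrow> basis_elt \<Rightarrow> int" where
  "unit_coord b c = (if c = b then 1 else 0)"

text \<open>The defining relations: \<open>[x\<^sub>i, x\<^sub>k]\<close> for \<open>i < k\<close>. In type \<open>H\<close>, both \<open>[x\<^sub>i, x\<^bsub>n+j\<^esub>]\<close> and
  \<open>[x\<^sub>j, x\<^bsub>n+i\<^esub>]\<close> are \<open>y\<^bsub>ij\<^esub>\<close> for \<open>i \<le> j\<close>, whence the minimum and maximum.\<close>

fun x_relation :: "lattice_type \<Rightarrow> nat \<Rightarrow> nat \<Rightarrow> nat \<Rightarrow> basis_elt \<Rightarrow> int" where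
  "x_relation (FType d) n i k = unit_coord (BY i k)"
| "x_relation GType n i k =
     (if i \<le> n \<and> n < k then unit_coord (BY i (k - n)) else (\<lambda>_. 0))"
| "x_relation HType n i k =
     (if i \<le> n \<and> n < k then unit_coord (BY (min i (k - n)) (max i (k - n))) else (\<lambda>_. 0))"

fun lie_bracket :: "lattice_type \<Rightarrow> nat \<Rightarrow> basis_elt \<Rightarrow> basis_elt \<Rightarrow> basis_elt \<Rightarrow> int" where
  "lie_bracket T n (BX i) (BX k) =
     (if i < k then x_relation T n i k
      else if k < i then (\<lambda>c. - x_relation T n k i c)
      else (\<lambda>_. 0))"
| "lie_bracket T n (BY i j) b = (\<lambda>_. 0)"
| "lie_bracket T n (BX i) (BY j k) = (\<lambda>_. 0)"


section \<open>The groups of points\<close>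

fun beta_basis :: "lattice_type \<Rightarrow> nat \<Rightarrow> basis_elt \<Rightarrow> basis_elt \<Rightarrow> basis_elt \<Rightarrow> int" where
  "beta_basis T n (BX i) (BX j) = (if i > j then lie_bracket T n (BX i) (BX j) else (\<lambda>_. 0))"
| "beta_basis T n (BY i j) b = (\<lambda>_. 0)"
| "beta_basis T n (BX i) (BY j k) = (\<lambda>_. 0)"

definition beta ::
  "lattice_type \<Rightarrow> nat \<Rightarrow> ('r, 'm) ring_scheme \<Rightarrow> (basis_elt \<Rightarrow> 'r) \<Rightarrow> (basis_elt \<Rightarrow> 'r) \<Rightarrow> basis_elt \<Rightarrow> 'r" where
  "beta T n R g h c =
     (\<Oplus>\<^bsub>R\<^esub>a\<in>lattice_basis T n. \<Oplus>\<^bsub>R\<^esub>b\<in>lattice_basis T n.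
        [beta_basis T n a b c] \<cdot>\<^bsub>R\<^esub> (g a \<otimes>\<^bsub>R\<^esub> h b))"

text \<open>\<open>\<Lambda> \<otimes>\<^sub>\<int> R\<close> is the free \<open>R\<close>-module on \<open>lattice_basis T n\<close>, given by coordinates in \<open>R\<close>.\<close>

definition point_group ::
  "lattice_type \<Rightarrow> nat \<Rightarrow> ('r, 'm) ring_scheme \<Rightarrow> (basis_elt \<Rightarrow> 'r) monoid" where
  "point_group T n R =
     \<lparr>carrier = lattice_basis T n \<rightarrow>\<^sub>E carrier R,
      monoid.mult = (\<lambda>g h. \<lambda>c\<in>lattice_basis T n. (g c \<oplus>\<^bsub>R\<^esub> h c) \<oplus>\<^bsub>R\<^esub> beta T n R g h c),
      one = (\<lambda>c\<in>lattice_basis T n. \<zero>\<^bsub>R\<^esub>)\<rparr>"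


section \<open>Representation zeta functions of finite groups\<close>

definition GL :: "nat \<Rightarrow> complex mat monoid" where
  "GL m = units_of (ring_mat TYPE(complex) m ())"

definition irreps :: "('g, 'b) monoid_scheme \<Rightarrow> nat \<Rightarrow> ('g \<Rightarrow> complex mat) set" where
  "irreps G m =
     {\<rho> \<in> hom G (GL m). m > 0 \<and>
        (\<forall>W. subspace class_ring W (module_vec TYPE(complex) m) \<longrightarrow>
             (\<forall>g\<in>carrier G. \<forall>w\<in>W. \<rho> g *\<^sub>v w \<in> W) \<longrightarrow>
             W = {0\<^sub>v m} \<or> W = carrier_vec m)}"

definition irrep_iso ::
  "('g, 'b) monoid_scheme \<Rightarrow> nat \<Rightarrow> (('g \<Rightarrow> complex mat) \<times> ('g \<Rightarrow> complex mat)) set" where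
  "irrep_iso G m =
     {(\<rho>, \<sigma>). \<rho> \<in> irreps G m \<and> \<sigma> \<in> irreps G m \<and>
        (\<exists>A\<in>carrier (GL m). \<forall>g\<in>carrier G. A * \<rho> g = \<sigma> g * A)}"

definition num_irreps :: "('g, 'b) monoid_scheme \<Rightarrow> nat \<Rightarrow> nat" where
  "num_irreps G m = card (irreps G m // irrep_iso G m)"

text \<open>For finite \<open>G\<close> only finitely many terms are nonzero.\<close>

definition zeta_irr :: "('g, 'b) monoid_scheme \<Rightarrow> complex \<Rightarrow> complex" where
  "zeta_irr G s = (\<Sum>\<^sub>\<infinity>m\<in>{1..}. of_nat (num_irreps G m) * of_nat m powr (- s))"


section \<open>Number fields and completions\<close>

text \<open>The type \<open>'k\<close>, a field of characteristic \<open>0\<close>, is a number field if it is finite-dimensional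
  over the rationals.\<close>

definition number_field :: "'k::field_char_0 itself \<Rightarrow> bool" where
  "number_field _ \<longleftrightarrow>
     (\<exists>B :: 'k set. finite B \<and> Modules.module.span (\<lambda>r x. of_rat r * x) B = UNIV)"

definition integer_ring :: "'k::field_char_0 ring" where
  "integer_ring =
     \<lparr>carrier = {x. algebraic_int x}, monoid.mult = (*), one = 1, zero = 0, add = (+)\<rparr>"

definition ideal_pow :: "('a, 'b) ring_scheme \<Rightarrow> 'a set \<Rightarrow> nat \<Rightarrow> 'a set" where
  "ideal_pow R I N = I [^]\<^bsub>ideals_set R\<^esub> N"

definition residue_pow :: "('a, 'b) ring_scheme \<Rightarrow> 'a set \<Rightarrow> nat \<Rightarrow> 'a set ring" where
  "residue_pow R I N = R Quot ideal_pow R I N"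

text \<open>The inverse limit of the rings \<open>R / I\<^sup>N\<close>. A coset of \<open>I\<close> to the power \<open>N + 1\<close> is mapped to
  a coset of \<open>I\<close> to the power \<open>N\<close> by the canonical projection iff it is contained in it.\<close>

definition adic_completion :: "('a, 'b) ring_scheme \<Rightarrow> 'a set \<Rightarrow> (nat \<Rightarrow> 'a set) ring" where
  "adic_completion R I =
     \<lparr>carrier = {f. \<forall>N. f N \<in> carrier (residue_pow R I N) \<and> f (Suc N) \<subseteq> f N},
      monoid.mult = (\<lambda>f g N. f N \<otimes>\<^bsub>residue_pow R I N\<^esub> g N),
      one = (\<lambda>N. \<one>\<^bsub>residue_pow R I N\<^esub>),
      zero = (\<lambda>N. \<zero>\<^bsub>residue_pow R I N\<^esub>),
      add = (\<lambda>f g N. f N \<oplus>\<^bsub>residue_pow R I N\<^esub> g N)\<rparr>"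

text \<open>The kernel of the projection of the completion onto \<open>R / I\<close>. If \<open>I\<close> is a maximal ideal of
  \<open>R\<close>, it is the unique maximal ideal of the completion.\<close>

definition completion_ideal :: "('a, 'b) ring_scheme \<Rightarrow> 'a set \<Rightarrow> (nat \<Rightarrow> 'a set) set" where
  "completion_ideal R I = {f \<in> carrier (adic_completion R I). f 1 = \<zero>\<^bsub>residue_pow R I 1\<^esub>}"


section \<open>The bivariate zeta function\<close>

text \<open>Here \<open>R\<close> is a complete local ring with maximal ideal \<open>M\<close> and residue field of
  cardinality \<open>q\<close>.\<close>

definition bivariate_term ::
  "lattice_type \<Rightarrow> nat \<Rightarrow> ('r, 'm) ring_scheme \<Rightarrow> 'r set \<Rightarrow> nat \<Rightarrow> complex \<Rightarrow> complex \<Rightarrow> nat \<Rightarrow> complex" where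
  "bivariate_term T n R M q s1 s2 N =
     zeta_irr (point_group T n (residue_pow R M N)) s1 * of_nat q powr (- (of_nat N * s2))"

definition bivariate_zeta ::
  "lattice_type \<Rightarrow> nat \<Rightarrow> ('r, 'm) ring_scheme \<Rightarrow> 'r set \<Rightarrow> nat \<Rightarrow> complex \<Rightarrow> complex \<Rightarrow> complex" where
  "bivariate_zeta T n R M q s1 s2 = (\<Sum>N. bivariate_term T n R M q s1 s2 N)"


section \<open>The data of the explicit formula\<close>

fun f_poly :: "lattice_type \<Rightarrow> nat \<Rightarrow> nat set \<Rightarrow> 'a::field \<Rightarrow> 'a" where
  "f_poly (FType d) n I x =
     gauss_multinom n I (x\<^sup>2) * qpoch (x ^ (2 * (idx n I 1 + d) + 1)) (x\<^sup>2) (n - idx n I 1)"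
| "f_poly GType n I x = gauss_multinom n I x * qpoch (x ^ (idx n I 1 + 1)) x (n - idx n I 1)"
| "f_poly HType n I x =
     (\<Prod>j=1..card I. inverse (qpoch (x\<^sup>2) (x\<^sup>2) (gap n I j div 2))) *
     qpoch (x ^ (idx n I 1 + 1)) x (n - idx n I 1)"

fun abar :: "lattice_type \<Rightarrow> nat \<Rightarrow> nat \<Rightarrow> int" where
  "abar (FType d) n i = int ((2 * n + d) choose 2) - int ((2 * i + d) choose 2) + int (2 * i + d)"
| "abar GType n i = (int n)\<^sup>2 - (int i)\<^sup>2 + 2 * int i"
| "abar HType n i = int ((n + 1) choose 2) - int ((i + 1) choose 2) + 2 * int i"

definition qmonomial ::
  "lattice_type \<Rightarrow> nat \<Rightarrow> nat \<Rightarrow> complex \<Rightarrow> complex \<Rightarrow> nat \<Rightarrow> complex" where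
  "qmonomial T n q s1 s2 i = of_nat q powr (of_int (abar T n i) - of_nat (n - i) * s1 - s2)"

end

theory Submission
  imports Defs "HOL-Algebra.Multiplicative_Group" "Jordan_Normal_Form.Spectral_Radius" "Jordan_Normal_Form.Char_Poly"
begin

text \<open>
  Each quotient of the ring of integers by a power of \<open>P\<close> is a finite chain ring with an additive character that is nontrivial on every nonzero
  ideal. Over such a ring the group of points has class \<open>2\<close>, and the irreducible characters lying over a
  given central character all have the same degree, whose square is the index of the radical of the
  alternating form attached to that character. The zeta function is thus a power sum, over all \<open>w\<close>, of the
  cardinalities of the radicals of the generic matrices \<open>form T n w\<close>. Averages of such powers are computed
  by elimination: a unit entry of minimal valuation is pivoted away, and the Schur complement is again a
  uniformly distributed generic matrix. Solving the resulting recursion row by row shows that the terms of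
  the series satisfy a triangular linear recursion in the level, whose generating function is the sum over
  chains \<open>I\<close>.
\<close>

section \<open>Linear characters of finite groups and how many ways they extend\<close>

section \<open>Groups of nilpotency class two\<close>

text \<open>An orbit method would divide by 2 and lose the primes above 2. The representations are
  therefore induced from maximal isotropic subgroups, and the commutator is read off from the
  asymmetric \<open>beta\<close>, whose values in the two orders differ by the Lie bracket. The
  residue rings have zero divisors, so a quotient by a power of the uniformizer is determined only
  up to an annihilator; Schur complements are written with products in which one factor is divided
  and the other remains divisible, and such products do not depend on the choice. To keep the
  entries independent, the recursion tracks the set \<open>A\<close> of rows already known to be
  divisible by one more power than the fresh rows \<open>F\<close>; the averages turn out to depend
  on the sizes of the two sets only. The weights solving it are the proportions of matrices of given
  corank over the residue field. Symmetric matrices need 2 by 2 pivot blocks, since in residue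
  characteristic 2 they cannot always be diagonalized. Finally, \<open>1 + s / 2\<close>, the
  exponent of the cardinality of the radical, joins the number of extensions of a central character
  to the degree.\<close>

definition chars :: "('g, 'b) monoid_scheme => 'g set => ('g => complex) set" where
  "chars G H = {\<phi> \<in> extensional H. \<phi> \<one>\<^bsub>G\<^esub> = 1 \<and> (\<forall>x\<in>H. \<forall>y\<in>H. \<phi> (x \<otimes>\<^bsub>G\<^esub> y) = \<phi> x * \<phi> y)}"

text \<open>The subgroup generated by \<open>K\<close> and \<open>g\<close> when \<open>g\<close>
  normalizes \<open>K\<close>. Natural exponents suffice because the group is finite.\<close>

definition adjoin :: "('g, 'b) monoid_scheme => 'g set => 'g => 'g set" where
  "adjoin G K g = {k \<otimes>\<^bsub>G\<^esub> g [^]\<^bsub>G\<^esub> n | k n. k \<in> K \<and> n \<in> (UNIV :: nat set)}"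

definition extensions :: "('g, 'b) monoid_scheme => 'g set => 'g set => ('g => complex) => ('g => complex) set" where
  "extensions G K H l = {\<omega> \<in> chars G H. \<forall>k\<in>K. \<omega> k = l k}"

lemma charsD:
  assumes "\<phi> \<in> chars G H"
  shows "\<phi> \<one>\<^bsub>G\<^esub> = 1" "x \<in> H ==> y \<in> H ==> \<phi> (x \<otimes>\<^bsub>G\<^esub> y) = \<phi> x * \<phi> y"
    "\<phi> \<in> extensional H"
  using assms by (auto simp: chars_def)

context group
begin

text \<open>The inverse of \<open>x\<close> is the power \<open>x [^] (order G - 1)\<close>, so
  closure under products gives closure under inverses.\<close>

lemma subgroup_of_finite:
  assumes fin: "finite (carrier G)" and sub: "H \<subseteq> carrier G" and one: "\<one> \<in> H"
    and cl: "!!x y. x \<in> H ==> y \<in> H ==> x \<otimes> y \<in> H"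
  shows "subgroup H G"
proof
  show "H \<subseteq> carrier G" "\<one> \<in> H" by fact+
  show "!!x y. x \<in> H ==> y \<in> H ==> x \<otimes> y \<in> H" by fact
  fix x assume x: "x \<in> H"
  have pw: "x [^] n \<in> H" for n :: nat
    by (induction n) (use x one cl in auto)
  have xc: "x \<in> carrier G" using x sub by auto
  have pos: "0 < order G" using fin one sub by (auto simp: order_def card_gt_0_iff)
  have "x [^] (order G - 1) \<otimes> x = x [^] order G"
    using pos xc by (metis Suc_diff_1 nat_pow_Suc)
  also have "\<dots> = \<one>" using xc by (rule pow_order_eq_1)
  finally have "inv x = x [^] (order G - 1)"
    using xc by (metis inv_equality nat_pow_closed)
  then show "inv x \<in> H" using pw by simp
qed

lemma chars_nonzero:
  assumes "\<phi> \<in> chars G H" "subgroup H G" "x \<in> H"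
  shows "\<phi> x \<noteq> 0"
proof -
  have "\<phi> x * \<phi> (inv x) = 1"
    using assms charsD[OF assms(1)] subgroup.m_inv_closed[OF assms(2,3)]
    by (metis r_inv subgroup.mem_carrier)
  then show ?thesis by auto
qed

lemma chars_pow:
  assumes "\<phi> \<in> chars G H" "subgroup H G" "x \<in> H"
  shows "\<phi> (x [^] (n::nat)) = \<phi> x ^ n"
proof (induction n)
  case 0 then show ?case using charsD[OF assms(1)] by simp
next
  case (Suc n)
  have "x [^] n \<in> H"
    using assms(2,3) by (induction n) (auto simp: subgroup.one_closed subgroup.m_closed)
  then show ?case using charsD(2)[OF assms(1) _ assms(3)] Suc by (simp add: mult.commute)
qed

lemma pow_in_subgroup: "subgroup H G ==> x \<in> H ==> x [^] (n::nat) \<in> H"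
  by (induction n) (auto simp: subgroup.one_closed subgroup.m_closed)

lemma pow_swap:
  assumes K: "subgroup K G" and g: "g \<in> carrier G"
    and sw: "!!k. k \<in> K ==> \<exists>k'\<in>K. g \<otimes> k = k' \<otimes> g" and k: "k \<in> K"
  shows "\<exists>k'\<in>K. g [^] (n::nat) \<otimes> k = k' \<otimes> g [^] n"
  using k
proof (induction n arbitrary: k)
  case 0 then show ?case using K by (auto intro!: bexI[of _ k] simp: subgroup.mem_carrier)
next
  case (Suc n)
  have Kc: "!!k. k \<in> K ==> k \<in> carrier G" using K by (simp add: subgroup.mem_carrier)
  obtain k' where k': "k' \<in> K" "g \<otimes> k = k' \<otimes> g" using sw Suc by blast
  obtain k'' where k'': "k'' \<in> K" "g [^] n \<otimes> k' = k'' \<otimes> g [^] n" using Suc k' by blast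
  have "g [^] Suc n \<otimes> k = g [^] n \<otimes> (g \<otimes> k)" using g Kc Suc by (simp add: m_assoc)
  also have "\<dots> = (g [^] n \<otimes> k') \<otimes> g" using g Kc k' by (simp add: m_assoc)
  also have "\<dots> = k'' \<otimes> g [^] Suc n" using g Kc k'' by (simp add: m_assoc)
  finally show ?case using k'' by blast
qed

lemma subgroup_adjoin:
  assumes fin: "finite (carrier G)" and K: "subgroup K G" and g: "g \<in> carrier G"
    and sw: "!!k. k \<in> K ==> \<exists>k'\<in>K. g \<otimes> k = k' \<otimes> g"
  shows "subgroup (adjoin G K g) G" "K \<subseteq> adjoin G K g" "g \<in> adjoin G K g"
proof -
  have Kc: "!!k. k \<in> K ==> k \<in> carrier G" using K by (simp add: subgroup.mem_carrier)
  have K1: "\<one> \<in> K" using K by (simp add: subgroup.one_closed)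
  show s: "K \<subseteq> adjoin G K g"
  proof
    fix k assume "k \<in> K"
    then show "k \<in> adjoin G K g"
      unfolding adjoin_def by (auto intro!: exI[of _ k] exI[of _ "0::nat"] simp: Kc)
  qed
  show "g \<in> adjoin G K g"
    unfolding adjoin_def using g K1 by (auto intro!: exI[of _ \<one>] exI[of _ "1::nat"])
  show "subgroup (adjoin G K g) G"
  proof (rule subgroup_of_finite[OF fin])
    show "adjoin G K g \<subseteq> carrier G" using g Kc by (auto simp: adjoin_def)
    show "\<one> \<in> adjoin G K g" using s K1 by auto
    fix x y assume "x \<in> adjoin G K g" "y \<in> adjoin G K g"
    then obtain k m k' n where x: "x = k \<otimes> g [^] (m::nat)" "k \<in> K" and y: "y = k' \<otimes> g [^] (n::nat)" "k' \<in> K"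
      by (auto simp: adjoin_def)
    obtain k'' where k'': "k'' \<in> K" "g [^] m \<otimes> k' = k'' \<otimes> g [^] m" using pow_swap[OF K g sw y(2)] by blast
    have "x \<otimes> y = k \<otimes> (g [^] m \<otimes> k') \<otimes> g [^] n" using x y g Kc by (simp add: m_assoc)
    also have "\<dots> = (k \<otimes> k'') \<otimes> g [^] (m + n)" using x k'' g Kc by (simp add: m_assoc nat_pow_mult[symmetric])
    finally show "x \<otimes> y \<in> adjoin G K g" unfolding adjoin_def
      using subgroup.m_closed[OF K x(2) k''(1)] by blast
  qed
qed

text \<open>\<open>d\<close> is the order of \<open>g\<close> modulo \<open>K\<close>. Two normal
  forms with exponents \<open>i < j\<close> would put the power \<open>g [^] (j - i)\<close>, with
  exponent below \<open>d\<close>, into \<open>K\<close>.\<close>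

lemma adjoin_unique:
  assumes K: "subgroup K G" and g: "g \<in> carrier G"
    and d: "0 < d" "g [^] d \<in> K" "!!e. 0 < e ==> e < d ==> g [^] (e::nat) \<notin> K"
    and k: "k \<in> K" "k' \<in> K" and i: "i < d" "j < d" and eq: "k \<otimes> g [^] i = k' \<otimes> g [^] j"
  shows "k = k' \<and> i = j"
proof -
  have Kc: "!!k. k \<in> K ==> k \<in> carrier G" using K by (simp add: subgroup.mem_carrier)
  have *: "i = j" if le: "i \<le> j" and kk: "k \<in> K" "k' \<in> K" and "j < d" and eq: "k \<otimes> g [^] i = k' \<otimes> g [^] j" for k k' i j
  proof (rule ccontr)
    assume "i \<noteq> j"
    then obtain e where e: "j = e + i" "0 < e" using le that[of "j - i"] by auto
    have "k \<otimes> g [^] i = (k' \<otimes> g [^] e) \<otimes> g [^] i"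
      using eq e kk Kc g by (simp add: m_assoc nat_pow_mult)
    then have "k = k' \<otimes> g [^] e" using kk Kc g by (simp add: right_cancel)
    then have "g [^] e = inv k' \<otimes> k" using kk Kc g by (simp add: inv_solve_left)
    then have "g [^] e \<in> K" using kk K by (simp add: subgroup.m_closed subgroup.m_inv_closed)
    then show False using d(3)[of e] e that by auto
  qed
  have "i = j" using *[of i j k k'] *[of j i k' k] k i eq by (cases i j rule: le_cases) auto
  then show ?thesis using eq k Kc g by simp
qed

text \<open>\<open>c\<close> is the value to be taken at \<open>g\<close>, hence a
  \<open>d\<close>-th root of the value prescribed at \<open>g [^] d\<close>. The rule sending
  \<open>k g^n\<close> to \<open>l k * c ^ n\<close> is multiplicative because, by
  \<open>sw\<close>, moving \<open>g\<close> past \<open>k\<close> costs only an element on which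
  \<open>l\<close> is 1.\<close>

lemma extend_char:
  assumes fin: "finite (carrier G)" and K: "subgroup K G" and g: "g \<in> carrier G"
    and l: "l \<in> chars G K"
    and sw: "!!k. k \<in> K ==> \<exists>z\<in>K. l z = 1 \<and> g \<otimes> k = z \<otimes> (k \<otimes> g)"
    and d: "0 < d" "g [^] d \<in> K" "!!e. 0 < e ==> e < d ==> g [^] (e::nat) \<notin> K"
    and c: "c ^ d = l (g [^] d)"
  shows "\<exists>m \<in> extensions G K (adjoin G K g) l. m g = c"
proof -
  have Kc: "!!k. k \<in> K ==> k \<in> carrier G" using K by (simp add: subgroup.mem_carrier)
  have K1: "\<one> \<in> K" using K by (simp add: subgroup.one_closed)
  have lm: "l (x \<otimes> y) = l x * l y" if "x \<in> K" "y \<in> K" for x y using charsD[OF l] that by auto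
  have Km: "x \<otimes> y \<in> K" if "x \<in> K" "y \<in> K" for x y using K that by (simp add: subgroup.m_closed)
  have uniq: "\<exists>!p. fst p \<in> K \<and> snd p < d \<and> x = fst p \<otimes> g [^] snd p" if xa: "x \<in> adjoin G K g" for x
  proof -
    obtain k n where x: "x = k \<otimes> g [^] (n::nat)" "k \<in> K" using xa by (auto simp: adjoin_def)
    have "g [^] n = (g [^] d) [^] (n div d) \<otimes> g [^] (n mod d)"
      using g by (simp add: nat_pow_pow nat_pow_mult)
    then have "x = (k \<otimes> (g [^] d) [^] (n div d)) \<otimes> g [^] (n mod d)"
      using x g Kc by (simp add: m_assoc)
    moreover have "k \<otimes> (g [^] d) [^] (n div d) \<in> K" by (rule subgroup.m_closed[OF K x(2) pow_in_subgroup[OF K d(2)]])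
    ultimately have "\<exists>p. fst p \<in> K \<and> snd p < d \<and> x = fst p \<otimes> g [^] snd p"
      using d(1) by (intro exI[of _ "(k \<otimes> (g [^] d) [^] (n div d), n mod d)"]) auto
    then show ?thesis
    proof (rule ex_ex1I)
      fix p p' assume "fst p \<in> K \<and> snd p < d \<and> x = fst p \<otimes> g [^] snd p" "fst p' \<in> K \<and> snd p' < d \<and> x = fst p' \<otimes> g [^] snd p'"
      then show "p = p'" using adjoin_unique[OF K g d, of "fst p" "fst p'" "snd p" "snd p'"] by (auto intro: prod_eqI)
    qed
  qed
  \<comment> \<open>The unique normal form of an element; \<open>m\<close> is defined through
    it.\<close>
  define P where "P x = (THE p. fst p \<in> K \<and> snd p < d \<and> x = fst p \<otimes> g [^] snd p)" for x
  have PP: "P (k \<otimes> g [^] i) = (k, i)" if "k \<in> K" "i < d" for k i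
    unfolding P_def by (rule the1_equality[OF uniq]) (use that in \<open>auto simp: adjoin_def\<close>)
  define m where "m = restrict (\<lambda>x. l (fst (P x)) * c ^ snd (P x)) (adjoin G K g)"
  \<comment> \<open>The formula holds for every exponent: powers of \<open>g [^] d\<close> are moved
    into \<open>K\<close>, and \<open>c ^ d = l (g [^] d)\<close> makes both readings agree.\<close>
  have mm: "m (k \<otimes> g [^] (n::nat)) = l k * c ^ n" if k: "k \<in> K" for k n
  proof -
    have gg: "g [^] n = (g [^] d) [^] (n div d) \<otimes> g [^] (n mod d)"
      using g by (simp add: nat_pow_pow nat_pow_mult)
    define k' where "k' = k \<otimes> (g [^] d) [^] (n div d)"
    have k': "k' \<in> K" unfolding k'_def by (rule subgroup.m_closed[OF K k pow_in_subgroup[OF K d(2)]])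
    have eq: "k \<otimes> g [^] n = k' \<otimes> g [^] (n mod d)"
      using gg k g Kc by (simp add: k'_def m_assoc)
    have "k \<otimes> g [^] n \<in> adjoin G K g" using k by (auto simp: adjoin_def)
    then have "m (k \<otimes> g [^] n) = l k' * c ^ (n mod d)"
      unfolding m_def using PP[OF k', of "n mod d"] d(1) eq by simp
    also have "l k' = l k * l (g [^] d) ^ (n div d)"
      unfolding k'_def using k d(2) K chars_pow[OF l K d(2)] by (simp add: lm pow_in_subgroup)
    also have "\<dots> * c ^ (n mod d) = l k * (c ^ (d * (n div d)) * c ^ (n mod d))"
      by (simp add: c[symmetric] power_mult)
    also have "\<dots> = l k * c ^ n" by (simp add: power_add[symmetric])
    finally show ?thesis .
  qed
  have mK: "m k = l k" if "k \<in> K" for k using mm[OF that, of 0] that Kc by simp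
  have lz: "l k \<noteq> 0" if "k \<in> K" for k using chars_nonzero[OF l K that] .
  have sw2: "\<exists>z\<in>K. l z = 1 \<and> g [^] (n::nat) \<otimes> k = z \<otimes> (k \<otimes> g [^] n)" if k: "k \<in> K" for n k
  proof (induction n)
    case 0 then show ?case using k Kc K1 charsD(1)[OF l] by (auto intro!: bexI[of _ \<one>])
  next
    case (Suc n)
    obtain z where z: "z \<in> K" "l z = 1" "g [^] n \<otimes> k = z \<otimes> (k \<otimes> g [^] n)" using Suc by blast
    obtain y where y: "y \<in> K" "l y = 1" "g \<otimes> (z \<otimes> k) = y \<otimes> (z \<otimes> k \<otimes> g)" using sw[OF Km[OF z(1) k]] by blast
    have "g [^] Suc n \<otimes> k = g \<otimes> (g [^] n \<otimes> k)" using g k Kc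
      by (metis m_assoc nat_pow_Suc2 nat_pow_closed)
    also have "\<dots> = (g \<otimes> (z \<otimes> k)) \<otimes> g [^] n" using z g k Kc by (simp add: m_assoc)
    also have "\<dots> = y \<otimes> (z \<otimes> k \<otimes> g) \<otimes> g [^] n" using y by simp
    also have "\<dots> = (y \<otimes> z) \<otimes> (k \<otimes> (g \<otimes> g [^] n))" using y z g k Kc by (simp add: m_assoc)
    also have "\<dots> = (y \<otimes> z) \<otimes> (k \<otimes> g [^] Suc n)" using g by (metis nat_pow_Suc2)
    finally show ?case using y z by (intro bexI[of _ "y \<otimes> z"]) (auto simp: lm Km)
  qed
  have "m (x \<otimes> y) = m x * m y" if xy: "x \<in> adjoin G K g" "y \<in> adjoin G K g" for x y
  proof -
    obtain k i k' j where x: "x = k \<otimes> g [^] (i::nat)" "k \<in> K" and y: "y = k' \<otimes> g [^] (j::nat)" "k' \<in> K"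
      using xy by (auto simp: adjoin_def)
    obtain z where z: "z \<in> K" "l z = 1" "g [^] i \<otimes> k' = z \<otimes> (k' \<otimes> g [^] i)" using sw2[OF y(2)] by blast
    have "x \<otimes> y = k \<otimes> (g [^] i \<otimes> k') \<otimes> g [^] j" using x y g Kc by (simp add: m_assoc)
    also have "\<dots> = (k \<otimes> (z \<otimes> k')) \<otimes> g [^] (i + j)" using x y z g Kc by (simp add: m_assoc nat_pow_mult[symmetric])
    finally have "m (x \<otimes> y) = l (k \<otimes> (z \<otimes> k')) * c ^ (i + j)" using x y z by (simp add: mm Km)
    also have "\<dots> = m x * m y" using x y z by (simp add: mm lm Km power_add)
    finally show ?thesis .
  qed
  moreover have "m \<one> = 1" using mK[OF K1] charsD(1)[OF l] by simp
  moreover have "m \<in> extensional (adjoin G K g)" by (simp add: m_def)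
  ultimately have "m \<in> extensions G K (adjoin G K g) l"
    using mK by (auto simp: extensions_def chars_def)
  moreover have "m g = c" using mm[OF K1, of 1] g charsD(1)[OF l] by simp
  ultimately show ?thesis by blast
qed

lemma exists_least_power:
  assumes fin: "finite (carrier G)" and K: "subgroup K G" and g: "g \<in> carrier G"
  obtains d :: nat where "0 < d" "g [^] d \<in> K" "!!e. 0 < e ==> e < d ==> g [^] e \<notin> K"
proof -
  have "0 < order G" using fin g by (auto simp: order_def card_gt_0_iff)
  moreover have "g [^] order G \<in> K" using g K by (simp add: pow_order_eq_1 subgroup.one_closed)
  ultimately have ex: "\<exists>d::nat. 0 < d \<and> g [^] d \<in> K" by blast
  show thesis
  proof (rule that)
    show "0 < (LEAST d::nat. 0 < d \<and> g [^] d \<in> K)" "g [^] (LEAST d::nat. 0 < d \<and> g [^] d \<in> K) \<in> K"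
      using LeastI_ex[OF ex] by auto
  qed (use not_less_Least in auto)
qed

lemma card_adjoin:
  assumes K: "subgroup K G" and g: "g \<in> carrier G"
    and d: "0 < d" "g [^] d \<in> K" "!!e. 0 < e ==> e < d ==> g [^] (e::nat) \<notin> K"
  shows "card (adjoin G K g) = d * card K"
proof -
  have Kc: "!!k. k \<in> K ==> k \<in> carrier G" using K by (simp add: subgroup.mem_carrier)
  have "adjoin G K g = (\<lambda>(k, i). k \<otimes> g [^] i) ` (K \<times> {..<d})"
  proof (intro equalityI subsetI)
    fix x assume "x \<in> adjoin G K g"
    then obtain k n where x: "x = k \<otimes> g [^] (n::nat)" "k \<in> K" by (auto simp: adjoin_def)
    have "g [^] n = (g [^] d) [^] (n div d) \<otimes> g [^] (n mod d)"
      using g by (simp add: nat_pow_pow nat_pow_mult)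
    then have "x = (k \<otimes> (g [^] d) [^] (n div d)) \<otimes> g [^] (n mod d)"
      using x g Kc by (simp add: m_assoc)
    moreover have "k \<otimes> (g [^] d) [^] (n div d) \<in> K"
      by (rule subgroup.m_closed[OF K x(2) pow_in_subgroup[OF K d(2)]])
    ultimately show "x \<in> (\<lambda>(k, i). k \<otimes> g [^] i) ` (K \<times> {..<d})" using d(1) by force
  qed (auto simp: adjoin_def)
  moreover have "inj_on (\<lambda>(k, i). k \<otimes> g [^] i) (K \<times> {..<d})"
    using adjoin_unique[OF K g d] by (auto simp: inj_on_def)
  ultimately show ?thesis by (simp add: card_image card_cartesian_product)
qed

text \<open>The count is the index of \<open>K\<close> in \<open>H\<close>. Adjoin one
  \<open>g\<close> of order \<open>d\<close> modulo \<open>K\<close>: there are \<open>d\<close>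
  extensions of \<open>l\<close> to the larger group, one for each \<open>d\<close>-th root of
  \<open>l (g [^] d)\<close>, and each inherits the commutator condition, so the induction applies
  to it.\<close>

lemma card_extensions_aux:
  assumes fin: "finite (carrier G)" and H: "subgroup H G"
  shows "subgroup K G ==> K \<subseteq> H ==> l \<in> chars G K ==>
    (!!x y. x \<in> H ==> y \<in> H ==> \<exists>z\<in>K. l z = 1 \<and> x \<otimes> y = z \<otimes> (y \<otimes> x)) ==>
    finite (extensions G K H l) \<and> card (extensions G K H l) * card K = card H"
proof (induction "card H - card K" arbitrary: K l rule: less_induct)
  case less
  note K = less.prems(1) and KH = less.prems(2) and l = less.prems(3) and comm = less.prems(4)
  have Hc: "!!k. k \<in> H ==> k \<in> carrier G" using H by (simp add: subgroup.mem_carrier)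
  have finH: "finite H" using fin Hc by (meson finite_subset subsetI)
  show ?case
  proof (cases "K = H")
    case True
    have "extensions G K H l = {l}"
      using l True by (auto simp: extensions_def chars_def intro: extensionalityI)
    then show ?thesis using True by simp
  next
    case False
    then obtain g where gH: "g \<in> H" "g \<notin> K" using KH by blast
    have g: "g \<in> carrier G" using gH Hc by simp
    have sw: "\<exists>z\<in>K. l z = 1 \<and> g \<otimes> k = z \<otimes> (k \<otimes> g)" if "k \<in> K" for k
      using comm[OF gH(1)] that KH by blast
    have sw': "\<exists>k'\<in>K. g \<otimes> k = k' \<otimes> g" if k: "k \<in> K" for k
    proof -
      obtain z where z: "z \<in> K" "g \<otimes> k = z \<otimes> (k \<otimes> g)" using sw[OF k] by blast
      have "g \<otimes> k = (z \<otimes> k) \<otimes> g"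
        using z k g subgroup.mem_carrier[OF K] by (simp add: m_assoc)
      then show ?thesis using subgroup.m_closed[OF K z(1) k] by blast
    qed
    obtain d where d: "0 < d" "g [^] d \<in> K" "!!e. 0 < e ==> e < d ==> g [^] (e::nat) \<notin> K"
      using exists_least_power[OF fin K g] by blast
    define K' where "K' = adjoin G K g"
    have K': "subgroup K' G" "K \<subseteq> K'" "g \<in> K'" using subgroup_adjoin[OF fin K g sw'] by (auto simp: K'_def)
    have K'H: "K' \<subseteq> H"
    proof
      fix x assume "x \<in> K'"
      then obtain k n where x: "x = k \<otimes> g [^] (n::nat)" "k \<in> K" by (auto simp: K'_def adjoin_def)
      show "x \<in> H" unfolding x(1) using subgroup.m_closed[OF H _ pow_in_subgroup[OF H gH(1)]] x(2) KH by blast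
    qed
    have "K \<subset> K'" using K' gH by blast
    then have lt: "card K < card K'" using finH K'H by (meson finite_subset psubset_card_mono)
    have leH: "card K' \<le> card H" using K'H finH by (simp add: card_mono)
    \<comment> \<open>One chosen extension to \<open>K'\<close> for each admissible value
      \<open>c\<close> at \<open>g\<close>. An extension to \<open>K'\<close> is determined by this
      value, so these are all of them.\<close>
    define m where "m c = (SOME m. m \<in> extensions G K K' l \<and> m g = c)" for c
    define C where "C = {c. c ^ d = l (g [^] d)}"
    have lz: "l (g [^] d) \<noteq> 0" using chars_nonzero[OF l K d(2)] .
    have cardC: "card C = d" unfolding C_def using card_nth_roots[OF lz d(1)] .
    have finC: "finite C" using cardC d(1) card.infinite by fastforce
    have mc: "m c \<in> extensions G K K' l \<and> m c g = c" if "c \<in> C" for c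
    proof -
      have "\<exists>m. m \<in> extensions G K K' l \<and> m g = c"
        using extend_char[OF fin K g l sw d, of c] that by (auto simp: K'_def C_def)
      from someI_ex[OF this] show ?thesis by (simp add: m_def)
    qed
    have IH: "finite (extensions G K' H (m c)) \<and> card (extensions G K' H (m c)) * card K' = card H" if c: "c \<in> C" for c
    proof (rule less.hyps)
      show "card H - card K' < card H - card K" using lt leH by linarith
      show "subgroup K' G" "K' \<subseteq> H" by fact+
      show "m c \<in> chars G K'" using mc[OF c] by (simp add: extensions_def)
      show "\<exists>z\<in>K'. m c z = 1 \<and> x \<otimes> y = z \<otimes> (y \<otimes> x)" if xy: "x \<in> H" "y \<in> H" for x y
      proof -
        obtain z where z: "z \<in> K" "l z = 1" "x \<otimes> y = z \<otimes> (y \<otimes> x)" using comm[OF xy] by blast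
        have "m c z = 1" using mc[OF c] z by (simp add: extensions_def)
        then show ?thesis using z K'(2) by blast
      qed
    qed
    have eq: "extensions G K H l = (\<Union>c\<in>C. extensions G K' H (m c))"
    proof (intro equalityI subsetI)
      fix w assume w: "w \<in> extensions G K H l"
      then have wc: "w \<in> chars G H" and wl: "!!k. k \<in> K ==> w k = l k" by (auto simp: extensions_def)
      have cC: "w g \<in> C" using chars_pow[OF wc H gH(1), of d] wl[OF d(2)] by (simp add: C_def)
      have "w x = m (w g) x" if x: "x \<in> K'" for x
      proof -
        obtain k n where x: "x = k \<otimes> g [^] (n::nat)" "k \<in> K" using x by (auto simp: K'_def adjoin_def)
        have "w x = w k * w (g [^] n)"
          unfolding x(1) using x(2) KH by (intro charsD(2)[OF wc] pow_in_subgroup[OF H gH(1)]) auto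
        then have "w x = l k * w g ^ n"
          using x(2) wl chars_pow[OF wc H gH(1)] by simp
        moreover have "m (w g) x = l k * w g ^ n"
        proof -
          have mw: "m (w g) \<in> chars G K'" "!!k. k \<in> K ==> m (w g) k = l k" "m (w g) g = w g"
            using mc[OF cC] by (auto simp: extensions_def)
          have "m (w g) x = m (w g) k * m (w g) (g [^] n)"
            unfolding x(1) using x(2) K'(2) by (intro charsD(2)[OF mw(1)] pow_in_subgroup[OF K'(1,3)]) auto
          then show ?thesis using x(2) mw chars_pow[OF mw(1) K'(1,3)] by simp
        qed
        ultimately show ?thesis by simp
      qed
      then show "w \<in> (\<Union>c\<in>C. extensions G K' H (m c))" using cC wc by (auto simp: extensions_def)
    next
      fix w assume "w \<in> (\<Union>c\<in>C. extensions G K' H (m c))"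
      then obtain c where c: "c \<in> C" "w \<in> extensions G K' H (m c)" by blast
      have "w k = l k" if "k \<in> K" for k
        using that c(2) mc[OF c(1)] K'(2) by (auto simp: extensions_def)
      then show "w \<in> extensions G K H l" using c(2) by (simp add: extensions_def)
    qed
    have disj: "extensions G K' H (m c) \<inter> extensions G K' H (m c') = {}" if "c \<in> C" "c' \<in> C" "c \<noteq> c'" for c c'
    proof -
      have *: "w g = c" if "c \<in> C" "w \<in> extensions G K' H (m c)" for w c
      proof -
        have "w g = m c g" using that(2) K'(3) by (simp add: extensions_def)
        then show ?thesis using mc[OF that(1)] by simp
      qed
      show ?thesis using *[OF \<open>c \<in> C\<close>] *[OF \<open>c' \<in> C\<close>] \<open>c \<noteq> c'\<close> by blast
    qed
    have "card (extensions G K H l) = (\<Sum>c\<in>C. card (extensions G K' H (m c)))"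
      unfolding eq using finC IH disj by (intro card_UN_disjoint) auto
    then have "card (extensions G K H l) * card K' = (\<Sum>c\<in>C. card H)"
      using IH by (simp add: sum_distrib_right)
    also have "\<dots> = d * card H" using cardC by simp
    finally have "card (extensions G K H l) * (d * card K) = d * card H"
      using card_adjoin[OF K g d] by (simp add: K'_def)
    then have "card (extensions G K H l) * card K = card H" using d(1) by simp
    moreover have "finite (extensions G K H l)" unfolding eq using finC IH by blast
    ultimately show ?thesis by simp
  qed
qed

lemmas card_extensions = card_extensions_aux[THEN conjunct2]
lemmas finite_extensions = card_extensions_aux[THEN conjunct1]

end

section \<open>Complex matrix representations: Schur's lemma and orthogonality\<close>

lemma mat_mult_entry:
  assumes "A \<in> carrier_mat m n" "B \<in> carrier_mat n l" "i < m" "j < l"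
  shows "(A * B) $$ (i, j) = (\<Sum>k=0..<n. A $$ (i, k) * B $$ (k, j))"
  using assms by (auto simp: scalar_prod_def intro!: sum.cong)

lemma subspace_vec_iff:
  "VectorSpace.subspace class_ring W (module_vec TYPE(complex) m) \<longleftrightarrow>
     W \<subseteq> carrier_vec m \<and> 0\<^sub>v m \<in> W \<and> (\<forall>x\<in>W. \<forall>y\<in>W. x + y \<in> W) \<and> (\<forall>c. \<forall>x\<in>W. c \<cdot>\<^sub>v x \<in> W)"
  using vec_vs[where ?'a = complex, of m] vec_module[where ?'a = complex, of m]
  by (auto simp: VectorSpace.subspace_def LinearCombinations.submodule_def module_vec_def)

lemma carrier_GL: "carrier (GL m) = Units (ring_mat TYPE(complex) m ())"
  by (simp add: GL_def units_of_def)

lemma mult_GL: "A \<otimes>\<^bsub>GL m\<^esub> B = A * B"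
  by (simp add: GL_def units_of_def ring_mat_def)

lemma GL_iff_det: "A \<in> carrier (GL m) \<longleftrightarrow> A \<in> carrier_mat m m \<and> Determinant.det A \<noteq> 0"
  using unit_imp_det_non_zero[of A m "()"] det_non_zero_imp_unit[of A m "()"]
  by (auto simp: carrier_GL Units_def ring_mat_def)

context group
begin

text \<open>The image of the unit element is an invertible idempotent, hence the identity
  matrix.\<close>

lemma hom_GL_D:
  assumes "\<rho> \<in> hom G (GL m)"
  shows "g \<in> carrier G ==> \<rho> g \<in> carrier_mat m m"
    "g \<in> carrier G ==> h \<in> carrier G ==> \<rho> (g \<otimes> h) = \<rho> g * \<rho> h"
    "\<rho> \<one> = 1\<^sub>m m"
proof -
  show 1: "\<rho> g \<in> carrier_mat m m" if "g \<in> carrier G" for g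
    using assms that by (auto simp: hom_def GL_iff_det)
  show 2: "\<rho> (g \<otimes> h) = \<rho> g * \<rho> h" if "g \<in> carrier G" "h \<in> carrier G" for g h
    using assms that by (auto simp: hom_def mult_GL)
  have "\<rho> \<one> \<in> Units (ring_mat TYPE(complex) m ())" using assms by (auto simp: hom_def carrier_GL)
  then obtain X where X: "X \<in> carrier_mat m m" "X * \<rho> \<one> = 1\<^sub>m m"
    by (auto simp: Units_def ring_mat_def)
  have "\<rho> \<one> = (X * \<rho> \<one>) * \<rho> \<one>" using X 1[of \<one>] by simp
  also have "\<dots> = X * (\<rho> \<one> * \<rho> \<one>)" using X 1[of \<one>] by (intro assoc_mult_mat) auto
  also have "\<dots> = 1\<^sub>m m" using 2[of \<one> \<one>] X by simp
  finally show "\<rho> \<one> = 1\<^sub>m m" .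
qed

lemma hom_GL_I:
  assumes 1: "!!g. g \<in> carrier G ==> \<rho> g \<in> carrier_mat m m"
    and 2: "!!g h. g \<in> carrier G ==> h \<in> carrier G ==> \<rho> (g \<otimes> h) = \<rho> g * \<rho> h"
    and 3: "\<rho> \<one> = 1\<^sub>m m"
  shows "\<rho> \<in> hom G (GL m)"
proof -
  have "\<rho> g \<in> Units (ring_mat TYPE(complex) m ())" if g: "g \<in> carrier G" for g
    using 1[OF g] 1[of "inv g"] 2[of g "inv g"] 2[of "inv g" g] 3 g
    by (auto simp: Units_def ring_mat_def intro!: bexI[of _ "\<rho> (inv g)"])
  then show ?thesis using 2 by (auto simp: hom_def carrier_GL mult_GL)
qed

lemma irreps_invariant:
  assumes "\<rho> \<in> irreps G m" "W \<subseteq> carrier_vec m" "0\<^sub>v m \<in> W"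
    "!!x y. x \<in> W ==> y \<in> W ==> x + y \<in> W" "!!c x. x \<in> W ==> c \<cdot>\<^sub>v x \<in> W"
    "!!g w. g \<in> carrier G ==> w \<in> W ==> \<rho> g *\<^sub>v w \<in> W"
  shows "W = {0\<^sub>v m} \<or> W = carrier_vec m"
  using assms by (auto simp: irreps_def subspace_vec_iff)

text \<open>Schur's lemma through the kernel: the vectors killed by \<open>T\<close> form an
  invariant subspace once \<open>T\<close> can be moved past every \<open>\<rho> g\<close>. The
  matrix \<open>S\<close> may vary with \<open>g\<close>, which covers intertwiners into another
  representation as well as endomorphisms shifted by a scalar.\<close>

lemma irreps_kernel:
  assumes r: "\<rho> \<in> irreps G m" and T: "T \<in> carrier_mat m m"
    and comm: "!!g. g \<in> carrier G ==> \<exists>S \<in> carrier_mat m m. T * \<rho> g = S * T"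
    and ker: "v \<in> carrier_vec m" "v \<noteq> 0\<^sub>v m" "T *\<^sub>v v = 0\<^sub>v m"
  shows "T = 0\<^sub>m m m"
proof -
  define W where "W = {v \<in> carrier_vec m. T *\<^sub>v v = 0\<^sub>v m}"
  have rc: "\<rho> g \<in> carrier_mat m m" if "g \<in> carrier G" for g
    using r that hom_GL_D(1) by (auto simp: irreps_def)
  have "W = {0\<^sub>v m} \<or> W = carrier_vec m"
  proof (rule irreps_invariant[OF r])
    show "W \<subseteq> carrier_vec m" by (auto simp: W_def)
    show "0\<^sub>v m \<in> W" using T by (auto simp: W_def)
    show "x + y \<in> W" if "x \<in> W" "y \<in> W" for x y
      using that T mult_add_distrib_mat_vec[OF T, of x y] by (auto simp: W_def)
    show "c \<cdot>\<^sub>v x \<in> W" if "x \<in> W" for c x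
      using that T mult_mat_vec[OF T, of x c] by (auto simp: W_def)
    fix g w assume g: "g \<in> carrier G" and w: "w \<in> W"
    obtain S where S: "S \<in> carrier_mat m m" "T * \<rho> g = S * T" using comm[OF g] by blast
    have w: "w \<in> carrier_vec m" "T *\<^sub>v w = 0\<^sub>v m" using w by (auto simp: W_def)
    have "T *\<^sub>v (\<rho> g *\<^sub>v w) = (T * \<rho> g) *\<^sub>v w"
      using T rc[OF g] w by (simp add: assoc_mult_mat_vec[of T m m "\<rho> g" m w])
    also have "\<dots> = S *\<^sub>v (T *\<^sub>v w)" using S T w by (simp add: assoc_mult_mat_vec[of S m m T m w])
    also have "\<dots> = 0\<^sub>v m" unfolding w(2) using S by (auto intro!: eq_vecI simp: scalar_prod_def)
    finally have "T *\<^sub>v (\<rho> g *\<^sub>v w) = 0\<^sub>v m" .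
    then show "\<rho> g *\<^sub>v w \<in> W" using rc[OF g] w by (auto simp: W_def)
  qed
  then have W: "W = carrier_vec m" using ker by (auto simp: W_def)
  show ?thesis
  proof (rule eq_matI)
    fix i j assume "i < dim_row (0\<^sub>m m m)" "j < dim_col (0\<^sub>m m m)"
    then have ij: "i < m" "j < m" by auto
    have "unit_vec m j \<in> W" unfolding W by (rule unit_vec_carrier)
    then have "T *\<^sub>v unit_vec m j = 0\<^sub>v m" by (simp add: W_def)
    moreover have "T *\<^sub>v unit_vec m j = col T j" using T ij by (auto intro!: eq_vecI)
    ultimately have "col T j $ i = 0" using ij by simp
    then show "T $$ (i, j) = 0\<^sub>m m m $$ (i, j)" using T ij by simp
  qed (use T in auto)
qed

text \<open>Over the complex numbers \<open>T\<close> has an eigenvalue \<open>c\<close>; then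
  \<open>T - c\<close> has a nonzero kernel vector and vanishes.\<close>

lemma schur_scalar:
  assumes r: "\<rho> \<in> irreps G m" and T: "T \<in> carrier_mat m m"
    and comm: "!!g. g \<in> carrier G ==> T * \<rho> g = \<rho> g * T"
  shows "T = (T $$ (0, 0)) \<cdot>\<^sub>m 1\<^sub>m m"
proof -
  have m: "m > 0" using r by (auto simp: irreps_def)
  have rc: "\<rho> g \<in> carrier_mat m m" if "g \<in> carrier G" for g
    using r that hom_GL_D(1) by (auto simp: irreps_def)
  obtain c where "eigenvalue T c" using spectrum_non_empty[OF T m] by (auto simp: spectrum_def)
  then obtain v where v: "v \<in> carrier_vec m" "v \<noteq> 0\<^sub>v m" "T *\<^sub>v v = c \<cdot>\<^sub>v v"
    using T by (auto simp: eigenvalue_def eigenvector_def)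
  define S where "S = T - c \<cdot>\<^sub>m 1\<^sub>m m"
  have S: "S \<in> carrier_mat m m" unfolding S_def by (intro minus_carrier_mat smult_carrier_mat one_carrier_mat)
  have "S = 0\<^sub>m m m"
  proof (rule irreps_kernel[OF r S _ v(1,2)])
    fix g assume g: "g \<in> carrier G"
    have "S * \<rho> g = T * \<rho> g - (c \<cdot>\<^sub>m 1\<^sub>m m) * \<rho> g"
      unfolding S_def using T rc[OF g] by (intro minus_mult_distrib_mat) auto
    also have "(c \<cdot>\<^sub>m 1\<^sub>m m) * \<rho> g = c \<cdot>\<^sub>m \<rho> g" using rc[OF g] by (simp add: smult_mat_def[symmetric] mult_smult_assoc_mat[of _ m m])
    also have "c \<cdot>\<^sub>m \<rho> g = \<rho> g * (c \<cdot>\<^sub>m 1\<^sub>m m)" using mult_smult_distrib[OF rc[OF g] one_carrier_mat, of c] rc[OF g] by simp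
    also have "T * \<rho> g - \<rho> g * (c \<cdot>\<^sub>m 1\<^sub>m m) = \<rho> g * S"
      unfolding comm[OF g] S_def using T rc[OF g] by (intro mult_minus_distrib_mat[symmetric]) auto
    finally show "\<exists>S'\<in>carrier_mat m m. S * \<rho> g = S' * S" using rc[OF g] by blast
  next
    have "S *\<^sub>v v = T *\<^sub>v v - (c \<cdot>\<^sub>m 1\<^sub>m m) *\<^sub>v v"
      unfolding S_def using T v by (intro minus_mult_distrib_mat_vec) auto
    also have "(c \<cdot>\<^sub>m 1\<^sub>m m) *\<^sub>v v = c \<cdot>\<^sub>v v" using v by (auto intro!: eq_vecI)
    finally show "S *\<^sub>v v = 0\<^sub>v m" using v by simp
  qed
  then have e: "(T - c \<cdot>\<^sub>m 1\<^sub>m m) $$ (i, j) = 0" if "i < m" "j < m" for i j using that by (simp add: S_def)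
  have T': "T $$ (i, j) = (if i = j then c else 0)" if "i < m" "j < m" for i j
    using e[OF that] T that by auto
  show ?thesis by (rule eq_matI) (use T T' m in auto)
qed

text \<open>The elementary matrix with entry 1 at \<open>(a, b)\<close>, multiplied by
  \<open>\<sigma> g\<close> on the left and by \<open>\<rho> (inv g)\<close> on the right and summed
  over the group.\<close>

definition intertwine :: "('a => complex mat) => ('a => complex mat) => nat => nat => nat => complex mat" where
  "intertwine \<sigma> \<rho> m a b = mat m m (\<lambda>(i, j). \<Sum>g\<in>carrier G. \<sigma> g $$ (i, a) * \<rho> (inv g) $$ (b, j))"

lemma intertwine_comm:
  assumes s: "\<sigma> \<in> hom G (GL m)" and r: "\<rho> \<in> hom G (GL m)" and ab: "a < m" "b < m"
    and h: "h \<in> carrier G"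
  shows "intertwine \<sigma> \<rho> m a b * \<rho> h = \<sigma> h * intertwine \<sigma> \<rho> m a b"
proof (rule eq_matI)
  let ?T = "intertwine \<sigma> \<rho> m a b"
  note sD = hom_GL_D[OF s] and rD = hom_GL_D[OF r]
  have T: "?T \<in> carrier_mat m m" by (simp add: intertwine_def)
  have entry: "?T $$ (i, j) = (\<Sum>g\<in>carrier G. \<sigma> g $$ (i, a) * \<rho> (inv g) $$ (b, j))" if "i < m" "j < m" for i j
    using that by (simp add: intertwine_def)
  fix i j assume "i < dim_row (\<sigma> h * ?T)" "j < dim_col (\<sigma> h * ?T)"
  then have ij: "i < m" "j < m" using sD(1)[OF h] T by auto
  have "(?T * \<rho> h) $$ (i, j) = (\<Sum>k=0..<m. ?T $$ (i, k) * \<rho> h $$ (k, j))"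
    by (rule mat_mult_entry[OF T rD(1)[OF h] ij])
  also have "\<dots> = (\<Sum>k=0..<m. (\<Sum>g\<in>carrier G. \<sigma> g $$ (i, a) * \<rho> (inv g) $$ (b, k)) * \<rho> h $$ (k, j))"
    using ij by (intro sum.cong refl arg_cong2[of _ _ _ _ "(*)"] entry) auto
  also have "\<dots> = (\<Sum>g\<in>carrier G. \<sigma> g $$ (i, a) * (\<Sum>k=0..<m. \<rho> (inv g) $$ (b, k) * \<rho> h $$ (k, j)))"
    by (simp add: sum_distrib_left sum_distrib_right mult.assoc) (rule sum.swap)
  also have "\<dots> = (\<Sum>g\<in>carrier G. \<sigma> g $$ (i, a) * \<rho> (inv g \<otimes> h) $$ (b, j))"
  proof (rule sum.cong[OF refl])
    fix g assume g: "g \<in> carrier G"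
    show "\<sigma> g $$ (i, a) * (\<Sum>k=0..<m. \<rho> (inv g) $$ (b, k) * \<rho> h $$ (k, j)) = \<sigma> g $$ (i, a) * \<rho> (inv g \<otimes> h) $$ (b, j)"
      using mat_mult_entry[OF rD(1)[of "inv g"] rD(1)[OF h] ab(2) ij(2)] rD(2)[of "inv g" h] g h by simp
  qed
  also have "\<dots> = (\<Sum>g\<in>carrier G. \<sigma> (h \<otimes> g) $$ (i, a) * \<rho> (inv g) $$ (b, j))"
  proof (rule sum.reindex_bij_witness[of _ "\<lambda>g. h \<otimes> g" "\<lambda>g. inv h \<otimes> g"])
    fix g assume g: "g \<in> carrier G"
    show "h \<otimes> (inv h \<otimes> g) = g" "inv h \<otimes> g \<in> carrier G" using g h by (auto simp: m_assoc[symmetric])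
    have "inv (inv h \<otimes> g) = inv g \<otimes> h" using g h by (simp add: inv_mult_group)
    then show "\<sigma> (h \<otimes> (inv h \<otimes> g)) $$ (i, a) * \<rho> (inv (inv h \<otimes> g)) $$ (b, j) = \<sigma> g $$ (i, a) * \<rho> (inv g \<otimes> h) $$ (b, j)"
      using g h by (simp add: m_assoc[symmetric])
  qed (use h in \<open>auto simp: m_assoc[symmetric]\<close>)
  also have "\<dots> = (\<Sum>g\<in>carrier G. (\<Sum>k=0..<m. \<sigma> h $$ (i, k) * \<sigma> g $$ (k, a)) * \<rho> (inv g) $$ (b, j))"
    using mat_mult_entry[OF sD(1)[OF h] sD(1) ij(1) ab(1)] sD(2)[OF h] by (intro sum.cong) auto
  also have "\<dots> = (\<Sum>k=0..<m. \<sigma> h $$ (i, k) * (\<Sum>g\<in>carrier G. \<sigma> g $$ (k, a) * \<rho> (inv g) $$ (b, j)))"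
    by (simp add: sum_distrib_left sum_distrib_right mult.assoc) (rule sum.swap)
  also have "\<dots> = (\<Sum>k=0..<m. \<sigma> h $$ (i, k) * ?T $$ (k, j))"
    using ij by (intro sum.cong refl arg_cong2[of _ _ _ _ "(*)"] entry[symmetric]) auto
  also have "\<dots> = (\<sigma> h * ?T) $$ (i, j)"
    by (rule mat_mult_entry[OF sD(1)[OF h] T ij, symmetric])
  finally show "(?T * \<rho> h) $$ (i, j) = (\<sigma> h * ?T) $$ (i, j)" .
qed (use hom_GL_D(1)[OF s h] hom_GL_D(1)[OF r h] in \<open>auto simp: intertwine_def\<close>)

definition tr :: "nat => complex mat => complex" where
  "tr m A = (\<Sum>i=0..<m. A $$ (i, i))"

text \<open>Passes from the family of averaged intertwiners to the inner product of the two
  characters.\<close>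

lemma sum_intertwine:
  "(\<Sum>a=0..<m. \<Sum>b=0..<m. intertwine \<sigma> \<rho> m a b $$ (a, b)) = (\<Sum>g\<in>carrier G. tr m (\<sigma> g) * tr m (\<rho> (inv g)))"
proof -
  have "(\<Sum>a=0..<m. \<Sum>b=0..<m. intertwine \<sigma> \<rho> m a b $$ (a, b)) =
    (\<Sum>a=0..<m. \<Sum>b=0..<m. \<Sum>g\<in>carrier G. \<sigma> g $$ (a, a) * \<rho> (inv g) $$ (b, b))"
    by (intro sum.cong) (auto simp: intertwine_def)
  also have "\<dots> = (\<Sum>a=0..<m. \<Sum>g\<in>carrier G. \<Sum>b=0..<m. \<sigma> g $$ (a, a) * \<rho> (inv g) $$ (b, b))"
    by (intro sum.cong refl sum.swap)
  also have "\<dots> = (\<Sum>g\<in>carrier G. \<Sum>a=0..<m. \<Sum>b=0..<m. \<sigma> g $$ (a, a) * \<rho> (inv g) $$ (b, b))"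
    by (rule sum.swap)
  also have "\<dots> = (\<Sum>g\<in>carrier G. tr m (\<sigma> g) * tr m (\<rho> (inv g)))"
    by (simp add: tr_def sum_product)
  finally show ?thesis .
qed

lemma tr_comm:
  assumes "A \<in> carrier_mat m m" "B \<in> carrier_mat m m"
  shows "tr m (A * B) = tr m (B * A)"
proof -
  have "tr m (A * B) = (\<Sum>i=0..<m. \<Sum>k=0..<m. A $$ (i, k) * B $$ (k, i))"
    unfolding tr_def using mat_mult_entry[OF assms] by (intro sum.cong) auto
  also have "\<dots> = (\<Sum>k=0..<m. \<Sum>i=0..<m. B $$ (k, i) * A $$ (i, k))"
    by (subst sum.swap) (simp add: mult.commute)
  also have "\<dots> = tr m (B * A)"
    unfolding tr_def using mat_mult_entry[OF assms(2,1)] by (intro sum.cong) auto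
  finally show ?thesis .
qed

text \<open>Each averaged matrix is a scalar \<open>t a b\<close>, so only \<open>a = b\<close>
  contributes to the sum of entries, and the trace of the average gives
  \<open>m * t a a = card (carrier G)\<close>.\<close>

lemma schur_orthogonality:
  assumes fin: "finite (carrier G)" and r: "\<rho> \<in> irreps G m"
  shows "(\<Sum>g\<in>carrier G. tr m (\<rho> g) * tr m (\<rho> (inv g))) = of_nat (card (carrier G))"
proof -
  have h: "\<rho> \<in> hom G (GL m)" and m: "m > 0" using r by (auto simp: irreps_def)
  note D = hom_GL_D[OF h]
  let ?T = "intertwine \<rho> \<rho> m"
  define t where "t a b = ?T a b $$ (0, 0)" for a b
  have sc: "?T a b $$ (i, j) = (if i = j then t a b else 0)" if "a < m" "b < m" "i < m" "j < m" for a b i j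
  proof -
    have T: "?T a b \<in> carrier_mat m m" by (simp add: intertwine_def)
    have "?T a b = ?T a b $$ (0, 0) \<cdot>\<^sub>m 1\<^sub>m m"
      by (rule schur_scalar[OF r T intertwine_comm[OF h h that(1,2)]])
    then have "?T a b $$ (i, j) = (?T a b $$ (0, 0) \<cdot>\<^sub>m 1\<^sub>m m) $$ (i, j)" by (rule arg_cong)
    then show ?thesis unfolding t_def[symmetric] using that by simp
  qed
  have tr: "of_nat m * t a a = of_nat (card (carrier G))" if a: "a < m" for a
  proof -
    have 1: "(\<Sum>i=0..<m. ?T a a $$ (i, i)) = of_nat m * t a a"
      using sc[OF a a] by simp
    have "(\<Sum>i=0..<m. ?T a a $$ (i, i)) = (\<Sum>i=0..<m. \<Sum>g\<in>carrier G. \<rho> (inv g) $$ (a, i) * \<rho> g $$ (i, a))"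
      by (intro sum.cong) (auto simp: intertwine_def mult.commute)
    also have "\<dots> = (\<Sum>g\<in>carrier G. \<Sum>i=0..<m. \<rho> (inv g) $$ (a, i) * \<rho> g $$ (i, a))"
      by (rule sum.swap)
    also have "\<dots> = (\<Sum>g\<in>carrier G. 1)"
    proof (rule sum.cong[OF refl])
      fix g assume g: "g \<in> carrier G"
      have "(\<Sum>i=0..<m. \<rho> (inv g) $$ (a, i) * \<rho> g $$ (i, a)) = (\<rho> (inv g) * \<rho> g) $$ (a, a)"
        using mat_mult_entry[OF D(1)[of "inv g"] D(1)[OF g] a a] g by simp
      also have "\<rho> (inv g) * \<rho> g = 1\<^sub>m m" using D(2)[of "inv g" g] D(3) g by simp
      finally show "(\<Sum>i=0..<m. \<rho> (inv g) $$ (a, i) * \<rho> g $$ (i, a)) = 1" using a by simp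
    qed
    finally show ?thesis using 1 by simp
  qed
  have "(\<Sum>g\<in>carrier G. tr m (\<rho> g) * tr m (\<rho> (inv g))) = (\<Sum>a=0..<m. \<Sum>b=0..<m. ?T a b $$ (a, b))"
    by (rule sum_intertwine[symmetric])
  also have "\<dots> = (\<Sum>a=0..<m. \<Sum>b=0..<m. if a = b then t a a else 0)"
    by (intro sum.cong refl) (auto simp: sc)
  also have "\<dots> = (\<Sum>a=0..<m. t a a)" by simp
  also have "\<dots> = (\<Sum>a=0..<m. of_nat (card (carrier G)) / of_nat m)"
    using tr m by (intro sum.cong) (auto simp: field_simps)
  also have "\<dots> = of_nat (card (carrier G))" using m by simp
  finally show ?thesis .
qed

end

section \<open>Class-two groups and the alternating form of a central character\<close>

locale class2_group = group +
  fixes Z :: "'a set" and cm :: "'a => 'a => 'a"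
  assumes fin: "finite (carrier G)" and Z: "subgroup Z G"
    and central: "!!z g. z \<in> Z ==> g \<in> carrier G ==> z \<otimes> g = g \<otimes> z"
    and cm_Z: "!!g h. g \<in> carrier G ==> h \<in> carrier G ==> cm g h \<in> Z"
    and swap: "!!g h. g \<in> carrier G ==> h \<in> carrier G ==> g \<otimes> h = cm g h \<otimes> (h \<otimes> g)"
begin

text \<open>The radical of the bimultiplicative form \<open>l (cm g h)\<close>. It will turn out to
  consist of the elements on which the irreducible representations over \<open>l\<close> are
  scalar.\<close>

definition rad :: "('a => complex) => 'a set" where
  "rad l = {g \<in> carrier G. \<forall>h\<in>carrier G. l (cm g h) = 1}"

lemma Zc: "z \<in> Z ==> z \<in> carrier G" using Z by (simp add: subgroup.mem_carrier)

lemma cm_unique: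
  assumes "g \<in> carrier G" "h \<in> carrier G" "z \<in> carrier G" "g \<otimes> h = z \<otimes> (h \<otimes> g)"
  shows "cm g h = z"
  using swap[OF assms(1,2)] assms Zc[OF cm_Z[OF assms(1,2)]] by simp

lemma cm_mult_left:
  assumes g: "g \<in> carrier G" "g' \<in> carrier G" and h: "h \<in> carrier G"
  shows "cm (g \<otimes> g') h = cm g h \<otimes> cm g' h"
proof (rule cm_unique)
  note c = Zc[OF cm_Z]
  have "(g \<otimes> g') \<otimes> h = g \<otimes> (g' \<otimes> h)" using g h by (simp add: m_assoc)
  also have "\<dots> = g \<otimes> (cm g' h \<otimes> (h \<otimes> g'))" using swap[OF g(2) h] by simp
  also have "\<dots> = (g \<otimes> cm g' h) \<otimes> (h \<otimes> g')" using g h c by (simp add: m_assoc)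
  also have "g \<otimes> cm g' h = cm g' h \<otimes> g" using central[OF cm_Z] g h by simp
  also have "(cm g' h \<otimes> g) \<otimes> (h \<otimes> g') = cm g' h \<otimes> ((g \<otimes> h) \<otimes> g')" using g h c by (simp add: m_assoc)
  also have "g \<otimes> h = cm g h \<otimes> (h \<otimes> g)" using swap[OF g(1) h] .
  also have "cm g' h \<otimes> ((cm g h \<otimes> (h \<otimes> g)) \<otimes> g') = (cm g' h \<otimes> cm g h) \<otimes> (h \<otimes> (g \<otimes> g'))"
    using g h c by (simp add: m_assoc)
  also have "cm g' h \<otimes> cm g h = cm g h \<otimes> cm g' h" using central[OF cm_Z[OF g(2) h]] c g h by simp
  finally show "(g \<otimes> g') \<otimes> h = (cm g h \<otimes> cm g' h) \<otimes> (h \<otimes> (g \<otimes> g'))" .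
qed (use assms Zc[OF cm_Z] in auto)

lemma cm_swap:
  assumes "g \<in> carrier G" "h \<in> carrier G"
  shows "cm g h \<otimes> cm h g = \<one>"
proof -
  note c = Zc[OF cm_Z]
  have "g \<otimes> h = (cm g h \<otimes> cm h g) \<otimes> (g \<otimes> h)"
    using swap[OF assms] swap[OF assms(2,1)] assms c by (simp add: m_assoc)
  then show ?thesis using assms c by (metis m_closed one_closed r_cancel_one')
qed

lemma cm_central: "z \<in> Z ==> g \<in> carrier G ==> cm z g = \<one>"
  using central Zc by (intro cm_unique) auto

context
  fixes l assumes l: "l \<in> chars G Z"
begin

lemma form_mult_left:
  assumes "g \<in> carrier G" "g' \<in> carrier G" "h \<in> carrier G"
  shows "l (cm (g \<otimes> g') h) = l (cm g h) * l (cm g' h)"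
  using assms cm_mult_left charsD(2)[OF l] cm_Z by simp

lemma form_swap:
  assumes "g \<in> carrier G" "h \<in> carrier G"
  shows "l (cm g h) * l (cm h g) = 1"
  using assms cm_swap charsD(1,2)[OF l] cm_Z by (metis (no_types))

lemma form_swap_1:
  assumes "g \<in> carrier G" "h \<in> carrier G"
  shows "l (cm g h) = 1 \<longleftrightarrow> l (cm h g) = 1"
  using form_swap[OF assms] by auto

lemma form_self: "g \<in> carrier G ==> l (cm g g) = 1"
  using cm_unique[of g g \<one>] charsD(1)[OF l] by simp

lemma form_one: "g \<in> carrier G ==> l (cm \<one> g) = 1"
  using cm_unique[of \<one> g \<one>] charsD(1)[OF l] by simp

lemma form_pow: "g \<in> carrier G ==> h \<in> carrier G ==> l (cm g h) = 1 ==> l (cm (g [^] (n::nat)) h) = 1"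
  by (induction n) (auto simp: form_one form_mult_left)

lemma rad_subgroup: "subgroup (rad l) G"
proof (rule subgroup_of_finite[OF fin])
  show "rad l \<subseteq> carrier G" by (auto simp: rad_def)
  show "\<one> \<in> rad l" by (auto simp: rad_def form_one)
qed (auto simp: rad_def form_mult_left)

lemma Z_rad: "Z \<subseteq> rad l"
  using Zc cm_central charsD(1)[OF l] by (auto simp: rad_def)

definition isotropic :: "'a set => bool" where
  "isotropic A \<longleftrightarrow> subgroup A G \<and> rad l \<subseteq> A \<and> (\<forall>x\<in>A. \<forall>y\<in>A. l (cm x y) = 1)"

text \<open>A largest isotropic subgroup is its own orthogonal complement: an element orthogonal to
  \<open>A\<close> is also orthogonal to itself, so adjoining it keeps \<open>A\<close> isotropic,
  and maximality puts it into \<open>A\<close>.\<close>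

lemma maximal_isotropic:
  obtains A where "isotropic A" "!!g. g \<in> carrier G ==> (!!a. a \<in> A ==> l (cm g a) = 1) ==> g \<in> A"
proof -
  have "isotropic (rad l)" using rad_subgroup by (auto simp: isotropic_def rad_def)
  moreover have "\<forall>A. isotropic A --> card A \<le> card (carrier G)"
    using fin by (auto simp: isotropic_def intro!: card_mono dest: subgroup.subset)
  ultimately obtain A where A: "isotropic A" "!!B. isotropic B ==> card B \<le> card A"
    using ex_has_greatest_nat[of isotropic "rad l" card "Suc (card (carrier G))"] by (auto simp: less_Suc_eq_le)
  have sA: "subgroup A G" "rad l \<subseteq> A" using A by (auto simp: isotropic_def)
  have Ac: "a \<in> A ==> a \<in> carrier G" for a using sA(1) by (simp add: subgroup.mem_carrier)
  show thesis
  proof (rule that[OF A(1)])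
    fix g assume g: "g \<in> carrier G" and iso: "!!a. a \<in> A ==> l (cm g a) = 1"
    have sw: "\<exists>k'\<in>A. g \<otimes> k = k' \<otimes> g" if k: "k \<in> A" for k
    proof -
      have z: "cm g k \<in> A" using cm_Z[OF g Ac[OF k]] Z_rad sA(2) by blast
      have "g \<otimes> k = (cm g k \<otimes> k) \<otimes> g" using swap[OF g Ac[OF k]] Ac[OF k] Ac[OF z] g by (simp add: m_assoc)
      then show ?thesis using subgroup.m_closed[OF sA(1) z k] by blast
    qed
    note ad = subgroup_adjoin[OF fin sA(1) g sw]
    have g1: "l (cm x g) = 1" if x: "x \<in> adjoin G A g" for x
    proof -
      obtain k n where x: "x = k \<otimes> g [^] (n::nat)" "k \<in> A" using x by (auto simp: adjoin_def)
      have "l (cm k g) = 1" using iso[OF x(2)] form_swap_1[OF g Ac[OF x(2)]] by simp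
      then show ?thesis unfolding x(1)
        using form_mult_left[OF Ac[OF x(2)] _ g] form_pow[OF g g form_self[OF g]] g by simp
    qed
    have k1: "l (cm x a) = 1" if x: "x \<in> adjoin G A g" and a: "a \<in> A" for x a
    proof -
      obtain k n where x: "x = k \<otimes> g [^] (n::nat)" "k \<in> A" using x by (auto simp: adjoin_def)
      have "l (cm k a) = 1" using A(1) x(2) a by (auto simp: isotropic_def)
      then show ?thesis unfolding x(1)
        using form_mult_left[OF Ac[OF x(2)] _ Ac[OF a]] form_pow[OF g Ac[OF a] iso[OF a]] g by simp
    qed
    have "l (cm x y) = 1" if x: "x \<in> adjoin G A g" and y: "y \<in> adjoin G A g" for x y
    proof -
      have xc: "x \<in> carrier G" using ad(1) x by (simp add: subgroup.mem_carrier)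
      obtain k n where y: "y = k \<otimes> g [^] (n::nat)" "k \<in> A" using y by (auto simp: adjoin_def)
      have "l (cm k x) = 1" "l (cm g x) = 1"
        using k1[OF x y(2)] g1[OF x] form_swap_1[OF xc g] form_swap_1[OF xc Ac[OF y(2)]] by auto
      then have "l (cm y x) = 1" unfolding y(1)
        using form_mult_left[OF Ac[OF y(2)] _ xc] form_pow[OF g xc] g by simp
      then show ?thesis using form_swap_1[OF xc, of y] y g Ac by simp
    qed
    then have "isotropic (adjoin G A g)" using ad sA by (auto simp: isotropic_def)
    then have "card (adjoin G A g) \<le> card A" by (rule A(2))
    moreover have "finite (adjoin G A g)" using ad(1) fin by (meson finite_subset subgroup.subset)
    ultimately have "adjoin G A g = A" using ad(2) by (metis card_seteq)
    then show "g \<in> A" using ad(3) by simp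
  qed
qed

text \<open>All commutators of \<open>A\<close> lie in the kernel of \<open>w\<close>, so the number
  of extensions is an index and in particular not zero.\<close>

lemma isotropic_extension:
  assumes A: "isotropic A" and w: "w \<in> extensions G Z (rad l) l"
  shows "\<exists>w'. w' \<in> extensions G (rad l) A w"
proof -
  have sA: "subgroup A G" "rad l \<subseteq> A" using A by (auto simp: isotropic_def)
  have Ac: "a \<in> A ==> a \<in> carrier G" for a using sA(1) by (simp add: subgroup.mem_carrier)
  have "card (extensions G (rad l) A w) * card (rad l) = card A"
  proof (rule card_extensions[OF fin sA(1) rad_subgroup sA(2)])
    show "w \<in> chars G (rad l)" using w by (simp add: extensions_def)
    fix x y assume xy: "x \<in> A" "y \<in> A"
    have "w (cm x y) = 1" using w A xy cm_Z[OF Ac Ac] by (auto simp: extensions_def isotropic_def)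
    then show "\<exists>z\<in>rad l. w z = 1 \<and> x \<otimes> y = z \<otimes> (y \<otimes> x)"
      using swap[OF Ac Ac] xy Z_rad cm_Z[OF Ac Ac] by blast
  qed
  moreover have "card A > 0" using subgroup.finite_imp_card_positive[OF sA(1) fin] .
  ultimately have "card (extensions G (rad l) A w) \<noteq> 0" by (metis mult_0 not_gr0)
  then show ?thesis by (metis card.empty equals0I)
qed

end

text \<open>Numbered representatives of the right cosets of \<open>A\<close>; the numbers will index
  the rows and columns of the induced representation.\<close>

lemma transversal:
  assumes A: "subgroup A G"
  shows "\<exists>m t. (\<forall>i::nat. i < m --> t i \<in> carrier G) \<and>
    (\<forall>g\<in>carrier G. \<exists>!j. j < m \<and> g \<otimes> inv (t j) \<in> A) \<and> 0 < m"
proof -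
  have finC: "finite (rcosets A)" using fin A by (simp add: RCOSETS_def)
  obtain h where h: "bij_betw h {0..<card (rcosets A)} (rcosets A)" using ex_bij_betw_nat_finite[OF finC] by blast
  let ?m = "card (rcosets A)"
  have Asub: "A \<subseteq> carrier G" using A by (rule subgroup.subset)
  have "\<exists>t\<in>carrier G. h i = A #> t" if "i < ?m" for i
    using bij_betwE[OF h] that by (force simp: RCOSETS_def)
  then obtain t where t: "!!i. i < ?m ==> t i \<in> carrier G \<and> h i = A #> t i" by metis
  have mem: "x \<otimes> inv y \<in> A \<longleftrightarrow> A #> x = A #> y" if xy: "x \<in> carrier G" "y \<in> carrier G" for x y
  proof
    assume a: "x \<otimes> inv y \<in> A"
    have "x = (x \<otimes> inv y) \<otimes> y" using xy by (simp add: m_assoc)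
    then have "x \<in> A #> y" using a by (auto simp: r_coset_def)
    then show "A #> x = A #> y" using repr_independence[OF _ xy(2) A, of x] by simp
  next
    assume "A #> x = A #> y"
    then have "x \<in> A #> y" using rcos_self[OF xy(1) A] by simp
    then obtain a where "a \<in> A" "x = a \<otimes> y" by (auto simp: r_coset_def)
    then show "x \<otimes> inv y \<in> A" using xy Asub by (auto simp: m_assoc)
  qed
  have c1: "\<one> \<in> carrier G" by simp
  show ?thesis
  proof (rule exI[of _ ?m], rule exI[of _ t], intro conjI allI impI ballI)
    show "t i \<in> carrier G" if "i < ?m" for i using t that by blast
    fix g assume g: "g \<in> carrier G"
    have "A #> g \<in> rcosets A" using g by (auto simp: RCOSETS_def)
    then have "A #> g \<in> h ` {0..<?m}" using bij_betw_imp_surj_on[OF h] by simp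
    then obtain j where j: "j < ?m" "h j = A #> g" by auto
    show "\<exists>!j. j < ?m \<and> g \<otimes> inv (t j) \<in> A"
    proof (rule ex1I[of _ j])
      show "j < ?m \<and> g \<otimes> inv (t j) \<in> A" using mem[OF g, of "t j"] t[OF j(1)] j by simp
      fix k assume k: "k < ?m \<and> g \<otimes> inv (t k) \<in> A"
      then have "h k = h j" using mem[OF g, of "t k"] t[of k] j by simp
      then show "k = j" using h k j by (auto simp: bij_betw_def inj_on_def)
    qed
  next
    have "A #> \<one> \<in> rcosets A" using c1 by (auto simp: RCOSETS_def)
    then show "0 < ?m" using finC by (auto simp: card_gt_0_iff)
  qed
qed

end

lemma smult_one_mult:
  fixes A :: "'a::comm_semiring_1 mat"
  shows "A \<in> carrier_mat m n ==> (c \<cdot>\<^sub>m 1\<^sub>m m) * A = c \<cdot>\<^sub>m A"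
  using mult_smult_assoc_mat[OF one_carrier_mat, of A m n c] by simp

lemma one_smult_mat:
  fixes A :: "'a::comm_semiring_1 mat"
  shows "1 \<cdot>\<^sub>m A = A"
  by (rule eq_matI) auto

section \<open>Irreducible representations classified by their scalars on \<open>Z\<close> and on
  the radical\<close>

context class2_group
begin

text \<open>The entry \<open>(0, 0)\<close> recovers the scalar of a scalar matrix:
  \<open>lam\<close> is the character by which \<open>Z\<close> acts, \<open>omg\<close> its
  extension to the radical.\<close>

definition lam :: "('a => complex mat) => 'a => complex" where
  "lam \<rho> = restrict (\<lambda>z. \<rho> z $$ (0, 0)) Z"

definition omg :: "('a => complex mat) => 'a => complex" where
  "omg \<rho> = restrict (\<lambda>g. \<rho> g $$ (0, 0)) (rad (lam \<rho>))"

context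
  fixes \<rho> m assumes r: "\<rho> \<in> irreps G m"
begin

lemma m_pos: "m > 0" and r_hom: "\<rho> \<in> hom G (GL m)"
  using r by (auto simp: irreps_def)

lemma scalar_of_comm:
  assumes x: "x \<in> carrier G" and c: "!!g. g \<in> carrier G ==> \<rho> (x \<otimes> g) = \<rho> (g \<otimes> x)"
  shows "\<rho> x = \<rho> x $$ (0, 0) \<cdot>\<^sub>m 1\<^sub>m m"
  using hom_GL_D[OF r_hom] x c by (intro schur_scalar[OF r]) metis+

lemma rho_Z: "z \<in> Z ==> \<rho> z = lam \<rho> z \<cdot>\<^sub>m 1\<^sub>m m"
  unfolding lam_def by simp (rule scalar_of_comm, simp_all add: Zc central)

lemma chars_of_scalar:
  assumes H: "subgroup H G" and s: "!!x. x \<in> H ==> \<rho> x = \<rho> x $$ (0, 0) \<cdot>\<^sub>m 1\<^sub>m m"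
  shows "restrict (\<lambda>x. \<rho> x $$ (0, 0)) H \<in> chars G H"
proof -
  note D = hom_GL_D[OF r_hom]
  have mult: "\<rho> (x \<otimes> y) $$ (0, 0) = \<rho> x $$ (0, 0) * \<rho> y $$ (0, 0)" if x: "x \<in> H" and y: "y \<in> H" for x y
  proof -
    have xc: "x \<in> carrier G" "y \<in> carrier G" using H x y by (auto simp: subgroup.mem_carrier)
    have "\<rho> (x \<otimes> y) = (\<rho> x $$ (0, 0) \<cdot>\<^sub>m 1\<^sub>m m) * \<rho> y" using D(2)[OF xc] s[OF x] by simp
    also have "\<dots> = \<rho> x $$ (0, 0) \<cdot>\<^sub>m \<rho> y" by (rule smult_one_mult[OF D(1)[OF xc(2)]])
    finally show ?thesis using D(1)[OF xc(2)] m_pos by simp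
  qed
  show ?thesis
    using mult D(3) m_pos subgroup.m_closed[OF H] subgroup.one_closed[OF H] by (auto simp: chars_def)
qed

lemma lam_chars: "lam \<rho> \<in> chars G Z"
  unfolding lam_def
proof (rule chars_of_scalar[OF Z])
  fix z assume "z \<in> Z" then show "\<rho> z = \<rho> z $$ (0, 0) \<cdot>\<^sub>m 1\<^sub>m m" using rho_Z[of z] by (simp add: lam_def)
qed

lemma rho_swap:
  assumes "g \<in> carrier G" "h \<in> carrier G"
  shows "\<rho> g * \<rho> h = lam \<rho> (cm g h) \<cdot>\<^sub>m (\<rho> h * \<rho> g)"
proof -
  note D = hom_GL_D[OF r_hom]
  have "\<rho> g * \<rho> h = \<rho> (cm g h) * \<rho> (h \<otimes> g)"
    using D(2) assms swap Zc[OF cm_Z] by (metis m_closed)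
  also have "\<dots> = (lam \<rho> (cm g h) \<cdot>\<^sub>m 1\<^sub>m m) * \<rho> (h \<otimes> g)" using rho_Z[OF cm_Z[OF assms]] by simp
  also have "\<dots> = lam \<rho> (cm g h) \<cdot>\<^sub>m \<rho> (h \<otimes> g)" using assms by (intro smult_one_mult[OF D(1)]) simp
  finally show ?thesis using D(2) assms by simp
qed

text \<open>An element of the radical commutes with each group element up to a commutator on which
  \<open>lam \<rho>\<close> is 1, so its image commutes with the whole representation.\<close>

lemma rho_rad: "g \<in> rad (lam \<rho>) ==> \<rho> g = omg \<rho> g \<cdot>\<^sub>m 1\<^sub>m m"
  unfolding omg_def
proof (simp, rule scalar_of_comm)
  assume g: "g \<in> rad (lam \<rho>)"
  then show gc: "g \<in> carrier G" by (auto simp: rad_def)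
  fix h assume h: "h \<in> carrier G"
  then show "\<rho> (g \<otimes> h) = \<rho> (h \<otimes> g)"
    using rho_swap[OF gc h] g hom_GL_D(2)[OF r_hom] gc by (simp add: rad_def one_smult_mat)
qed

lemma omg_extensions: "omg \<rho> \<in> extensions G Z (rad (lam \<rho>)) (lam \<rho>)"
proof -
  have "omg \<rho> \<in> chars G (rad (lam \<rho>))"
    unfolding omg_def
  proof (rule chars_of_scalar[OF rad_subgroup[OF lam_chars]])
    fix g assume "g \<in> rad (lam \<rho>)"
    then show "\<rho> g = \<rho> g $$ (0, 0) \<cdot>\<^sub>m 1\<^sub>m m" using rho_rad[of g] by (simp add: omg_def)
  qed
  moreover have "omg \<rho> z = lam \<rho> z" if "z \<in> Z" for z
    using that Z_rad[OF lam_chars] by (auto simp: omg_def lam_def)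
  ultimately show ?thesis by (simp add: extensions_def)
qed

lemma tr_rad: "g \<in> rad (lam \<rho>) ==> tr m (\<rho> g) = of_nat m * omg \<rho> g"
  using rho_rad[of g] by (simp add: tr_def)

text \<open>Conjugation by a suitable \<open>h\<close> multiplies \<open>\<rho> g\<close> by a
  scalar different from 1, yet preserves the trace.\<close>

lemma tr_nonrad:
  assumes g: "g \<in> carrier G" "g \<notin> rad (lam \<rho>)"
  shows "tr m (\<rho> g) = 0"
proof -
  note D = hom_GL_D[OF r_hom]
  obtain h where h: "h \<in> carrier G" "lam \<rho> (cm g h) \<noteq> 1" using g by (auto simp: rad_def)
  have ih: "\<rho> h * \<rho> (inv h) = 1\<^sub>m m" "\<rho> (inv h) * \<rho> h = 1\<^sub>m m"
    using D(2)[of h "inv h"] D(2)[of "inv h" h] D(3) h by auto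
  have c: "\<rho> g \<in> carrier_mat m m" "\<rho> h \<in> carrier_mat m m" "\<rho> (inv h) \<in> carrier_mat m m"
    using D(1) g h by auto
  have sm: "tr m (c \<cdot>\<^sub>m A) = c * tr m A" if "A \<in> carrier_mat m m" for c A
    using that by (simp add: tr_def sum_distrib_left)
  have "tr m (\<rho> g) = tr m ((\<rho> g * \<rho> h) * \<rho> (inv h))"
    using c ih by (simp add: assoc_mult_mat[of _ m m _ m _ m])
  also have "\<dots> = lam \<rho> (cm g h) * tr m ((\<rho> h * \<rho> g) * \<rho> (inv h))"
    unfolding rho_swap[OF g(1) h(1)] using c mult_smult_assoc_mat[of "\<rho> h * \<rho> g" m m "\<rho> (inv h)" m] by (simp add: sm)
  also have "tr m ((\<rho> h * \<rho> g) * \<rho> (inv h)) = tr m (\<rho> (inv h) * (\<rho> h * \<rho> g))" using c by (intro tr_comm) auto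
  also have "\<rho> (inv h) * (\<rho> h * \<rho> g) = \<rho> g"
    using c ih by (simp add: assoc_mult_mat[symmetric, of _ m m _ m _ m])
  finally show ?thesis using h by simp
qed

text \<open>The character is supported on the radical, where the product of its values at
  \<open>g\<close> and \<open>inv g\<close> is \<open>m^2\<close>; orthogonality equates the sum of
  these products with the order of the group.\<close>

lemma card_irrep: "m\<^sup>2 * card (rad (lam \<rho>)) = card (carrier G)"
proof -
  let ?R = "rad (lam \<rho>)"
  note sR = rad_subgroup[OF lam_chars]
  have Rc: "?R \<subseteq> carrier G" using sR by (rule subgroup.subset)
  have wc: "omg \<rho> \<in> chars G ?R" using omg_extensions by (simp add: extensions_def)
  have "of_nat (card (carrier G)) = (\<Sum>g\<in>carrier G. tr m (\<rho> g) * tr m (\<rho> (inv g)))"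
    using schur_orthogonality[OF fin r] by simp
  also have "\<dots> = (\<Sum>g\<in>?R. tr m (\<rho> g) * tr m (\<rho> (inv g)))"
    using Rc fin tr_nonrad by (intro sum.mono_neutral_right) auto
  also have "\<dots> = (\<Sum>g\<in>?R. (of_nat m)\<^sup>2)"
  proof (rule sum.cong[OF refl])
    fix g assume g: "g \<in> ?R"
    have ig: "inv g \<in> ?R" using sR g by (rule subgroup.m_inv_closed)
    have "omg \<rho> g * omg \<rho> (inv g) = 1"
      using charsD(2)[OF wc g ig] charsD(1)[OF wc] g Rc by auto
    then show "tr m (\<rho> g) * tr m (\<rho> (inv g)) = (of_nat m)\<^sup>2"
      using tr_rad[OF g] tr_rad[OF ig] by (simp add: power2_eq_square mult.left_commute)
  qed
  also have "\<dots> = of_nat (m\<^sup>2 * card ?R)" by simp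
  finally show ?thesis using of_nat_eq_iff by metis
qed

end

text \<open>The two invariants fix all traces. If they agree, the averaged intertwiner entries sum
  to the order of the group, so one intertwiner is nonzero and, as \<open>\<rho>\<close> is
  irreducible, injective.\<close>

lemma irrep_iso_iff:
  assumes r: "\<rho> \<in> irreps G m" and s: "\<sigma> \<in> irreps G m"
  shows "(\<rho>, \<sigma>) \<in> irrep_iso G m \<longleftrightarrow> lam \<rho> = lam \<sigma> \<and> omg \<rho> = omg \<sigma>"
proof
  note m = m_pos[OF r] and Dr = hom_GL_D[OF r_hom[OF r]] and Ds = hom_GL_D[OF r_hom[OF s]]
  assume "(\<rho>, \<sigma>) \<in> irrep_iso G m"
  then obtain A where A: "A \<in> carrier (GL m)" "!!g. g \<in> carrier G ==> A * \<rho> g = \<sigma> g * A"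
    by (auto simp: irrep_iso_def)
  then have Ac: "A \<in> carrier_mat m m" "Determinant.det A \<noteq> 0" by (auto simp: GL_iff_det)
  have nz: "A \<noteq> 0\<^sub>m m m" using Ac m by (auto simp: det_zero)
  have "\<exists>i<m. \<exists>j<m. A $$ (i, j) \<noteq> 0"
  proof (rule ccontr)
    assume "\<not> ?thesis"
    then have "A = 0\<^sub>m m m" using Ac(1) by (intro eq_matI) auto
    then show False using nz by simp
  qed
  then obtain i j where ij: "i < m" "j < m" "A $$ (i, j) \<noteq> 0" by blast
  have sc: "c = d" if g: "g \<in> carrier G" and rg: "\<rho> g = c \<cdot>\<^sub>m 1\<^sub>m m" and sg: "\<sigma> g = d \<cdot>\<^sub>m 1\<^sub>m m" for g c d
  proof -
    have "A * \<rho> g = c \<cdot>\<^sub>m A" unfolding rg using mult_smult_distrib[OF Ac(1) one_carrier_mat, of c] Ac by simp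
    moreover have "\<sigma> g * A = d \<cdot>\<^sub>m A" unfolding sg using mult_smult_assoc_mat[OF one_carrier_mat Ac(1), of d] Ac by simp
    ultimately have "(c \<cdot>\<^sub>m A) $$ (i, j) = (d \<cdot>\<^sub>m A) $$ (i, j)" using A(2)[OF g] by simp
    then show ?thesis using ij Ac by simp
  qed
  have lam: "lam \<rho> = lam \<sigma>"
  proof (rule extensionalityI[of _ Z])
    fix z assume z: "z \<in> Z"
    show "lam \<rho> z = lam \<sigma> z" by (rule sc[OF Zc[OF z] rho_Z[OF r z] rho_Z[OF s z]])
  qed (auto simp: lam_def)
  moreover have "omg \<rho> = omg \<sigma>"
  proof (rule extensionalityI[of _ "rad (lam \<rho>)"])
    fix g assume g: "g \<in> rad (lam \<rho>)"
    then have gc: "g \<in> carrier G" by (auto simp: rad_def)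
    show "omg \<rho> g = omg \<sigma> g"
      by (rule sc[OF gc rho_rad[OF r g] rho_rad[OF s]]) (use g lam in simp)
  qed (auto simp: omg_def lam)
  ultimately show "lam \<rho> = lam \<sigma> \<and> omg \<rho> = omg \<sigma>" by simp
next
  note m = m_pos[OF r] and Dr = hom_GL_D[OF r_hom[OF r]] and Ds = hom_GL_D[OF r_hom[OF s]]
  assume eq: "lam \<rho> = lam \<sigma> \<and> omg \<rho> = omg \<sigma>"
  let ?R = "rad (lam \<rho>)"
  note sR = rad_subgroup[OF lam_chars[OF r]]
  have Rc: "?R \<subseteq> carrier G" using sR by (rule subgroup.subset)
  have wc: "omg \<rho> \<in> chars G ?R" using omg_extensions[OF r] by (simp add: extensions_def)
  have trs: "tr m (\<rho> g) = tr m (\<sigma> g)" if "g \<in> carrier G" for g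
    using tr_rad[OF r, of g] tr_rad[OF s, of g] tr_nonrad[OF r, of g] tr_nonrad[OF s, of g] eq that
    by (cases "g \<in> ?R") auto
  have "(\<Sum>a=0..<m. \<Sum>b=0..<m. intertwine \<sigma> \<rho> m a b $$ (a, b)) = (\<Sum>g\<in>carrier G. tr m (\<sigma> g) * tr m (\<rho> (inv g)))"
    by (rule sum_intertwine)
  also have "\<dots> = (\<Sum>g\<in>carrier G. tr m (\<rho> g) * tr m (\<rho> (inv g)))"
    using trs by (intro sum.cong) auto
  also have "\<dots> = of_nat (card (carrier G))" by (rule schur_orthogonality[OF fin r])
  also have "\<dots> \<noteq> 0" using fin by auto
  finally have ne: "(\<Sum>a=0..<m. \<Sum>b=0..<m. intertwine \<sigma> \<rho> m a b $$ (a, b)) \<noteq> 0" .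
  have "\<exists>a<m. \<exists>b<m. intertwine \<sigma> \<rho> m a b $$ (a, b) \<noteq> 0"
  proof (rule ccontr)
    assume "\<not> ?thesis"
    then have "(\<Sum>a=0..<m. \<Sum>b=0..<m. intertwine \<sigma> \<rho> m a b $$ (a, b)) = 0"
      by (intro sum.neutral ballI) auto
    then show False using ne by simp
  qed
  then obtain a b where ab: "a < m" "b < m" "intertwine \<sigma> \<rho> m a b $$ (a, b) \<noteq> 0" by blast
  let ?T = "intertwine \<sigma> \<rho> m a b"
  have T: "?T \<in> carrier_mat m m" by (simp add: intertwine_def)
  have comm: "?T * \<rho> g = \<sigma> g * ?T" if "g \<in> carrier G" for g
    by (rule intertwine_comm[OF r_hom[OF s] r_hom[OF r] ab(1,2) that])
  have "Determinant.det ?T \<noteq> 0"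
  proof
    assume "Determinant.det ?T = 0"
    then obtain v where v: "v \<in> carrier_vec m" "v \<noteq> 0\<^sub>v m" "?T *\<^sub>v v = 0\<^sub>v m"
      using det_0_iff_vec_prod_zero_field[OF T] by blast
    have "?T = 0\<^sub>m m m"
      by (rule irreps_kernel[OF r T _ v]) (use comm Ds(1) in blast)
    then show False using ab by simp
  qed
  then have "?T \<in> carrier (GL m)" using T by (simp add: GL_iff_det)
  then show "(\<rho>, \<sigma>) \<in> irrep_iso G m" using r s comm by (auto simp: irrep_iso_def)
qed

text \<open>Induce an extension \<open>w'\<close> of \<open>w\<close> from a maximal isotropic
  subgroup \<open>A\<close>. The elements of \<open>A\<close> act diagonally by pairwise different
  characters, and the group permutes the coordinate lines transitively; together this gives
  irreducibility.\<close>

lemma irrep_exists: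
  assumes l: "l \<in> chars G Z" and w: "w \<in> extensions G Z (rad l) l"
  shows "\<exists>m. \<exists>\<rho>\<in>irreps G m. lam \<rho> = l \<and> omg \<rho> = w"
proof -
  obtain A where A: "isotropic l A" and maxA: "!!g. g \<in> carrier G ==> (!!a. a \<in> A ==> l (cm g a) = 1) ==> g \<in> A"
    using maximal_isotropic[OF l] by blast
  have sA: "subgroup A G" "rad l \<subseteq> A" using A by (auto simp: isotropic_def[OF l])
  have Ac: "a \<in> A ==> a \<in> carrier G" for a using sA(1) by (simp add: subgroup.mem_carrier)
  have ZA: "z \<in> Z ==> z \<in> A" for z using sA(2) Z_rad[OF l] by blast
  obtain w' where w': "w' \<in> extensions G (rad l) A w" using isotropic_extension[OF l A w] by blast
  then have w'c: "w' \<in> chars G A" by (simp add: extensions_def)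
  have w'w: "w' g = w g" if "g \<in> rad l" for g using w' that by (simp add: extensions_def)
  have w'l: "w' z = l z" if "z \<in> Z" for z using w'w[of z] w that Z_rad[OF l] by (auto simp: extensions_def)
  obtain m t where T: "\<forall>i::nat. i < m --> t i \<in> carrier G" "\<forall>g\<in>carrier G. \<exists>!j. j < m \<and> g \<otimes> inv (t j) \<in> A" and m: "0 < m"
    using transversal[OF sA(1)] by (elim exE conjE)
  have t: "t i \<in> carrier G" if "i < m" for i using T(1) that by simp
  have tr: "\<exists>!j. j < m \<and> g \<otimes> inv (t j) \<in> A" if "g \<in> carrier G" for g using T(2) that by (rule bspec)
  define u where "u x = (if x \<in> A then w' x else 0)" for x
  \<comment> \<open>The induced representation in matrix form: row \<open>i\<close> has its only
    nonzero entry in the column \<open>j\<close> for which \<open>t i g\<close> lies in the coset of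
    \<open>t j\<close>.\<close>
  define \<rho> where "\<rho> g = mat m m (\<lambda>(i, j). u (t i \<otimes> g \<otimes> inv (t j)))" for g
  have rc: "\<rho> g \<in> carrier_mat m m" for g by (simp add: \<rho>_def)
  have rij: "\<rho> g $$ (i, j) = u (t i \<otimes> g \<otimes> inv (t j))" if "i < m" "j < m" for g i j using that by (simp add: \<rho>_def)
  have A_inv: "x \<in> A ==> inv x \<in> A" for x using sA(1) by (rule subgroup.m_inv_closed)
  have A_m: "x \<in> A ==> y \<in> A ==> x \<otimes> y \<in> A" for x y using sA(1) by (rule subgroup.m_closed)
  have A_m_iff: "x \<otimes> y \<in> A \<longleftrightarrow> y \<in> A" if "x \<in> A" "y \<in> carrier G" for x y
  proof
    assume "x \<otimes> y \<in> A"
    then have "inv x \<otimes> (x \<otimes> y) \<in> A" using A_m A_inv that by blast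
    then show "y \<in> A" using that Ac by (simp add: m_assoc[symmetric])
  qed (use A_m that in blast)
  have u_m: "u (x \<otimes> y) = w' x * u y" if "x \<in> A" "y \<in> carrier G" for x y
    using A_m_iff[OF that] charsD(2)[OF w'c that(1)] by (auto simp: u_def)
  have tt: "t i \<otimes> inv (t j) \<in> A \<longleftrightarrow> i = j" if "i < m" "j < m" for i j
  proof
    assume a: "t i \<otimes> inv (t j) \<in> A"
    have "t i \<otimes> inv (t i) \<in> A" using t[OF that(1)] subgroup.one_closed[OF sA(1)] by simp
    then show "i = j" using tr[OF t[OF that(1)]] a that by blast
  qed (use t that subgroup.one_closed[OF sA(1)] in simp)
  have r1: "\<rho> \<one> = 1\<^sub>m m"
  proof (rule eq_matI)
    fix i j assume "i < dim_row (1\<^sub>m m)" "j < dim_col (1\<^sub>m m)"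
    then have ij: "i < m" "j < m" by auto
    show "\<rho> \<one> $$ (i, j) = 1\<^sub>m m $$ (i, j)"
      using ij tt[OF ij] t charsD(1)[OF w'c] by (auto simp: rij u_def)
  qed (auto simp: \<rho>_def)
  have rm: "\<rho> (g \<otimes> h) = \<rho> g * \<rho> h" if g: "g \<in> carrier G" and h: "h \<in> carrier G" for g h
  proof (rule eq_matI)
    fix i k assume "i < dim_row (\<rho> g * \<rho> h)" "k < dim_col (\<rho> g * \<rho> h)"
    then have ik: "i < m" "k < m" by (auto simp: \<rho>_def)
    note ti = t[OF ik(1)] and tk = t[OF ik(2)]
    have "t i \<otimes> g \<in> carrier G" using ti g by simp
    then obtain j where j: "j < m" "t i \<otimes> g \<otimes> inv (t j) \<in> A" and uq: "!!j'. j' < m ==> t i \<otimes> g \<otimes> inv (t j') \<in> A ==> j' = j"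
      using tr[of "t i \<otimes> g"] by blast
    note tj = t[OF j(1)]
    have u0: "u (t i \<otimes> g \<otimes> inv (t j')) = 0" if j': "j' < m" "j' \<noteq> j" for j'
    proof -
      have "t i \<otimes> g \<otimes> inv (t j') \<notin> A" using uq[OF j'(1)] j'(2) by blast
      then show ?thesis by (simp add: u_def)
    qed
    have "(\<rho> g * \<rho> h) $$ (i, k) = (\<Sum>j'=0..<m. u (t i \<otimes> g \<otimes> inv (t j')) * u (t j' \<otimes> h \<otimes> inv (t k)))"
      unfolding mat_mult_entry[OF rc rc ik] using ik by (intro sum.cong) (simp_all add: rij)
    also have "\<dots> = (\<Sum>j'=0..<m. if j' = j then u (t i \<otimes> g \<otimes> inv (t j)) * u (t j \<otimes> h \<otimes> inv (t k)) else 0)"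
    proof (rule sum.cong[OF refl])
      fix j' assume "j' \<in> {0..<m}"
      then have j'm: "j' < m" by simp
      show "u (t i \<otimes> g \<otimes> inv (t j')) * u (t j' \<otimes> h \<otimes> inv (t k)) =
        (if j' = j then u (t i \<otimes> g \<otimes> inv (t j)) * u (t j \<otimes> h \<otimes> inv (t k)) else 0)"
        by (cases "j' = j") (simp_all add: u0[OF j'm])
    qed
    also have "\<dots> = u (t i \<otimes> g \<otimes> inv (t j)) * u (t j \<otimes> h \<otimes> inv (t k))" using j by simp
    also have "\<dots> = u ((t i \<otimes> g \<otimes> inv (t j)) \<otimes> (t j \<otimes> h \<otimes> inv (t k)))"
      using u_m[OF j(2)] tj h tk j(2) by (simp add: u_def)
    also have "(t i \<otimes> g \<otimes> inv (t j)) \<otimes> (t j \<otimes> h \<otimes> inv (t k)) = t i \<otimes> (g \<otimes> h) \<otimes> inv (t k)"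
    proof -
      have "inv (t j) \<otimes> (t j \<otimes> (h \<otimes> inv (t k))) = h \<otimes> inv (t k)"
        using tj tk h by (simp add: m_assoc[symmetric])
      then show ?thesis using ti tj tk g h by (simp add: m_assoc)
    qed
    finally show "\<rho> (g \<otimes> h) $$ (i, k) = (\<rho> g * \<rho> h) $$ (i, k)" using ik by (simp add: rij)
  qed (auto simp: \<rho>_def)
  have hm: "\<rho> \<in> hom G (GL m)" by (rule hom_GL_I[OF rc rm r1])
  have diag: "\<rho> a $$ (i, j) = (if i = j then l (cm (t i) a) * w' a else 0)" if a: "a \<in> A" and ij: "i < m" "j < m" for a i j
  proof -
    note ti = t[OF ij(1)] and tj = t[OF ij(2)]
    have z: "cm (t i) a \<in> Z" using cm_Z ti Ac[OF a] by simp
    have za: "cm (t i) a \<otimes> a \<in> A" using A_m ZA[OF z] a by simp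
    have "t i \<otimes> a \<otimes> inv (t j) = (cm (t i) a \<otimes> a) \<otimes> (t i \<otimes> inv (t j))"
      using swap[OF ti Ac[OF a]] ti tj Zc[OF z] Ac[OF a] by (simp add: m_assoc)
    then have "\<rho> a $$ (i, j) = w' (cm (t i) a \<otimes> a) * u (t i \<otimes> inv (t j))"
      using u_m[OF za, of "t i \<otimes> inv (t j)"] ti tj rij[OF ij] by simp
    also have "w' (cm (t i) a \<otimes> a) = l (cm (t i) a) * w' a"
      using charsD(2)[OF w'c ZA[OF z] a] w'l[OF z] by simp
    also have "u (t i \<otimes> inv (t j)) = (if i = j then 1 else 0)"
      using tt[OF ij] ti charsD(1)[OF w'c] by (auto simp: u_def)
    finally show ?thesis by simp
  qed
  \<comment> \<open>If two coset representatives gave the same diagonal character, their quotient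
    would be orthogonal to \<open>A\<close>, hence in \<open>A\<close>.\<close>
  have sep: "\<exists>a\<in>A. l (cm (t i) a) \<noteq> l (cm (t j) a)" if ij: "i < m" "j < m" "i \<noteq> j" for i j
  proof (rule ccontr)
    note ti = t[OF ij(1)] and tj = t[OF ij(2)]
    assume "\<not> ?thesis"
    then have eq: "!!a. a \<in> A ==> l (cm (t i) a) = l (cm (t j) a)" by blast
    have "l (cm (t i \<otimes> inv (t j)) a) = 1" if a: "a \<in> A" for a
    proof -
      have "l (cm (t i \<otimes> inv (t j)) a) = l (cm (t j) a) * l (cm (inv (t j)) a)"
        using form_mult_left[OF l ti _ Ac[OF a], of "inv (t j)"] tj eq[OF a] by simp
      also have "\<dots> = l (cm (t j \<otimes> inv (t j)) a)"
        using form_mult_left[OF l tj _ Ac[OF a], of "inv (t j)"] tj by simp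
      also have "\<dots> = 1" using tj form_one[OF l Ac[OF a]] by simp
      finally show ?thesis .
    qed
    then have "t i \<otimes> inv (t j) \<in> A" using maxA[of "t i \<otimes> inv (t j)"] ti tj by simp
    then show False using tt ij by simp
  qed
  have "\<rho> \<in> irreps G m"
    unfolding irreps_def
  proof (intro CollectI conjI hm m allI impI)
    fix W assume "VectorSpace.subspace class_ring W (module_vec TYPE(complex) m)"
      and "\<forall>g\<in>carrier G. \<forall>w\<in>W. \<rho> g *\<^sub>v w \<in> W"
    then have W: "W \<subseteq> carrier_vec m" "0\<^sub>v m \<in> W" "!!x y. x \<in> W ==> y \<in> W ==> x + y \<in> W"
      "!!c x. x \<in> W ==> c \<cdot>\<^sub>v x \<in> W" "!!g w. g \<in> carrier G ==> w \<in> W ==> \<rho> g *\<^sub>v w \<in> W"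
      by (auto simp: subspace_vec_iff)
    show "W = {0\<^sub>v m} \<or> W = carrier_vec m"
    proof (rule disjCI)
      assume "W \<noteq> carrier_vec m"
      show "W = {0\<^sub>v m}"
      proof (rule ccontr)
        assume "W \<noteq> {0\<^sub>v m}"
        then have "\<exists>x. x \<in> W \<and> x \<noteq> 0\<^sub>v m" using W by auto
        \<comment> \<open>Size of the support. A nonzero vector of minimal support in
          \<open>W\<close> has a single nonzero coordinate: otherwise \<open>\<rho> a\<close> minus
          a scalar would erase one coordinate and keep another.\<close>
        define sp where "sp x = card {i. i < m \<and> x $ i \<noteq> 0}" for x :: "complex vec"
        obtain x where x: "x \<in> W" "x \<noteq> 0\<^sub>v m" and mn: "!!y. y \<in> W ==> y \<noteq> 0\<^sub>v m ==> sp x \<le> sp y"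
          using ex_has_least_nat[of "\<lambda>x. x \<in> W \<and> x \<noteq> 0\<^sub>v m" _ sp] \<open>\<exists>x. x \<in> W \<and> x \<noteq> 0\<^sub>v m\<close> by metis
        have xc: "x \<in> carrier_vec m" using x W by auto
        obtain i where i: "i < m" "x $ i \<noteq> 0" using x(2) xc by (metis carrier_vecD eq_vecI index_zero_vec)
        have x0: "x $ j = 0" if j: "j < m" "j \<noteq> i" for j
        proof (rule ccontr)
          assume xj: "x $ j \<noteq> 0"
          obtain a where a: "a \<in> A" "l (cm (t i) a) \<noteq> l (cm (t j) a)" using sep[OF i(1) j(1)] j by blast
          have act: "(\<rho> a *\<^sub>v x) $ k = l (cm (t k) a) * w' a * x $ k" if k: "k < m" for k
          proof -
            have "(\<rho> a *\<^sub>v x) $ k = (\<Sum>k'=0..<m. \<rho> a $$ (k, k') * x $ k')"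
              using k xc rc[of a] by (auto simp: scalar_prod_def)
            also have "\<dots> = (\<Sum>k'=0..<m. if k' = k then l (cm (t k) a) * w' a * x $ k else 0)"
              using k by (intro sum.cong) (auto simp: diag[OF a(1)])
            finally show ?thesis using k by simp
          qed
          define y where "y = \<rho> a *\<^sub>v x + (- (l (cm (t i) a) * w' a)) \<cdot>\<^sub>v x"
          have yW: "y \<in> W" unfolding y_def using W x Ac[OF a(1)] by blast
          have yk: "y $ k = (l (cm (t k) a) - l (cm (t i) a)) * w' a * x $ k" if "k < m" for k
            unfolding y_def using act[OF that] xc rc[of a] that by (simp add: algebra_simps)
          have "w' a \<noteq> 0" using chars_nonzero[OF w'c sA(1) a(1)] .
          then have "y $ j \<noteq> 0" using yk[OF j(1)] a xj by auto
          then have y0: "y \<noteq> 0\<^sub>v m" using j by auto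
          have "{k. k < m \<and> y $ k \<noteq> 0} \<subset> {k. k < m \<and> x $ k \<noteq> 0}"
            using yk i by fastforce
          then have "sp y < sp x" unfolding sp_def by (intro psubset_card_mono) auto
          then show False using mn[OF yW y0] by simp
        qed
        have ei: "unit_vec m i \<in> W"
        proof -
          have "unit_vec m i = (1 / x $ i) \<cdot>\<^sub>v x" using xc x0 i by (intro eq_vecI) auto
          then show ?thesis using W(4)[OF x(1)] by metis
        qed
        have ej: "unit_vec m j \<in> W" if j: "j < m" for j
        proof -
          \<comment> \<open>This element carries the basis vector of coset \<open>i\<close> to that
            of coset \<open>j\<close>.\<close>
          let ?g = "inv (t j) \<otimes> t i"
          note ti = t[OF i(1)] and tj = t[OF j]
          have "\<rho> ?g *\<^sub>v unit_vec m i = unit_vec m j"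
          proof (rule eq_vecI)
            fix k assume "k < dim_vec (unit_vec m j)"
            then have k: "k < m" by simp
            have "(\<rho> ?g *\<^sub>v unit_vec m i) $ k = \<rho> ?g $$ (k, i)" using k i rc[of ?g] by simp
            also have "\<dots> = u (t k \<otimes> inv (t j))"
              unfolding rij[OF k i(1)] using ti tj t[OF k] by (simp add: m_assoc)
            also have "\<dots> = unit_vec m j $ k" using tt[OF k j] k j tj charsD(1)[OF w'c] by (auto simp: u_def)
            finally show "(\<rho> ?g *\<^sub>v unit_vec m i) $ k = unit_vec m j $ k" .
          qed (use rc[of ?g] in simp)
          then show ?thesis using W(5)[OF _ ei, of ?g] ti tj by simp
        qed
        have "vec m (\<lambda>i. if i < k then v $ i else 0) \<in> W" if v: "v \<in> carrier_vec m" and "k \<le> m" for k v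
          using \<open>k \<le> m\<close>
        proof (induction k)
          case 0
          have "vec m (\<lambda>i. if i < 0 then v $ i else 0) = 0\<^sub>v m" by auto
          then show ?case using W(2) by simp
        next
          case (Suc k)
          have "vec m (\<lambda>i. if i < Suc k then v $ i else 0) = vec m (\<lambda>i. if i < k then v $ i else 0) + (v $ k) \<cdot>\<^sub>v unit_vec m k"
            using Suc by (intro eq_vecI) (auto simp: less_Suc_eq)
          moreover have "vec m (\<lambda>i. if i < k then v $ i else 0) \<in> W" using Suc by simp
          ultimately show ?case using W(3) W(4)[OF ej[of k], of "v $ k"] Suc by simp
        qed
        note * = this
        have "v \<in> W" if v: "v \<in> carrier_vec m" for v
        proof -
          have "vec m (\<lambda>i. if i < m then v $ i else 0) = v" using v by (intro eq_vecI) auto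
          then show ?thesis using *[OF v le_refl] by simp
        qed
        then show False using W(1) \<open>W \<noteq> carrier_vec m\<close> by blast
      qed
    qed
  qed
  moreover have z00: "\<rho> g $$ (0, 0) = w g" if g: "g \<in> rad l" for g
  proof -
    have gc: "g \<in> carrier G" and gA: "g \<in> A" using g sA(2) by (auto simp: rad_def)
    have "l (cm (t 0) g) = 1" using form_swap_1[OF l gc t[OF m]] g t[OF m] by (auto simp: rad_def)
    then show ?thesis using diag[OF gA m m] w'w[OF g] by simp
  qed
  have "lam \<rho> = l"
  proof (rule extensionalityI[of _ Z])
    fix z assume z: "z \<in> Z"
    have zr: "z \<in> rad l" using z Z_rad[OF l] by blast
    show "lam \<rho> z = l z" using z00[OF zr] w'w[OF zr] w'l[OF z] z by (simp add: lam_def)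
  qed (use charsD(3)[OF l] in \<open>auto simp: lam_def\<close>)
  moreover have "omg \<rho> = w"
  proof (rule extensionalityI[of _ "rad l"])
    show "w \<in> extensional (rad l)" using w by (auto simp: extensions_def chars_def)
  qed (use z00 \<open>lam \<rho> = l\<close> in \<open>auto simp: omg_def\<close>)
  ultimately show ?thesis by blast
qed

end

lemma card_quotient_kernel:
  assumes "!!x y. x \<in> A ==> y \<in> A ==> (x, y) \<in> r \<longleftrightarrow> f x = f y" "r \<subseteq> A \<times> A"
  shows "card (A // r) = card (f ` A)"
proof -
  have img: "r `` {x} = {y \<in> A. f y = f x}" if "x \<in> A" for x
    using assms that by auto
  have "A // r = (\<lambda>v. {y \<in> A. f y = v}) ` (f ` A)"
    by (auto simp: quotient_def img)
  moreover have "inj_on (\<lambda>v. {y \<in> A. f y = v}) (f ` A)"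
    by (auto simp: inj_on_def)
  ultimately show ?thesis by (simp add: card_image)
qed

lemma powr_square_half:
  assumes "d > 0"
  shows "(of_nat (d\<^sup>2) :: complex) powr (- s / 2) = of_nat d powr (- s)"
proof -
  have "(of_nat (d\<^sup>2) :: complex) powr (- s / 2) = of_nat d powr (- s / 2) * of_nat d powr (- s / 2)"
    by (simp add: power2_eq_square powr_times_real)
  also have "\<dots> = of_nat d powr (- s)" by (simp add: powr_add[symmetric])
  finally show ?thesis .
qed

text \<open>These are the extensions of the trivial character of the trivial subgroup.\<close>

lemma (in group) chars_count:
  assumes fin: "finite (carrier G)" and Z: "subgroup Z G"
    and comm: "!!x y. x \<in> Z ==> y \<in> Z ==> x \<otimes> y = y \<otimes> x"
  shows "finite (chars G Z)" "card (chars G Z) = card Z"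
proof -
  define l where "l = restrict (\<lambda>_. 1 :: complex) {\<one>}"
  have K: "subgroup {\<one>} G" by (rule triv_subgroup)
  have l: "l \<in> chars G {\<one>}" by (auto simp: l_def chars_def)
  have sub: "{\<one>} \<subseteq> Z" using Z by (simp add: subgroup.one_closed)
  have c: "\<exists>z\<in>{\<one>}. l z = 1 \<and> x \<otimes> y = z \<otimes> (y \<otimes> x)" if xy: "x \<in> Z" "y \<in> Z" for x y
    using comm[OF xy] xy subgroup.mem_carrier[OF Z] by (simp add: l_def)
  have "extensions G {\<one>} Z l = chars G Z" by (auto simp: extensions_def chars_def l_def)
  then show "finite (chars G Z)" "card (chars G Z) = card Z"
    using card_extensions[OF fin Z K sub l c] finite_extensions[OF fin Z K sub l c] by auto
qed

context class2_group
begin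

text \<open>Labels for the isomorphism classes of irreducible representations of all degrees
  together.\<close>

definition params :: "(('a => complex) \<times> ('a => complex)) set" where
  "params = Sigma (chars G Z) (\<lambda>l. extensions G Z (rad l) l)"

lemma rad_extensions:
  assumes l: "l \<in> chars G Z"
  shows "finite (extensions G Z (rad l) l)" "card (extensions G Z (rad l) l) * card Z = card (rad l)"
proof -
  have c: "\<exists>z\<in>Z. l z = 1 \<and> x \<otimes> y = z \<otimes> (y \<otimes> x)" if xy: "x \<in> rad l" "y \<in> rad l" for x y
    using xy swap[of x y] cm_Z[of x y] by (auto simp: rad_def)
  show "finite (extensions G Z (rad l) l)" "card (extensions G Z (rad l) l) * card Z = card (rad l)"
    using card_extensions[OF fin rad_subgroup[OF l] Z Z_rad[OF l] l c]
      finite_extensions[OF fin rad_subgroup[OF l] Z Z_rad[OF l] l c] by auto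
qed

lemma finite_chars_Z: "finite (chars G Z)"
  using chars_count(1)[OF fin Z] central Zc by blast

lemma finite_params: "finite params"
  unfolding params_def using finite_chars_Z rad_extensions(1) by auto

lemma irreps_params:
  "(\<lambda>\<rho>. (lam \<rho>, omg \<rho>)) ` irreps G m = {p \<in> params. 0 < m \<and> m\<^sup>2 * card (rad (fst p)) = card (carrier G)}"
proof (intro equalityI subsetI)
  fix p assume "p \<in> (\<lambda>\<rho>. (lam \<rho>, omg \<rho>)) ` irreps G m"
  then obtain \<rho> where "\<rho> \<in> irreps G m" "p = (lam \<rho>, omg \<rho>)" by blast
  then show "p \<in> {p \<in> params. 0 < m \<and> m\<^sup>2 * card (rad (fst p)) = card (carrier G)}"
    using lam_chars omg_extensions card_irrep m_pos by (auto simp: params_def)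
next
  fix p assume p: "p \<in> {p \<in> params. 0 < m \<and> m\<^sup>2 * card (rad (fst p)) = card (carrier G)}"
  obtain l w where lw: "p = (l, w)" by (cases p)
  have l: "l \<in> chars G Z" "w \<in> extensions G Z (rad l) l" and m: "m\<^sup>2 * card (rad l) = card (carrier G)" "0 < m"
    using p by (auto simp: lw params_def)
  obtain m' \<rho> where r: "\<rho> \<in> irreps G m'" "lam \<rho> = l" "omg \<rho> = w" using irrep_exists[OF l] by blast
  have "m'\<^sup>2 * card (rad l) = m\<^sup>2 * card (rad l)" using card_irrep[OF r(1)] r m by simp
  moreover have "card (rad l) > 0" using subgroup.finite_imp_card_positive[OF rad_subgroup[OF l(1)] fin] .
  ultimately have "m' = m" by simp
  then show "p \<in> (\<lambda>\<rho>. (lam \<rho>, omg \<rho>)) ` irreps G m" using r lw by auto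
qed

lemma num_irreps_eq:
  "num_irreps G m = card {p \<in> params. 0 < m \<and> m\<^sup>2 * card (rad (fst p)) = card (carrier G)}"
  unfolding num_irreps_def irreps_params[symmetric]
proof (rule card_quotient_kernel)
  show "irrep_iso G m \<subseteq> irreps G m \<times> irreps G m" by (auto simp: irrep_iso_def)
qed (simp add: irrep_iso_iff)

text \<open>Over each \<open>l\<close> there are \<open>card (rad l) / card Z\<close> classes, all
  of the same degree, the square root of the index of \<open>rad l\<close>; the root is absorbed
  into the exponent \<open>- s / 2\<close>.\<close>

theorem zeta_irr_class2:
  "zeta_irr G s = (\<Sum>l\<in>chars G Z. of_nat (card (rad l)) / of_nat (card Z) *
     (of_nat (card (carrier G)) / of_nat (card (rad l))) powr (- s / 2))"
proof -
  \<comment> \<open>The degree belonging to a label. It exists because some representation has this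
    label, which makes the index of the radical a perfect square.\<close>
  define d where "d p = (THE m. 0 < m \<and> m\<^sup>2 * card (rad (fst p)) = card (carrier G))" for p :: "('a => complex) \<times> ('a => complex)"
  have rp: "card (rad l) > 0" if "l \<in> chars G Z" for l
    using subgroup.finite_imp_card_positive[OF rad_subgroup[OF that] fin] .
  have d: "0 < m \<and> m\<^sup>2 * card (rad (fst p)) = card (carrier G) \<longleftrightarrow> d p = m" if p: "p \<in> params" for p m
  proof -
    obtain l w where lw: "p = (l, w)" "l \<in> chars G Z" "w \<in> extensions G Z (rad l) l" using p by (auto simp: params_def)
    obtain m' \<rho> where r: "\<rho> \<in> irreps G m'" "lam \<rho> = l" "omg \<rho> = w" using irrep_exists[OF lw(2,3)] by blast
    have m': "0 < m' \<and> m'\<^sup>2 * card (rad (fst p)) = card (carrier G)"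
      using card_irrep[OF r(1)] m_pos[OF r(1)] r lw by simp
    have uq: "m = m'" if "0 < m \<and> m\<^sup>2 * card (rad (fst p)) = card (carrier G)" for m
    proof -
      have "m\<^sup>2 * card (rad l) = m'\<^sup>2 * card (rad l)" using that m' lw by simp
      then show ?thesis using rp[OF lw(2)] by simp
    qed
    have "d p = m'" unfolding d_def using m' uq by (intro the_equality) blast+
    then show ?thesis using m' uq by metis
  qed
  have num: "num_irreps G m = card {p \<in> params. d p = m}" for m
    unfolding num_irreps_eq using d by (intro arg_cong[of _ _ card]) auto
  have dpos: "d p \<in> {1..}" if "p \<in> params" for p using d[OF that, of "d p"] by simp
  have "zeta_irr G s = (\<Sum>\<^sub>\<infinity>m\<in>d ` params. of_nat (num_irreps G m) * of_nat m powr (- s))"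
    unfolding zeta_irr_def
  proof (rule infsum_cong_neutral)
    fix m assume "m \<in> {1..} - d ` params"
    then have e: "{p \<in> params. d p = m} = {}" by auto
    show "of_nat (num_irreps G m) * of_nat m powr (- s) = (0::complex)" unfolding num e by simp
  qed (use dpos in auto)
  also have "\<dots> = (\<Sum>m\<in>d ` params. of_nat (num_irreps G m) * of_nat m powr (- s))"
    using finite_params by simp
  also have "\<dots> = (\<Sum>p\<in>params. of_nat (d p) powr (- s))"
    unfolding num using sum_fun_comp[OF finite_params, of "d ` params" d "\<lambda>m. of_nat m powr (- s)"] finite_params by simp
  also have "\<dots> = (\<Sum>p\<in>params. (of_nat (card (carrier G)) / of_nat (card (rad (fst p)))) powr (- s / 2))"
  proof (rule sum.cong[OF refl])
    fix p assume p: "p \<in> params"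
    have dp: "0 < d p" "(d p)\<^sup>2 * card (rad (fst p)) = card (carrier G)" using d[OF p, of "d p"] by auto
    have "card (rad (fst p)) \<noteq> 0" using rp p by (auto simp: params_def)
    then have "of_nat (card (carrier G)) / of_nat (card (rad (fst p))) = (of_nat ((d p)\<^sup>2) :: complex)"
      using dp(2)[symmetric] by simp
    then show "of_nat (d p) powr (- s) = (of_nat (card (carrier G)) / of_nat (card (rad (fst p)))) powr (- s / 2)"
      using powr_square_half[OF dp(1), of s] by simp
  qed
  also have "\<dots> = (\<Sum>l\<in>chars G Z. \<Sum>w\<in>extensions G Z (rad l) l. (of_nat (card (carrier G)) / of_nat (card (rad l))) powr (- s / 2))"
    unfolding params_def using finite_chars_Z rad_extensions(1) by (subst sum.Sigma) (auto simp: split_def)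
  also have "\<dots> = (\<Sum>l\<in>chars G Z. of_nat (card (rad l)) / of_nat (card Z) *
     (of_nat (card (carrier G)) / of_nat (card (rad l))) powr (- s / 2))"
  proof (rule sum.cong[OF refl])
    fix l assume l: "l \<in> chars G Z"
    have "card Z \<noteq> 0" using subgroup.finite_imp_card_positive[OF Z fin] by simp
    then have "of_nat (card (extensions G Z (rad l) l)) = (of_nat (card (rad l)) / of_nat (card Z) :: complex)"
      using rad_extensions(2)[OF l, symmetric] by simp
    then show "(\<Sum>w\<in>extensions G Z (rad l) l. (of_nat (card (carrier G)) / of_nat (card (rad l))) powr (- s / 2)) =
      of_nat (card (rad l)) / of_nat (card Z) * (of_nat (card (carrier G)) / of_nat (card (rad l))) powr (- s / 2)"
      by simp
  qed
  finally show ?thesis .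
qed

end

section \<open>Local rings with a nilpotent principal maximal ideal: valuations, sizes of ideals,
  additive characters\<close>

section \<open>Finite chain rings\<close>

text \<open>\<open>N\<close> is the length of the ring and \<open>q\<close> the size of its residue
  field. For \<open>N = 0\<close> the ring is zero and belongs to the first term of the series; it
  has no residue field, so \<open>reps\<close> is stated for \<open>N > 0\<close>.\<close>

locale chain_ring = cring R for R (structure) +
  fixes \<pi> :: 'a and N q :: nat
  assumes p_carrier [simp]: "\<pi> \<in> carrier R"
    and quasi_unit: "x \<in> carrier R ==> (!!y. y \<in> carrier R ==> x \<noteq> \<pi> \<otimes> y) ==>
      \<exists>y\<in>carrier R. \<exists>z\<in>carrier R. x \<otimes> y = \<one> \<oplus> \<pi> \<otimes> z"
    and p_N: "\<pi> [^] N = \<zero>"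
    and p_k: "k < N ==> \<pi> [^] k \<noteq> \<zero>"
    and reps: "N > 0 ==> \<exists>F\<subseteq>carrier R. finite F \<and> card F = q \<and>
      (\<forall>x\<in>carrier R. \<exists>f\<in>F. \<exists>y\<in>carrier R. x = f \<oplus> \<pi> \<otimes> y) \<and>
      (\<forall>f\<in>F. \<forall>f'\<in>F. \<forall>y\<in>carrier R. f \<ominus> f' = \<pi> \<otimes> y --> f = f')"
    and q2: "q \<ge> 2"
begin

definition J :: "nat => 'a set" where "J k = {\<pi> [^] k \<otimes> y | y. y \<in> carrier R}"

lemma J_I: "y \<in> carrier R ==> \<pi> [^] k \<otimes> y \<in> J k" by (auto simp: J_def)

lemma J_carrier: "x \<in> J k ==> x \<in> carrier R" by (auto simp: J_def)

lemma J_zero [simp]: "\<zero> \<in> J k"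
  using J_I[of \<zero> k] by simp

lemma J_0: "J 0 = carrier R"
proof (intro equalityI subsetI)
  fix x assume "x \<in> carrier R"
  then show "x \<in> J 0" using J_I[of x 0] by simp
qed (rule J_carrier)

lemma J_N: "J N = {\<zero>}"
proof (intro equalityI subsetI)
  fix x assume "x \<in> J N"
  then obtain y where "x = \<pi> [^] N \<otimes> y" "y \<in> carrier R" by (auto simp: J_def)
  then show "x \<in> {\<zero>}" by (simp add: p_N)
qed simp

lemma J_Suc_sub: "J (Suc k) \<subseteq> J k"
proof
  fix x assume "x \<in> J (Suc k)"
  then obtain y where "x = \<pi> [^] Suc k \<otimes> y" "y \<in> carrier R" by (auto simp: J_def)
  then show "x \<in> J k" using J_I[of "\<pi> \<otimes> y" k] by (simp add: m_assoc)
qed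

lemma J_mono: "j \<le> k ==> J k \<subseteq> J j"
  by (induction k) (use J_Suc_sub in \<open>auto simp: le_Suc_eq\<close>)

lemma J_add: "x \<in> J k ==> y \<in> J k ==> x \<oplus> y \<in> J k"
  by (auto simp: J_def r_distr[symmetric])

lemma J_neg: "x \<in> J k ==> \<ominus> x \<in> J k"
  by (auto simp: J_def r_minus[symmetric])

lemma J_minus: "x \<in> J k ==> y \<in> J k ==> x \<ominus> y \<in> J k"
  by (simp add: a_minus_def J_add J_neg)

lemma J_mult: "x \<in> J k ==> y \<in> carrier R ==> x \<otimes> y \<in> J k"
  by (auto simp: J_def m_assoc)

lemma J_mult': "x \<in> J k ==> y \<in> carrier R ==> y \<otimes> x \<in> J k"
  using J_mult[of x k y] J_carrier[of x k] by (simp add: m_comm)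

text \<open>Factorization by the geometric sum, through which 1 minus a nilpotent element becomes
  invertible.\<close>

lemma one_minus_pow:
  assumes u: "u \<in> carrier R"
  shows "\<exists>v\<in>carrier R. (\<one> \<ominus> u) \<otimes> v = \<one> \<ominus> u [^] (k::nat)"
proof (induction k)
  case 0
  show ?case using u by (intro bexI[of _ \<zero>]) (auto simp: a_minus_def r_neg)
next
  case (Suc k)
  then obtain v where v: "v \<in> carrier R" "(\<one> \<ominus> u) \<otimes> v = \<one> \<ominus> u [^] k" by blast
  have "(\<one> \<ominus> u) \<otimes> (v \<oplus> u [^] k) = (\<one> \<ominus> u) \<otimes> v \<oplus> (\<one> \<ominus> u) \<otimes> u [^] k"
    using u v by (simp add: r_distr)
  also have "\<dots> = (\<one> \<ominus> u [^] k) \<oplus> (u [^] k \<ominus> u [^] k \<otimes> u)"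
  proof -
    have "(\<one> \<ominus> u) \<otimes> u [^] k = u [^] k \<ominus> u \<otimes> u [^] k" using u by (simp add: a_minus_def l_distr l_minus)
    moreover have "u \<otimes> u [^] k = u [^] k \<otimes> u" using u by (simp add: m_comm)
    ultimately show ?thesis using v by simp
  qed
  also have "\<dots> = \<one> \<ominus> u [^] Suc k"
  proof -
    have "u [^] k \<in> carrier R" "u [^] k \<otimes> u \<in> carrier R" using u by auto
    then show ?thesis by (simp add: a_minus_def a_assoc r_neg2 l_neg r_neg r_neg1)
  qed
  finally show ?case using u v by (intro bexI[of _ "v \<oplus> u [^] k"]) auto
qed

lemma unit_one_minus:
  assumes z: "z \<in> J 1"
  shows "\<one> \<ominus> z \<in> Units R"
proof -
  obtain y where y: "z = \<pi> \<otimes> y" "y \<in> carrier R" using z by (auto simp: J_def)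
  then have zc: "z \<in> carrier R" by simp
  obtain v where v: "v \<in> carrier R" "(\<one> \<ominus> z) \<otimes> v = \<one> \<ominus> z [^] N" using one_minus_pow[OF zc] by blast
  have "z [^] N = \<zero>" using y by (simp add: nat_pow_distrib p_N)
  then have "(\<one> \<ominus> z) \<otimes> v = \<one>" using v by (simp add: a_minus_def)
  then show ?thesis using v zc m_comm[of "\<one> \<ominus> z" v] by (auto simp: Units_def intro!: bexI[of _ v])
qed

text \<open>\<open>quasi_unit\<close> provides an inverse modulo \<open>\<pi>\<close>; the error is
  nilpotent and can be divided out.\<close>

lemma Units_iff_aux:
  assumes x: "x \<in> carrier R" "x \<notin> J 1"
  shows "x \<in> Units R"
proof -
  have "x \<noteq> \<pi> \<otimes> y" if "y \<in> carrier R" for y using x(2) J_I[OF that, of 1] by auto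
  then obtain y z where yz: "y \<in> carrier R" "z \<in> carrier R" "x \<otimes> y = \<one> \<oplus> \<pi> \<otimes> z" using quasi_unit[OF x(1)] by blast
  have "\<ominus> (\<pi> \<otimes> z) \<in> J 1" using J_neg J_I[of z 1] yz by simp
  then have "\<one> \<ominus> \<ominus> (\<pi> \<otimes> z) \<in> Units R" by (rule unit_one_minus)
  then have u: "x \<otimes> y \<in> Units R" using yz by (simp add: a_minus_def)
  then obtain i where i: "i \<in> carrier R" "(x \<otimes> y) \<otimes> i = \<one>" by (auto simp: Units_def)
  have "x \<otimes> (y \<otimes> i) = \<one>" using i x yz(1) by (simp add: m_assoc[symmetric])
  moreover have "y \<otimes> i \<in> carrier R" using i yz(1) by simp
  ultimately show ?thesis using x(1) m_comm[OF x(1), of "y \<otimes> i"] by (auto simp: Units_def intro!: bexI[of _ "y \<otimes> i"])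
qed

lemma J_exact:
  assumes x: "x \<in> J k" "x \<notin> J (Suc k)"
  obtains u where "u \<in> Units R" "x = \<pi> [^] k \<otimes> u"
proof -
  obtain u where u: "u \<in> carrier R" "x = \<pi> [^] k \<otimes> u" using x by (auto simp: J_def)
  have "u \<notin> J 1"
  proof
    assume "u \<in> J 1"
    then obtain y where "u = \<pi> \<otimes> y" "y \<in> carrier R" by (auto simp: J_def)
    then have "x = \<pi> [^] Suc k \<otimes> y" using u by (simp add: m_assoc)
    then show False using x \<open>y \<in> carrier R\<close> J_I by blast
  qed
  then show thesis using that u Units_iff_aux by blast
qed

lemma p_pow_unit_zero:
  assumes "u \<in> Units R" "\<pi> [^] (k::nat) \<otimes> u = \<zero>"
  shows "N \<le> k"
proof (rule ccontr)
  assume "\<not> N \<le> k"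
  then have k: "\<pi> [^] k \<noteq> \<zero>" using p_k by simp
  have "\<pi> [^] k = (\<pi> [^] k \<otimes> u) \<otimes> inv u" using assms(1) by (simp add: m_assoc Units_closed)
  also have "\<dots> = \<zero>" unfolding assms(2) using assms(1) by simp
  finally show False using k by simp
qed

text \<open>A unit minus a multiple of \<open>\<pi>\<close> is again a unit, so membership would
  make \<open>\<pi> [^] k\<close> vanish.\<close>

lemma J_unit_notin:
  assumes k: "k < N" and u: "u \<in> Units R"
  shows "\<pi> [^] k \<otimes> u \<notin> J (Suc k)"
proof
  assume "\<pi> [^] k \<otimes> u \<in> J (Suc k)"
  then obtain y where y: "y \<in> carrier R" "\<pi> [^] k \<otimes> u = \<pi> [^] Suc k \<otimes> y" by (auto simp: J_def)
  have uc: "u \<in> carrier R" using u by auto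
  have py: "\<pi> \<otimes> y \<in> carrier R" using y by simp
  have "\<pi> [^] k \<otimes> (u \<ominus> \<pi> \<otimes> y) = \<pi> [^] k \<otimes> u \<ominus> \<pi> [^] k \<otimes> (\<pi> \<otimes> y)"
    using uc py by (simp add: a_minus_def r_distr r_minus)
  also have "\<dots> = \<zero>" using y uc by (simp add: m_assoc a_minus_def r_neg)
  finally have z: "\<pi> [^] k \<otimes> (u \<ominus> \<pi> \<otimes> y) = \<zero>" .
  have "u \<ominus> \<pi> \<otimes> y = u \<otimes> (\<one> \<ominus> (\<pi> \<otimes> (y \<otimes> inv u)))"
  proof -
    have iu: "inv u \<in> carrier R" "u \<otimes> inv u = \<one>" using u by auto
    have "u \<otimes> (\<pi> \<otimes> (y \<otimes> inv u)) = (\<pi> \<otimes> y) \<otimes> (u \<otimes> inv u)" using uc iu(1) y(1) by (simp add: m_ac)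
    then show ?thesis using uc iu y by (simp add: a_minus_def r_distr r_minus)
  qed
  moreover have "\<pi> \<otimes> (y \<otimes> inv u) \<in> J 1" using J_I[of "y \<otimes> inv u" 1] y u by simp
  ultimately have "u \<ominus> \<pi> \<otimes> y \<in> Units R" using unit_one_minus u by simp
  then show False using p_pow_unit_zero[OF _ z] k by simp
qed

text \<open>Each element of \<open>J k\<close> is \<open>\<pi> [^] k \<otimes> f \<oplus> j\<close>
  with a unique residue representative \<open>f\<close> and a unique \<open>j\<close> in the next
  ideal.\<close>

lemma card_J_Suc:
  assumes k: "k < N" and fin: "finite (J (Suc k))"
  shows "finite (J k) \<and> card (J k) = q * card (J (Suc k))"
proof -
  obtain F where F: "F \<subseteq> carrier R" "finite F" "card F = q"
    "!!x. x \<in> carrier R ==> \<exists>f\<in>F. \<exists>y\<in>carrier R. x = f \<oplus> \<pi> \<otimes> y"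
    "!!f f' y. f \<in> F ==> f' \<in> F ==> y \<in> carrier R ==> f \<ominus> f' = \<pi> \<otimes> y ==> f = f'"
    using reps k by (metis gr_implies_not0 neq0_conv)
  let ?h = "\<lambda>(f, j). \<pi> [^] k \<otimes> f \<oplus> j"
  have "J k = ?h ` (F \<times> J (Suc k))"
  proof (intro equalityI subsetI)
    fix x assume "x \<in> J k"
    then obtain y where y: "y \<in> carrier R" "x = \<pi> [^] k \<otimes> y" by (auto simp: J_def)
    obtain f z where fz: "f \<in> F" "z \<in> carrier R" "y = f \<oplus> \<pi> \<otimes> z" using F(4)[OF y(1)] by blast
    have fc: "f \<in> carrier R" using fz F by auto
    have "x = \<pi> [^] k \<otimes> f \<oplus> \<pi> [^] Suc k \<otimes> z" using y fz fc by (simp add: r_distr m_assoc)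
    then show "x \<in> ?h ` (F \<times> J (Suc k))" using fz J_I[of z "Suc k"] by force
  next
    fix x assume "x \<in> ?h ` (F \<times> J (Suc k))"
    then obtain f j where "f \<in> F" "j \<in> J (Suc k)" "x = \<pi> [^] k \<otimes> f \<oplus> j" by auto
    then show "x \<in> J k" using J_Suc_sub F(1) by (auto intro!: J_add J_I)
  qed
  moreover have "inj_on ?h (F \<times> J (Suc k))"
  proof (rule inj_onI, clarify)
    fix f j f' j' assume f: "f \<in> F" "f' \<in> F" and j: "j \<in> J (Suc k)" "j' \<in> J (Suc k)"
      and eq: "\<pi> [^] k \<otimes> f \<oplus> j = \<pi> [^] k \<otimes> f' \<oplus> j'"
    have c: "f \<in> carrier R" "f' \<in> carrier R" "j \<in> carrier R" "j' \<in> carrier R" using f j F(1) J_carrier by auto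
    let ?P = "\<pi> [^] k"
    have pc: "?P \<otimes> f \<in> carrier R" "?P \<otimes> f' \<in> carrier R" using c by auto
    have "?P \<otimes> (f \<ominus> f') = ?P \<otimes> f \<ominus> ?P \<otimes> f'" using c by (simp add: a_minus_def r_distr r_minus)
    also have "?P \<otimes> f = (?P \<otimes> f' \<oplus> j') \<ominus> j"
      using eq[symmetric] c pc by (simp add: a_minus_def a_assoc r_neg)
    also have "\<dots> \<ominus> ?P \<otimes> f' = j' \<ominus> j"
    proof -
      have "(?P \<otimes> f' \<oplus> j') \<ominus> j \<ominus> ?P \<otimes> f' = (?P \<otimes> f' \<oplus> \<ominus> (?P \<otimes> f')) \<oplus> (j' \<ominus> j)"
        using c pc by (simp add: a_minus_def a_ac)
      then show ?thesis using c pc by (simp add: r_neg)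
    qed
    finally have d: "\<pi> [^] k \<otimes> (f \<ominus> f') \<in> J (Suc k)" using j J_minus by simp
    have "f = f'"
    proof (rule ccontr)
      assume "f \<noteq> f'"
      then have "f \<ominus> f' \<notin> J 1" using F(5)[OF f] by (auto simp: J_def)
      then have "f \<ominus> f' \<in> Units R" using c Units_iff_aux by simp
      then show False using J_unit_notin[OF k] d by blast
    qed
    then show "f = f' \<and> j = j'" using eq c by simp
  qed
  ultimately show ?thesis using F fin by (simp add: card_image card_cartesian_product)
qed

lemma card_J: "k \<le> N ==> finite (J k) \<and> card (J k) = q ^ (N - k)"
proof (induction "N - k" arbitrary: k)
  case 0
  then have "k = N" by simp
  then show ?case by (simp add: J_N)
next
  case (Suc n)
  then have k: "k < N" by simp
  have "finite (J (Suc k)) \<and> card (J (Suc k)) = q ^ (N - Suc k)" using Suc k by simp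
  then show ?case using card_J_Suc[OF k] k by (simp add: Suc_diff_Suc[symmetric])
qed

lemma finite_R: "finite (carrier R)" and card_R: "card (carrier R) = q ^ N"
  using card_J[of 0] by (auto simp: J_0)

lemma finite_J: "finite (J k)"
  using finite_R J_carrier by (meson finite_subset subsetI)

lemma nonzero_form:
  assumes x: "x \<in> carrier R" "x \<noteq> \<zero>"
  obtains k u where "k < N" "u \<in> Units R" "x = \<pi> [^] k \<otimes> u"
proof -
  have "x \<in> J 0" "x \<notin> J N" using x by (auto simp: J_0 J_N)
  then obtain k where k: "k < N" "x \<in> J k" "x \<notin> J (Suc k)"
    using inc_induct[of 0 N "\<lambda>k. x \<notin> J k"] by (metis dec_induct zero_le)
  then show thesis using J_exact that by metis
qed

text \<open>Valuations add, and a product vanishes once their sum reaches \<open>N\<close>. The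
  annihilator measures the freedom that a pivot of valuation \<open>k\<close> leaves in the
  solutions of a linear system.\<close>

lemma ann_eq_J:
  assumes k: "k \<le> N"
  shows "{x \<in> carrier R. \<pi> [^] k \<otimes> x = \<zero>} = J (N - k)"
proof (intro equalityI subsetI)
  fix x assume "x \<in> J (N - k)"
  then obtain y where y: "y \<in> carrier R" "x = \<pi> [^] (N - k) \<otimes> y" by (auto simp: J_def)
  have "\<pi> [^] k \<otimes> x = \<pi> [^] (k + (N - k)) \<otimes> y" using y by (simp add: nat_pow_mult[symmetric] m_assoc)
  then show "x \<in> {x \<in> carrier R. \<pi> [^] k \<otimes> x = \<zero>}" using y k p_N by simp
next
  fix x assume x: "x \<in> {x \<in> carrier R. \<pi> [^] k \<otimes> x = \<zero>}"
  show "x \<in> J (N - k)"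
  proof (cases "x = \<zero>")
    case False
    then obtain j u where ju: "j < N" "u \<in> Units R" "x = \<pi> [^] j \<otimes> u" using x nonzero_form by blast
    have "\<pi> [^] (k + j) \<otimes> u = \<zero>" using x ju by (simp add: nat_pow_mult[symmetric] m_assoc Units_closed)
    then have "N \<le> k + j" using p_pow_unit_zero[OF ju(2)] by blast
    then have "J j \<subseteq> J (N - k)" by (intro J_mono) simp
    then show ?thesis using ju J_I[of u j] by auto
  qed simp
qed

lemma card_ann: "k \<le> N ==> card {x \<in> carrier R. \<pi> [^] k \<otimes> x = \<zero>} = q ^ k"
  using ann_eq_J card_J[of "N - k"] by simp

lemma add_group: "group (add_monoid R)"
  using a_group .

lemma J_subgroup: "subgroup (J k) (add_monoid R)"
  using J_carrier J_add J_neg by unfold_locales (auto simp: a_inv_def)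

text \<open>A character that is nontrivial on the minimal ideal \<open>J (N - 1)\<close> works,
  because every nonzero \<open>w\<close> has each element of that ideal among its multiples. It
  exists by counting: the characters trivial on this ideal are only a \<open>q\<close>-th part of
  all.\<close>

lemma additive_character:
  obtains \<psi> where "\<psi> \<in> chars (add_monoid R) (carrier R)"
    "!!w. w \<in> carrier R ==> w \<noteq> \<zero> ==> \<exists>r\<in>carrier R. \<psi> (w \<otimes> r) \<noteq> 1"
proof (cases "N = 0")
  case True
  then have "carrier R = {\<zero>}" using J_N J_0 by simp
  then show thesis using that[of "restrict (\<lambda>_. 1) (carrier R)"] by (auto simp: chars_def)
next
  case False
  let ?G = "add_monoid R"
  have fG: "finite (carrier ?G)" using finite_R by simp
  have sG: "subgroup (carrier R) ?G" using J_subgroup[of 0] by (simp add: J_0)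
  let ?K = "J (N - 1)"
  define l where "l = restrict (\<lambda>_. 1 :: complex) ?K"
  have l: "l \<in> chars ?G ?K" using J_add by (auto simp: l_def chars_def)
  have comm: "\<exists>z\<in>?K. l z = 1 \<and> x \<otimes>\<^bsub>?G\<^esub> y = z \<otimes>\<^bsub>?G\<^esub> (y \<otimes>\<^bsub>?G\<^esub> x)" if "x \<in> carrier R" "y \<in> carrier R" for x y
    using that by (intro bexI[of _ \<zero>]) (auto simp: l_def a_comm)
  have sub: "?K \<subseteq> carrier R" using J_carrier by blast
  have c1: "card (extensions ?G ?K (carrier R) l) * card ?K = card (carrier R)"
    by (rule group.card_extensions[OF add_group fG sG J_subgroup sub l comm])
  have cK: "card ?K = q" using card_J[of "N - 1"] False by simp
  have f2: "finite (chars ?G (carrier R))" "card (chars ?G (carrier R)) = card (carrier R)"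
  proof -
    define l0 where "l0 = restrict (\<lambda>_. 1 :: complex) {\<zero>}"
    have K: "subgroup {\<zero>} ?G" using J_subgroup[of N] by (simp add: J_N)
    have l0: "l0 \<in> chars ?G {\<zero>}" by (auto simp: l0_def chars_def)
    have sub0: "{\<zero>} \<subseteq> carrier R" by simp
    have c: "\<exists>z\<in>{\<zero>}. l0 z = 1 \<and> x \<otimes>\<^bsub>?G\<^esub> y = z \<otimes>\<^bsub>?G\<^esub> (y \<otimes>\<^bsub>?G\<^esub> x)" if "x \<in> carrier R" "y \<in> carrier R" for x y
      using that by (auto simp: l0_def a_comm)
    have e: "extensions ?G {\<zero>} (carrier R) l0 = chars ?G (carrier R)" by (auto simp: extensions_def chars_def l0_def)
    show "finite (chars ?G (carrier R))" using group.finite_extensions[OF add_group fG sG K sub0 l0 c] unfolding e .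
    show "card (chars ?G (carrier R)) = card (carrier R)" using group.card_extensions[OF add_group fG sG K sub0 l0 c] unfolding e by simp
  qed
  have "\<not> chars ?G (carrier R) \<subseteq> extensions ?G ?K (carrier R) l"
  proof
    assume "chars ?G (carrier R) \<subseteq> extensions ?G ?K (carrier R) l"
    then have "chars ?G (carrier R) = extensions ?G ?K (carrier R) l" by (auto simp: extensions_def)
    then have "card (carrier R) * q = card (carrier R)" using c1 f2 cK by simp
    moreover have "card (carrier R) > 0" using card_R q2 by simp
    ultimately show False using q2 by simp
  qed
  then obtain \<psi> where \<psi>: "\<psi> \<in> chars ?G (carrier R)" "\<psi> \<notin> extensions ?G ?K (carrier R) l" by blast
  then obtain k where k: "k \<in> ?K" "\<psi> k \<noteq> 1" by (auto simp: extensions_def l_def)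
  show thesis
  proof (rule that[OF \<psi>(1)])
    fix w assume w: "w \<in> carrier R" "w \<noteq> \<zero>"
    obtain j u where ju: "j < N" "u \<in> Units R" "w = \<pi> [^] j \<otimes> u" using nonzero_form[OF w] .
    obtain y where y: "y \<in> carrier R" "k = \<pi> [^] (N - 1) \<otimes> y" using k by (auto simp: J_def)
    \<comment> \<open>The multiplier taking \<open>w = \<pi> [^] j \<otimes> u\<close> to
      \<open>k\<close>: cancel the unit and raise the valuation from \<open>j\<close> to
      \<open>N - 1\<close>.\<close>
    let ?r = "inv u \<otimes> (\<pi> [^] (N - 1 - j) \<otimes> y)"
    have ic: "inv u \<in> carrier R" "u \<in> carrier R" "u \<otimes> inv u = \<one>" using ju by auto
    have "w \<otimes> ?r = (u \<otimes> inv u) \<otimes> ((\<pi> [^] j \<otimes> \<pi> [^] (N - 1 - j)) \<otimes> y)"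
      unfolding ju(3) using ic(1,2) y(1) by (simp add: m_ac)
    also have "\<dots> = k" using ju(1) y ic(3) by (simp add: nat_pow_mult)
    finally show "\<exists>r\<in>carrier R. \<psi> (w \<otimes> r) \<noteq> 1" using k ic y by (intro bexI[of _ ?r]) auto
  qed
qed

end

section \<open>The point group as a class-two group, with its commutator form in coordinates\<close>

section \<open>The groups of points over a chain ring\<close>

definition yb :: "nat \<times> nat => basis_elt" where "yb = (\<lambda>(i, j). BY i j)"

lemma lattice_basis_eq: "lattice_basis T n = BX ` {1..num_x T n} \<union> yb ` y_indices T n"
  by (simp add: lattice_basis_def yb_def)

lemma finite_y_indices: "finite (y_indices T n)"
proof (rule finite_subset)
  show "y_indices T n \<subseteq> {0..num_x T n} \<times> {0..num_x T n}" by (cases T) auto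
qed simp

lemma finite_lattice_basis: "finite (lattice_basis T n)"
  by (simp add: lattice_basis_eq finite_y_indices)

text \<open>\<open>beta\<close> keeps the brackets of \<open>x_i\<close> and \<open>x_j\<close> with
  \<open>i > j\<close>, which are the negatives of the defining relations.\<close>

lemma beta_basis_values: "beta_basis T n a b c \<in> {0, - 1}"
proof -
  have "x_relation T n i k c \<in> {0, 1}" for i k by (cases T) (auto simp: unit_coord_def)
  then show ?thesis by (cases a; cases b) auto
qed

lemma beta_basis_BY: "beta_basis T n (BY i j) b c = 0" "beta_basis T n a (BY i j) c = 0"
  by (simp, cases a) auto

lemma beta_basis_BX_coord: "beta_basis T n a b (BX i) = 0"
  by (cases T; cases a; cases b) (auto simp: unit_coord_def)

context cring
begin

lemma add_pow_0: "x \<in> carrier R ==> [(0::int)] \<cdot>\<^bsub>R\<^esub> x = \<zero>"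
  by (simp add: add_pow_def int_pow_def2)

lemma add_pow_neg_1: "x \<in> carrier R ==> [(- 1 :: int)] \<cdot>\<^bsub>R\<^esub> x = \<ominus> x"
  by (simp add: add_pow_def int_pow_def2 a_inv_def)

lemma beta_pow_closed: "x \<in> carrier R ==> [beta_basis T n a b c] \<cdot>\<^bsub>R\<^esub> x \<in> carrier R"
  using beta_basis_values[of T n a b c] by (auto simp: add_pow_0 add_pow_neg_1)

lemma beta_pow_add:
  "x \<in> carrier R ==> y \<in> carrier R ==>
    [beta_basis T n a b c] \<cdot>\<^bsub>R\<^esub> (x \<oplus> y) = [beta_basis T n a b c] \<cdot>\<^bsub>R\<^esub> x \<oplus> [beta_basis T n a b c] \<cdot>\<^bsub>R\<^esub> y"
  using beta_basis_values[of T n a b c] by (auto simp: add_pow_0 add_pow_neg_1 minus_add)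

text \<open>Weaker than membership in the group: the values off the basis are arbitrary.\<close>

definition cochain :: "lattice_type => nat => (basis_elt => 'a) => bool" where
  "cochain T n g \<longleftrightarrow> (\<forall>c\<in>lattice_basis T n. g c \<in> carrier R)"

lemma cochainD: "cochain T n g ==> c \<in> lattice_basis T n ==> g c \<in> carrier R"
  by (simp add: cochain_def)

lemma beta_inner_closed:
  assumes "cochain T n g" "cochain T n h" "a \<in> lattice_basis T n"
  shows "(\<Oplus>b\<in>lattice_basis T n. [beta_basis T n a b c] \<cdot>\<^bsub>R\<^esub> (g a \<otimes> h b)) \<in> carrier R"
  using assms by (intro finsum_closed) (auto simp: cochain_def beta_pow_closed)

lemma beta_closed:
  assumes "cochain T n g" "cochain T n h"
  shows "beta T n R g h c \<in> carrier R"
  unfolding beta_def using assms by (intro finsum_closed) (auto intro!: beta_inner_closed)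

lemma finsum_add_eq:
  assumes "!!a. a \<in> A ==> f a = f1 a \<oplus> f2 a" "!!a. a \<in> A ==> f1 a \<in> carrier R" "!!a. a \<in> A ==> f2 a \<in> carrier R"
  shows "finsum R f A = finsum R f1 A \<oplus> finsum R f2 A"
proof -
  have "finsum R f A = (\<Oplus>a\<in>A. f1 a \<oplus> f2 a)" using assms by (intro finsum_cong') auto
  also have "\<dots> = finsum R f1 A \<oplus> finsum R f2 A" using assms by (intro finsum_addf) auto
  finally show ?thesis .
qed

text \<open>\<open>beta\<close> sees only the \<open>BX\<close> coordinates. Additivity is required
  for these alone so that the rule applies to group products, which pick up a \<open>beta\<close>
  term in the \<open>BY\<close> coordinates.\<close>

lemma beta_add_left:
  assumes g: "cochain T n g1" "cochain T n g2" "cochain T n g" "cochain T n h"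
    and eq: "!!i. BX i \<in> lattice_basis T n ==> g (BX i) = g1 (BX i) \<oplus> g2 (BX i)"
  shows "beta T n R g h c = beta T n R g1 h c \<oplus> beta T n R g2 h c"
proof -
  note D = cochainD[OF g(1)] cochainD[OF g(2)] cochainD[OF g(3)] cochainD[OF g(4)]
  have "[beta_basis T n a b c] \<cdot>\<^bsub>R\<^esub> (g a \<otimes> h b)
    = [beta_basis T n a b c] \<cdot>\<^bsub>R\<^esub> (g1 a \<otimes> h b) \<oplus> [beta_basis T n a b c] \<cdot>\<^bsub>R\<^esub> (g2 a \<otimes> h b)"
    if ab: "a \<in> lattice_basis T n" "b \<in> lattice_basis T n" for a b
  proof (cases a)
    case (BX i)
    then show ?thesis using eq[of i] ab D by (simp add: l_distr beta_pow_add)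
  next
    case (BY i j)
    then show ?thesis using ab D by (simp add: add_pow_0)
  qed
  then show ?thesis
    unfolding beta_def using g by (intro finsum_add_eq beta_inner_closed) (auto simp: beta_pow_closed D)
qed

lemma beta_add_right:
  assumes g: "cochain T n h1" "cochain T n h2" "cochain T n h" "cochain T n g"
    and eq: "!!i. BX i \<in> lattice_basis T n ==> h (BX i) = h1 (BX i) \<oplus> h2 (BX i)"
  shows "beta T n R g h c = beta T n R g h1 c \<oplus> beta T n R g h2 c"
proof -
  note D = cochainD[OF g(1)] cochainD[OF g(2)] cochainD[OF g(3)] cochainD[OF g(4)]
  have "[beta_basis T n a b c] \<cdot>\<^bsub>R\<^esub> (g a \<otimes> h b)
    = [beta_basis T n a b c] \<cdot>\<^bsub>R\<^esub> (g a \<otimes> h1 b) \<oplus> [beta_basis T n a b c] \<cdot>\<^bsub>R\<^esub> (g a \<otimes> h2 b)"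
    if ab: "a \<in> lattice_basis T n" "b \<in> lattice_basis T n" for a b
  proof (cases b)
    case (BX i)
    then show ?thesis using eq[of i] ab D by (simp add: r_distr beta_pow_add)
  next
    case (BY i j)
    then show ?thesis using ab D by (simp add: add_pow_0 beta_basis_BY)
  qed
  then show ?thesis
    unfolding beta_def using g by (intro finsum_add_eq beta_inner_closed) (auto simp: beta_pow_closed D)
qed

lemma beta_zero_left:
  assumes g: "cochain T n g" "cochain T n h" and z: "!!i. BX i \<in> lattice_basis T n ==> g (BX i) = \<zero>"
  shows "beta T n R g h c = \<zero>"
proof -
  have "beta T n R g h c = beta T n R g h c \<oplus> beta T n R g h c"
    by (rule beta_add_left) (use g z in auto)
  then show ?thesis using beta_closed[OF g, of c] by simp
qed

lemma beta_zero_right: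
  assumes g: "cochain T n g" "cochain T n h" and z: "!!i. BX i \<in> lattice_basis T n ==> h (BX i) = \<zero>"
  shows "beta T n R g h c = \<zero>"
proof -
  have "beta T n R g h c = beta T n R g h c \<oplus> beta T n R g h c"
    by (rule beta_add_right) (use g z in auto)
  then show ?thesis using beta_closed[OF g, of c] by simp
qed

lemma beta_BX:
  assumes g: "cochain T n g" "cochain T n h"
  shows "beta T n R g h (BX i) = \<zero>"
proof -
  have "[(0::int)] \<cdot>\<^bsub>R\<^esub> (g a \<otimes> h b) = \<zero>" if "a \<in> lattice_basis T n" "b \<in> lattice_basis T n" for a b
    using that g by (simp add: add_pow_0 cochain_def)
  then show ?thesis unfolding beta_def beta_basis_BX_coord
    by (intro add.finprod_one_eqI) auto
qed

abbreviation "PG T n \<equiv> point_group T n R"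

lemma PG_carrier: "carrier (PG T n) = lattice_basis T n \<rightarrow>\<^sub>E carrier R"
  by (simp add: point_group_def)

lemma PG_cochain: "g \<in> carrier (PG T n) ==> cochain T n g"
  by (auto simp: point_group_def cochain_def)

lemma PG_one: "\<one>\<^bsub>PG T n\<^esub> = (\<lambda>c\<in>lattice_basis T n. \<zero>)"
  by (simp add: point_group_def)

lemma PG_mult: "g \<otimes>\<^bsub>PG T n\<^esub> h = (\<lambda>c\<in>lattice_basis T n. (g c \<oplus> h c) \<oplus> beta T n R g h c)"
  by (simp add: point_group_def)

lemma PG_mult_apply: "c \<in> lattice_basis T n ==> (g \<otimes>\<^bsub>PG T n\<^esub> h) c = (g c \<oplus> h c) \<oplus> beta T n R g h c"
  by (simp add: PG_mult)

lemma PG_mult_BX: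
  assumes "cochain T n g" "cochain T n h" "BX i \<in> lattice_basis T n"
  shows "(g \<otimes>\<^bsub>PG T n\<^esub> h) (BX i) = g (BX i) \<oplus> h (BX i)"
  using assms by (simp add: PG_mult_apply beta_BX cochain_def)

lemma PG_closed: "cochain T n g ==> cochain T n h ==> g \<otimes>\<^bsub>PG T n\<^esub> h \<in> carrier (PG T n)"
  unfolding PG_mult PG_carrier by (auto simp: beta_closed cochain_def)

lemma PG_eqI:
  assumes "g \<in> carrier (PG T n)" "h \<in> carrier (PG T n)" "!!c. c \<in> lattice_basis T n ==> g c = h c"
  shows "g = h"
  using assms by (auto simp: PG_carrier intro: PiE_ext)

text \<open>Associativity is bilinearity of \<open>beta\<close>: both bracketings add the values of
  \<open>beta\<close> on the three pairs.\<close>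

lemma PG_group: "group (PG T n)"
proof (rule groupI)
  let ?G = "PG T n"
  show "\<one>\<^bsub>?G\<^esub> \<in> carrier ?G" by (auto simp: PG_one PG_carrier)
  then have co1: "cochain T n \<one>\<^bsub>?G\<^esub>" by (rule PG_cochain)
  show "g \<otimes>\<^bsub>?G\<^esub> h \<in> carrier ?G" if "g \<in> carrier ?G" "h \<in> carrier ?G" for g h
    using that by (intro PG_closed PG_cochain)
  show "g \<otimes>\<^bsub>?G\<^esub> h \<otimes>\<^bsub>?G\<^esub> k = g \<otimes>\<^bsub>?G\<^esub> (h \<otimes>\<^bsub>?G\<^esub> k)"
    if G: "g \<in> carrier ?G" "h \<in> carrier ?G" "k \<in> carrier ?G" for g h k
  proof -
    have co: "cochain T n g" "cochain T n h" "cochain T n k" using G by (auto intro: PG_cochain)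
    have gh: "g \<otimes>\<^bsub>?G\<^esub> h \<in> carrier ?G" "h \<otimes>\<^bsub>?G\<^esub> k \<in> carrier ?G" using co by (auto intro: PG_closed)
    have cgh: "cochain T n (g \<otimes>\<^bsub>?G\<^esub> h)" "cochain T n (h \<otimes>\<^bsub>?G\<^esub> k)" using gh by (auto intro: PG_cochain)
    have b1: "beta T n R (g \<otimes>\<^bsub>?G\<^esub> h) k c = beta T n R g k c \<oplus> beta T n R h k c" for c
      by (rule beta_add_left[OF co(1,2) cgh(1) co(3)]) (simp add: PG_mult_BX co)
    have b2: "beta T n R g (h \<otimes>\<^bsub>?G\<^esub> k) c = beta T n R g h c \<oplus> beta T n R g k c" for c
      by (rule beta_add_right[OF co(2,3) cgh(2) co(1)]) (simp add: PG_mult_BX co)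
    show ?thesis
    proof (rule PG_eqI[of _ T n])
      show "g \<otimes>\<^bsub>?G\<^esub> h \<otimes>\<^bsub>?G\<^esub> k \<in> carrier ?G" "g \<otimes>\<^bsub>?G\<^esub> (h \<otimes>\<^bsub>?G\<^esub> k) \<in> carrier ?G"
        using cgh co by (auto intro: PG_closed)
      fix c assume c: "c \<in> lattice_basis T n"
      show "(g \<otimes>\<^bsub>?G\<^esub> h \<otimes>\<^bsub>?G\<^esub> k) c = (g \<otimes>\<^bsub>?G\<^esub> (h \<otimes>\<^bsub>?G\<^esub> k)) c"
        unfolding PG_mult_apply[OF c] b1 b2
        using cochainD[OF co(1) c] cochainD[OF co(2) c] cochainD[OF co(3) c]
          beta_closed[OF co(1,2), of c] beta_closed[OF co(1,3), of c] beta_closed[OF co(2,3), of c]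
        by (simp add: a_ac)
    qed
  qed
  show "\<one>\<^bsub>?G\<^esub> \<otimes>\<^bsub>?G\<^esub> g = g" if G: "g \<in> carrier ?G" for g
  proof (rule PG_eqI[of _ T n, OF PG_closed[OF co1 PG_cochain[OF G]] G])
    fix c assume c: "c \<in> lattice_basis T n"
    have "beta T n R \<one>\<^bsub>?G\<^esub> g c = \<zero>"
      by (rule beta_zero_left[OF co1 PG_cochain[OF G]]) (simp add: PG_one)
    then show "(\<one>\<^bsub>?G\<^esub> \<otimes>\<^bsub>?G\<^esub> g) c = g c"
      using cochainD[OF PG_cochain[OF G] c] c by (simp add: PG_mult_apply PG_one)
  qed
  show "\<exists>k\<in>carrier ?G. k \<otimes>\<^bsub>?G\<^esub> g = \<one>\<^bsub>?G\<^esub>" if G: "g \<in> carrier ?G" for g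
  proof -
    have co: "cochain T n g" using G by (rule PG_cochain)
    \<comment> \<open>The inverse is \<open>- g\<close> corrected by \<open>beta T n R g g\<close>,
      which cancels \<open>beta\<close> of \<open>- g\<close> and \<open>g\<close>.\<close>
    define k where "k = (\<lambda>c\<in>lattice_basis T n. \<ominus> g c \<oplus> beta T n R g g c)"
    have kG: "k \<in> carrier ?G" using cochainD[OF co] beta_closed[OF co co] by (auto simp: k_def PG_carrier)
    have ck: "cochain T n k" using kG by (rule PG_cochain)
    have b: "beta T n R k g c \<oplus> beta T n R g g c = \<zero>" for c
    proof -
      have "beta T n R \<one>\<^bsub>?G\<^esub> g c = beta T n R k g c \<oplus> beta T n R g g c"
        by (rule beta_add_left[OF ck co co1 co]) (use cochainD[OF co] in \<open>auto simp: PG_one k_def beta_BX[OF co co] l_neg\<close>)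
      moreover have "beta T n R \<one>\<^bsub>?G\<^esub> g c = \<zero>"
        by (rule beta_zero_left[OF co1 co]) (simp add: PG_one)
      ultimately show ?thesis by simp
    qed
    have "k \<otimes>\<^bsub>?G\<^esub> g = \<one>\<^bsub>?G\<^esub>"
    proof (rule PG_eqI[of _ T n, OF PG_closed[OF ck co] \<open>\<one>\<^bsub>?G\<^esub> \<in> carrier ?G\<close>])
      fix c assume c: "c \<in> lattice_basis T n"
      have x: "g c \<in> carrier R" "beta T n R g g c \<in> carrier R" "beta T n R k g c \<in> carrier R"
        using cochainD[OF co c] beta_closed[OF co co] beta_closed[OF ck co] by auto
      have "(k \<otimes>\<^bsub>?G\<^esub> g) c = (\<ominus> g c \<oplus> g c) \<oplus> (beta T n R k g c \<oplus> beta T n R g g c)"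
        unfolding PG_mult_apply[OF c] using c x by (simp add: k_def a_ac)
      then show "(k \<otimes>\<^bsub>?G\<^esub> g) c = \<one>\<^bsub>?G\<^esub> c" using x c by (simp add: b PG_one l_neg)
    qed
    then show ?thesis using kG by blast
  qed
qed

text \<open>A central subgroup, additive in the \<open>y\<close> coordinates. The function
  \<open>PGc\<close> below is the commutator, the antisymmetrization of \<open>beta\<close> and thus
  the Lie bracket.\<close>

definition PGZ :: "lattice_type => nat => (basis_elt => 'a) set" where
  "PGZ T n = {z \<in> carrier (PG T n). \<forall>i\<in>{1..num_x T n}. z (BX i) = \<zero>}"

definition PGc :: "lattice_type => nat => (basis_elt => 'a) => (basis_elt => 'a) => basis_elt => 'a" where
  "PGc T n g h = (\<lambda>c\<in>lattice_basis T n. beta T n R g h c \<ominus> beta T n R h g c)"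

lemma BX_in_basis: "BX i \<in> lattice_basis T n \<longleftrightarrow> i \<in> {1..num_x T n}"
  by (auto simp: lattice_basis_eq yb_def split: prod.splits)

lemma PGZ_mult:
  assumes "z \<in> PGZ T n" "cochain T n g" "c \<in> lattice_basis T n"
  shows "(z \<otimes>\<^bsub>PG T n\<^esub> g) c = z c \<oplus> g c" "(g \<otimes>\<^bsub>PG T n\<^esub> z) c = g c \<oplus> z c"
proof -
  have z: "cochain T n z" "!!i. BX i \<in> lattice_basis T n ==> z (BX i) = \<zero>"
    using assms(1) by (auto simp: PGZ_def BX_in_basis intro: PG_cochain)
  show "(z \<otimes>\<^bsub>PG T n\<^esub> g) c = z c \<oplus> g c" "(g \<otimes>\<^bsub>PG T n\<^esub> z) c = g c \<oplus> z c"
    using beta_zero_left[OF z(1) assms(2) z(2)] beta_zero_right[OF assms(2) z(1) z(2)]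
      cochainD[OF z(1) assms(3)] cochainD[OF assms(2,3)] by (auto simp: PG_mult_apply[OF assms(3)])
qed

end

context cring
begin

text \<open>The functional with coordinates \<open>w\<close>, evaluated at the bracket of
  \<open>x_i\<close> and \<open>x_k\<close> for \<open>i < k\<close>. The alternating matrix
  \<open>form\<close> built from it is generic, or has off-diagonal blocks \<open>W\<close> and
  minus its transpose with \<open>W\<close> generic or generic symmetric.\<close>

fun upper_form :: "lattice_type => nat => (nat \<times> nat => 'a) => nat => nat => 'a" where
  "upper_form (FType d) n w i k = w (i, k)"
| "upper_form GType n w i k = (if i \<le> n \<and> n < k then w (i, k - n) else \<zero>)"
| "upper_form HType n w i k = (if i \<le> n \<and> n < k then w (min i (k - n), max i (k - n)) else \<zero>)"

definition form :: "lattice_type => nat => (nat \<times> nat => 'a) => nat => nat => 'a" where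
  "form T n w i k = (if i < k then upper_form T n w i k else if k < i then \<ominus> upper_form T n w k i else \<zero>)"

text \<open>The left kernel of \<open>B\<close> on the index set \<open>S\<close>. With variable
  index sets, rows and columns are deleted without renumbering.\<close>

definition Rad :: "nat set => (nat => nat => 'a) => (nat => 'a) set" where
  "Rad S B = {x \<in> S \<rightarrow>\<^sub>E carrier R. \<forall>k\<in>S. (\<Oplus>i\<in>S. x i \<otimes> B i k) = \<zero>}"

lemma upper_form_index:
  assumes "i \<in> {1..num_x T n}" "k \<in> {1..num_x T n}" "i < k"
  shows "(\<exists>p\<in>y_indices T n. x_relation T n i k = unit_coord (yb p) \<and> (\<forall>w. upper_form T n w i k = w p)) \<or>
    x_relation T n i k = (\<lambda>_. 0) \<and> (\<forall>w. upper_form T n w i k = \<zero>)"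
proof (cases T)
  case (FType d)
  then have "(i, k) \<in> y_indices T n" using assms by auto
  then show ?thesis using FType by (auto simp: yb_def intro!: bexI[of _ "(i, k)"])
next
  case GType
  then show ?thesis
  proof (cases "i \<le> n \<and> n < k")
    case True
    then have "(i, k - n) \<in> y_indices T n" using assms GType by auto
    then show ?thesis using True GType by (intro disjI1 bexI[of _ "(i, k - n)"]) (simp_all add: yb_def)
  qed auto
next
  case HType
  then show ?thesis
  proof (cases "i \<le> n \<and> n < k")
    case True
    then have "(min i (k - n), max i (k - n)) \<in> y_indices T n" using assms HType by auto
    then show ?thesis using True HType by (intro disjI1 bexI[of _ "(min i (k - n), max i (k - n))"]) (simp_all add: yb_def)
  qed auto
qed

lemma upper_form_closed:
  assumes "w \<in> y_indices T n \<rightarrow>\<^sub>E carrier R" "i \<in> {1..num_x T n}" "k \<in> {1..num_x T n}" "i < k"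
  shows "upper_form T n w i k \<in> carrier R"
  using upper_form_index[OF assms(2-4)] assms(1) by auto

lemma form_closed:
  assumes "w \<in> y_indices T n \<rightarrow>\<^sub>E carrier R" "i \<in> {1..num_x T n}" "k \<in> {1..num_x T n}"
  shows "form T n w i k \<in> carrier R"
  using upper_form_closed[OF assms(1), of i k] upper_form_closed[OF assms(1), of k i] assms by (auto simp: form_def)

end

context chain_ring
begin

lemma finite_PG: "finite (carrier (PG T n))"
  unfolding PG_carrier using finite_R finite_lattice_basis by (intro finite_PiE) auto

lemma PGc_PGZ: "g \<in> carrier (PG T n) ==> h \<in> carrier (PG T n) ==> PGc T n g h \<in> PGZ T n"
  using beta_closed[of T n g h] beta_closed[of T n h g]
  by (auto simp: PGZ_def PGc_def PG_carrier BX_in_basis beta_BX PG_cochain[unfolded PG_carrier] a_minus_def)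

lemma PG_class2: "class2_group (PG T n) (PGZ T n) (PGc T n)"
proof -
  interpret G: group "PG T n" by (rule PG_group)
  show ?thesis
  proof (intro class2_group.intro PG_group class2_group_axioms.intro)
    show "finite (carrier (PG T n))" by (rule finite_PG)
    show "subgroup (PGZ T n) (PG T n)"
    proof (rule G.subgroup_of_finite[OF finite_PG])
      show "PGZ T n \<subseteq> carrier (PG T n)" by (auto simp: PGZ_def)
      show "\<one>\<^bsub>PG T n\<^esub> \<in> PGZ T n" using G.one_closed unfolding PGZ_def by (simp add: PG_one BX_in_basis)
      fix x y assume xy: "x \<in> PGZ T n" "y \<in> PGZ T n"
      then have c: "cochain T n x" "cochain T n y" by (auto simp: PGZ_def intro: PG_cochain)
      then show "x \<otimes>\<^bsub>PG T n\<^esub> y \<in> PGZ T n"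
        using xy PG_closed[OF c] by (auto simp: PGZ_def BX_in_basis PG_mult_BX)
    qed
    fix z g assume z: "z \<in> PGZ T n" and g: "g \<in> carrier (PG T n)"
    have zc: "z \<in> carrier (PG T n)" using z by (simp add: PGZ_def)
    show "z \<otimes>\<^bsub>PG T n\<^esub> g = g \<otimes>\<^bsub>PG T n\<^esub> z"
    proof (rule PG_eqI[of _ T n, OF G.m_closed[OF zc g] G.m_closed[OF g zc]])
      fix c assume c: "c \<in> lattice_basis T n"
      show "(z \<otimes>\<^bsub>PG T n\<^esub> g) c = (g \<otimes>\<^bsub>PG T n\<^esub> z) c"
        using PGZ_mult[OF z PG_cochain[OF g] c] cochainD[OF PG_cochain[OF g] c] cochainD[OF PG_cochain[OF zc] c]
        by (simp add: a_comm)
    qed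
  next
    fix g h assume g: "g \<in> carrier (PG T n)" and h: "h \<in> carrier (PG T n)"
    show z: "PGc T n g h \<in> PGZ T n" by (rule PGc_PGZ[OF g h])
    then have zc: "PGc T n g h \<in> carrier (PG T n)" by (simp add: PGZ_def)
    note co = PG_cochain[OF g] PG_cochain[OF h]
    show "g \<otimes>\<^bsub>PG T n\<^esub> h = PGc T n g h \<otimes>\<^bsub>PG T n\<^esub> (h \<otimes>\<^bsub>PG T n\<^esub> g)"
    proof (rule PG_eqI[of _ T n, OF G.m_closed[OF g h] G.m_closed[OF zc G.m_closed[OF h g]]])
      fix c assume c: "c \<in> lattice_basis T n"
      have x: "g c \<in> carrier R" "h c \<in> carrier R" "beta T n R g h c \<in> carrier R" "beta T n R h g c \<in> carrier R"
        using cochainD[OF co(1) c] cochainD[OF co(2) c] beta_closed co by auto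
      have "(PGc T n g h \<otimes>\<^bsub>PG T n\<^esub> (h \<otimes>\<^bsub>PG T n\<^esub> g)) c = PGc T n g h c \<oplus> (h \<otimes>\<^bsub>PG T n\<^esub> g) c"
        by (rule PGZ_mult[OF z PG_cochain[OF G.m_closed[OF h g]] c])
      also have "\<dots> = (beta T n R g h c \<ominus> beta T n R h g c) \<oplus> ((h c \<oplus> g c) \<oplus> beta T n R h g c)"
        using c by (simp add: PGc_def PG_mult_apply)
      also have "\<dots> = ((g c \<oplus> h c) \<oplus> beta T n R g h c) \<oplus> (\<ominus> beta T n R h g c \<oplus> beta T n R h g c)"
        using x by (simp add: a_minus_def a_ac)
      also have "\<dots> = (g \<otimes>\<^bsub>PG T n\<^esub> h) c" using x c by (simp add: l_neg PG_mult_apply)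
      finally show "(g \<otimes>\<^bsub>PG T n\<^esub> h) c = (PGc T n g h \<otimes>\<^bsub>PG T n\<^esub> (h \<otimes>\<^bsub>PG T n\<^esub> g)) c" by simp
    qed
  qed
qed

definition coords :: "lattice_type => nat => (basis_elt => 'a) => (nat => 'a) \<times> (nat \<times> nat => 'a)" where
  "coords T n g = (\<lambda>i\<in>{1..num_x T n}. g (BX i), \<lambda>p\<in>y_indices T n. g (yb p))"

lemma yb_in_basis: "yb p \<in> lattice_basis T n \<longleftrightarrow> p \<in> y_indices T n"
  by (cases p) (auto simp: lattice_basis_eq yb_def split: prod.splits)

lemma coords_bij: "bij_betw (coords T n) (carrier (PG T n)) (({1..num_x T n} \<rightarrow>\<^sub>E carrier R) \<times> (y_indices T n \<rightarrow>\<^sub>E carrier R))"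
proof (rule bij_betwI')
  fix g h assume g: "g \<in> carrier (PG T n)" and h: "h \<in> carrier (PG T n)"
  show "coords T n g = coords T n h \<longleftrightarrow> g = h"
  proof
    assume eq: "coords T n g = coords T n h"
    show "g = h"
    proof (rule PG_eqI[OF g h])
      fix c assume "c \<in> lattice_basis T n"
      then consider i where "i \<in> {1..num_x T n}" "c = BX i" | p where "p \<in> y_indices T n" "c = yb p"
        by (auto simp: lattice_basis_eq)
      then show "g c = h c"
      proof cases
        case (1 i)
        have "fst (coords T n g) i = fst (coords T n h) i" using eq by simp
        then show ?thesis using 1 by (simp add: coords_def)
      next
        case (2 p)
        have "snd (coords T n g) p = snd (coords T n h) p" using eq by simp
        then show ?thesis using 2 by (simp add: coords_def)
      qed
    qed
  qed simp
next
  fix g assume "g \<in> carrier (PG T n)"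
  then show "coords T n g \<in> ({1..num_x T n} \<rightarrow>\<^sub>E carrier R) \<times> (y_indices T n \<rightarrow>\<^sub>E carrier R)"
    by (auto simp: coords_def PG_carrier BX_in_basis yb_in_basis)
next
  fix xy assume xy: "xy \<in> ({1..num_x T n} \<rightarrow>\<^sub>E carrier R) \<times> (y_indices T n \<rightarrow>\<^sub>E carrier R)"
  define g where "g = (\<lambda>c\<in>lattice_basis T n. case c of BX i => fst xy i | BY i j => snd xy (i, j))"
  have gX: "g (BX i) = fst xy i" if "i \<in> {1..num_x T n}" for i using that by (simp add: g_def BX_in_basis)
  have gY: "g (yb p) = snd xy p" if "p \<in> y_indices T n" for p
    using that yb_in_basis[of p T n] by (cases p) (simp add: g_def yb_def)
  have "g c \<in> carrier R" if "c \<in> lattice_basis T n" for c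
    using that gX gY xy by (auto simp: lattice_basis_eq)
  then have "g \<in> carrier (PG T n)" by (auto simp: PG_carrier g_def)
  moreover have "coords T n g = xy"
    using xy gX gY by (cases xy) (auto simp: coords_def PiE_iff intro!: extensionalityI[of _ "{1..num_x T n}"] extensionalityI[of _ "y_indices T n"])
  ultimately show "\<exists>g\<in>carrier (PG T n). xy = coords T n g" by blast
qed

lemma PGZ_coords: "coords T n ` PGZ T n = {\<lambda>i\<in>{1..num_x T n}. \<zero>} \<times> (y_indices T n \<rightarrow>\<^sub>E carrier R)"
proof (intro equalityI subsetI)
  fix xy assume "xy \<in> coords T n ` PGZ T n"
  then obtain z where z: "z \<in> PGZ T n" "xy = coords T n z" by blast
  have "coords T n z \<in> ({1..num_x T n} \<rightarrow>\<^sub>E carrier R) \<times> (y_indices T n \<rightarrow>\<^sub>E carrier R)"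
    using z bij_betwE[OF coords_bij] by (auto simp: PGZ_def)
  then show "xy \<in> {\<lambda>i\<in>{1..num_x T n}. \<zero>} \<times> (y_indices T n \<rightarrow>\<^sub>E carrier R)"
    using z by (auto simp: coords_def PGZ_def cong: restrict_cong)
next
  fix xy assume xy: "xy \<in> {\<lambda>i\<in>{1..num_x T n}. \<zero>} \<times> (y_indices T n \<rightarrow>\<^sub>E carrier R)"
  then have "xy \<in> ({1..num_x T n} \<rightarrow>\<^sub>E carrier R) \<times> (y_indices T n \<rightarrow>\<^sub>E carrier R)" by auto
  then obtain g where g: "g \<in> carrier (PG T n)" "xy = coords T n g"
    using bij_betw_imp_surj_on[OF coords_bij] by blast
  have "restrict (\<lambda>i. g (BX i)) {1..num_x T n} = (\<lambda>i\<in>{1..num_x T n}. \<zero>)" using xy g by (simp add: coords_def)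
  then have "g (BX i) = \<zero>" if "i \<in> {1..num_x T n}" for i using that by (metis restrict_apply')
  then show "xy \<in> coords T n ` PGZ T n" using g by (auto simp: PGZ_def)
qed

lemma inj_coords: "A \<subseteq> carrier (PG T n) ==> inj_on (coords T n) A"
  using coords_bij by (meson bij_betw_imp_inj_on inj_on_subset)

lemma card_PGZ: "card (PGZ T n) = card (y_indices T n \<rightarrow>\<^sub>E carrier R)"
proof -
  have "card (PGZ T n) = card (coords T n ` PGZ T n)"
    by (rule card_image[symmetric], rule inj_coords) (auto simp: PGZ_def)
  then show ?thesis unfolding PGZ_coords by (simp add: card_cartesian_product_singleton)
qed

lemma card_PG: "card (carrier (PG T n)) = card ({1..num_x T n} \<rightarrow>\<^sub>E carrier R) * card (PGZ T n)"
  using bij_betw_same_card[OF coords_bij[of T n]] by (simp add: card_PGZ card_cartesian_product)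

section \<open>Characters of the central subgroup and the radicals of their forms\<close>

context
  fixes \<psi> assumes psi: "\<psi> \<in> chars (add_monoid R) (carrier R)"
    and psi_nontriv: "!!w. w \<in> carrier R ==> w \<noteq> \<zero> ==> \<exists>r\<in>carrier R. \<psi> (w \<otimes> r) \<noteq> 1"
begin

lemma psi_add: "x \<in> carrier R ==> y \<in> carrier R ==> \<psi> (x \<oplus> y) = \<psi> x * \<psi> y"
  using charsD(2)[OF psi] by simp

lemma psi_0: "\<psi> \<zero> = 1" using charsD(1)[OF psi] by simp

lemma psi_neg: "x \<in> carrier R ==> \<psi> (\<ominus> x) = inverse (\<psi> x)"
  using psi_add[of x "\<ominus> x"] by (simp add: r_neg psi_0 inverse_unique)

lemma psi_minus: "x \<in> carrier R ==> y \<in> carrier R ==> \<psi> (x \<ominus> y) = \<psi> x / \<psi> y"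
  by (simp add: a_minus_def psi_add psi_neg divide_inverse)

lemma psi_finsum: "finite A ==> (!!a. a \<in> A ==> f a \<in> carrier R) ==> \<psi> (finsum R f A) = (\<Prod>a\<in>A. \<psi> (f a))"
proof (induction A rule: finite_induct)
  case (insert a A)
  then have "finsum R f (insert a A) = f a \<oplus> finsum R f A" by (intro finsum_insert) auto
  then show ?case using insert by (simp add: psi_add)
qed (simp add: psi_0)

text \<open>The pairing of the \<open>y\<close> coordinates with \<open>w\<close>, composed with
  \<open>\<psi>\<close>; these will be all characters of \<open>PGZ\<close>, each for one
  \<open>w\<close>.\<close>

definition lamw :: "lattice_type => nat => (nat \<times> nat => 'a) => (basis_elt => 'a) => complex" where
  "lamw T n w = restrict (\<lambda>z. \<Prod>p\<in>y_indices T n. \<psi> (w p \<otimes> z (yb p))) (PGZ T n)"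

lemma lamw_chars:
  assumes w: "w \<in> y_indices T n \<rightarrow>\<^sub>E carrier R"
  shows "lamw T n w \<in> chars (PG T n) (PGZ T n)"
proof -
  interpret class2_group "PG T n" "PGZ T n" "PGc T n" by (rule PG_class2)
  have one: "\<one>\<^bsub>PG T n\<^esub> \<in> PGZ T n" using Z by (rule subgroup.one_closed)
  have wc: "w p \<in> carrier R" if "p \<in> y_indices T n" for p using w that by auto
  have "lamw T n w \<one>\<^bsub>PG T n\<^esub> = 1"
    using one wc unfolding lamw_def by (simp add: PG_one yb_in_basis psi_0)
  moreover have "lamw T n w (x \<otimes>\<^bsub>PG T n\<^esub> y) = lamw T n w x * lamw T n w y" if x: "x \<in> PGZ T n" and y: "y \<in> PGZ T n" for x y
  proof -
    have c: "cochain T n x" "cochain T n y" using x y by (auto simp: PGZ_def intro: PG_cochain)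
    have "\<psi> (w p \<otimes> (x \<otimes>\<^bsub>PG T n\<^esub> y) (yb p)) = \<psi> (w p \<otimes> x (yb p)) * \<psi> (w p \<otimes> y (yb p))" if p: "p \<in> y_indices T n" for p
      using PGZ_mult(1)[OF x c(2)] p wc[OF p] cochainD[OF c(1)] cochainD[OF c(2)] yb_in_basis
      by (simp add: r_distr psi_add)
    then show ?thesis using x y subgroup.m_closed[OF Z x y] by (simp add: lamw_def prod.distrib)
  qed
  ultimately show ?thesis by (auto simp: chars_def lamw_def)
qed

text \<open>A nonzero difference of \<open>w\<close> and \<open>w'\<close> at \<open>p\<close> is
  detected by \<open>\<psi>\<close> on central points supported at \<open>p\<close>.\<close>

lemma lamw_inj: "inj_on (lamw T n) (y_indices T n \<rightarrow>\<^sub>E carrier R)"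
proof (rule inj_onI, rule PiE_ext)
  fix w w' p assume w: "w \<in> y_indices T n \<rightarrow>\<^sub>E carrier R" "w' \<in> y_indices T n \<rightarrow>\<^sub>E carrier R"
    and eq: "lamw T n w = lamw T n w'" and p: "p \<in> y_indices T n"
  have wc: "w p \<in> carrier R" "w' p \<in> carrier R" if "p \<in> y_indices T n" for p using w that by auto
  show "w p = w' p"
  proof (rule ccontr)
    assume "w p \<noteq> w' p"
    then have "w p \<ominus> w' p \<noteq> \<zero>" using wc[OF p] by simp
    then obtain r where r: "r \<in> carrier R" "\<psi> ((w p \<ominus> w' p) \<otimes> r) \<noteq> 1" using psi_nontriv[of "w p \<ominus> w' p"] wc[OF p] by auto
    have "(\<lambda>i\<in>{1..num_x T n}. \<zero>, \<lambda>p'\<in>y_indices T n. if p' = p then r else \<zero>) \<in> coords T n ` PGZ T n"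
      unfolding PGZ_coords using r by auto
    then obtain z where z: "z \<in> PGZ T n" "(\<lambda>i\<in>{1..num_x T n}. \<zero>, \<lambda>p'\<in>y_indices T n. if p' = p then r else \<zero>) = coords T n z" by blast
    have zp: "z (yb p') = (if p' = p then r else \<zero>)" if "p' \<in> y_indices T n" for p'
      using z(2) that by (auto simp: coords_def dest!: fun_cong[of _ _ p'])
    have l: "lamw T n v z = \<psi> (v p \<otimes> r)" if v: "v \<in> y_indices T n \<rightarrow>\<^sub>E carrier R" for v
    proof -
      have "lamw T n v z = (\<Prod>p'\<in>y_indices T n. if p' = p then \<psi> (v p \<otimes> r) else 1)"
        using z(1) PiE_mem[OF v] by (auto simp: lamw_def zp psi_0 intro!: prod.cong)
      then show ?thesis using p by (simp add: finite_y_indices)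
    qed
    have "\<psi> (w p \<otimes> r) = \<psi> (w' p \<otimes> r)" using l[OF w(1)] l[OF w(2)] eq by simp
    moreover have "(w p \<ominus> w' p) \<otimes> r = w p \<otimes> r \<ominus> w' p \<otimes> r" using wc[OF p] r by (simp add: a_minus_def l_distr l_minus)
    moreover have "\<psi> (w' p \<otimes> r) \<noteq> 0" using psi_add[of "w' p \<otimes> r" "\<ominus> (w' p \<otimes> r)"] wc[OF p] r by (auto simp: r_neg psi_0)
    ultimately show False using r wc[OF p] by (simp add: psi_minus)
  qed
qed auto

text \<open>Injectivity is enough, since a finite abelian group has as many characters as
  elements.\<close>

lemma lamw_bij: "bij_betw (lamw T n) (y_indices T n \<rightarrow>\<^sub>E carrier R) (chars (PG T n) (PGZ T n))"
proof -
  interpret class2_group "PG T n" "PGZ T n" "PGc T n" by (rule PG_class2)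
  have sub: "lamw T n ` (y_indices T n \<rightarrow>\<^sub>E carrier R) \<subseteq> chars (PG T n) (PGZ T n)" using lamw_chars by blast
  have "card (chars (PG T n) (PGZ T n)) = card (PGZ T n)"
    using chars_count(2)[OF fin Z] central Zc by blast
  also have "\<dots> = card (lamw T n ` (y_indices T n \<rightarrow>\<^sub>E carrier R))" by (simp add: card_PGZ card_image[OF lamw_inj])
  finally have "lamw T n ` (y_indices T n \<rightarrow>\<^sub>E carrier R) = chars (PG T n) (PGZ T n)"
    using card_seteq[OF finite_chars_Z sub] by simp
  then show ?thesis using lamw_inj by (simp add: bij_betw_def)
qed

end
end

context chain_ring
begin

context
  fixes \<psi> assumes psi: "\<psi> \<in> chars (add_monoid R) (carrier R)"
    and psi_nontriv: "!!w. w \<in> carrier R ==> w \<noteq> \<zero> ==> \<exists>r\<in>carrier R. \<psi> (w \<otimes> r) \<noteq> 1"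
begin

lemma psi_beta:
  assumes v: "v \<in> carrier R" and g: "cochain T n g" "cochain T n h"
  shows "\<psi> (v \<otimes> beta T n R g h c) =
    (\<Prod>i\<in>{1..num_x T n}. \<Prod>k\<in>{1..num_x T n}.
      if k < i \<and> x_relation T n k i c \<noteq> 0 then inverse (\<psi> (v \<otimes> (g (BX i) \<otimes> h (BX k)))) else 1)"
proof -
  let ?L = "lattice_basis T n" and ?X = "{1..num_x T n}"
  let ?t = "\<lambda>a b. [beta_basis T n a b c] \<cdot>\<^bsub>R\<^esub> (g a \<otimes> h b)"
  note D = cochainD[OF g(1)] cochainD[OF g(2)]
  define F where "F a b = (if beta_basis T n a b c = 0 then 1 else inverse (\<psi> (v \<otimes> (g a \<otimes> h b))))" for a b
  have t: "\<psi> (v \<otimes> ?t a b) = F a b" if "a \<in> ?L" "b \<in> ?L" for a b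
  proof -
    have "g a \<otimes> h b \<in> carrier R" using D that by simp
    then show ?thesis using beta_basis_values[of T n a b c] v
      by (auto simp: F_def add_pow_0 add_pow_neg_1 psi_0[OF psi psi_nontriv] r_minus psi_neg[OF psi psi_nontriv])
  qed
  have tc: "?t a b \<in> carrier R" if "a \<in> ?L" "b \<in> ?L" for a b using D that by (simp add: beta_pow_closed)
  have "v \<otimes> beta T n R g h c = (\<Oplus>a\<in>?L. v \<otimes> (\<Oplus>b\<in>?L. ?t a b))"
    unfolding beta_def using v tc finite_lattice_basis by (intro finsum_rdistr) auto
  also have "\<psi> \<dots> = (\<Prod>a\<in>?L. \<psi> (v \<otimes> (\<Oplus>b\<in>?L. ?t a b)))"
    using v tc finite_lattice_basis by (intro psi_finsum[OF psi psi_nontriv]) auto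
  also have "\<dots> = (\<Prod>a\<in>?L. \<Prod>b\<in>?L. F a b)"
  proof (rule prod.cong[OF refl])
    fix a assume a: "a \<in> ?L"
    have "v \<otimes> (\<Oplus>b\<in>?L. ?t a b) = (\<Oplus>b\<in>?L. v \<otimes> ?t a b)"
      using v tc[OF a] finite_lattice_basis by (intro finsum_rdistr) auto
    also have "\<psi> \<dots> = (\<Prod>b\<in>?L. \<psi> (v \<otimes> ?t a b))"
      using v tc[OF a] finite_lattice_basis by (intro psi_finsum[OF psi psi_nontriv]) auto
    also have "\<dots> = (\<Prod>b\<in>?L. F a b)" using t[OF a] by (intro prod.cong) auto
    finally show "\<psi> (v \<otimes> (\<Oplus>b\<in>?L. ?t a b)) = (\<Prod>b\<in>?L. F a b)" .
  qed
  also have "\<dots> = (\<Prod>a\<in>BX ` ?X. \<Prod>b\<in>?L. F a b)"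
    using finite_lattice_basis[of T n] by (intro prod.mono_neutral_right) (auto simp: lattice_basis_eq F_def yb_def)
  also have "\<dots> = (\<Prod>i\<in>?X. \<Prod>b\<in>?L. F (BX i) b)" by (subst prod.reindex) (auto simp: inj_on_def)
  also have "\<dots> = (\<Prod>i\<in>?X. \<Prod>k\<in>?X. F (BX i) (BX k))"
  proof (rule prod.cong[OF refl])
    fix i
    have "(\<Prod>b\<in>?L. F (BX i) b) = (\<Prod>b\<in>BX ` ?X. F (BX i) b)"
      using finite_lattice_basis[of T n] by (intro prod.mono_neutral_right) (auto simp: lattice_basis_eq F_def yb_def)
    then show "(\<Prod>b\<in>?L. F (BX i) b) = (\<Prod>k\<in>?X. F (BX i) (BX k))" by (subst (asm) prod.reindex) (auto simp: inj_on_def)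
  qed
  also have "\<dots> = (\<Prod>i\<in>?X. \<Prod>k\<in>?X. if k < i \<and> x_relation T n k i c \<noteq> 0 then inverse (\<psi> (v \<otimes> (g (BX i) \<otimes> h (BX k)))) else 1)"
    by (intro prod.cong refl) (auto simp: F_def)
  finally show ?thesis .
qed

lemma psi_upper:
  assumes w: "w \<in> y_indices T n \<rightarrow>\<^sub>E carrier R" and ik: "i \<in> {1..num_x T n}" "k \<in> {1..num_x T n}" "i < k"
    and t: "t \<in> carrier R"
  shows "(\<Prod>y\<in>y_indices T n. if x_relation T n i k (yb y) \<noteq> 0 then inverse (\<psi> (w y \<otimes> t)) else 1) = inverse (\<psi> (upper_form T n w i k \<otimes> t))"
  using upper_form_index[OF ik]
proof (elim disjE bexE conjE)
  fix y0 assume y0: "y0 \<in> y_indices T n" "x_relation T n i k = unit_coord (yb y0)" "\<forall>w. upper_form T n w i k = w y0"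
  have "(\<Prod>y\<in>y_indices T n. if x_relation T n i k (yb y) \<noteq> 0 then inverse (\<psi> (w y \<otimes> t)) else 1)
    = (\<Prod>y\<in>y_indices T n. if y = y0 then inverse (\<psi> (w y \<otimes> t)) else 1)"
    by (intro prod.cong) (auto simp: y0 unit_coord_def yb_def split: prod.splits)
  then show ?thesis using y0 by (simp add: finite_y_indices)
next
  assume "x_relation T n i k = (\<lambda>_. 0)" "\<forall>w. upper_form T n w i k = \<zero>"
  then show ?thesis using t by (simp add: psi_0[OF psi psi_nontriv])
qed

text \<open>The commutator form is \<open>\<psi>\<close> of the bilinear form with matrix
  \<open>form T n w\<close>. The product is grouped by the coordinates of \<open>h\<close>, so that
  nondegeneracy of \<open>\<psi>\<close> can be used for each of them separately.\<close>

lemma lamw_comm: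
  assumes w: "w \<in> y_indices T n \<rightarrow>\<^sub>E carrier R" and g: "g \<in> carrier (PG T n)" and h: "h \<in> carrier (PG T n)"
  shows "lamw \<psi> T n w (PGc T n g h) = (\<Prod>k\<in>{1..num_x T n}. \<psi> (h (BX k) \<otimes> (\<Oplus>i\<in>{1..num_x T n}. g (BX i) \<otimes> form T n w i k)))"
proof -
  let ?X = "{1..num_x T n}" and ?Y = "y_indices T n"
  note co = PG_cochain[OF g] PG_cochain[OF h]
  have gX: "g (BX i) \<in> carrier R" "h (BX i) \<in> carrier R" if "i \<in> ?X" for i
    using that cochainD[OF co(1)] cochainD[OF co(2)] by (auto simp: BX_in_basis)
  have wc: "w y \<in> carrier R" if "y \<in> ?Y" for y using w that by auto
  \<comment> \<open>Contribution of one pair of indices to \<open>beta\<close>, which is supported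
    on \<open>k < i\<close>; the inverse reflects the sign of \<open>beta\<close>.\<close>
  define U where "U g h i k = (if k < i then inverse (\<psi> (upper_form T n w k i \<otimes> (g (BX i) \<otimes> h (BX k)))) else 1)" for g h :: "basis_elt => 'a" and i k
  have beta: "(\<Prod>y\<in>?Y. \<psi> (w y \<otimes> beta T n R g h (yb y))) = (\<Prod>i\<in>?X. \<Prod>k\<in>?X. U g h i k)"
    if c: "cochain T n g" "cochain T n h" for g h
  proof -
    have "(\<Prod>y\<in>?Y. \<psi> (w y \<otimes> beta T n R g h (yb y))) = (\<Prod>y\<in>?Y. \<Prod>i\<in>?X. \<Prod>k\<in>?X.
        if k < i \<and> x_relation T n k i (yb y) \<noteq> 0 then inverse (\<psi> (w y \<otimes> (g (BX i) \<otimes> h (BX k)))) else 1)"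
      using psi_beta[OF wc c] by (intro prod.cong) auto
    also have "\<dots> = (\<Prod>i\<in>?X. \<Prod>y\<in>?Y. \<Prod>k\<in>?X.
        if k < i \<and> x_relation T n k i (yb y) \<noteq> 0 then inverse (\<psi> (w y \<otimes> (g (BX i) \<otimes> h (BX k)))) else 1)"
      by (rule prod.swap)
    also have "\<dots> = (\<Prod>i\<in>?X. \<Prod>k\<in>?X. \<Prod>y\<in>?Y.
        if k < i \<and> x_relation T n k i (yb y) \<noteq> 0 then inverse (\<psi> (w y \<otimes> (g (BX i) \<otimes> h (BX k)))) else 1)"
      by (intro prod.cong refl prod.swap)
    also have "\<dots> = (\<Prod>i\<in>?X. \<Prod>k\<in>?X. U g h i k)"
    proof (intro prod.cong refl)
      fix i k assume ik: "i \<in> ?X" "k \<in> ?X"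
      have "g (BX i) \<in> carrier R" "h (BX k) \<in> carrier R" using ik cochainD[OF c(1)] cochainD[OF c(2)] by (auto simp: BX_in_basis)
      then show "(\<Prod>y\<in>?Y. if k < i \<and> x_relation T n k i (yb y) \<noteq> 0 then inverse (\<psi> (w y \<otimes> (g (BX i) \<otimes> h (BX k)))) else 1) = U g h i k"
        using psi_upper[OF w ik(2,1), of "g (BX i) \<otimes> h (BX k)"] by (cases "k < i") (auto simp: U_def)
    qed
    finally show ?thesis .
  qed
  have "lamw \<psi> T n w (PGc T n g h) = (\<Prod>y\<in>?Y. \<psi> (w y \<otimes> PGc T n g h (yb y)))"
    using PGc_PGZ[OF g h] by (simp add: lamw_def[OF psi psi_nontriv])
  also have "\<dots> = (\<Prod>y\<in>?Y. \<psi> (w y \<otimes> beta T n R g h (yb y)) / \<psi> (w y \<otimes> beta T n R h g (yb y)))"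
  proof (rule prod.cong[OF refl])
    fix y assume y: "y \<in> ?Y"
    have b: "beta T n R g h (yb y) \<in> carrier R" "beta T n R h g (yb y) \<in> carrier R" using beta_closed co by auto
    then have "w y \<otimes> PGc T n g h (yb y) = w y \<otimes> beta T n R g h (yb y) \<ominus> w y \<otimes> beta T n R h g (yb y)"
      using y wc[OF y] by (simp add: PGc_def yb_in_basis a_minus_def r_distr r_minus)
    then show "\<psi> (w y \<otimes> PGc T n g h (yb y)) = \<psi> (w y \<otimes> beta T n R g h (yb y)) / \<psi> (w y \<otimes> beta T n R h g (yb y))"
      using b wc[OF y] by (simp add: psi_minus[OF psi psi_nontriv])
  qed
  also have "\<dots> = (\<Prod>i\<in>?X. \<Prod>k\<in>?X. U g h i k) / (\<Prod>k\<in>?X. \<Prod>i\<in>?X. U h g k i)"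
    by (simp add: prod_dividef beta[OF co] beta[OF co(2,1)])
  also have "(\<Prod>k\<in>?X. \<Prod>i\<in>?X. U h g k i) = (\<Prod>i\<in>?X. \<Prod>k\<in>?X. U h g k i)" by (rule prod.swap)
  also have "(\<Prod>i\<in>?X. \<Prod>k\<in>?X. U g h i k) / (\<Prod>i\<in>?X. \<Prod>k\<in>?X. U h g k i) = (\<Prod>i\<in>?X. \<Prod>k\<in>?X. U g h i k / U h g k i)"
    by (simp add: prod_dividef)
  also have "\<dots> = (\<Prod>i\<in>?X. \<Prod>k\<in>?X. \<psi> (h (BX k) \<otimes> (g (BX i) \<otimes> form T n w i k)))"
  proof (intro prod.cong refl)
    fix i k assume ik: "i \<in> ?X" "k \<in> ?X"
    note c = gX[OF ik(1)] gX[OF ik(2)]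
    consider "i < k" | "k < i" | "i = k" by linarith
    then show "U g h i k / U h g k i = \<psi> (h (BX k) \<otimes> (g (BX i) \<otimes> form T n w i k))"
    proof cases
      case 1
      have u: "upper_form T n w i k \<in> carrier R" using upper_form_closed[OF w ik 1] .
      have "upper_form T n w i k \<otimes> (h (BX k) \<otimes> g (BX i)) = h (BX k) \<otimes> (g (BX i) \<otimes> upper_form T n w i k)"
        using u c by (simp add: m_ac)
      then show ?thesis using 1 by (simp add: U_def form_def field_simps)
    next
      case 2
      have u: "upper_form T n w k i \<in> carrier R" using upper_form_closed[OF w ik(2,1) 2] .
      have "upper_form T n w k i \<otimes> (g (BX i) \<otimes> h (BX k)) = h (BX k) \<otimes> (g (BX i) \<otimes> upper_form T n w k i)"
        using u c by (simp add: m_ac)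
      moreover have "h (BX k) \<otimes> (g (BX i) \<otimes> \<ominus> upper_form T n w k i) = \<ominus> (h (BX k) \<otimes> (g (BX i) \<otimes> upper_form T n w k i))"
        using u c by (simp add: r_minus)
      ultimately show ?thesis using 2 u c by (simp add: U_def form_def psi_neg[OF psi psi_nontriv])
    next
      case 3
      then show ?thesis using c by (simp add: U_def form_def psi_0[OF psi psi_nontriv])
    qed
  qed
  also have "\<dots> = (\<Prod>k\<in>?X. \<Prod>i\<in>?X. \<psi> (h (BX k) \<otimes> (g (BX i) \<otimes> form T n w i k)))" by (rule prod.swap)
  also have "\<dots> = (\<Prod>k\<in>?X. \<psi> (h (BX k) \<otimes> (\<Oplus>i\<in>?X. g (BX i) \<otimes> form T n w i k)))"
  proof (rule prod.cong[OF refl])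
    fix k assume k: "k \<in> ?X"
    have c: "g (BX i) \<otimes> form T n w i k \<in> carrier R" if "i \<in> ?X" for i
      using gX(1)[OF that] form_closed[OF w that k] by simp
    have "h (BX k) \<otimes> (\<Oplus>i\<in>?X. g (BX i) \<otimes> form T n w i k) = (\<Oplus>i\<in>?X. h (BX k) \<otimes> (g (BX i) \<otimes> form T n w i k))"
      using c gX(2)[OF k] by (intro finsum_rdistr) auto
    also have "\<psi> \<dots> = (\<Prod>i\<in>?X. \<psi> (h (BX k) \<otimes> (g (BX i) \<otimes> form T n w i k)))"
      using c gX(2)[OF k] by (intro psi_finsum[OF psi psi_nontriv]) auto
    finally show "(\<Prod>i\<in>?X. \<psi> (h (BX k) \<otimes> (g (BX i) \<otimes> form T n w i k))) = \<psi> (h (BX k) \<otimes> (\<Oplus>i\<in>?X. g (BX i) \<otimes> form T n w i k))" by simp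
  qed
  finally show ?thesis .
qed

text \<open>Points \<open>h\<close> with one nonzero coordinate \<open>k\<close> and arbitrary value
  there force, by nondegeneracy of \<open>\<psi>\<close>, the linear equation of column
  \<open>k\<close>.\<close>

lemma rad_lamw:
  assumes w: "w \<in> y_indices T n \<rightarrow>\<^sub>E carrier R"
  shows "{g \<in> carrier (PG T n). \<forall>h\<in>carrier (PG T n). lamw \<psi> T n w (PGc T n g h) = 1}
    = {g \<in> carrier (PG T n). fst (coords T n g) \<in> Rad {1..num_x T n} (form T n w)}"
proof -
  let ?X = "{1..num_x T n}"
  have "(\<forall>h\<in>carrier (PG T n). lamw \<psi> T n w (PGc T n g h) = 1) \<longleftrightarrow> fst (coords T n g) \<in> Rad ?X (form T n w)"
    if g: "g \<in> carrier (PG T n)" for g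
  proof -
    define s where "s k = (\<Oplus>i\<in>?X. g (BX i) \<otimes> form T n w i k)" for k
    have gX: "g (BX i) \<in> carrier R" if "i \<in> ?X" for i
      using that cochainD[OF PG_cochain[OF g]] by (auto simp: BX_in_basis)
    have sc: "s k \<in> carrier R" if "k \<in> ?X" for k
      unfolding s_def using gX form_closed[OF w _ that] by (intro finsum_closed) auto
    have "(\<Oplus>i\<in>?X. fst (coords T n g) i \<otimes> form T n w i k) = s k" if "k \<in> ?X" for k
      unfolding s_def using gX form_closed[OF w _ that] by (intro finsum_cong') (auto simp: coords_def)
    then have R: "fst (coords T n g) \<in> Rad ?X (form T n w) \<longleftrightarrow> (\<forall>k\<in>?X. s k = \<zero>)"
      using gX by (auto simp: Rad_def coords_def)
    have L: "lamw \<psi> T n w (PGc T n g h) = (\<Prod>k\<in>?X. \<psi> (h (BX k) \<otimes> s k))" if h: "h \<in> carrier (PG T n)" for h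
      unfolding s_def by (rule lamw_comm[OF w g h])
    show ?thesis
      unfolding R
    proof
      assume a: "\<forall>h\<in>carrier (PG T n). lamw \<psi> T n w (PGc T n g h) = 1"
      show "\<forall>k\<in>?X. s k = \<zero>"
      proof (rule ballI, rule ccontr)
        fix k assume k: "k \<in> ?X" "s k \<noteq> \<zero>"
        then obtain r where r: "r \<in> carrier R" "\<psi> (s k \<otimes> r) \<noteq> 1" using psi_nontriv sc by blast
        define h where "h = (\<lambda>c\<in>lattice_basis T n. if c = BX k then r else \<zero>)"
        have h: "h \<in> carrier (PG T n)" using r by (auto simp: h_def PG_carrier)
        have "(\<Prod>k'\<in>?X. \<psi> (h (BX k') \<otimes> s k')) = (\<Prod>k'\<in>?X. if k' = k then \<psi> (r \<otimes> s k) else 1)"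
          using sc by (intro prod.cong) (auto simp: h_def BX_in_basis psi_0[OF psi psi_nontriv])
        also have "\<dots> = \<psi> (r \<otimes> s k)" using k by simp
        finally have "\<psi> (r \<otimes> s k) = 1" using a L[OF h] h by simp
        then show False using r sc[OF k(1)] by (simp add: m_comm)
      qed
    next
      assume a: "\<forall>k\<in>?X. s k = \<zero>"
      show "\<forall>h\<in>carrier (PG T n). lamw \<psi> T n w (PGc T n g h) = 1"
      proof
        fix h assume h: "h \<in> carrier (PG T n)"
        have "h (BX k) \<in> carrier R" if "k \<in> ?X" for k
          using that cochainD[OF PG_cochain[OF h]] by (auto simp: BX_in_basis)
        then show "lamw \<psi> T n w (PGc T n g h) = 1"
          unfolding L[OF h] using a by (intro prod.neutral) (auto simp: psi_0[OF psi psi_nontriv])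
      qed
    qed
  qed
  then show ?thesis by blast
qed

lemma card_rad_lamw:
  assumes w: "w \<in> y_indices T n \<rightarrow>\<^sub>E carrier R"
  shows "card {g \<in> carrier (PG T n). fst (coords T n g) \<in> Rad {1..num_x T n} (form T n w)}
    = card (Rad {1..num_x T n} (form T n w)) * card (PGZ T n)"
proof -
  let ?A = "{g \<in> carrier (PG T n). fst (coords T n g) \<in> Rad {1..num_x T n} (form T n w)}"
  have sub: "Rad {1..num_x T n} (form T n w) \<subseteq> {1..num_x T n} \<rightarrow>\<^sub>E carrier R" by (auto simp: Rad_def)
  have "coords T n ` ?A = Rad {1..num_x T n} (form T n w) \<times> (y_indices T n \<rightarrow>\<^sub>E carrier R)"
  proof (intro equalityI subsetI)
    fix xy assume "xy \<in> coords T n ` ?A"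
    then show "xy \<in> Rad {1..num_x T n} (form T n w) \<times> (y_indices T n \<rightarrow>\<^sub>E carrier R)"
      using bij_betwE[OF coords_bij[of T n]] by (auto simp: mem_Times_iff)
  next
    fix xy assume xy: "xy \<in> Rad {1..num_x T n} (form T n w) \<times> (y_indices T n \<rightarrow>\<^sub>E carrier R)"
    then have "xy \<in> ({1..num_x T n} \<rightarrow>\<^sub>E carrier R) \<times> (y_indices T n \<rightarrow>\<^sub>E carrier R)" using sub by auto
    then obtain g where "g \<in> carrier (PG T n)" "xy = coords T n g"
      using bij_betw_imp_surj_on[OF coords_bij] by blast
    then show "xy \<in> coords T n ` ?A" using xy by (auto simp: mem_Times_iff)
  qed
  moreover have "card (coords T n ` ?A) = card ?A" by (rule card_image, rule inj_coords) auto
  ultimately show ?thesis by (simp add: card_PGZ card_cartesian_product)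
qed

end

text \<open>The central subgroup cancels: the group and each radical are
  \<open>card (PGZ T n)\<close> times the corresponding sets of \<open>x\<close>
  coordinates.\<close>

theorem zeta_irr_point_group:
  "zeta_irr (PG T n) s = (\<Sum>w\<in>y_indices T n \<rightarrow>\<^sub>E carrier R.
     of_nat (card (Rad {1..num_x T n} (form T n w))) *
     (of_nat (card (carrier R) ^ num_x T n) / of_nat (card (Rad {1..num_x T n} (form T n w)))) powr (- s / 2))"
proof -
  obtain \<psi> where psi: "\<psi> \<in> chars (add_monoid R) (carrier R)"
    "!!w. w \<in> carrier R ==> w \<noteq> \<zero> ==> \<exists>r\<in>carrier R. \<psi> (w \<otimes> r) \<noteq> 1"
    by (rule additive_character) blast
  interpret G: class2_group "PG T n" "PGZ T n" "PGc T n" by (rule PG_class2)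
  have z: "card (PGZ T n) \<noteq> 0" using subgroup.finite_imp_card_positive[OF G.Z G.fin] by simp
  have rad: "card (G.rad (lamw \<psi> T n w)) = card (Rad {1..num_x T n} (form T n w)) * card (PGZ T n)"
    if w: "w \<in> y_indices T n \<rightarrow>\<^sub>E carrier R" for w
    unfolding G.rad_def by (rule trans[OF arg_cong[OF rad_lamw[OF psi w], of card] card_rad_lamw[OF psi w]])
  have "zeta_irr (PG T n) s = (\<Sum>w\<in>y_indices T n \<rightarrow>\<^sub>E carrier R.
    of_nat (card (G.rad (lamw \<psi> T n w))) / of_nat (card (PGZ T n)) *
     (of_nat (card (carrier (PG T n))) / of_nat (card (G.rad (lamw \<psi> T n w)))) powr (- s / 2))"
    unfolding G.zeta_irr_class2 by (rule sum.reindex_bij_betw[OF lamw_bij[OF psi], symmetric])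
  also have "\<dots> = (\<Sum>w\<in>y_indices T n \<rightarrow>\<^sub>E carrier R.
     of_nat (card (Rad {1..num_x T n} (form T n w))) *
     (of_nat (card (carrier R) ^ num_x T n) / of_nat (card (Rad {1..num_x T n} (form T n w)))) powr (- s / 2))"
  proof (rule sum.cong[OF refl])
    fix w assume w: "w \<in> y_indices T n \<rightarrow>\<^sub>E carrier R"
    have X: "card (carrier (PG T n)) = card (carrier R) ^ num_x T n * card (PGZ T n)"
      by (simp add: card_PG card_PiE)
    have "of_nat (r * card (PGZ T n)) / of_nat (card (PGZ T n)) = (of_nat r :: complex)"
      "of_nat (x * card (PGZ T n)) / of_nat (r * card (PGZ T n)) = (of_nat x / of_nat r :: complex)" for r x
      using z by auto
    then show "of_nat (card (G.rad (lamw \<psi> T n w))) / of_nat (card (PGZ T n)) *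
     (of_nat (card (carrier (PG T n))) / of_nat (card (G.rad (lamw \<psi> T n w)))) powr (- s / 2) =
     of_nat (card (Rad {1..num_x T n} (form T n w))) *
     (of_nat (card (carrier R) ^ num_x T n) / of_nat (card (Rad {1..num_x T n} (form T n w)))) powr (- s / 2)"
      unfolding rad[OF w] X by (simp only:)
  qed
  finally show ?thesis .
qed

end

section \<open>Eliminating a pair of indices from an alternating matrix over a chain ring\<close>

section \<open>Radicals of generic alternating matrices\<close>

context cring
begin

text \<open>The zero diagonal is a condition of its own, since 2 may be a zero divisor.\<close>

definition alternating :: "nat set => (nat => nat => 'a) => bool" where
  "alternating S B \<longleftrightarrow> (\<forall>l\<in>S. \<forall>m\<in>S. B l m \<in> carrier R \<and> B l m = \<ominus> B m l) \<and> (\<forall>l\<in>S. B l l = \<zero>)"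

lemma Rad_cong: "(!!l m. l \<in> S ==> m \<in> S ==> B l m = B' l m) ==> (!!l m. l \<in> S ==> m \<in> S ==> B' l m \<in> carrier R) ==> Rad S B = Rad S B'"
proof -
  assume a: "!!l m. l \<in> S ==> m \<in> S ==> B l m = B' l m" "!!l m. l \<in> S ==> m \<in> S ==> B' l m \<in> carrier R"
  have "(\<Oplus>i\<in>S. x i \<otimes> B i k) = (\<Oplus>i\<in>S. x i \<otimes> B' i k)" if "x \<in> S \<rightarrow>\<^sub>E carrier R" "k \<in> S" for x k
    using that a by (intro finsum_cong') auto
  then show ?thesis by (auto simp: Rad_def)
qed

end

context chain_ring
begin

text \<open>A chosen quotient by \<open>\<pi> [^] k\<close>, determined only up to an annihilator.
  By \<open>dv_swap\<close> its product with an element of \<open>J k\<close> does not depend on the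
  choice. Zero is sent to zero by definition, which preserves the block structure of
  matrices.\<close>

definition dv :: "nat => 'a => 'a" where
  "dv k x = (if x = \<zero> then \<zero> else SOME b. b \<in> carrier R \<and> x = \<pi> [^] k \<otimes> b)"

lemma dv: "x \<in> J k ==> dv k x \<in> carrier R" "x \<in> J k ==> \<pi> [^] k \<otimes> dv k x = x"
proof -
  assume "x \<in> J k"
  then have "\<exists>b. b \<in> carrier R \<and> x = \<pi> [^] k \<otimes> b" by (auto simp: J_def)
  from someI_ex[OF this] show "dv k x \<in> carrier R" "\<pi> [^] k \<otimes> dv k x = x" by (auto simp: dv_def)
qed

lemma dv_0 [simp]: "dv k \<zero> = \<zero>" by (simp add: dv_def)

lemma dv_swap: "x \<in> J k ==> y \<in> J k ==> dv k x \<otimes> y = x \<otimes> dv k y"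
proof -
  assume xy: "x \<in> J k" "y \<in> J k"
  have "dv k x \<otimes> (\<pi> [^] k \<otimes> dv k y) = (\<pi> [^] k \<otimes> dv k x) \<otimes> dv k y"
    using dv(1)[OF xy(1)] dv(1)[OF xy(2)] by (simp add: m_ac)
  then show ?thesis using dv(2)[OF xy(1)] dv(2)[OF xy(2)] by simp
qed

lemma dv_mult_J: "x \<in> J k ==> y \<in> J k ==> x \<in> J e \<or> y \<in> J e ==> dv k x \<otimes> y \<in> J e"
  using dv_swap[of x k y] J_mult[of x e "dv k y"] J_mult'[of y e "dv k x"] dv(1) by auto

context
  fixes S :: "nat set" and B :: "nat => nat => 'a" and i j k :: nat and u :: 'a
  assumes S: "finite S" and alt: "alternating S B" and BJ: "!!l m. l \<in> S ==> m \<in> S ==> B l m \<in> J k"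
    and ij: "i \<in> S" "j \<in> S" "i \<noteq> j" and u: "u \<in> Units R" "B i j = \<pi> [^] k \<otimes> u" and k: "k \<le> N"
begin

text \<open>The Schur complement of the 2 by 2 pivot block at \<open>i\<close> and \<open>j\<close>.
  In each product one factor is divided by \<open>\<pi> [^] k\<close> and the other is left
  divisible.\<close>

definition red :: "nat => nat => 'a" where
  "red l m = B l m \<oplus> inv u \<otimes> (dv k (B l i) \<otimes> B j m \<ominus> dv k (B l j) \<otimes> B i m)"

lemma Bc: "l \<in> S ==> m \<in> S ==> B l m \<in> carrier R" using alt unfolding alternating_def by blast

lemma dvc: "l \<in> S ==> m \<in> S ==> dv k (B l m) \<in> carrier R" using dv(1) BJ by blast

lemma Balt: "l \<in> S ==> m \<in> S ==> B l m = \<ominus> B m l" using alt unfolding alternating_def by blast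

lemma B0: "l \<in> S ==> B l l = \<zero>" using alt unfolding alternating_def by blast

lemma v: "inv u \<in> carrier R" "u \<in> carrier R" "inv u \<otimes> u = \<one>" using u by auto

lemma red_closed: "l \<in> S ==> m \<in> S ==> red l m \<in> carrier R"
  using Bc dvc v ij by (simp add: red_def)

lemma dv_transpose:
  assumes "l \<in> S" "m \<in> S" "a \<in> S" "b \<in> S"
  shows "dv k (B m a) \<otimes> B b l = dv k (B l b) \<otimes> B a m"
proof -
  have c: "dv k (B m a) \<in> carrier R" "dv k (B l b) \<in> carrier R" "B l b \<in> carrier R" "B b l \<in> carrier R" "B m a \<in> carrier R" "B a m \<in> carrier R"
    using assms Bc dvc by auto
  have "dv k (B m a) \<otimes> B b l = \<ominus> (dv k (B m a) \<otimes> B l b)"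
    using c Balt[OF assms(4,1)] by (simp add: r_minus)
  also have "dv k (B m a) \<otimes> B l b = B m a \<otimes> dv k (B l b)" using dv_swap BJ assms by blast
  also have "\<ominus> (B m a \<otimes> dv k (B l b)) = dv k (B l b) \<otimes> B a m"
    using c Balt[OF assms(2,3)] by (simp add: l_minus m_comm)
  finally show ?thesis .
qed

lemma red_alternating: "alternating S red"
  unfolding alternating_def
proof (intro conjI ballI)
  fix l m assume l: "l \<in> S" and m: "m \<in> S"
  show "red l m \<in> carrier R" by (rule red_closed[OF l m])
  let ?a = "dv k (B l i) \<otimes> B j m" and ?b = "dv k (B l j) \<otimes> B i m"
  have c: "?a \<in> carrier R" "?b \<in> carrier R" "B m l \<in> carrier R" using l m ij Bc dvc by auto
  have "red m l = B m l \<oplus> inv u \<otimes> (?b \<ominus> ?a)"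
    using dv_transpose[OF l m ij(1,2)] dv_transpose[OF l m ij(2,1)] by (simp add: red_def)
  moreover have "red l m = \<ominus> B m l \<oplus> inv u \<otimes> (?a \<ominus> ?b)" using Balt[OF l m] by (simp add: red_def)
  moreover have "inv u \<otimes> (?a \<ominus> ?b) = \<ominus> (inv u \<otimes> (?b \<ominus> ?a))"
    using c v by (simp add: a_minus_def r_distr r_minus minus_add a_comm)
  ultimately show "red l m = \<ominus> red m l" using c v by (simp add: minus_add)
next
  fix l assume l: "l \<in> S"
  have "dv k (B l i) \<otimes> B j l = dv k (B l j) \<otimes> B i l" by (rule dv_transpose[OF l l ij(1,2)])
  moreover have "dv k (B l j) \<otimes> B i l \<in> carrier R" using l ij Bc dvc by auto
  ultimately show "red l l = \<zero>" using v by (simp add: red_def B0[OF l] a_minus_def r_neg)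
qed

lemma finsum_lin:
  assumes "finite A" "!!l. l \<in> A ==> a l \<in> carrier R" "!!l. l \<in> A ==> b l \<in> carrier R" "!!l. l \<in> A ==> d l \<in> carrier R"
    "v \<in> carrier R" "c \<in> carrier R" "e \<in> carrier R"
  shows "(\<Oplus>l\<in>A. a l \<oplus> v \<otimes> (b l \<otimes> c \<ominus> d l \<otimes> e)) = (\<Oplus>l\<in>A. a l) \<oplus> v \<otimes> ((\<Oplus>l\<in>A. b l) \<otimes> c \<ominus> (\<Oplus>l\<in>A. d l) \<otimes> e)"
  using assms
proof (induction A rule: finite_induct)
  case empty
  then show ?case by (simp add: a_minus_def)
next
  case (insert x A)
  have c: "(\<Oplus>l\<in>A. a l) \<in> carrier R" "(\<Oplus>l\<in>A. b l) \<in> carrier R" "(\<Oplus>l\<in>A. d l) \<in> carrier R"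
    using insert by (auto intro!: finsum_closed)
  have "(\<Oplus>l\<in>insert x A. a l \<oplus> v \<otimes> (b l \<otimes> c \<ominus> d l \<otimes> e)) = (a x \<oplus> v \<otimes> (b x \<otimes> c \<ominus> d x \<otimes> e)) \<oplus> (\<Oplus>l\<in>A. a l \<oplus> v \<otimes> (b l \<otimes> c \<ominus> d l \<otimes> e))"
    using insert by (intro finsum_insert) auto
  also have "(\<Oplus>l\<in>A. a l \<oplus> v \<otimes> (b l \<otimes> c \<ominus> d l \<otimes> e)) = (\<Oplus>l\<in>A. a l) \<oplus> v \<otimes> ((\<Oplus>l\<in>A. b l) \<otimes> c \<ominus> (\<Oplus>l\<in>A. d l) \<otimes> e)"
    using insert by auto
  also have "(a x \<oplus> v \<otimes> (b x \<otimes> c \<ominus> d x \<otimes> e)) \<oplus> ((\<Oplus>l\<in>A. a l) \<oplus> v \<otimes> ((\<Oplus>l\<in>A. b l) \<otimes> c \<ominus> (\<Oplus>l\<in>A. d l) \<otimes> e))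
     = (a x \<oplus> (\<Oplus>l\<in>A. a l)) \<oplus> v \<otimes> ((b x \<oplus> (\<Oplus>l\<in>A. b l)) \<otimes> c \<ominus> (d x \<oplus> (\<Oplus>l\<in>A. d l)) \<otimes> e)"
    using c insert.prems by (simp add: a_minus_def l_distr r_distr minus_add r_minus a_ac)
  also have "a x \<oplus> (\<Oplus>l\<in>A. a l) = (\<Oplus>l\<in>insert x A. a l)" using insert by (intro finsum_insert[symmetric]) auto
  also have "b x \<oplus> (\<Oplus>l\<in>A. b l) = (\<Oplus>l\<in>insert x A. b l)" using insert by (intro finsum_insert[symmetric]) auto
  also have "d x \<oplus> (\<Oplus>l\<in>A. d l) = (\<Oplus>l\<in>insert x A. d l)" using insert by (intro finsum_insert[symmetric]) auto
  finally show ?case .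
qed

abbreviation (input) "S' \<equiv> S - {i, j}"

definition comb :: "nat => (nat => 'a) => 'a" where
  "comb m y = (\<Oplus>l\<in>S'. y l \<otimes> dv k (B l m))"

text \<open>Solves the equations of columns \<open>i\<close> and \<open>j\<close> for the two
  eliminated coordinates; \<open>\<alpha>\<close> and \<open>\<beta>\<close> express the freedom in
  dividing by \<open>\<pi> [^] k\<close>.\<close>

definition lift :: "'a => 'a => (nat => 'a) => nat => 'a" where
  "lift \<alpha> \<beta> y = (\<lambda>l\<in>S. if l = i then \<alpha> \<ominus> inv u \<otimes> comb j y else if l = j then \<beta> \<oplus> inv u \<otimes> comb i y else y l)"

context
  fixes y assumes y: "y \<in> S' \<rightarrow>\<^sub>E carrier R"
begin

lemma yc: "l \<in> S' ==> y l \<in> carrier R" using y by blast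

lemma comb_closed: "m \<in> S ==> comb m y \<in> carrier R"
  unfolding comb_def using yc dvc by (intro finsum_closed) auto

lemma sum_column: "m \<in> S ==> (\<Oplus>l\<in>S'. y l \<otimes> B l m) = \<pi> [^] k \<otimes> comb m y"
proof -
  assume m: "m \<in> S"
  have "(\<Oplus>l\<in>S'. y l \<otimes> B l m) = (\<Oplus>l\<in>S'. \<pi> [^] k \<otimes> (y l \<otimes> dv k (B l m)))"
  proof (rule finsum_cong'[OF refl])
    fix l assume l: "l \<in> S'"
    have "\<pi> [^] k \<otimes> (y l \<otimes> dv k (B l m)) = y l \<otimes> (\<pi> [^] k \<otimes> dv k (B l m))"
      using yc[OF l] dvc[of l m] l m by (simp add: m_lcomm)
    then show "y l \<otimes> B l m = \<pi> [^] k \<otimes> (y l \<otimes> dv k (B l m))" using dv(2)[OF BJ[of l m]] l m by simp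
  qed (use yc dvc m in auto)
  also have "\<dots> = \<pi> [^] k \<otimes> comb m y"
    unfolding comb_def using S yc dvc m by (intro finsum_rdistr[symmetric]) auto
  finally show ?thesis .
qed

lemma sum_red:
  assumes m: "m \<in> S"
  shows "(\<Oplus>l\<in>S'. y l \<otimes> red l m) = (\<Oplus>l\<in>S'. y l \<otimes> B l m) \<oplus> inv u \<otimes> (comb i y \<otimes> B j m \<ominus> comb j y \<otimes> B i m)"
proof -
  have "(\<Oplus>l\<in>S'. y l \<otimes> red l m) = (\<Oplus>l\<in>S'. y l \<otimes> B l m \<oplus> inv u \<otimes> ((y l \<otimes> dv k (B l i)) \<otimes> B j m \<ominus> (y l \<otimes> dv k (B l j)) \<otimes> B i m))"
  proof (rule finsum_cong'[OF refl])
    fix l assume l: "l \<in> S'"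
    have c: "y l \<in> carrier R" "B l m \<in> carrier R" "dv k (B l i) \<in> carrier R" "dv k (B l j) \<in> carrier R" "B j m \<in> carrier R" "B i m \<in> carrier R"
      using l m ij yc Bc dvc by auto
    show "y l \<otimes> red l m = y l \<otimes> B l m \<oplus> inv u \<otimes> ((y l \<otimes> dv k (B l i)) \<otimes> B j m \<ominus> (y l \<otimes> dv k (B l j)) \<otimes> B i m)"
      unfolding red_def using c v(1) by (simp add: a_minus_def r_distr r_minus m_ac)
  qed (use m ij v yc Bc dvc in auto)
  also have "\<dots> = (\<Oplus>l\<in>S'. y l \<otimes> B l m) \<oplus> inv u \<otimes> ((\<Oplus>l\<in>S'. y l \<otimes> dv k (B l i)) \<otimes> B j m \<ominus> (\<Oplus>l\<in>S'. y l \<otimes> dv k (B l j)) \<otimes> B i m)"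
    using S m ij v yc Bc dvc by (intro finsum_lin) auto
  finally show ?thesis by (simp add: comb_def)
qed

context
  fixes \<alpha> \<beta> assumes ab: "\<alpha> \<in> carrier R" "\<beta> \<in> carrier R"
begin

lemma lift_closed: "l \<in> S ==> lift \<alpha> \<beta> y l \<in> carrier R"
  using ab v comb_closed ij yc by (auto simp: lift_def)

lemma sum_lift:
  assumes m: "m \<in> S"
  shows "(\<Oplus>l\<in>S. lift \<alpha> \<beta> y l \<otimes> B l m) = (\<alpha> \<ominus> inv u \<otimes> comb j y) \<otimes> B i m \<oplus> ((\<beta> \<oplus> inv u \<otimes> comb i y) \<otimes> B j m \<oplus> (\<Oplus>l\<in>S'. y l \<otimes> B l m))"
proof -
  have e: "S = insert i (insert j S')" using ij by auto
  have c: "lift \<alpha> \<beta> y l \<otimes> B l m \<in> carrier R" if "l \<in> S" for l using lift_closed Bc that m by simp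
  have "(\<Oplus>l\<in>S. lift \<alpha> \<beta> y l \<otimes> B l m) = (\<Oplus>l\<in>insert i (insert j S'). lift \<alpha> \<beta> y l \<otimes> B l m)" using e by simp
  also have "\<dots> = lift \<alpha> \<beta> y i \<otimes> B i m \<oplus> (\<Oplus>l\<in>insert j S'. lift \<alpha> \<beta> y l \<otimes> B l m)"
    using S ij c by (intro finsum_insert) auto
  also have "(\<Oplus>l\<in>insert j S'. lift \<alpha> \<beta> y l \<otimes> B l m) = lift \<alpha> \<beta> y j \<otimes> B j m \<oplus> (\<Oplus>l\<in>S'. lift \<alpha> \<beta> y l \<otimes> B l m)"
    using S ij c by (intro finsum_insert) auto
  also have "(\<Oplus>l\<in>S'. lift \<alpha> \<beta> y l \<otimes> B l m) = (\<Oplus>l\<in>S'. y l \<otimes> B l m)"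
    using yc Bc m by (intro finsum_cong') (auto simp: lift_def)
  finally show ?thesis using ij by (simp add: lift_def)
qed

text \<open>Column \<open>j\<close> contains the pivot, and \<open>lift\<close> is made to cancel
  the contribution of the remaining coordinates. What survives says that \<open>\<pi> [^] k\<close>
  kills \<open>\<alpha>\<close> if the column sum vanishes.\<close>

lemma sum_lift_j: "(\<Oplus>l\<in>S. lift \<alpha> \<beta> y l \<otimes> B l j) = u \<otimes> (\<pi> [^] k \<otimes> \<alpha>)"
proof -
  let ?P = "\<pi> [^] k \<otimes> comb j y"
  have c: "comb j y \<in> carrier R" "comb i y \<in> carrier R" using comb_closed ij by auto
  have 1: "inv u \<otimes> (\<pi> [^] k \<otimes> (u \<otimes> comb j y)) = ?P"
  proof -
    have "inv u \<otimes> (\<pi> [^] k \<otimes> (u \<otimes> comb j y)) = (inv u \<otimes> u) \<otimes> ?P" using c v(1,2) by (simp add: m_ac)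
    then show ?thesis using c v by simp
  qed
  have "(\<alpha> \<ominus> inv u \<otimes> comb j y) \<otimes> B i j = u \<otimes> (\<pi> [^] k \<otimes> \<alpha>) \<ominus> inv u \<otimes> (\<pi> [^] k \<otimes> (u \<otimes> comb j y))"
  proof -
    have "(\<alpha> \<ominus> inv u \<otimes> comb j y) \<otimes> (\<pi> [^] k \<otimes> u) = \<alpha> \<otimes> (\<pi> [^] k \<otimes> u) \<ominus> (inv u \<otimes> comb j y) \<otimes> (\<pi> [^] k \<otimes> u)"
      using c ab v(1,2) by (simp add: a_minus_def l_distr l_minus)
    moreover have "\<alpha> \<otimes> (\<pi> [^] k \<otimes> u) = u \<otimes> (\<pi> [^] k \<otimes> \<alpha>)" using ab v(2) by (simp add: m_ac)
    moreover have "(inv u \<otimes> comb j y) \<otimes> (\<pi> [^] k \<otimes> u) = inv u \<otimes> (\<pi> [^] k \<otimes> (u \<otimes> comb j y))"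
      using c v(1,2) by (simp add: m_ac)
    ultimately show ?thesis unfolding u(2) by (simp only:)
  qed
  then show ?thesis unfolding sum_lift[OF ij(2)] sum_column[OF ij(2)] 1
    using c ab v by (simp add: B0 ij a_minus_def a_assoc l_neg)
qed

lemma sum_lift_i: "(\<Oplus>l\<in>S. lift \<alpha> \<beta> y l \<otimes> B l i) = \<ominus> (u \<otimes> (\<pi> [^] k \<otimes> \<beta>))"
proof -
  let ?P = "\<pi> [^] k \<otimes> comb i y"
  have c: "comb j y \<in> carrier R" "comb i y \<in> carrier R" using comb_closed ij by auto
  have 1: "inv u \<otimes> (\<pi> [^] k \<otimes> (u \<otimes> comb i y)) = ?P"
  proof -
    have "inv u \<otimes> (\<pi> [^] k \<otimes> (u \<otimes> comb i y)) = (inv u \<otimes> u) \<otimes> ?P" using c v(1,2) by (simp add: m_ac)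
    then show ?thesis using c v by simp
  qed
  have B: "B j i = \<ominus> (\<pi> [^] k \<otimes> u)" using Balt[OF ij(2,1)] u(2) by simp
  have "(\<beta> \<oplus> inv u \<otimes> comb i y) \<otimes> B j i = \<ominus> (u \<otimes> (\<pi> [^] k \<otimes> \<beta>)) \<oplus> \<ominus> (inv u \<otimes> (\<pi> [^] k \<otimes> (u \<otimes> comb i y)))"
  proof -
    have "(\<beta> \<oplus> inv u \<otimes> comb i y) \<otimes> \<ominus> (\<pi> [^] k \<otimes> u) = \<ominus> (\<beta> \<otimes> (\<pi> [^] k \<otimes> u)) \<oplus> \<ominus> ((inv u \<otimes> comb i y) \<otimes> (\<pi> [^] k \<otimes> u))"
      using c ab v(1,2) by (simp add: l_distr r_minus minus_add)
    moreover have "\<beta> \<otimes> (\<pi> [^] k \<otimes> u) = u \<otimes> (\<pi> [^] k \<otimes> \<beta>)" using ab v(2) by (simp add: m_ac)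
    moreover have "(inv u \<otimes> comb i y) \<otimes> (\<pi> [^] k \<otimes> u) = inv u \<otimes> (\<pi> [^] k \<otimes> (u \<otimes> comb i y))"
      using c v(1,2) by (simp add: m_ac)
    ultimately show ?thesis unfolding B by (simp only:)
  qed
  then show ?thesis unfolding sum_lift[OF ij(1)] sum_column[OF ij(1)] 1
    using c ab v by (simp add: B0 ij a_minus_def a_assoc l_neg)
qed

text \<open>In the other columns the substitution turns \<open>B\<close> into its Schur complement,
  up to two terms that vanish when \<open>\<pi> [^] k\<close> kills \<open>\<alpha>\<close> and
  \<open>\<beta>\<close>.\<close>

lemma sum_lift_m:
  assumes m: "m \<in> S"
  shows "(\<Oplus>l\<in>S. lift \<alpha> \<beta> y l \<otimes> B l m) = (\<alpha> \<otimes> B i m \<oplus> \<beta> \<otimes> B j m) \<oplus> (\<Oplus>l\<in>S'. y l \<otimes> red l m)"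
proof -
  have c: "comb j y \<in> carrier R" "comb i y \<in> carrier R" "B i m \<in> carrier R" "B j m \<in> carrier R"
    using comb_closed ij Bc m by auto
  have s: "(\<Oplus>l\<in>S'. y l \<otimes> B l m) \<in> carrier R" using yc Bc m by (intro finsum_closed) auto
  show ?thesis unfolding sum_lift[OF m] sum_red[OF m]
    using c s ab v(1) by (simp add: a_minus_def l_distr r_distr l_minus r_minus m_assoc a_ac)
qed

end
end

lemma unit_cancel_zero: "x \<in> carrier R ==> u \<otimes> x = \<zero> ==> x = \<zero>"
proof -
  assume x: "x \<in> carrier R" "u \<otimes> x = \<zero>"
  have "x = inv u \<otimes> (u \<otimes> x)" using x(1) v by (simp add: m_assoc[symmetric])
  then show "x = \<zero>" using x v by simp
qed

text \<open>\<open>lift\<close> is a bijection onto the kernel of \<open>B\<close> from triples of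
  two elements killed by \<open>\<pi> [^] k\<close> and one kernel vector of the Schur complement;
  each of the former has \<open>q ^ k\<close> choices.\<close>

lemma card_Rad_pivot: "card (Rad S B) = q ^ (2 * k) * card (Rad (S - {i, j}) red)"
proof -
  let ?A = "{x \<in> carrier R. \<pi> [^] k \<otimes> x = \<zero>}"
  let ?h = "\<lambda>(\<alpha>, \<beta>, y). lift \<alpha> \<beta> y"
  have redc: "y l \<otimes> red l m \<in> carrier R" if "y \<in> S' \<rightarrow>\<^sub>E carrier R" "l \<in> S'" "m \<in> S" for y l m
    using red_closed[of l m] that by auto
  have annB: "\<alpha> \<otimes> B l m = \<zero>" if a: "\<alpha> \<in> ?A" and lm: "l \<in> S" "m \<in> S" for \<alpha> l m
  proof -
    have ac: "\<alpha> \<in> carrier R" and a0: "\<pi> [^] k \<otimes> \<alpha> = \<zero>" using a by auto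
    have "\<alpha> \<otimes> B l m = \<alpha> \<otimes> (\<pi> [^] k \<otimes> dv k (B l m))" using dv(2)[OF BJ[OF lm]] by simp
    also have "\<dots> = (\<pi> [^] k \<otimes> \<alpha>) \<otimes> dv k (B l m)" using ac dvc[OF lm] by (simp add: m_ac)
    finally show ?thesis unfolding a0 using dvc[OF lm] by simp
  qed
  have "Rad S B = ?h ` (?A \<times> ?A \<times> Rad S' red)"
  proof (intro equalityI subsetI)
    fix x assume x: "x \<in> Rad S B"
    define y where "y = restrict x S'"
    have xc: "x l \<in> carrier R" if "l \<in> S" for l using x that by (auto simp: Rad_def)
    have y: "y \<in> S' \<rightarrow>\<^sub>E carrier R" using xc by (auto simp: y_def)
    have c: "comb j y \<in> carrier R" "comb i y \<in> carrier R" using comb_closed[OF y] ij by auto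
    define \<alpha> \<beta> where "\<alpha> = x i \<oplus> inv u \<otimes> comb j y" and "\<beta> = x j \<ominus> inv u \<otimes> comb i y"
    have ab: "\<alpha> \<in> carrier R" "\<beta> \<in> carrier R" using xc ij c v by (auto simp: \<alpha>_def \<beta>_def)
    have lx: "lift \<alpha> \<beta> y = x"
    proof (rule extensionalityI[of _ S])
      show "lift \<alpha> \<beta> y \<in> extensional S" by (simp add: lift_def)
      show "x \<in> extensional S" using x by (auto simp: Rad_def PiE_def)
      fix l assume l: "l \<in> S"
      show "lift \<alpha> \<beta> y l = x l"
        using l ij xc c v by (auto simp: lift_def \<alpha>_def \<beta>_def y_def a_minus_def a_assoc r_neg l_neg)
    qed
    have R0: "(\<Oplus>l\<in>S. lift \<alpha> \<beta> y l \<otimes> B l m) = \<zero>" if "m \<in> S" for m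
      unfolding lx using x that by (auto simp: Rad_def)
    have pa: "\<pi> [^] k \<otimes> \<alpha> \<in> carrier R" "\<pi> [^] k \<otimes> \<beta> \<in> carrier R" using ab by auto
    have "u \<otimes> (\<pi> [^] k \<otimes> \<alpha>) = \<zero>" using R0[OF ij(2)] sum_lift_j[OF y ab] by simp
    then have A: "\<alpha> \<in> ?A" using unit_cancel_zero[OF pa(1)] ab by simp
    have "\<ominus> (u \<otimes> (\<pi> [^] k \<otimes> \<beta>)) = \<zero>" using R0[OF ij(1)] sum_lift_i[OF y ab] by simp
    then have "u \<otimes> (\<pi> [^] k \<otimes> \<beta>) = \<zero>" using pa v by (metis add.inv_eq_1_iff m_closed)
    then have Bt: "\<beta> \<in> ?A" using unit_cancel_zero[OF pa(2)] ab by simp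
    have "(\<Oplus>l\<in>S'. y l \<otimes> red l m) = \<zero>" if m: "m \<in> S'" for m
    proof -
      have mS: "m \<in> S" using m by simp
      have "(\<Oplus>l\<in>S'. y l \<otimes> red l m) \<in> carrier R" using redc[OF y _ mS] by (intro finsum_closed) auto
      then show ?thesis using R0[OF mS] sum_lift_m[OF y ab mS] annB[OF A ij(1) mS] annB[OF Bt ij(2) mS] by simp
    qed
    then have "y \<in> Rad S' red" using y by (auto simp: Rad_def)
    then show "x \<in> ?h ` (?A \<times> ?A \<times> Rad S' red)" using A Bt lx by force
  next
    fix x assume "x \<in> ?h ` (?A \<times> ?A \<times> Rad S' red)"
    then obtain \<alpha> \<beta> y where aby: "\<alpha> \<in> ?A" "\<beta> \<in> ?A" "y \<in> Rad S' red" "x = lift \<alpha> \<beta> y" by auto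
    have y: "y \<in> S' \<rightarrow>\<^sub>E carrier R" using aby by (auto simp: Rad_def)
    have ab: "\<alpha> \<in> carrier R" "\<beta> \<in> carrier R" "\<pi> [^] k \<otimes> \<alpha> = \<zero>" "\<pi> [^] k \<otimes> \<beta> = \<zero>" using aby by auto
    have "(\<Oplus>l\<in>S. lift \<alpha> \<beta> y l \<otimes> B l m) = \<zero>" if m: "m \<in> S" for m
    proof -
      consider "m = i" | "m = j" | "m \<in> S'" using m by auto
      then show ?thesis
      proof cases
        case 1
        then show ?thesis using sum_lift_i[OF y ab(1,2)] ab v by simp
      next
        case 2
        then show ?thesis using sum_lift_j[OF y ab(1,2)] ab v by simp
      next
        case 3
        then have "(\<Oplus>l\<in>S'. y l \<otimes> red l m) = \<zero>" using aby by (auto simp: Rad_def)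
        then show ?thesis using sum_lift_m[OF y ab(1,2) m] annB[OF aby(1) ij(1) m] annB[OF aby(2) ij(2) m] by simp
      qed
    qed
    then show "x \<in> Rad S B" using lift_closed[OF y ab(1,2)] aby(4) by (auto simp: Rad_def lift_def)
  qed
  moreover have "inj_on ?h (?A \<times> ?A \<times> Rad S' red)"
  proof (rule inj_onI)
    fix z z' assume z: "z \<in> ?A \<times> ?A \<times> Rad S' red" "z' \<in> ?A \<times> ?A \<times> Rad S' red" "?h z = ?h z'"
    obtain \<alpha> \<beta> y \<alpha>' \<beta>' y' where zz: "z = (\<alpha>, \<beta>, y)" "z' = (\<alpha>', \<beta>', y')" by (cases z, cases z') auto
    have a: "\<alpha> \<in> carrier R" "\<beta> \<in> carrier R" "\<alpha>' \<in> carrier R" "\<beta>' \<in> carrier R"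
      and y: "y \<in> Rad S' red" "y' \<in> Rad S' red" and eq: "lift \<alpha> \<beta> y = lift \<alpha>' \<beta>' y'"
      using z by (auto simp: zz)
    have yE: "y \<in> S' \<rightarrow>\<^sub>E carrier R" "y' \<in> S' \<rightarrow>\<^sub>E carrier R" using y by (auto simp: Rad_def)
    have yy: "y = y'"
    proof (rule PiE_ext[OF yE])
      fix l assume "l \<in> S'"
      then show "y l = y' l" using fun_cong[OF eq, of l] by (simp add: lift_def)
    qed
    have c: "inv u \<otimes> comb j y \<in> carrier R" "inv u \<otimes> comb i y \<in> carrier R" using comb_closed[OF yE(1)] ij v by auto
    have "\<alpha> \<ominus> inv u \<otimes> comb j y = \<alpha>' \<ominus> inv u \<otimes> comb j y"
      using fun_cong[OF eq, of i] ij by (simp add: lift_def yy)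
    then have "\<alpha> = \<alpha>'" using a c by (simp add: a_minus_def)
    moreover have "\<beta> \<oplus> inv u \<otimes> comb i y = \<beta>' \<oplus> inv u \<otimes> comb i y"
      using fun_cong[OF eq, of j] ij by (simp add: lift_def yy)
    then have "\<beta> = \<beta>'" using a c by simp
    ultimately show "z = z'" using yy zz by simp
  qed
  ultimately have "card (Rad S B) = card ?A * (card ?A * card (Rad S' red))"
    by (simp add: card_image card_cartesian_product)
  then show ?thesis using card_ann[OF k] by (simp add: mult_2 power_add)
qed

end
end

section \<open>Averages over independent entries of prescribed divisibility, and the elimination
  step\<close>

context chain_ring
begin

text \<open>The entries range independently over ideals; \<open>lev y\<close> is the power of
  \<open>\<pi>\<close> known to divide the entry \<open>y\<close>.\<close>

definition box :: "(nat \<times> nat) set => (nat \<times> nat => nat) => (nat \<times> nat => 'a) set" where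
  "box Y lev = (\<Pi>\<^sub>E y\<in>Y. J (lev y))"

definition avg :: "(nat \<times> nat => 'a) set => ((nat \<times> nat => 'a) => complex) => complex" where
  "avg V f = (\<Sum>w\<in>V. f w) / of_nat (card V)"

lemma finite_box: "finite Y ==> finite (box Y lev)"
  unfolding box_def by (intro finite_PiE) (auto simp: finite_J)

lemma card_box: "finite Y ==> card (box Y lev) = (\<Prod>y\<in>Y. card (J (lev y)))"
  unfolding box_def by (rule card_PiE)

lemma card_box_pos: "finite Y ==> card (box Y lev) > 0"
proof -
  assume f: "finite Y"
  have "J k \<noteq> {}" for k using J_zero[of k] by blast
  then show ?thesis unfolding card_box[OF f] using finite_J by (intro prod_pos) (auto simp: card_gt_0_iff)
qed

lemma boxD: "w \<in> box Y lev ==> y \<in> Y ==> w y \<in> J (lev y)"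
  by (auto simp: box_def)

lemma box_carrier: "w \<in> box Y lev ==> y \<in> Y ==> w y \<in> carrier R"
  using boxD J_carrier by blast

lemma box_cong: "(!!y. y \<in> Y ==> lev y = lev' y) ==> box Y lev = box Y lev'"
  unfolding box_def by (rule PiE_cong) simp

text \<open>Uniform distribution survives pivoting: once the coordinates outside \<open>Y2\<close>
  are fixed, the correction \<open>t\<close> is fixed too, and translation by it permutes the box
  over \<open>Y2\<close>. The event \<open>Q\<close> is decided by the fixed coordinates.\<close>

lemma pivot_sum:
  assumes Y: "finite Y" "Y2 \<subseteq> Y"
    and Qdep: "!!w w'. w \<in> box Y lev ==> w' \<in> box Y lev ==> (!!y. y \<in> Y - Y2 ==> w y = w' y) ==> Q w ==> Q w'"
    and tdep: "!!w w' y. w \<in> box Y lev ==> w' \<in> box Y lev ==> (!!y. y \<in> Y - Y2 ==> w y = w' y) ==> y \<in> Y2 ==> t w y = t w' y"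
    and tJ: "!!w y. w \<in> box Y lev ==> Q w ==> y \<in> Y2 ==> t w y \<in> J (lev y)"
    and f: "!!w. w \<in> box Y lev ==> Q w ==> f w = c * f2 (\<lambda>y\<in>Y2. w y \<oplus> t w y)"
  shows "(\<Sum>w\<in>{w \<in> box Y lev. Q w}. f w) = c * of_nat (card {w \<in> box Y lev. Q w}) * avg (box Y2 lev) f2"
proof -
  let ?V = "{w \<in> box Y lev. Q w}"
  let ?W = "(\<lambda>w. restrict w (Y - Y2)) ` ?V"
  let ?P = "\<lambda>w. (restrict w (Y - Y2), \<lambda>y\<in>Y2. w y \<oplus> t w y)"
  have fin2: "finite Y2" using Y finite_subset by blast
  have bij: "bij_betw ?P ?V (?W \<times> box Y2 lev)"
  proof (rule bij_betwI')
    fix w w' assume w: "w \<in> ?V" "w' \<in> ?V"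
    show "?P w = ?P w' \<longleftrightarrow> w = w'"
    proof
      assume eq: "?P w = ?P w'"
      have off: "w y = w' y" if y: "y \<in> Y - Y2" for y
      proof -
        have "restrict w (Y - Y2) y = restrict w' (Y - Y2) y" using eq by simp
        then show ?thesis using y by simp
      qed
      have wb: "w \<in> box Y lev" "w' \<in> box Y lev" using w by auto
      show "w = w'"
      proof (rule PiE_ext[of _ Y "\<lambda>y. J (lev y)"])
        show "w \<in> (\<Pi>\<^sub>E y\<in>Y. J (lev y))" "w' \<in> (\<Pi>\<^sub>E y\<in>Y. J (lev y))" using wb by (auto simp: box_def)
        fix y assume y: "y \<in> Y"
        show "w y = w' y"
        proof (cases "y \<in> Y2")
          case True
          have "(\<lambda>y\<in>Y2. w y \<oplus> t w y) y = (\<lambda>y\<in>Y2. w' y \<oplus> t w' y) y" using eq by simp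
          then have e: "w y \<oplus> t w y = w' y \<oplus> t w' y" using True by simp
          have "t w y = t w' y" by (rule tdep[OF wb off True])
          moreover have "t w' y \<in> carrier R" using tJ[of w' y] w True J_carrier by blast
          ultimately show ?thesis using e box_carrier[OF wb(1) y] box_carrier[OF wb(2) y] by simp
        qed (use off y in blast)
      qed
    qed simp
  next
    fix w assume w: "w \<in> ?V"
    then have wb: "w \<in> box Y lev" "Q w" by auto
    have "(\<lambda>y\<in>Y2. w y \<oplus> t w y) \<in> box Y2 lev"
      unfolding box_def using boxD[OF wb(1)] tJ[OF wb] Y(2) by (auto intro!: J_add)
    then show "?P w \<in> ?W \<times> box Y2 lev" using w by blast
  next
    fix ad assume "ad \<in> ?W \<times> box Y2 lev"
    then obtain w0 d where w0: "w0 \<in> box Y lev" "Q w0" and d: "d \<in> box Y2 lev" and ad: "ad = (restrict w0 (Y - Y2), d)"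
      by blast
    \<comment> \<open>The preimage of a prescribed pair: undo the translation on \<open>Y2\<close>,
      keep \<open>w0\<close> elsewhere.\<close>
    define w where "w = (\<lambda>y\<in>Y. if y \<in> Y2 then d y \<ominus> t w0 y else w0 y)"
    have wb: "w \<in> box Y lev"
      unfolding box_def w_def using boxD[OF w0(1)] boxD[OF d] tJ[OF w0] by (auto intro!: J_minus)
    have off: "w0 y = w y" if "y \<in> Y - Y2" for y using that by (simp add: w_def)
    have Qw: "Q w" by (rule Qdep[OF w0(1) wb off w0(2)])
    have tw: "t w0 y = t w y" if "y \<in> Y2" for y by (rule tdep[OF w0(1) wb off that])
    have "(\<lambda>y\<in>Y2. w y \<oplus> t w y) = d"
    proof (rule extensionalityI[of _ Y2])
      show "d \<in> extensional Y2" using d by (auto simp: box_def PiE_def)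
      fix y assume y: "y \<in> Y2"
      have c: "t w0 y \<in> carrier R" "d y \<in> carrier R" using tJ[OF w0 y] J_carrier box_carrier[OF d y] by auto
      have "w y \<oplus> t w y = (d y \<ominus> t w0 y) \<oplus> t w0 y" using y Y(2) tw[OF y] by (auto simp: w_def)
      also have "\<dots> = d y" using c by (simp add: a_minus_def a_assoc l_neg)
      finally show "(\<lambda>y\<in>Y2. w y \<oplus> t w y) y = d y" using y by simp
    qed simp
    moreover have "restrict w (Y - Y2) = restrict w0 (Y - Y2)" using off by (auto simp: restrict_def)
    ultimately show "\<exists>w\<in>?V. ad = ?P w" using wb Qw ad by (intro bexI[of _ w]) auto
  qed
  have finV: "finite ?V" using finite_box[OF Y(1)] by simp
  have "(\<Sum>w\<in>?V. f w) = (\<Sum>w\<in>?V. (\<lambda>ad. c * f2 (snd ad)) (?P w))" using f by (intro sum.cong) auto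
  also have "\<dots> = (\<Sum>ad\<in>?W \<times> box Y2 lev. c * f2 (snd ad))" by (rule sum.reindex_bij_betw[OF bij])
  also have "\<dots> = (\<Sum>a\<in>?W. \<Sum>d\<in>box Y2 lev. c * f2 d)" unfolding sum.cartesian_product by (intro sum.cong) auto
  also have "\<dots> = of_nat (card ?W) * (c * (\<Sum>d\<in>box Y2 lev. f2 d))" by (simp add: sum_distrib_left)
  finally have 1: "(\<Sum>w\<in>?V. f w) = of_nat (card ?W) * (c * (\<Sum>d\<in>box Y2 lev. f2 d))" .
  have "card ?V = card ?W * card (box Y2 lev)"
    using bij_betw_same_card[OF bij] by (simp add: card_cartesian_product)
  then show ?thesis using card_box_pos[OF fin2, of lev] by (simp add: 1 avg_def)
qed

lemma card_box_lower:
  assumes Y: "finite Y" "L \<subseteq> Y" and lev: "!!y. y \<in> L ==> lev y = k" and k: "k < N"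
  shows "card (box Y lev) = q ^ card L * card (box Y (\<lambda>y. if y \<in> L then Suc k else lev y))"
proof -
  have "(\<Prod>y\<in>Y. card (J (lev y))) = (\<Prod>y\<in>Y. (if y \<in> L then q else 1) * card (J (if y \<in> L then Suc k else lev y)))"
  proof (rule prod.cong[OF refl])
    fix y assume "y \<in> Y"
    have "card (J k) = q * card (J (Suc k))" using card_J_Suc[OF k finite_J] by simp
    then show "card (J (lev y)) = (if y \<in> L then q else 1) * card (J (if y \<in> L then Suc k else lev y))"
      using lev by simp
  qed
  also have "\<dots> = (\<Prod>y\<in>Y. if y \<in> L then q else 1) * (\<Prod>y\<in>Y. card (J (if y \<in> L then Suc k else lev y)))"
    by (rule prod.distrib)
  also have "(\<Prod>y\<in>Y. if y \<in> L then q else 1) = q ^ card L"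
    using Y by (simp add: prod.If_cases Int_absorb1)
  finally show ?thesis by (simp add: card_box[OF Y(1)])
qed

text \<open>The entries in \<open>L\<close> all gain one more power of \<open>\<pi>\<close> with
  probability \<open>(1 / q) ^ card L\<close>. Otherwise one of them, \<open>e\<close>, has
  valuation exactly \<open>k\<close> and serves as a pivot, leaving \<open>c\<close> times a
  function of the translated entries in \<open>Y2 e\<close>, whose average \<open>h\<close> is the
  same for all \<open>e\<close>.\<close>

lemma elimination:
  assumes Y: "finite Y" "L \<subseteq> Y" and lev: "!!y. y \<in> L ==> lev y = k" and k: "k < N"
    and Y2: "!!e. e \<in> L ==> Y2 e \<subseteq> Y - L"
    and tdep: "!!e w w' y. e \<in> L ==> w \<in> box Y lev ==> w' \<in> box Y lev ==>
      (!!y. y \<in> Y - Y2 e ==> w y = w' y) ==> y \<in> Y2 e ==> t e w y = t e w' y"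
    and tJ: "!!e w y. e \<in> L ==> w \<in> box Y lev ==> w e \<notin> J (Suc k) ==> y \<in> Y2 e ==> t e w y \<in> J (lev y)"
    and f: "!!e w. e \<in> L ==> w \<in> box Y lev ==> w e \<notin> J (Suc k) ==> f w = c * f2 e (\<lambda>y\<in>Y2 e. w y \<oplus> t e w y)"
    and h: "!!e. e \<in> L ==> avg (box (Y2 e) lev) (f2 e) = h"
  shows "avg (box Y lev) f = (1 / of_nat q) ^ card L * avg (box Y (\<lambda>y. if y \<in> L then Suc k else lev y)) f
    + (1 - (1 / of_nat q) ^ card L) * (c * h)"
proof -
  let ?lev' = "\<lambda>y. if y \<in> L then Suc k else lev y"
  let ?V = "box Y lev" and ?V' = "box Y ?lev'"
  have V': "?V' = {w \<in> ?V. \<forall>e\<in>L. w e \<in> J (Suc k)}"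
  proof (intro equalityI subsetI)
    fix w assume w: "w \<in> ?V'"
    have "w y \<in> J (lev y)" if y: "y \<in> Y" for y
      using boxD[OF w y] lev[of y] J_Suc_sub[of k] by (auto split: if_splits)
    moreover have "w e \<in> J (Suc k)" if "e \<in> L" for e using boxD[OF w, of e] that Y(2) by auto
    ultimately show "w \<in> {w \<in> ?V. \<forall>e\<in>L. w e \<in> J (Suc k)}" using w by (auto simp: box_def PiE_def)
  next
    fix w assume "w \<in> {w \<in> ?V. \<forall>e\<in>L. w e \<in> J (Suc k)}"
    then show "w \<in> ?V'" by (auto simp: box_def PiE_def Pi_def)
  qed
  \<comment> \<open>A fixed choice of the pivot splits the remaining cases into disjoint events. It
    looks only at entries in \<open>L\<close>, which lie outside every \<open>Y2 e\<close>.\<close>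
  define ch where "ch w = (SOME e. e \<in> L \<and> w e \<notin> J (Suc k))" for w
  define Q where "Q e w \<longleftrightarrow> (\<exists>e\<in>L. w e \<notin> J (Suc k)) \<and> ch w = e" for e w
  have chL: "ch w \<in> L \<and> w (ch w) \<notin> J (Suc k)" if "\<exists>e\<in>L. w e \<notin> J (Suc k)" for w
    unfolding ch_def using someI_ex[of "\<lambda>e. e \<in> L \<and> w e \<notin> J (Suc k)"] that by blast
  have part: "?V - ?V' = (\<Union>e\<in>L. {w \<in> ?V. Q e w})" unfolding V' using chL by (auto simp: Q_def)
  have finL: "finite L" using Y finite_subset by blast
  have finV: "finite ?V" by (rule finite_box[OF Y(1)])
  have disj: "{w \<in> ?V. Q e w} \<inter> {w \<in> ?V. Q e' w} = {}" if "e \<noteq> e'" for e e' using that by (auto simp: Q_def)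
  have s: "(\<Sum>w\<in>{w \<in> ?V. Q e w}. f w) = c * of_nat (card {w \<in> ?V. Q e w}) * h" if e: "e \<in> L" for e
  proof -
    have QL: "w e \<notin> J (Suc k)" if "Q e w" for w using that chL[of w] by (auto simp: Q_def)
    have "(\<Sum>w\<in>{w \<in> ?V. Q e w}. f w) = c * of_nat (card {w \<in> ?V. Q e w}) * avg (box (Y2 e) lev) (f2 e)"
    proof (rule pivot_sum[where t = "t e", OF Y(1)])
      show "Y2 e \<subseteq> Y" using Y2[OF e] by blast
      fix w w' assume w: "w \<in> ?V" "w' \<in> ?V" and eq: "!!y. y \<in> Y - Y2 e ==> w y = w' y" and Qw: "Q e w"
      have eqL: "w y = w' y" if "y \<in> L" for y using eq[of y] that Y2[OF e] Y(2) by blast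
      have "(\<lambda>e. e \<in> L \<and> w e \<notin> J (Suc k)) = (\<lambda>e. e \<in> L \<and> w' e \<notin> J (Suc k))" using eqL by (intro ext) auto
      then have "ch w = ch w'" by (simp add: ch_def)
      then show "Q e w'" using Qw eqL by (auto simp: Q_def)
    next
      show "t e w y = t e w' y" if "w \<in> ?V" "w' \<in> ?V" "!!y. y \<in> Y - Y2 e ==> w y = w' y" "y \<in> Y2 e" for w w' y
        by (rule tdep[OF e that])
      show "t e w y \<in> J (lev y)" if "w \<in> ?V" "Q e w" "y \<in> Y2 e" for w y by (rule tJ[OF e that(1) QL[OF that(2)] that(3)])
      show "f w = c * f2 e (\<lambda>y\<in>Y2 e. w y \<oplus> t e w y)" if "w \<in> ?V" "Q e w" for w by (rule f[OF e that(1) QL[OF that(2)]])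
    qed
    then show ?thesis using h[OF e] by simp
  qed
  have "(\<Sum>w\<in>?V. f w) = (\<Sum>w\<in>?V'. f w) + (\<Sum>w\<in>?V - ?V'. f w)"
    using finV V' by (metis (no_types, lifting) add.commute mem_Collect_eq subsetI sum.subset_diff)
  also have "(\<Sum>w\<in>?V - ?V'. f w) = (\<Sum>e\<in>L. \<Sum>w\<in>{w \<in> ?V. Q e w}. f w)"
    unfolding part using finL finV disj by (intro sum.UNION_disjoint) auto
  also have "\<dots> = c * (\<Sum>e\<in>L. of_nat (card {w \<in> ?V. Q e w})) * h"
    by (simp add: s sum_distrib_left sum_distrib_right)
  also have "(\<Sum>e\<in>L. of_nat (card {w \<in> ?V. Q e w})) = (of_nat (card (?V - ?V')) :: complex)"
    unfolding part using finL finV disj by (subst card_UN_disjoint) auto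
  also have "card (?V - ?V') = card ?V - card ?V'" using finV V' by (intro card_Diff_subset) (auto intro: finite_subset)
  finally have 1: "(\<Sum>w\<in>?V. f w) = (\<Sum>w\<in>?V'. f w) + c * of_nat (card ?V - card ?V') * h" .
  have cV: "card ?V = q ^ card L * card ?V'" by (rule card_box_lower[OF Y lev k])
  have pos: "card ?V' > 0" by (rule card_box_pos[OF Y(1)])
  have q0: "(of_nat q :: complex) \<noteq> 0" using q2 by auto
  have le: "card ?V' \<le> card ?V" unfolding cV using q2 by simp
  have cV': "(of_nat (card ?V) :: complex) = of_nat q ^ card L * of_nat (card ?V')" unfolding cV by simp
  have p0: "(of_nat (card ?V') :: complex) \<noteq> 0" using pos by simp
  show ?thesis
    unfolding avg_def 1 of_nat_diff[OF le] cV' using q0 p0 by (simp add: field_simps power_one_over)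
qed

end

section \<open>Powers of kernel sizes and pivots of the matrices \<open>form T n w\<close>\<close>

context chain_ring
begin

text \<open>The quantity averaged throughout; \<open>\<tau>\<close> will be
  \<open>1 + s / 2\<close>.\<close>

definition wt :: "complex => lattice_type => nat => nat set => (nat \<times> nat => 'a) => complex" where
  "wt \<tau> T n S w = of_nat (card (Rad S (form T n w))) powr \<tau>"

abbreviation "Qt \<tau> \<equiv> (of_nat q :: complex) powr \<tau>"
abbreviation "Xq \<equiv> (1 / of_nat q :: complex)"

lemma powr_scale: "(of_nat (q ^ m * r) :: complex) powr \<tau> = Qt \<tau> ^ m * of_nat r powr \<tau>"
proof (induction m)
  case (Suc m)
  have "(of_nat (q ^ Suc m * r) :: complex) = of_nat q * of_nat (q ^ m * r)" by simp
  then have "(of_nat (q ^ Suc m * r) :: complex) powr \<tau> = Qt \<tau> * of_nat (q ^ m * r) powr \<tau>"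
    using powr_times_real[of "of_nat q" "of_nat (q ^ m * r)" \<tau>] by (simp add: mult.assoc)
  then show ?case using Suc by simp
qed simp

lemma avg_const:
  assumes "finite V" "V \<noteq> {}" "!!w. w \<in> V ==> f w = c"
  shows "avg V f = c"
  using assms by (simp add: avg_def)

lemma form_alternating:
  assumes "!!l m. l \<in> S ==> m \<in> S ==> l < m ==> upper_form T n w l m \<in> carrier R"
  shows "alternating S (form T n w)"
  unfolding alternating_def
proof (intro conjI ballI)
  fix l m assume lm: "l \<in> S" "m \<in> S"
  consider "l < m" | "m < l" | "l = m" by linarith
  then show "form T n w l m \<in> carrier R" "form T n w l m = \<ominus> form T n w m l"
    using assms[of l m] assms[of m l] lm by (cases; simp add: form_def)+
qed (simp add: form_def)

lemma form_J:
  assumes "l < m ==> upper_form T n w l m \<in> J e" "m < l ==> upper_form T n w m l \<in> J e"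
  shows "form T n w l m \<in> J e"
  using assms J_neg by (auto simp: form_def)

definition uu :: "nat => 'a => 'a" where "uu k x = (SOME u. u \<in> Units R \<and> x = \<pi> [^] k \<otimes> u)"

lemma uu: "x \<in> J k ==> x \<notin> J (Suc k) ==> uu k x \<in> Units R \<and> x = \<pi> [^] k \<otimes> uu k x"
proof -
  assume "x \<in> J k" "x \<notin> J (Suc k)"
  then have "\<exists>u. u \<in> Units R \<and> x = \<pi> [^] k \<otimes> u" by (meson J_exact)
  from someI_ex[OF this] show ?thesis by (simp add: uu_def)
qed

text \<open>The correction that the Schur complement adds to an entry, as a function of the matrix
  and the pivot position; it plays the role of the translation in \<open>pivot_sum\<close>.\<close>

definition corr :: "nat => (nat => nat => 'a) => nat => nat => nat => nat => 'a" where
  "corr k B a b l m = inv (uu k (B a b)) \<otimes> (dv k (B l a) \<otimes> B b m \<ominus> dv k (B l b) \<otimes> B a m)"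

text \<open>Pivoting respects levels: higher divisibility of an entry survives if it is shared by
  the row of \<open>l\<close> or by the column of \<open>m\<close> at the pivot indices.\<close>

lemma corr_J:
  assumes u: "uu k (B a b) \<in> Units R"
    and JJ: "B l a \<in> J k" "B l b \<in> J k" "B b m \<in> J k" "B a m \<in> J k"
    and e: "B l a \<in> J e \<and> B l b \<in> J e \<or> B b m \<in> J e \<and> B a m \<in> J e"
  shows "corr k B a b l m \<in> J e"
proof -
  have "dv k (B l a) \<otimes> B b m \<ominus> dv k (B l b) \<otimes> B a m \<in> J e"
    using dv_mult_J[OF JJ(1,3), of e] dv_mult_J[OF JJ(2,4), of e] e by (intro J_minus) blast+
  then show ?thesis unfolding corr_def using u by (intro J_mult') auto
qed

lemma corr_cong:
  assumes "B a b = B' a b" "B l a = B' l a" "B b m = B' b m" "B l b = B' l b" "B a m = B' a m"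
  shows "corr k B a b l m = corr k B' a b l m"
  using assms by (simp add: corr_def)

lemma red_corr: "red B a b k (uu k (B a b)) l m = B l m \<oplus> corr k B a b l m"
  if "finite S" "alternating S B" "!!l m. l \<in> S ==> m \<in> S ==> B l m \<in> J k" "a \<in> S" "b \<in> S" "a \<noteq> b"
    "B a b \<notin> J (Suc k)" "k \<le> N" for S B
proof -
  have u: "uu k (B a b) \<in> Units R" "B a b = \<pi> [^] k \<otimes> uu k (B a b)" using uu that by blast+
  show ?thesis using red_def[OF that(1,2) _ that(4-6) u that(8)] that(3) by (simp add: corr_def)
qed

lemma pivot:
  assumes S: "finite S" and alt: "alternating S B" and BJ: "!!l m. l \<in> S ==> m \<in> S ==> B l m \<in> J k"
    and ab: "a \<in> S" "b \<in> S" "a \<noteq> b" "B a b \<notin> J (Suc k)" and k: "k \<le> N"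
  shows "card (Rad S B) = q ^ (2 * k) * card (Rad (S - {a, b}) (\<lambda>l m. B l m \<oplus> corr k B a b l m))"
    "alternating (S - {a, b}) (\<lambda>l m. B l m \<oplus> corr k B a b l m)"
proof -
  have u: "uu k (B a b) \<in> Units R" "B a b = \<pi> [^] k \<otimes> uu k (B a b)" using uu BJ ab by blast+
  have e: "red B a b k (uu k (B a b)) = (\<lambda>l m. B l m \<oplus> corr k B a b l m)"
    using red_corr[OF S alt BJ ab k] by (intro ext)
  show "card (Rad S B) = q ^ (2 * k) * card (Rad (S - {a, b}) (\<lambda>l m. B l m \<oplus> corr k B a b l m))"
    using card_Rad_pivot[OF S alt BJ ab(1-3) u k] unfolding e .
  show "alternating (S - {a, b}) (\<lambda>l m. B l m \<oplus> corr k B a b l m)"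
    using red_alternating[OF S alt BJ ab(1-3) u k] unfolding e alternating_def by blast
qed

lemma Rad_form_eq:
  assumes alt: "alternating S C" and up: "!!l m. l \<in> S ==> m \<in> S ==> l < m ==> C l m = upper_form T n w l m"
  shows "Rad S C = Rad S (form T n w)"
proof (rule Rad_cong)
  fix l m assume lm: "l \<in> S" "m \<in> S"
  have a: "C l m \<in> carrier R" "C l m = \<ominus> C m l" "C l l = \<zero>" using alt lm unfolding alternating_def by blast+
  consider "l < m" | "m < l" | "l = m" by linarith
  then show eq: "C l m = form T n w l m"
  proof cases
    case 1 then show ?thesis using up[OF lm] by (simp add: form_def)
  next
    case 2 then show ?thesis using up[OF lm(2,1)] a(2) by (simp add: form_def)
  next
    case 3 then show ?thesis using a(3) by (simp add: form_def)
  qed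
  show "form T n w l m \<in> carrier R" using a(1) eq by simp
qed

text \<open>\<open>w'\<close> holds the coordinates of the Schur complement. That the complement is
  again a matrix of type \<open>T\<close>, as \<open>up\<close> demands, is the point to be checked
  for each type.\<close>

lemma wt_pivot:
  assumes "finite S" "alternating S (form T n w)" "!!l m. l \<in> S ==> m \<in> S ==> form T n w l m \<in> J k"
    "a \<in> S" "b \<in> S" "a \<noteq> b" "form T n w a b \<notin> J (Suc k)" "k \<le> N"
    and up: "!!l m. l \<in> S - {a, b} ==> m \<in> S - {a, b} ==> l < m ==>
      form T n w l m \<oplus> corr k (form T n w) a b l m = upper_form T n w' l m"
  shows "wt \<tau> T n S w = Qt \<tau> ^ (2 * k) * wt \<tau> T n (S - {a, b}) w'"
proof -
  note p = pivot[OF assms(1-8)]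
  have "card (Rad S (form T n w)) = q ^ (2 * k) * card (Rad (S - {a, b}) (form T n w'))"
    using p(1) Rad_form_eq[OF p(2) up] by simp
  then show ?thesis unfolding wt_def by (simp only: powr_scale)
qed

lemma wt_zero:
  assumes S: "finite S" and z: "!!l m. l \<in> S ==> m \<in> S ==> form T n w l m = \<zero>"
  shows "wt \<tau> T n S w = Qt \<tau> ^ (N * card S)"
proof -
  have "Rad S (form T n w) = Rad S (\<lambda>_ _. \<zero>)" by (rule Rad_cong) (auto simp: z)
  also have "\<dots> = S \<rightarrow>\<^sub>E carrier R"
  proof -
    have "(\<Oplus>i\<in>S. x i \<otimes> \<zero>) = \<zero>" if "x \<in> S \<rightarrow>\<^sub>E carrier R" for x
      using PiE_mem[OF that] by (intro add.finprod_one_eqI) auto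
    then show ?thesis by (auto simp: Rad_def)
  qed
  finally have "card (Rad S (form T n w)) = q ^ (N * card S) * 1"
    using S by (simp add: card_PiE card_R power_mult)
  then show ?thesis unfolding wt_def using powr_scale[of "N * card S" 1] by simp
qed

subsection \<open>Alternating matrices\<close>

definition YF :: "nat set => (nat \<times> nat) set" where
  "YF S = {(a, b). a \<in> S \<and> b \<in> S \<and> a < b}"

text \<open>Level of an entry when the indices in \<open>A\<close> are known to give one more power
  of \<open>\<pi>\<close> in their rows and columns.\<close>

definition touch :: "nat => nat set => nat \<times> nat => nat" where
  "touch k A y = (if fst y \<in> A \<or> snd y \<in> A then Suc k else k)"

text \<open>\<open>A\<close> holds the indices already processed at level \<open>k\<close>,
  \<open>F\<close> the fresh ones.\<close>

definition EF :: "complex => nat => nat => nat => nat set => nat set => complex" where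
  "EF \<tau> d n k A F = avg (box (YF (A \<union> F)) (touch k A)) (wt \<tau> (FType d) n (A \<union> F))"

lemma finite_YF: "finite S ==> finite (YF S)"
  by (rule finite_subset[of _ "S \<times> S"]) (auto simp: YF_def)

lemma form_F_J:
  assumes w: "w \<in> box (YF S) (touch k A)" and lm: "l \<in> S" "m \<in> S"
  shows "form (FType d) n w l m \<in> J k" "l \<in> A \<or> m \<in> A ==> form (FType d) n w l m \<in> J (Suc k)"
proof -
  have "w (l, m) \<in> J (touch k A (l, m))" if "l < m" using boxD[OF w, of "(l, m)"] lm that by (simp add: YF_def)
  moreover have "w (m, l) \<in> J (touch k A (m, l))" if "m < l" using boxD[OF w, of "(m, l)"] lm that by (simp add: YF_def)
  ultimately show "form (FType d) n w l m \<in> J k" "l \<in> A \<or> m \<in> A ==> form (FType d) n w l m \<in> J (Suc k)"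
    using J_Suc_sub[of k] by (auto intro!: form_J simp: touch_def split: if_splits)
qed

lemma form_F_alt: "w \<in> box (YF S) lev ==> alternating S (form (FType d) n w)"
  by (rule form_alternating) (auto simp: YF_def dest: box_carrier)

text \<open>Row \<open>i\<close> meets the other fresh indices in \<open>card F - 1\<close> entries.
  Either all of them gain a power and \<open>i\<close> moves to \<open>A\<close>, or a pivot at
  \<open>(i, j)\<close> removes both indices and contributes \<open>q ^ (2 * k)\<close> to the
  kernel.\<close>

lemma EF_rec:
  assumes fin: "finite A" "finite F" and disj: "A \<inter> F = {}" and i: "i \<in> F" and k: "k < N"
    and h: "!!j. j \<in> F ==> j \<noteq> i ==> EF \<tau> d n k A (F - {i, j}) = h"
  shows "EF \<tau> d n k A F = Xq ^ (card F - 1) * EF \<tau> d n k (insert i A) (F - {i})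
    + (1 - Xq ^ (card F - 1)) * (Qt \<tau> ^ (2 * k) * h)"
proof -
  let ?S = "A \<union> F" and ?T = "FType d"
  define L where "L = {y \<in> YF ?S. fst y = i \<and> snd y \<in> F \<or> snd y = i \<and> fst y \<in> F}"
  have finS: "finite ?S" using fin by simp
  have cL: "card L = card F - 1"
  proof -
    have "L = (\<lambda>j. (min i j, max i j)) ` (F - {i})"
    proof (intro equalityI subsetI)
      fix y assume "y \<in> L"
      then obtain a b where y: "y = (a, b)" "a < b" "a = i \<and> b \<in> F \<or> b = i \<and> a \<in> F" by (cases y) (auto simp: L_def YF_def)
      then show "y \<in> (\<lambda>j. (min i j, max i j)) ` (F - {i})" by (auto simp: image_iff intro: bexI[of _ a] bexI[of _ b])
    next
      fix y assume "y \<in> (\<lambda>j. (min i j, max i j)) ` (F - {i})"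
      then obtain j where j: "j \<in> F" "j \<noteq> i" "y = (min i j, max i j)" by blast
      then show "y \<in> L" using i by (cases "i < j") (auto simp: L_def YF_def)
    qed
    moreover have "inj_on (\<lambda>j. (min i j, max i j)) (F - {i})" by (auto simp: inj_on_def min_def max_def split: if_splits)
    ultimately show ?thesis using i by (simp add: card_image)
  qed
  define t where "t e w y = corr k (form ?T n w) (fst e) (snd e) (fst y) (snd y)" for e y :: "nat \<times> nat" and w
  have Ld: "fst e \<in> F" "snd e \<in> F" "fst e < snd e" "fst e = i \<or> snd e = i" if "e \<in> L" for e
    using that i by (auto simp: L_def YF_def)
  have eJ: "form ?T n w (fst e) (snd e) = w e" if "e \<in> L" for e w using Ld[OF that] by (simp add: form_def)
  have "avg (box (YF ?S) (touch k A)) (wt \<tau> ?T n ?S) =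
    Xq ^ card L * avg (box (YF ?S) (\<lambda>y. if y \<in> L then Suc k else touch k A y)) (wt \<tau> ?T n ?S)
    + (1 - Xq ^ card L) * (Qt \<tau> ^ (2 * k) * h)"
  proof (rule elimination[where ?Y2.0 = "\<lambda>e. YF (?S - {fst e, snd e})" and ?f2.0 = "\<lambda>e. wt \<tau> ?T n (?S - {fst e, snd e})" and t = t])
    show "finite (YF ?S)" by (rule finite_YF[OF finS])
    show "L \<subseteq> YF ?S" by (auto simp: L_def)
    show "k < N" by (rule k)
    show "touch k A y = k" if "y \<in> L" for y using Ld[OF that] disj by (auto simp: touch_def)
    show "YF (?S - {fst e, snd e}) \<subseteq> YF ?S - L" if "e \<in> L" for e using Ld[OF that] by (auto simp: YF_def L_def)
    show "t e w y = t e w' y" if e: "e \<in> L" and eq: "!!y. y \<in> YF ?S - YF (?S - {fst e, snd e}) ==> w y = w' y"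
      and y: "y \<in> YF (?S - {fst e, snd e})" for e w w' y
    proof -
      have "form ?T n w l m = form ?T n w' l m" if "l \<in> ?S" "m \<in> ?S" "l \<in> {fst e, snd e} \<or> m \<in> {fst e, snd e}" for l m
        using eq[of "(l, m)"] eq[of "(m, l)"] that by (auto simp: form_def YF_def)
      then show ?thesis unfolding t_def using Ld[OF e] y by (intro corr_cong) (auto simp: YF_def)
    qed
    show "t e w y \<in> J (touch k A y)" if e: "e \<in> L" and w: "w \<in> box (YF ?S) (touch k A)" and we: "w e \<notin> J (Suc k)"
      and y: "y \<in> YF (?S - {fst e, snd e})" for e w y
    proof -
      have S: "fst e \<in> ?S" "snd e \<in> ?S" "fst y \<in> ?S" "snd y \<in> ?S" using Ld[OF e] y by (auto simp: YF_def)
      have "uu k (form ?T n w (fst e) (snd e)) \<in> Units R"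
        using uu[of "w e" k] form_F_J(1)[OF w S(1,2), of d n] we unfolding eJ[OF e] by blast
      then show ?thesis unfolding t_def
      proof (rule corr_J)
        show "form ?T n w (fst y) (fst e) \<in> J (touch k A y) \<and> form ?T n w (fst y) (snd e) \<in> J (touch k A y) \<or>
          form ?T n w (snd e) (snd y) \<in> J (touch k A y) \<and> form ?T n w (fst e) (snd y) \<in> J (touch k A y)"
          using form_F_J[OF w] S by (auto simp: touch_def)
      qed (use form_F_J(1)[OF w] S in auto)
    qed
    show "wt \<tau> ?T n ?S w = Qt \<tau> ^ (2 * k) * wt \<tau> ?T n (?S - {fst e, snd e}) (\<lambda>y\<in>YF (?S - {fst e, snd e}). w y \<oplus> t e w y)"
      if e: "e \<in> L" and w: "w \<in> box (YF ?S) (touch k A)" and we: "w e \<notin> J (Suc k)" for e w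
    proof (rule wt_pivot[OF finS form_F_alt[OF w]])
      show "form ?T n w (fst e) (snd e) \<notin> J (Suc k)" using we by (simp add: eJ[OF e])
      show "form ?T n w l m \<oplus> corr k (form ?T n w) (fst e) (snd e) l m = upper_form ?T n (\<lambda>y\<in>YF (?S - {fst e, snd e}). w y \<oplus> t e w y) l m"
        if "l \<in> ?S - {fst e, snd e}" "m \<in> ?S - {fst e, snd e}" "l < m" for l m
        using that by (simp add: YF_def t_def form_def[of ?T n w l m])
    qed (use Ld[OF e] k form_F_J(1)[OF w] in auto)
    show "avg (box (YF (?S - {fst e, snd e})) (touch k A)) (wt \<tau> ?T n (?S - {fst e, snd e})) = h" if e: "e \<in> L" for e
    proof -
      obtain j where j: "j \<in> F" "j \<noteq> i" "{fst e, snd e} = {i, j}"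
      proof (cases "fst e = i")
        case True
        then show ?thesis using Ld[OF e] by (intro that[of "snd e"]) auto
      next
        case False
        then show ?thesis using Ld[OF e] by (intro that[of "fst e"]) auto
      qed
      have "?S - {fst e, snd e} = A \<union> (F - {i, j})" unfolding j(3) using disj i j by auto
      then show ?thesis using h[OF j(1,2)] by (simp add: EF_def)
    qed
  qed
  moreover have "box (YF ?S) (\<lambda>y. if y \<in> L then Suc k else touch k A y) = box (YF ?S) (touch k (insert i A))"
    by (rule box_cong) (use i in \<open>auto simp: L_def YF_def touch_def\<close>)
  moreover have "?S = insert i A \<union> (F - {i})" using i by auto
  ultimately show ?thesis unfolding EF_def cL by simp
qed

text \<open>With no fresh index left every entry has level \<open>k + 1\<close>, and all indices
  become fresh again.\<close>

lemma EF_shift: "EF \<tau> d n k A {} = EF \<tau> d n (Suc k) {} A"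
proof -
  have "box (YF A) (touch k A) = box (YF A) (touch (Suc k) {})"
    by (rule box_cong) (auto simp: YF_def touch_def)
  then show ?thesis by (simp add: EF_def)
qed

lemma EF_end: "finite S ==> EF \<tau> d n N {} S = Qt \<tau> ^ (N * card S)"
proof -
  assume S: "finite S"
  have ne: "box (YF S) (touch N {}) \<noteq> {}" using card_box_pos[OF finite_YF[OF S], of "touch N {}"] by force
  show ?thesis unfolding EF_def
  proof (rule avg_const)
    fix w assume "w \<in> box (YF ({} \<union> S)) (touch N {})"
    then have w: "w \<in> box (YF S) (touch N {})" by simp
    have "form (FType d) n w l m = \<zero>" if "l \<in> S" "m \<in> S" for l m
      using form_F_J(1)[OF w that, of d n] by (simp add: J_N)
    then show "wt \<tau> (FType d) n ({} \<union> S) w = Qt \<tau> ^ (N * card S)" using wt_zero[OF S] by simp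
  qed (use ne finite_box[OF finite_YF[OF S]] in auto)
qed

end

context cring
begin

text \<open>Two successive pivots combined. \<open>K\<close> is the power of \<open>\<pi>\<close>,
  while \<open>v\<close> and \<open>v1\<close> are inverses of the units of the two pivots; the last
  assumption says that, after multiplication by \<open>K\<close>, the second unit is
  \<open>u - v c a\<close>, up to sign the determinant of the symmetric 2 by 2 block divided by
  \<open>u\<close>. The right side is invariant under exchanging \<open>l\<close> and
  \<open>m\<close>.\<close>

lemma schur_symmetric:
  assumes c: "K \<in> carrier R" "v \<in> carrier R" "v1 \<in> carrier R" "u \<in> carrier R" "a \<in> carrier R" "c \<in> carrier R"
      "xl \<in> carrier R" "yl \<in> carrier R" "xm \<in> carrier R" "ym \<in> carrier R"
    and vu: "v \<otimes> u = \<one>" and K: "K \<otimes> v1 \<otimes> (u \<ominus> v \<otimes> (c \<otimes> a)) = K"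
  shows "v \<otimes> (yl \<otimes> (K \<otimes> xm)) \<oplus> v1 \<otimes> ((xl \<ominus> v \<otimes> (yl \<otimes> a)) \<otimes> (K \<otimes> (ym \<ominus> v \<otimes> (c \<otimes> xm))))
    = (K \<otimes> v1) \<otimes> (yl \<otimes> xm \<oplus> xl \<otimes> ym \<ominus> v \<otimes> (c \<otimes> (xl \<otimes> xm)) \<ominus> v \<otimes> (a \<otimes> (yl \<otimes> ym)))"
proof -
  define E where "E = K \<otimes> v1"
  \<comment> \<open>The cross term, which occurs with opposite signs in the two pivots and
    cancels.\<close>
  define W where "W = (v \<otimes> (c \<otimes> a)) \<otimes> (v \<otimes> (yl \<otimes> xm))"
  have Ec: "E \<in> carrier R" "W \<in> carrier R" using c by (auto simp: E_def W_def)
  have 1: "v \<otimes> (yl \<otimes> (K \<otimes> xm)) = E \<otimes> (yl \<otimes> xm) \<ominus> E \<otimes> W"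
  proof -
    have "v \<otimes> (yl \<otimes> (K \<otimes> xm)) = K \<otimes> (v \<otimes> (yl \<otimes> xm))" using c by (simp add: m_ac)
    also have "\<dots> = (E \<otimes> (u \<ominus> v \<otimes> (c \<otimes> a))) \<otimes> (v \<otimes> (yl \<otimes> xm))" using K by (simp add: E_def)
    also have "\<dots> = E \<otimes> ((v \<otimes> u) \<otimes> (yl \<otimes> xm)) \<ominus> E \<otimes> W"
    proof -
      have "(E \<otimes> (u \<ominus> v \<otimes> (c \<otimes> a))) \<otimes> (v \<otimes> (yl \<otimes> xm)) = E \<otimes> ((u \<ominus> v \<otimes> (c \<otimes> a)) \<otimes> (v \<otimes> (yl \<otimes> xm)))"
        using c Ec by (simp add: m_assoc)
      also have "(u \<ominus> v \<otimes> (c \<otimes> a)) \<otimes> (v \<otimes> (yl \<otimes> xm)) = u \<otimes> (v \<otimes> (yl \<otimes> xm)) \<ominus> W"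
        using c by (simp add: W_def a_minus_def l_distr l_minus)
      also have "u \<otimes> (v \<otimes> (yl \<otimes> xm)) = (v \<otimes> u) \<otimes> (yl \<otimes> xm)" using c by (simp add: m_ac)
      finally show ?thesis using c Ec by (simp add: a_minus_def r_distr r_minus)
    qed
    finally show ?thesis using c by (simp add: vu)
  qed
  have 2: "v1 \<otimes> ((xl \<ominus> v \<otimes> (yl \<otimes> a)) \<otimes> (K \<otimes> (ym \<ominus> v \<otimes> (c \<otimes> xm))))
    = E \<otimes> (xl \<otimes> ym) \<ominus> E \<otimes> (v \<otimes> (c \<otimes> (xl \<otimes> xm))) \<ominus> E \<otimes> (v \<otimes> (a \<otimes> (yl \<otimes> ym))) \<oplus> E \<otimes> W"
  proof -
    have P: "v \<otimes> (yl \<otimes> a) \<in> carrier R" "v \<otimes> (c \<otimes> xm) \<in> carrier R" using c by auto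
    have "v1 \<otimes> ((xl \<ominus> v \<otimes> (yl \<otimes> a)) \<otimes> (K \<otimes> (ym \<ominus> v \<otimes> (c \<otimes> xm)))) = E \<otimes> ((xl \<ominus> v \<otimes> (yl \<otimes> a)) \<otimes> (ym \<ominus> v \<otimes> (c \<otimes> xm)))"
      using c by (simp add: E_def m_ac)
    also have "(xl \<ominus> v \<otimes> (yl \<otimes> a)) \<otimes> (ym \<ominus> v \<otimes> (c \<otimes> xm)) = xl \<otimes> ym \<ominus> xl \<otimes> (v \<otimes> (c \<otimes> xm)) \<ominus> (v \<otimes> (yl \<otimes> a)) \<otimes> ym \<oplus> (v \<otimes> (yl \<otimes> a)) \<otimes> (v \<otimes> (c \<otimes> xm))"
      using c P by (simp add: a_minus_def l_distr r_distr l_minus r_minus minus_add a_ac)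
    also have "xl \<otimes> (v \<otimes> (c \<otimes> xm)) = v \<otimes> (c \<otimes> (xl \<otimes> xm))" using c by (simp add: m_ac)
    also have "(v \<otimes> (yl \<otimes> a)) \<otimes> ym = v \<otimes> (a \<otimes> (yl \<otimes> ym))" using c by (simp add: m_ac)
    also have "(v \<otimes> (yl \<otimes> a)) \<otimes> (v \<otimes> (c \<otimes> xm)) = W" using c by (simp add: W_def m_ac)
    finally show ?thesis using c Ec by (simp add: a_minus_def r_distr r_minus)
  qed
  show ?thesis unfolding 1 2 E_def[symmetric]
    using c Ec by (simp add: a_minus_def r_distr r_minus a_ac r_neg1 r_neg2)
qed

end

section \<open>Alternating matrices whose diagonal blocks vanish\<close>

context chain_ring
begin

text \<open>Indices of the alternating matrix with off-diagonal block \<open>W\<close>: the rows of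
  \<open>W\<close> are in \<open>A\<close>, its columns in \<open>C\<close>, shifted by
  \<open>n\<close>.\<close>

definition SG :: "nat => nat set => nat set => nat set" where "SG n A C = A \<union> (+) n ` C"

definition bipartite :: "nat => nat set => (nat => nat => 'a) => bool" where
  "bipartite n S B \<longleftrightarrow> (\<forall>l\<in>S. \<forall>m\<in>S. (l \<le> n \<longleftrightarrow> m \<le> n) --> B l m = \<zero>)"

lemma SG_mem:
  assumes "A \<subseteq> {1..n}" "C \<subseteq> {1..n}"
  shows "l \<le> n ==> l \<in> SG n A C \<longleftrightarrow> l \<in> A" "n < m ==> m \<in> SG n A C \<longleftrightarrow> m - n \<in> C"
    "c \<in> C ==> n + c \<in> SG n A C"
  using assms by (force simp: SG_def image_iff)+

lemma SG_cases:
  assumes "A \<subseteq> {1..n}" "C \<subseteq> {1..n}" "l \<in> SG n A C"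
  obtains "l \<in> A" "l \<le> n" | c where "c \<in> C" "l = n + c" "n < l"
proof -
  consider "l \<in> A" | c where "c \<in> C" "l = n + c" using assms(3) by (auto simp: SG_def)
  then show thesis
  proof cases
    case 1
    then have "l \<le> n" using assms(1) by auto
    then show ?thesis using that(1) 1 by blast
  next
    case 2
    then have "n < l" using assms(2) by auto
    then show ?thesis using that(2) 2 by blast
  qed
qed

lemma finite_SG: "finite A ==> finite C ==> finite (SG n A C)" by (simp add: SG_def)

lemma card_SG:
  assumes "A \<subseteq> {1..n}" "C \<subseteq> {1..n}"
  shows "card (SG n A C) = card A + card C"
proof -
  have "A \<inter> (+) n ` C = {}" using assms by fastforce
  moreover have "finite A" "finite C" using assms finite_subset by auto
  ultimately show ?thesis unfolding SG_def by (subst card_Un_disjoint) (auto simp: card_image)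
qed

lemma SG_diff:
  assumes "A \<subseteq> {1..n}" "C \<subseteq> {1..n}" "a \<in> A" "c \<in> C"
  shows "SG n A C - {a, n + c} = SG n (A - {a}) (C - {c})"
  using assms by (fastforce simp: SG_def)

text \<open>A pivot in the off-diagonal block leaves the diagonal blocks zero and changes the block
  above the diagonal by the usual rank-one term.\<close>

lemma bipartite_corr:
  assumes b: "bipartite n S B" and alt: "alternating S B" and BJ: "!!l m. l \<in> S ==> m \<in> S ==> B l m \<in> J k"
    and ac: "a \<in> S" "d \<in> S" "a \<le> n" "n < d" "B a d \<notin> J (Suc k)" and lm: "l \<in> S" "m \<in> S"
  shows "l \<le> n \<longleftrightarrow> m \<le> n ==> corr k B a d l m = \<zero>"
    "l \<le> n ==> n < m ==> corr k B a d l m = \<ominus> (inv (uu k (B a d)) \<otimes> (dv k (B l d) \<otimes> B a m))"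
proof -
  have z: "B l m = \<zero>" if "l \<in> S" "m \<in> S" "l \<le> n \<longleftrightarrow> m \<le> n" for l m using b that by (auto simp: bipartite_def)
  have c: "dv k (B l m) \<in> carrier R" "B l m \<in> carrier R" if "l \<in> S" "m \<in> S" for l m
    using dv(1)[OF BJ[OF that]] J_carrier[OF BJ[OF that]] by auto
  have u: "inv (uu k (B a d)) \<in> carrier R" using uu[OF BJ[OF ac(1,2)] ac(5)] by auto
  show "corr k B a d l m = \<zero>" if "l \<le> n \<longleftrightarrow> m \<le> n"
  proof (cases "l \<le> n")
    case True
    then have "B l a = \<zero>" "B a m = \<zero>" using z[OF lm(1) ac(1)] z[OF ac(1) lm(2)] ac that by auto
    then show ?thesis using c ac lm u by (simp add: corr_def a_minus_def)
  next
    case False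
    then have "B l d = \<zero>" "B d m = \<zero>" using z[OF lm(1) ac(2)] z[OF ac(2) lm(2)] ac that by auto
    then show ?thesis using c ac lm u by (simp add: corr_def a_minus_def)
  qed
  show "corr k B a d l m = \<ominus> (inv (uu k (B a d)) \<otimes> (dv k (B l d) \<otimes> B a m))" if "l \<le> n" "n < m"
  proof -
    have "B l a = \<zero>" using z[OF lm(1) ac(1)] ac that by auto
    then show ?thesis using c[OF lm(1) ac(2)] c[OF ac(1) lm(2)] c[OF ac(2) lm(2)] u
      by (simp add: corr_def a_minus_def r_minus)
  qed
qed

lemma bipartite_pivot:
  assumes b: "bipartite n S B" and alt: "alternating S B" and BJ: "!!l m. l \<in> S ==> m \<in> S ==> B l m \<in> J k"
    and ac: "a \<in> S" "d \<in> S" "a \<le> n" "n < d" "B a d \<notin> J (Suc k)"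
  shows "bipartite n S (\<lambda>l m. B l m \<oplus> corr k B a d l m)"
  unfolding bipartite_def
proof (intro ballI impI)
  fix l m assume lm: "l \<in> S" "m \<in> S" "l \<le> n \<longleftrightarrow> m \<le> n"
  have "B l m = \<zero>" using b lm by (auto simp: bipartite_def)
  then show "B l m \<oplus> corr k B a d l m = \<zero>" using bipartite_corr(1)[OF b alt BJ ac lm] by simp
qed

lemma corr_J':
  assumes BJ: "!!l m. l \<in> S ==> m \<in> S ==> B l m \<in> J k"
    and ac: "a \<in> S" "d \<in> S" "B a d \<notin> J (Suc k)" and lm: "l \<in> S" "m \<in> S"
    and e: "B l a \<in> J e \<and> B l d \<in> J e \<or> B d m \<in> J e \<and> B a m \<in> J e"
  shows "corr k B a d l m \<in> J e"
  using uu[OF BJ[OF ac(1,2)] ac(3)] by (intro corr_J) (use assms in auto)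

subsection \<open>General matrices\<close>

definition touch1 :: "nat => nat set => nat \<times> nat => nat" where
  "touch1 k A y = (if fst y \<in> A then Suc k else k)"

text \<open>Only rows are divided into processed \<open>A\<close> and fresh \<open>F\<close>. A
  pivot deletes a row of \<open>F\<close> and a column of \<open>C\<close>, so
  \<open>card C = card A + card F\<close> persists if the start is square.\<close>

definition EG :: "complex => nat => nat => nat set => nat set => nat set => complex" where
  "EG \<tau> n k A F C = avg (box ((A \<union> F) \<times> C) (touch1 k A)) (wt \<tau> GType n (SG n (A \<union> F) C))"

lemma form_G_bipartite: "bipartite n S (form GType n w)"
  by (auto simp: bipartite_def form_def)

context
  fixes n :: nat and A F C :: "nat set" assumes sub: "A \<union> F \<subseteq> {1..n}" "C \<subseteq> {1..n}" and disj: "A \<inter> F = {}"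
begin

lemma form_G_J:
  assumes w: "w \<in> box ((A \<union> F) \<times> C) (touch1 k A)" and lm: "l \<in> SG n (A \<union> F) C" "m \<in> SG n (A \<union> F) C"
  shows "form GType n w l m \<in> J k" "l \<in> A ==> form GType n w l m \<in> J (Suc k)"
proof -
  have 1: "upper_form GType n w l m \<in> J (if l \<in> A then Suc k else k)" if lm: "l \<in> SG n (A \<union> F) C" "m \<in> SG n (A \<union> F) C" for l m
  proof (cases "l \<le> n \<and> n < m")
    case True
    then have "l \<in> A \<union> F" "m - n \<in> C" using SG_mem[OF sub] lm SG_cases[OF sub lm(2)] by auto
    then show ?thesis using boxD[OF w, of "(l, m - n)"] True by (simp add: touch1_def)
  next
    case False
    then show ?thesis by (auto simp: )
  qed
  have 2: "upper_form GType n w m l \<in> J (Suc k)" if "l \<in> A" "m < l" using that sub by (auto simp: subset_iff)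
  have 3: "J (if l \<in> A then Suc k else k) \<subseteq> J k" for l using J_Suc_sub[of k] by auto
  show "form GType n w l m \<in> J k" using 1[OF lm] 1[OF lm(2,1)] 3 by (intro form_J) blast+
  show "form GType n w l m \<in> J (Suc k)" if "l \<in> A" using 1[OF lm] 2[OF that] that by (intro form_J) auto
qed

lemma form_G_alt:
  assumes w: "w \<in> box ((A \<union> F) \<times> C) (touch1 k A)"
  shows "alternating (SG n (A \<union> F) C) (form GType n w)"
proof (rule form_alternating)
  fix l m assume lm: "l \<in> SG n (A \<union> F) C" "m \<in> SG n (A \<union> F) C" "l < m"
  then show "upper_form GType n w l m \<in> carrier R"
    using J_carrier[OF form_G_J(1)[OF w lm(1,2)]] by (simp add: form_def)
qed

text \<open>All \<open>card C\<close> entries of row \<open>i\<close> are tested. A pivot of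
  \<open>W\<close> in column \<open>c\<close> is a pivot of the alternating matrix at
  \<open>(i, n + c)\<close>, hence the exponent \<open>2 * k\<close>.\<close>

lemma EG_rec:
  assumes i: "i \<in> F" and k: "k < N"
    and h: "!!c. c \<in> C ==> EG \<tau> n k A (F - {i}) (C - {c}) = h"
  shows "EG \<tau> n k A F C = Xq ^ card C * EG \<tau> n k (insert i A) (F - {i}) C
    + (1 - Xq ^ card C) * (Qt \<tau> ^ (2 * k) * h)"
proof -
  let ?D = "A \<union> F" and ?S = "SG n (A \<union> F) C" and ?T = "GType"
  have fin: "finite A" "finite F" "finite C" using sub by (blast intro: finite_subset[OF _ finite_atLeastAtMost])+
  have finS: "finite ?S" using fin by (simp add: finite_SG)
  let ?L = "{i} \<times> C"
  have iA: "i \<notin> A" and in': "i \<le> n" "i \<in> ?D" using i disj sub by auto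
  have iS: "i \<in> ?S" using SG_mem(1)[OF sub in'(1)] in' by simp
  define t where "t e w y = corr k (form ?T n w) i (n + snd e) (fst y) (n + snd y)" for e y :: "nat \<times> nat" and w
  have eJ: "form ?T n w i (n + c) = w (i, c)" if "c \<in> C" for c w
    using in' that sub by (auto simp: form_def)
  have cS: "n + c \<in> ?S" "n < n + c" if "c \<in> C" for c using SG_mem(3)[OF sub] that sub by auto
  have "avg (box (?D \<times> C) (touch1 k A)) (wt \<tau> ?T n ?S) =
    Xq ^ card ?L * avg (box (?D \<times> C) (\<lambda>y. if y \<in> ?L then Suc k else touch1 k A y)) (wt \<tau> ?T n ?S)
    + (1 - Xq ^ card ?L) * (Qt \<tau> ^ (2 * k) * h)"
  proof (rule elimination[where ?Y2.0 = "\<lambda>e. (?D - {i}) \<times> (C - {snd e})" and ?f2.0 = "\<lambda>e. wt \<tau> ?T n (SG n (?D - {i}) (C - {snd e}))" and t = t])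
    show "finite (?D \<times> C)" using fin by simp
    show "?L \<subseteq> ?D \<times> C" using i by auto
    show "k < N" by (rule k)
    show "touch1 k A y = k" if "y \<in> ?L" for y using that iA by (auto simp: touch1_def)
    show "(?D - {i}) \<times> (C - {snd e}) \<subseteq> ?D \<times> C - ?L" if "e \<in> ?L" for e by auto
    show "t e w y = t e w' y" if e: "e \<in> ?L" and eq: "!!y. y \<in> ?D \<times> C - (?D - {i}) \<times> (C - {snd e}) ==> w y = w' y"
      and y: "y \<in> (?D - {i}) \<times> (C - {snd e})" for e w w' y
    proof -
      have c: "snd e \<in> C" using e by auto
      have "form ?T n w l m = form ?T n w' l m" if lm: "l \<in> ?S" "m \<in> ?S" "l \<in> {i, n + snd e} \<or> m \<in> {i, n + snd e}" for l m
      proof -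
        have "upper_form ?T n w l m = upper_form ?T n w' l m" if lm: "l \<in> ?S" "m \<in> ?S" "l \<in> {i, n + snd e} \<or> m \<in> {i, n + snd e}" for l m
        proof (cases "l \<le> n \<and> n < m")
          case True
          then have lD: "l \<in> ?D" using SG_mem(1)[OF sub] lm by auto
          obtain m' where m': "m' \<in> C" "m = n + m'" using True lm(2) SG_cases[OF sub lm(2)] by (metis linorder_not_less)
          have "l = i \<or> m' = snd e" using lm(3) True m' in' c sub by auto
          then have "w (l, m') = w' (l, m')" using eq[of "(l, m')"] lD m' by auto
          then show ?thesis using True m' by simp
        qed auto
        from this[of l m] this[of m l] show ?thesis using that by (auto simp: form_def)
      qed
      moreover have "fst y \<in> ?S" "n + snd y \<in> ?S" using y SG_mem[OF sub] sub by auto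
      ultimately show ?thesis unfolding t_def using iS cS[OF c] by (intro corr_cong) auto
    qed
    show "t e w y \<in> J (touch1 k A y)" if e: "e \<in> ?L" and w: "w \<in> box (?D \<times> C) (touch1 k A)" and we: "w e \<notin> J (Suc k)"
      and y: "y \<in> (?D - {i}) \<times> (C - {snd e})" for e w y
    proof -
      have c: "snd e \<in> C" "e = (i, snd e)" using e by auto
      have yS: "fst y \<in> ?S" "n + snd y \<in> ?S" using y SG_mem[OF sub] sub by auto
      show ?thesis unfolding t_def
      proof (rule corr_J'[OF form_G_J(1)[OF w] iS cS(1)[OF c(1)] _ yS])
        show "form ?T n w i (n + snd e) \<notin> J (Suc k)" using we c eJ by metis
        show "form ?T n w (fst y) i \<in> J (touch1 k A y) \<and> form ?T n w (fst y) (n + snd e) \<in> J (touch1 k A y) \<or>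
          form ?T n w (n + snd e) (n + snd y) \<in> J (touch1 k A y) \<and> form ?T n w i (n + snd y) \<in> J (touch1 k A y)"
          using form_G_J[OF w yS(1)] iS cS[OF c(1)] by (auto simp: touch1_def)
      qed
    qed
    show "wt \<tau> ?T n ?S w = Qt \<tau> ^ (2 * k) * wt \<tau> ?T n (SG n (?D - {i}) (C - {snd e})) (\<lambda>y\<in>(?D - {i}) \<times> (C - {snd e}). w y \<oplus> t e w y)"
      if e: "e \<in> ?L" and w: "w \<in> box (?D \<times> C) (touch1 k A)" and we: "w e \<notin> J (Suc k)" for e w
    proof -
      have c: "snd e \<in> C" "e = (i, snd e)" using e by auto
      have nJ: "form ?T n w i (n + snd e) \<notin> J (Suc k)" using we c eJ by metis
      have Sd: "?S - {i, n + snd e} = SG n (?D - {i}) (C - {snd e})" by (rule SG_diff[OF sub in'(2) c(1)])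
      have sub': "?D - {i} \<subseteq> {1..n}" "C - {snd e} \<subseteq> {1..n}" using sub by auto
      show ?thesis unfolding Sd[symmetric]
      proof (rule wt_pivot[OF finS form_G_alt[OF w] form_G_J(1)[OF w] iS cS(1)[OF c(1)] _ nJ])
        show "i \<noteq> n + snd e" using cS[OF c(1)] in' by simp
        show "k \<le> N" using k by simp
        fix l m assume l: "l \<in> ?S - {i, n + snd e}" and m: "m \<in> ?S - {i, n + snd e}" and lm: "l < m"
        have lS: "l \<in> ?S" "m \<in> ?S" using l m by auto
        show "form ?T n w l m \<oplus> corr k (form ?T n w) i (n + snd e) l m = upper_form ?T n (\<lambda>y\<in>(?D - {i}) \<times> (C - {snd e}). w y \<oplus> t e w y) l m"
        proof (cases "l \<le> n \<and> n < m")
          case True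
          have lD: "l \<in> ?D - {i}" using SG_mem(1)[OF sub'] l True unfolding Sd by auto
          have "m - n \<in> C - {snd e}" using m True SG_mem(2)[OF sub', of m] unfolding Sd by auto
          then show ?thesis using lD True lm by (simp add: form_def t_def)
        next
          case False
          then have eqv: "l \<le> n \<longleftrightarrow> m \<le> n" using lm by auto
          have "corr k (form ?T n w) i (n + snd e) l m = \<zero>"
            by (rule bipartite_corr(1)[OF form_G_bipartite form_G_alt[OF w] form_G_J(1)[OF w] iS cS(1)[OF c(1)] in'(1) cS(2)[OF c(1)] nJ lS eqv])
          then show ?thesis using False lm by (auto simp: form_def)
        qed
      qed
    qed
    show "avg (box ((?D - {i}) \<times> (C - {snd e})) (touch1 k A)) (wt \<tau> ?T n (SG n (?D - {i}) (C - {snd e}))) = h" if e: "e \<in> ?L" for e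
    proof -
      have D: "?D - {i} = A \<union> (F - {i})" using iA by auto
      have "snd e \<in> C" using e by auto
      from h[OF this] show ?thesis unfolding EG_def D .
    qed
  qed
  moreover have "box (?D \<times> C) (\<lambda>y. if y \<in> ?L then Suc k else touch1 k A y) = box (?D \<times> C) (touch1 k (insert i A))"
    by (rule box_cong) (auto simp: touch1_def)
  moreover have "insert i A \<union> (F - {i}) = ?D" using i by auto
  moreover have "card ?L = card C" by (simp add: card_cartesian_product_singleton)
  ultimately show ?thesis unfolding EG_def by (simp only:)
qed

end

lemma EG_shift: "EG \<tau> n k A {} C = EG \<tau> n (Suc k) {} A C"
proof -
  have "box (A \<times> C) (touch1 k A) = box (A \<times> C) (touch1 (Suc k) {})"
    by (rule box_cong) (auto simp: touch1_def)
  then show ?thesis by (simp add: EG_def)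
qed

lemma EG_end:
  assumes sub: "F \<subseteq> {1..n}" "C \<subseteq> {1..n}"
  shows "EG \<tau> n N {} F C = Qt \<tau> ^ (N * (card F + card C))"
proof -
  have fin: "finite F" "finite C" using sub by (blast intro: finite_subset[OF _ finite_atLeastAtMost])+
  have ne: "box (F \<times> C) (touch1 N {}) \<noteq> {}" using card_box_pos[of "F \<times> C" "touch1 N {}"] fin by force
  show ?thesis unfolding EG_def
  proof (rule avg_const)
    fix w assume "w \<in> box (({} \<union> F) \<times> C) (touch1 N {})"
    then have w: "w \<in> box (({} \<union> F) \<times> C) (touch1 N {})" .
    have "form GType n w l m = \<zero>" if "l \<in> SG n F C" "m \<in> SG n F C" for l m
      using form_G_J(1)[OF _ sub(2) _ w, of l m] that sub(1) by (simp add: J_N)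
    then show "wt \<tau> GType n (SG n ({} \<union> F) C) w = Qt \<tau> ^ (N * (card F + card C))"
      using wt_zero[OF finite_SG[OF fin], of n GType n w \<tau>] card_SG[OF sub] by simp
  qed (use ne finite_box fin in auto)
qed

end

context chain_ring
begin

subsection \<open>Symmetric matrices\<close>

text \<open>Where a symmetric entry is stored: only coordinates on and above the diagonal are
  independent.\<close>

definition mm :: "nat => nat => nat \<times> nat" where "mm i j = (min i j, max i j)"

lemma mm_swap: "mm i j = mm j i" by (simp add: mm_def min.commute max.commute)

definition YH :: "nat set => (nat \<times> nat) set" where
  "YH S = {(a, b). a \<in> S \<and> b \<in> S \<and> a \<le> b}"

definition EH :: "complex => nat => nat => nat set => nat set => complex" where
  "EH \<tau> n k A F = avg (box (YH (A \<union> F)) (touch k A)) (wt \<tau> HType n (SG n (A \<union> F) (A \<union> F)))"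

definition sch :: "nat => (nat => nat => 'a) => nat => nat => nat => nat => 'a" where
  "sch k B a b l m = B l m \<oplus> corr k B a b l m"

text \<open>Correction of the symmetric entry \<open>(l, m)\<close> for the diagonal pivot
  \<open>(a, a)\<close>. The function \<open>tH2\<close> does the same for the block at
  \<open>a\<close> and \<open>b\<close>, carried out as two alternating pivots at
  \<open>(a, n + b)\<close> and \<open>(b, n + a)\<close>.\<close>

definition tH1 :: "nat => nat => (nat \<times> nat => 'a) => nat => nat => nat => 'a" where
  "tH1 n k w a l m = corr k (form HType n w) a (n + a) l (n + m)"

definition tH2 :: "nat => nat => (nat \<times> nat => 'a) => nat => nat => nat => nat => 'a" where
  "tH2 n k w a b l m = corr k (form HType n w) a (n + b) l (n + m)
    \<oplus> corr k (sch k (form HType n w) a (n + b)) b (n + a) l (n + m)"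

lemma finite_YH: "finite S ==> finite (YH S)"
  by (rule finite_subset[of _ "S \<times> S"]) (auto simp: YH_def)

lemma mm_YH: "mm l c \<in> YH S \<longleftrightarrow> l \<in> S \<and> c \<in> S"
  by (auto simp: mm_def YH_def min_def max_def)

lemma YH_mm: "y \<in> YH S ==> y = mm (fst y) (snd y)"
  by (auto simp: mm_def YH_def)

lemma corr_row:
  assumes BJ: "!!l m. l \<in> S ==> m \<in> S ==> B l m \<in> J k"
    and ad: "a \<in> S" "d \<in> S" "B a d \<notin> J (Suc k)" and lm: "l \<in> S" "m \<in> S"
    and e: "(\<forall>p\<in>S. B l p \<in> J e) \<or> (\<forall>p\<in>S. B p m \<in> J e)"
  shows "corr k B a d l m \<in> J e"
  by (rule corr_J'[where S = S and B = B and k = k, OF BJ ad lm]) (use e ad in blast)+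

lemma sch_row:
  assumes BJ: "!!l m. l \<in> S ==> m \<in> S ==> B l m \<in> J k"
    and ad: "a \<in> S" "d \<in> S" "B a d \<notin> J (Suc k)" and lm: "l \<in> S" "m \<in> S"
    and e: "(\<forall>p\<in>S. B l p \<in> J e) \<or> (\<forall>p\<in>S. B p m \<in> J e)"
  shows "sch k B a d l m \<in> J e"
  unfolding sch_def
proof (rule J_add)
  show "B l m \<in> J e" using e lm by blast
  show "corr k B a d l m \<in> J e" by (rule corr_row[where S = S and B = B and k = k, OF BJ ad lm e])
qed

text \<open>Allows any explicit quotient \<open>p\<close> in place of the chosen one inside a
  product with an element of \<open>J k\<close>.\<close>

lemma dv_mult_eq:
  assumes "p \<in> carrier R" "r \<in> J k" "x = \<pi> [^] k \<otimes> p"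
  shows "dv k x \<otimes> r = p \<otimes> r"
proof -
  have x: "x \<in> J k" using assms by (auto simp: J_def)
  have r: "dv k r \<in> carrier R" "\<pi> [^] k \<otimes> dv k r = r" using dv assms(2) by auto
  have "dv k x \<otimes> r = x \<otimes> dv k r" by (rule dv_swap[OF x assms(2)])
  also have "\<dots> = p \<otimes> (\<pi> [^] k \<otimes> dv k r)" using assms r by (simp add: m_ac)
  finally show ?thesis using r by simp
qed

context
  fixes n :: nat and D :: "nat set" assumes D: "D \<subseteq> {1..n}"
begin

lemma H_mem: "a \<in> D ==> a \<in> SG n D D" "a \<in> D ==> n + a \<in> SG n D D" "a \<in> D ==> a \<le> n" "a \<in> D ==> n < n + a"
  using SG_mem[OF D D] D by auto

lemma H_pos: "a \<in> D ==> a \<noteq> 0" using D by auto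

lemma H_finite: "finite D" "finite (SG n D D)"
  using finite_subset[OF D] by (auto intro: finite_SG)

lemma H_val: "l \<in> D ==> c \<in> D ==> form HType n w l (n + c) = w (mm l c)"
  using H_mem(3)[of l] H_mem(4)[of c] by (simp add: form_def mm_def)

lemma H_val': "l \<in> D ==> c \<in> D ==> form HType n w (n + c) l = \<ominus> w (mm l c)"
  using H_mem[of l] H_mem[of c] by (simp add: form_def mm_def)

lemma H_bip: "bipartite n S (form HType n w)"
  by (auto simp: bipartite_def form_def)

lemma H_zero: "(l \<le> n \<longleftrightarrow> m \<le> n) ==> form HType n w l m = \<zero>"
  by (auto simp: form_def)

lemma H_J:
  assumes lm: "l \<in> SG n D D" "m \<in> SG n D D"
    and w: "!!a c. a \<in> D ==> c \<in> D ==> {l, m} = {a, n + c} ==> w (mm a c) \<in> J e"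
  shows "form HType n w l m \<in> J e"
proof (rule SG_cases[OF D D lm(1)])
  assume l: "l \<in> D" "l \<le> n"
  show ?thesis
  proof (rule SG_cases[OF D D lm(2)])
    assume "m \<in> D" "m \<le> n"
    then show ?thesis using l H_zero[of l m] by simp
  next
    fix c assume "c \<in> D" "m = n + c"
    then show ?thesis using H_val[OF l(1)] w[OF l(1)] by simp
  qed
next
  fix c assume l: "c \<in> D" "l = n + c" "n < l"
  show ?thesis
  proof (rule SG_cases[OF D D lm(2)])
    assume m: "m \<in> D" "m \<le> n"
    have "w (mm m c) \<in> J e" using w[OF m(1) l(1)] l by auto
    then show ?thesis using H_val'[OF m(1) l(1)] J_neg l by simp
  next
    fix c' assume "c' \<in> D" "m = n + c'" "n < m"
    then show ?thesis using l H_zero[of l m] by simp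
  qed
qed

context
  fixes w :: "nat \<times> nat => 'a" and k :: nat
  assumes w: "!!y. y \<in> YH D ==> w y \<in> J k" and k: "k \<le> N"
begin

lemma H_Jk: "l \<in> SG n D D ==> m \<in> SG n D D ==> form HType n w l m \<in> J k"
  by (rule H_J) (auto intro: w simp: mm_YH)

lemma H_alt: "alternating (SG n D D) (form HType n w)"
proof (rule form_alternating)
  fix l m assume lm: "l \<in> SG n D D" "m \<in> SG n D D" "l < m"
  then show "upper_form HType n w l m \<in> carrier R"
    using J_carrier[OF H_Jk[OF lm(1,2)]] by (simp add: form_def)
qed

lemma H_w: "a \<in> D ==> c \<in> D ==> w (mm a c) \<in> J k" "a \<in> D ==> c \<in> D ==> w (mm a c) \<in> carrier R"
    "a \<in> D ==> c \<in> D ==> dv k (w (mm a c)) \<in> carrier R"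
  using w J_carrier dv(1) by (metis mm_YH)+

lemma H_corr:
  assumes "a \<in> D" "b \<in> D" "w (mm a b) \<notin> J (Suc k)" "l \<in> D" "m \<in> D"
  shows "corr k (form HType n w) a (n + b) l (n + m) = \<ominus> (inv (uu k (w (mm a b))) \<otimes> (dv k (w (mm l b)) \<otimes> w (mm a m)))"
  using bipartite_corr(2)[OF H_bip H_alt H_Jk, of a "n + b" l "n + m"] assms H_mem by (simp add: H_val)

text \<open>The rank-one correction is symmetric because the division may be moved from one factor
  to the other.\<close>

lemma tH1_swap:
  assumes "a \<in> D" "w (mm a a) \<notin> J (Suc k)" "l \<in> D" "m \<in> D"
  shows "tH1 n k w a l m = tH1 n k w a m l"
proof -
  have "dv k (w (mm l a)) \<otimes> w (mm a m) = dv k (w (mm m a)) \<otimes> w (mm a l)"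
    using dv_swap[OF H_w(1)[of l a] H_w(1)[of a m]] assms H_w by (simp add: mm_swap m_comm)
  then show ?thesis using assms by (simp add: tH1_def H_corr)
qed

lemma tH1_wt:
  assumes a: "a \<in> D" "w (mm a a) \<notin> J (Suc k)"
  shows "wt \<tau> HType n (SG n D D) w = Qt \<tau> ^ (2 * k) *
    wt \<tau> HType n (SG n (D - {a}) (D - {a})) (\<lambda>y\<in>YH (D - {a}). w y \<oplus> tH1 n k w a (fst y) (snd y))"
proof -
  have Sd: "SG n D D - {a, n + a} = SG n (D - {a}) (D - {a})" by (rule SG_diff[OF D D a(1) a(1)])
  have D': "D - {a} \<subseteq> {1..n}" using D by auto
  have nJ: "form HType n w a (n + a) \<notin> J (Suc k)" using a by (simp add: H_val)
  show ?thesis unfolding Sd[symmetric]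
  proof (rule wt_pivot[OF H_finite(2) H_alt H_Jk H_mem(1,2)[OF a(1)] _ nJ k])
    show "a \<noteq> n + a" using H_mem(4)[OF a(1)] H_mem(3)[OF a(1)] by simp
    fix l m assume l: "l \<in> SG n D D - {a, n + a}" and m: "m \<in> SG n D D - {a, n + a}" and lm: "l < m"
    show "form HType n w l m \<oplus> corr k (form HType n w) a (n + a) l m =
      upper_form HType n (\<lambda>y\<in>YH (D - {a}). w y \<oplus> tH1 n k w a (fst y) (snd y)) l m"
    proof (cases "l \<le> n \<and> n < m")
      case True
      have lD: "l \<in> D - {a}" using SG_mem(1)[OF D' D'] l True unfolding Sd by auto
      have "m - n \<in> D - {a}" using m True SG_mem(2)[OF D' D', of m] unfolding Sd by auto
      then obtain c where c: "c \<in> D - {a}" "m = n + c" using True by (metis add_diff_inverse_nat not_less_iff_gr_or_eq)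
      have t: "tH1 n k w a (fst (mm l c)) (snd (mm l c)) = tH1 n k w a l c"
        using tH1_swap[OF a, of l c] lD c by (cases "l \<le> c") (auto simp: mm_def)
      have "mm l c \<in> YH (D - {a})" using lD c(1) by (simp only: mm_YH)
      then have "upper_form HType n (\<lambda>y\<in>YH (D - {a}). w y \<oplus> tH1 n k w a (fst y) (snd y)) l m
        = w (mm l c) \<oplus> tH1 n k w a l c" using True t unfolding c(2) by (simp add: mm_def[symmetric])
      moreover have "form HType n w l m = w (mm l c)" unfolding c(2) using lD c(1) by (intro H_val) auto
      ultimately show ?thesis unfolding c(2) tH1_def by simp
    next
      case False
      then have eqv: "l \<le> n \<longleftrightarrow> m \<le> n" using lm by auto
      have lS: "l \<in> SG n D D" "m \<in> SG n D D" using l m by auto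
      have "corr k (form HType n w) a (n + a) l m = \<zero>"
        by (rule bipartite_corr(1)[OF H_bip H_alt H_Jk H_mem(1,2)[OF a(1)] H_mem(3,4)[OF a(1)] nJ lS eqv])
      then show ?thesis using False lm by (auto simp: form_def)
    qed
  qed
qed

lemma tH1_J:
  assumes a: "a \<in> D" "w (mm a a) \<notin> J (Suc k)" and lm: "l \<in> D" "m \<in> D"
    and e: "(\<forall>c\<in>D. w (mm l c) \<in> J e) \<or> (\<forall>c\<in>D. w (mm c m) \<in> J e)"
  shows "tH1 n k w a l m \<in> J e"
  unfolding tH1_def using assms H_mem(1-3)
  by (intro corr_J'[where S = "SG n D D"] H_Jk) (auto simp: H_val H_zero H_pos J_zero)

context
  fixes a b :: nat
  assumes ab: "a \<in> D" "b \<in> D" "a \<noteq> b" "w (mm a b) \<notin> J (Suc k)"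
    and d: "w (mm a a) \<in> J (Suc k) \<or> w (mm b b) \<in> J (Suc k)"
begin

abbreviation "SS \<equiv> SG n D D"
abbreviation "BB \<equiv> form HType n w"
abbreviation "B1 \<equiv> sch k BB a (n + b)"

lemma H2_nJ: "BB a (n + b) \<notin> J (Suc k)" using ab by (simp add: H_val)

lemma H2_u: "uu k (w (mm a b)) \<in> Units R" "w (mm a b) = \<pi> [^] k \<otimes> uu k (w (mm a b))"
  using uu[OF H_w(1)[OF ab(1,2)] ab(4)] by blast+

lemma B1_J: "l \<in> SS ==> m \<in> SS ==> B1 l m \<in> J k"
  by (rule sch_row[where S = SS and B = BB and k = k, OF H_Jk H_mem(1)[OF ab(1)] H_mem(2)[OF ab(2)] H2_nJ]) (auto intro: H_Jk)

lemma B1_val: "l \<in> D ==> m \<in> D ==> B1 l (n + m) = w (mm l m) \<ominus> inv (uu k (w (mm a b))) \<otimes> (dv k (w (mm l b)) \<otimes> w (mm a m))"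
  using ab by (simp add: sch_def H_val H_corr a_minus_def)

text \<open>One of the two diagonal entries has an extra power of \<open>\<pi>\<close>, so the first
  pivot changes the entry \<open>(b, a)\<close> only within \<open>J (Suc k)\<close>, and its
  valuation remains \<open>k\<close>.\<close>

lemma B1_nJ: "B1 b (n + a) \<notin> J (Suc k)"
proof
  let ?x = "inv (uu k (w (mm a b))) \<otimes> (dv k (w (mm b b)) \<otimes> w (mm a a))"
  assume 1: "B1 b (n + a) \<in> J (Suc k)"
  have "dv k (w (mm b b)) \<otimes> w (mm a a) \<in> J (Suc k)"
    using dv_mult_J[OF H_w(1)[OF ab(2,2)] H_w(1)[OF ab(1,1)]] d by blast
  from J_mult'[OF this] have 2: "?x \<in> J (Suc k)" using H2_u by simp
  have c: "w (mm b a) \<in> carrier R" "?x \<in> carrier R" using H_w ab J_carrier[OF 2] by auto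
  have "(w (mm b a) \<ominus> ?x) \<oplus> ?x = w (mm b a)" using c by (simp add: a_minus_def a_assoc l_neg)
  moreover have "(w (mm b a) \<ominus> ?x) \<oplus> ?x \<in> J (Suc k)" using J_add[OF 1 2] ab by (simp add: B1_val)
  ultimately show False using ab(4) by (simp add: mm_swap[of b a])
qed

lemma B1_alt: "alternating (SS - {a, n + b}) B1"
  unfolding sch_def using pivot(2)[OF H_finite(2) H_alt H_Jk H_mem(1)[OF ab(1)] H_mem(2)[OF ab(2)] _ H2_nJ k]
    H_mem(3)[OF ab(1)] H_mem(4)[OF ab(2)] by fastforce

lemma B1_bip: "bipartite n SS B1"
  unfolding sch_def
  by (rule bipartite_pivot[OF H_bip H_alt H_Jk H_mem(1)[OF ab(1)] H_mem(2)[OF ab(2)] H_mem(3)[OF ab(1)] H_mem(4)[OF ab(2)] H2_nJ])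

lemma S2_mem: "b \<in> SS - {a, n + b}" "n + a \<in> SS - {a, n + b}" "m \<in> D - {a, b} ==> m \<in> SS - {a, n + b}"
    "m \<in> D - {a, b} ==> n + m \<in> SS - {a, n + b}"
  using H_mem[of m] H_mem[OF ab(1)] H_mem[OF ab(2)] ab(1-3) by auto

lemma B1_J': "l \<in> SS - {a, n + b} ==> m \<in> SS - {a, n + b} ==> B1 l m \<in> J k" using B1_J by auto

lemma B1_bip': "bipartite n (SS - {a, n + b}) B1" using B1_bip by (auto simp: bipartite_def)

lemma B1_corr:
  assumes "l \<in> D - {a, b}" "m \<in> D - {a, b}"
  shows "corr k B1 b (n + a) l (n + m) = \<ominus> (inv (uu k (B1 b (n + a))) \<otimes> (dv k (B1 l (n + a)) \<otimes> B1 b (n + m)))"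
  by (rule bipartite_corr(2)[OF B1_bip' B1_alt B1_J' S2_mem(1,2) H_mem(3)[OF ab(2)] H_mem(4)[OF ab(1)] B1_nJ S2_mem(3)[OF assms(1)] S2_mem(4)[OF assms(2)]])
    (use assms H_mem in auto)

text \<open>The first pivot may destroy the symmetry of \<open>W\<close>; the second restores it.
  All entries in the rows \<open>a\<close> and \<open>b\<close> are written as multiples of one
  power of \<open>\<pi>\<close>, which leads to \<open>schur_symmetric\<close>.\<close>

lemma tH2_swap:
  assumes lm: "l \<in> D - {a, b}" "m \<in> D - {a, b}"
  shows "tH2 n k w a b l m = tH2 n k w a b m l"
proof -
  let ?K = "\<pi> [^] k"
  define u v v1 x y where "u = uu k (w (mm a b))" and "v = inv u" and "v1 = inv (uu k (B1 b (n + a)))"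
    and "x l = dv k (w (mm l a))" and "y l = dv k (w (mm l b))" for l
  have u: "u \<in> Units R" "w (mm a b) = ?K \<otimes> u" using H2_u by (simp_all add: u_def)
  have u1: "uu k (B1 b (n + a)) \<in> Units R" "B1 b (n + a) = ?K \<otimes> uu k (B1 b (n + a))"
    using uu[OF B1_J B1_nJ] S2_mem by auto
  have K: "?K \<in> carrier R" by simp
  have uc: "u \<in> carrier R" "v \<in> carrier R" "v1 \<in> carrier R" "v \<otimes> u = \<one>" using u u1 by (auto simp: v_def v1_def)
  have xc: "x l \<in> carrier R" "w (mm l a) = ?K \<otimes> x l" "w (mm a l) = ?K \<otimes> x l"
    and yc: "y l \<in> carrier R" "w (mm l b) = ?K \<otimes> y l" "w (mm b l) = ?K \<otimes> y l" if "l \<in> D" for l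
    using H_w(3)[OF that ab(1)] dv(2)[OF H_w(1)[OF that ab(1)]] H_w(3)[OF that ab(2)] dv(2)[OF H_w(1)[OF that ab(2)]]
    by (simp_all add: x_def y_def mm_swap[of a l] mm_swap[of b l])
  have Ba: "B1 l (n + a) = ?K \<otimes> (x l \<ominus> v \<otimes> (y l \<otimes> x a))" if "l \<in> D" for l
  proof -
    have "B1 l (n + a) = ?K \<otimes> x l \<ominus> v \<otimes> (y l \<otimes> (?K \<otimes> x a))"
      using B1_val[OF that ab(1)] unfolding xc(2)[OF that] xc(2)[OF ab(1)] by (simp only: u_def v_def y_def)
    also have "v \<otimes> (y l \<otimes> (?K \<otimes> x a)) = ?K \<otimes> (v \<otimes> (y l \<otimes> x a))"
      using xc(1)[OF ab(1)] yc(1)[OF that] uc by (simp add: m_ac)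
    finally show ?thesis using xc(1)[OF ab(1)] xc(1)[OF that] yc(1)[OF that] uc by (simp add: a_minus_def r_distr r_minus)
  qed
  have Bb: "B1 b (n + m) = ?K \<otimes> (y m \<ominus> v \<otimes> (y b \<otimes> x m))" if "m \<in> D" for m
  proof -
    have "B1 b (n + m) = ?K \<otimes> y m \<ominus> v \<otimes> (y b \<otimes> (?K \<otimes> x m))"
      using B1_val[OF ab(2) that] unfolding xc(3)[OF that] yc(3)[OF that] by (simp only: u_def v_def y_def)
    also have "v \<otimes> (y b \<otimes> (?K \<otimes> x m)) = ?K \<otimes> (v \<otimes> (y b \<otimes> x m))"
      using yc(1)[OF ab(2)] xc(1)[OF that] uc by (simp add: m_ac)
    finally show ?thesis using yc(1)[OF ab(2)] xc(1)[OF that] yc(1)[OF that] uc by (simp add: a_minus_def r_distr r_minus)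
  qed
  \<comment> \<open>The unit of the second pivot is known only up to an annihilator of
    \<open>\<pi> [^] k\<close>, so the identity is stated after multiplication by this
    power.\<close>
  have Kv: "?K \<otimes> v1 \<otimes> (u \<ominus> v \<otimes> (y b \<otimes> x a)) = ?K"
  proof -
    have c: "u \<ominus> v \<otimes> (y b \<otimes> x a) \<in> carrier R" using uc xc(1)[OF ab(1)] yc(1)[OF ab(2)] by simp
    have xb: "?K \<otimes> x b = ?K \<otimes> u" using xc(3)[OF ab(2)] u(2) by simp
    have z: "v \<otimes> (y b \<otimes> x a) \<in> carrier R" using uc xc(1)[OF ab(1)] yc(1)[OF ab(2)] by simp
    have "?K \<otimes> (u \<ominus> v \<otimes> (y b \<otimes> x a)) = ?K \<otimes> (x b \<ominus> v \<otimes> (y b \<otimes> x a))"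
      using xb z uc(1) xc(1)[OF ab(2)] by (simp add: a_minus_def r_distr)
    also have "\<dots> = ?K \<otimes> uu k (B1 b (n + a))" using Ba[OF ab(2)] u1(2) by simp
    finally have e: "?K \<otimes> (u \<ominus> v \<otimes> (y b \<otimes> x a)) = ?K \<otimes> uu k (B1 b (n + a))" .
    have "?K \<otimes> v1 \<otimes> (u \<ominus> v \<otimes> (y b \<otimes> x a)) = v1 \<otimes> (?K \<otimes> (u \<ominus> v \<otimes> (y b \<otimes> x a)))"
      using uc c by (simp add: m_ac)
    also have "\<dots> = ?K \<otimes> (v1 \<otimes> uu k (B1 b (n + a)))" unfolding e using uc u1(1) by (simp add: m_ac Units_closed)
    also have "\<dots> = ?K" using u1(1) by (simp add: v1_def)
    finally show ?thesis .
  qed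
  have f: "tH2 n k w a b l m = \<ominus> ((?K \<otimes> v1) \<otimes> (y l \<otimes> x m \<oplus> x l \<otimes> y m \<ominus> v \<otimes> (y b \<otimes> (x l \<otimes> x m)) \<ominus> v \<otimes> (x a \<otimes> (y l \<otimes> y m))))"
    if lm: "l \<in> D - {a, b}" "m \<in> D - {a, b}" for l m
  proof -
    have lD: "l \<in> D" "m \<in> D" using lm by auto
    note cs = xc(1)[OF lD(1)] xc(1)[OF lD(2)] yc(1)[OF lD(1)] yc(1)[OF lD(2)] xc(1)[OF ab(1)] yc(1)[OF ab(2)]
    have p: "x l \<ominus> v \<otimes> (y l \<otimes> x a) \<in> carrier R" using cs uc by simp
    have Bj: "B1 b (n + m) \<in> J k" using B1_J[OF H_mem(1)[OF ab(2)] H_mem(2)[OF lD(2)]] .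
    have 1: "corr k BB a (n + b) l (n + m) = \<ominus> (v \<otimes> (y l \<otimes> (?K \<otimes> x m)))"
      using H_corr[OF ab(1,2,4) lD] xc(3)[OF lD(2)] by (simp add: u_def v_def y_def)
    have 2: "corr k B1 b (n + a) l (n + m) = \<ominus> (v1 \<otimes> ((x l \<ominus> v \<otimes> (y l \<otimes> x a)) \<otimes> (?K \<otimes> (y m \<ominus> v \<otimes> (y b \<otimes> x m)))))"
      unfolding B1_corr[OF lm] dv_mult_eq[OF p Bj Ba[OF lD(1)]] unfolding v1_def[symmetric] Bb[OF lD(2)] ..
    have "tH2 n k w a b l m = \<ominus> (v \<otimes> (y l \<otimes> (?K \<otimes> x m)) \<oplus> v1 \<otimes> ((x l \<ominus> v \<otimes> (y l \<otimes> x a)) \<otimes> (?K \<otimes> (y m \<ominus> v \<otimes> (y b \<otimes> x m)))))"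
      unfolding tH2_def 1 2 using cs uc p by (simp add: minus_add)
    also have "v \<otimes> (y l \<otimes> (?K \<otimes> x m)) \<oplus> v1 \<otimes> ((x l \<ominus> v \<otimes> (y l \<otimes> x a)) \<otimes> (?K \<otimes> (y m \<ominus> v \<otimes> (y b \<otimes> x m)))) =
      (?K \<otimes> v1) \<otimes> (y l \<otimes> x m \<oplus> x l \<otimes> y m \<ominus> v \<otimes> (y b \<otimes> (x l \<otimes> x m)) \<ominus> v \<otimes> (x a \<otimes> (y l \<otimes> y m)))"
      by (rule schur_symmetric[OF K uc(2,3,1) cs(5,6,1,3,2,4) uc(4) Kv])
    finally show ?thesis .
  qed
  have lD: "l \<in> D" "m \<in> D" using lm by auto
  note cs = xc(1)[OF lD(1)] xc(1)[OF lD(2)] yc(1)[OF lD(1)] yc(1)[OF lD(2)]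
  have "y l \<otimes> x m \<oplus> x l \<otimes> y m = y m \<otimes> x l \<oplus> x m \<otimes> y l" using cs by (simp add: m_comm a_comm)
  moreover have "x l \<otimes> x m = x m \<otimes> x l" "y l \<otimes> y m = y m \<otimes> y l" using cs by (simp_all add: m_comm)
  ultimately show ?thesis unfolding f[OF lm] f[OF lm(2,1)] by simp
qed

text \<open>Two pivots of valuation \<open>k\<close>, each contributing \<open>q ^ (2 * k)\<close>
  to the kernel.\<close>

lemma tH2_wt:
  "wt \<tau> HType n SS w = Qt \<tau> ^ (4 * k) *
    wt \<tau> HType n (SG n (D - {a, b}) (D - {a, b})) (\<lambda>y\<in>YH (D - {a, b}). w y \<oplus> tH2 n k w a b (fst y) (snd y))"
proof -
  let ?D = "D - {a, b}"
  let ?w = "\<lambda>y\<in>YH ?D. w y \<oplus> tH2 n k w a b (fst y) (snd y)"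
  have D': "?D \<subseteq> {1..n}" "D - {a} \<subseteq> {1..n}" "D - {b} \<subseteq> {1..n}" using D by auto
  have Sd: "SS - {a, n + b} - {b, n + a} = SG n ?D ?D"
  proof -
    have "SS - {a, n + b} = SG n (D - {a}) (D - {b})" by (rule SG_diff[OF D D ab(1,2)])
    moreover have "SG n (D - {a}) (D - {b}) - {b, n + a} = SG n (D - {a} - {b}) (D - {b} - {a})"
      by (rule SG_diff[OF D'(2,3)]) (use ab in auto)
    moreover have "D - {a} - {b} = ?D" "D - {b} - {a} = ?D" by auto
    ultimately show ?thesis by simp
  qed
  have ne: "a \<noteq> n + b" "b \<noteq> n + a" using H_mem(3,4)[OF ab(1)] H_mem(3,4)[OF ab(2)] by auto
  have p1: "card (Rad SS BB) = q ^ (2 * k) * card (Rad (SS - {a, n + b}) B1)"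
    unfolding sch_def by (rule pivot(1)[OF H_finite(2) H_alt H_Jk H_mem(1)[OF ab(1)] H_mem(2)[OF ab(2)] ne(1) H2_nJ k])
  let ?B2 = "\<lambda>l m. B1 l m \<oplus> corr k B1 b (n + a) l m"
  have fin: "finite (SS - {a, n + b})" using H_finite by simp
  note p2 = pivot[OF fin B1_alt B1_J' S2_mem(1,2) ne(2) B1_nJ k]
  have r: "Rad (SG n ?D ?D) ?B2 = Rad (SG n ?D ?D) (form HType n ?w)"
  proof (rule Rad_form_eq)
    show "alternating (SG n ?D ?D) ?B2" using p2(2) unfolding Sd .
    fix l m assume l: "l \<in> SG n ?D ?D" and m: "m \<in> SG n ?D ?D" and lm: "l < m"
    have lS: "l \<in> SS - {a, n + b}" "m \<in> SS - {a, n + b}" using l m unfolding Sd[symmetric] by auto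
    show "?B2 l m = upper_form HType n ?w l m"
    proof (cases "l \<le> n \<and> n < m")
      case True
      have lD: "l \<in> ?D" using SG_mem(1)[OF D'(1) D'(1)] l True by auto
      have "m - n \<in> ?D" using m True SG_mem(2)[OF D'(1) D'(1), of m] by auto
      then obtain c where c: "c \<in> ?D" "m = n + c" using True by (metis add_diff_inverse_nat not_less_iff_gr_or_eq)
      have t: "tH2 n k w a b (fst (mm l c)) (snd (mm l c)) = tH2 n k w a b l c"
        using tH2_swap[of l c] lD c by (cases "l \<le> c") (auto simp: mm_def)
      have "mm l c \<in> YH ?D" using lD c(1) by (simp only: mm_YH)
      then have 1: "upper_form HType n ?w l m = w (mm l c) \<oplus> tH2 n k w a b l c"
        using True t unfolding c(2) by (simp add: mm_def[symmetric])
      have lcD: "l \<in> D" "c \<in> D" using lD c by auto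
      have 2: "BB l m = w (mm l c)" unfolding c(2) by (rule H_val[OF lcD])
      have cc: "w (mm l c) \<in> carrier R" "corr k BB a (n + b) l m \<in> carrier R" "corr k B1 b (n + a) l m \<in> carrier R"
        using H_w(2)[OF lcD] J_carrier[OF corr_row[where S = SS and B = BB and k = k, OF H_Jk H_mem(1)[OF ab(1)] H_mem(2)[OF ab(2)] H2_nJ, of l m k]]
          J_carrier[OF corr_row[where S = "SS - {a, n + b}" and B = B1 and k = k, OF B1_J' S2_mem(1,2) B1_nJ lS, of k]] lS H_Jk B1_J' by auto
      have "?B2 l m = (BB l m \<oplus> corr k BB a (n + b) l m) \<oplus> corr k B1 b (n + a) l m" by (simp add: sch_def)
      also have "\<dots> = w (mm l c) \<oplus> tH2 n k w a b l c" using cc unfolding 2 unfolding tH2_def c(2) by (simp add: a_assoc)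
      finally show ?thesis unfolding 1 .
    next
      case False
      then have eqv: "l \<le> n \<longleftrightarrow> m \<le> n" using lm by auto
      have "?B2 l m = \<zero>"
        using bipartite_pivot[OF B1_bip' B1_alt B1_J' S2_mem(1,2) H_mem(3)[OF ab(2)] H_mem(4)[OF ab(1)] B1_nJ] lS eqv
        unfolding bipartite_def by blast
      then show ?thesis using False by auto
    qed
  qed
  have "card (Rad SS BB) = q ^ (4 * k) * card (Rad (SG n ?D ?D) (form HType n ?w))"
    using p1 p2(1) r unfolding Sd by (simp add: power_add[symmetric])
  then show ?thesis unfolding wt_def by (simp only: powr_scale)
qed

lemma tH2_J:
  assumes lm: "l \<in> D - {a, b}" "m \<in> D - {a, b}"
    and e: "(\<forall>c\<in>D. w (mm l c) \<in> J e) \<or> (\<forall>c\<in>D. w (mm c m) \<in> J e)"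
  shows "tH2 n k w a b l m \<in> J e"
proof -
  have lD: "l \<in> D" "m \<in> D" using lm by auto
  have row: "(\<forall>p\<in>SS. BB l p \<in> J e) \<or> (\<forall>p\<in>SS. BB p (n + m) \<in> J e)"
  proof (rule disj_forward[OF e])
    assume c: "\<forall>c\<in>D. w (mm l c) \<in> J e"
    show "\<forall>p\<in>SS. BB l p \<in> J e"
    proof
      fix p assume "p \<in> SS"
      then show "BB l p \<in> J e"
        by (rule SG_cases[OF D D]) (use c lD H_mem(3) in \<open>auto simp: H_val H_zero H_pos J_zero\<close>)
    qed
  next
    assume c: "\<forall>c\<in>D. w (mm c m) \<in> J e"
    show "\<forall>p\<in>SS. BB p (n + m) \<in> J e"
    proof
      fix p assume "p \<in> SS"
      then show "BB p (n + m) \<in> J e"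
        by (rule SG_cases[OF D D]) (use c lD H_mem(4) in \<open>auto simp: H_val H_zero H_pos J_zero\<close>)
    qed
  qed
  have lS: "l \<in> SS" "n + m \<in> SS" using H_mem lD by auto
  note c1 = corr_row[where S = SS and B = BB and k = k, OF H_Jk H_mem(1)[OF ab(1)] H_mem(2)[OF ab(2)] H2_nJ]
    and s1 = sch_row[where S = SS and B = BB and k = k, OF H_Jk H_mem(1)[OF ab(1)] H_mem(2)[OF ab(2)] H2_nJ]
  have row1: "(\<forall>p\<in>SS. B1 l p \<in> J e) \<or> (\<forall>p\<in>SS. B1 p (n + m) \<in> J e)"
    by (rule disj_forward[OF row]) (use s1 lS in blast)+
  show ?thesis unfolding tH2_def
    by (intro J_add c1 corr_row[where S = SS and B = B1 and k = k, OF B1_J H_mem(1)[OF ab(2)] H_mem(2)[OF ab(1)] B1_nJ]) (use lS row row1 in auto)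
qed

end
end

end
end

context chain_ring
begin

lemma touch_mm: "touch k A (mm l c) = (if l \<in> A \<or> c \<in> A then Suc k else k)"
  by (auto simp: touch_def mm_def min_def max_def)

text \<open>The level of \<open>(l, m)\<close> exceeds \<open>k\<close> only if \<open>l\<close> or
  \<open>m\<close> lies in \<open>A\<close>, and then a whole row or a whole column has the higher
  level.\<close>

lemma touch_row:
  assumes w: "!!a c. a \<in> D ==> c \<in> D ==> w (mm a c) \<in> J (touch k A (mm a c))" and lm: "l \<in> D" "m \<in> D"
  shows "(\<forall>c\<in>D. w (mm l c) \<in> J (touch k A (l, m))) \<or> (\<forall>c\<in>D. w (mm c m) \<in> J (touch k A (l, m)))"
proof -
  have s: "x \<in> J k" if "x \<in> J (if b then Suc k else k)" for x b using that J_Suc_sub[of k] by (cases b) auto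
  have "w (mm l c) \<in> J (if l \<in> A \<or> c \<in> A then Suc k else k)" if "c \<in> D" for c
    using w[OF lm(1) that] by (simp only: touch_mm)
  moreover have "w (mm c m) \<in> J (if c \<in> A \<or> m \<in> A then Suc k else k)" if "c \<in> D" for c
    using w[OF that lm(2)] by (simp only: touch_mm)
  ultimately show ?thesis using s by (cases "l \<in> A"; cases "m \<in> A") (fastforce simp: touch_def)+
qed

lemma form_H_cong:
  assumes D: "D \<subseteq> {1..n}" and eq: "!!c. c \<in> D ==> w (mm c a) = w' (mm c a)"
    and lm: "l \<in> SG n D D" "m \<in> SG n D D" and z: "l = a \<or> l = n + a \<or> m = a \<or> m = n + a" and a: "a \<in> D"
  shows "form HType n w l m = form HType n w' l m"
proof -
  have 1: "form HType n w x (n + c) = form HType n w' x (n + c)" if "x \<in> D" "c \<in> D" "x = a \<or> c = a" for x c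
    using H_val[OF D that(1,2)] eq that mm_swap by metis
  have 2: "form HType n w (n + c) x = form HType n w' (n + c) x" if "x \<in> D" "c \<in> D" "x = a \<or> c = a" for x c
    using H_val'[OF D that(1,2)] eq that mm_swap by metis
  have na: "a \<le> n" "a \<noteq> 0" using a D by auto
  show ?thesis
  proof (rule SG_cases[OF D D lm(1)])
    assume l: "l \<in> D" "l \<le> n"
    show ?thesis
    proof (rule SG_cases[OF D D lm(2)])
      fix c assume "c \<in> D" "m = n + c" "n < m"
      then show ?thesis using 1[OF l(1)] z na l by auto
    qed (use l H_zero[OF D, of l m] in auto)
  next
    fix c assume l: "c \<in> D" "l = n + c" "n < l"
    show ?thesis
    proof (rule SG_cases[OF D D lm(2)])
      assume "m \<in> D" "m \<le> n"
      then show ?thesis using 2[of m c] z na l by auto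
    qed (use l H_zero[OF D, of l m] in auto)
  qed
qed

lemma tH1_cong:
  assumes D: "D \<subseteq> {1..n}" and eq: "!!c. c \<in> D ==> w (mm c a) = w' (mm c a)" and a: "a \<in> D" and lm: "l \<in> D" "m \<in> D"
  shows "tH1 n k w a l m = tH1 n k w' a l m"
  unfolding tH1_def using H_mem[OF D] a lm by (intro corr_cong form_H_cong[where w = w and w' = w' and a = a, OF D eq]) auto

text \<open>The correction reads only entries involving \<open>a\<close> or \<open>b\<close>; this
  is the independence asked for by \<open>elimination\<close>.\<close>

lemma tH2_cong:
  assumes D: "D \<subseteq> {1..n}" and eq: "!!c. c \<in> D ==> w (mm c a) = w' (mm c a)" "!!c. c \<in> D ==> w (mm c b) = w' (mm c b)"
    and ab: "a \<in> D" "b \<in> D" and lm: "l \<in> D" "m \<in> D"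
  shows "tH2 n k w a b l m = tH2 n k w' a b l m"
proof -
  let ?B = "form HType n w" and ?B' = "form HType n w'"
  note mem = H_mem(1)[OF D ab(1)] H_mem(2)[OF D ab(1)] H_mem(1)[OF D ab(2)] H_mem(2)[OF D ab(2)]
  have B: "?B x y = ?B' x y" if "x \<in> SG n D D" "y \<in> SG n D D" "x \<in> {a, b, n + a, n + b} \<or> y \<in> {a, b, n + a, n + b}" for x y
    using form_H_cong[where w = w and w' = w' and a = a, OF D eq(1) that(1,2) _ ab(1)] form_H_cong[where w = w and w' = w' and a = b, OF D eq(2) that(1,2) _ ab(2)] that(3) by blast
  have 1: "corr k ?B a (n + b) x y = corr k ?B' a (n + b) x y" if "x \<in> SG n D D" "y \<in> SG n D D" for x y
    using that mem by (intro corr_cong B) auto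
  have 2: "sch k ?B a (n + b) x y = sch k ?B' a (n + b) x y"
    if "x \<in> SG n D D" "y \<in> SG n D D" "x \<in> {a, b, n + a, n + b} \<or> y \<in> {a, b, n + a, n + b}" for x y
    using B[OF that] 1[OF that(1,2)] by (simp add: sch_def)
  have lS: "l \<in> SG n D D" "n + m \<in> SG n D D" using H_mem[OF D] lm by auto
  have "corr k (sch k ?B a (n + b)) b (n + a) l (n + m) = corr k (sch k ?B' a (n + b)) b (n + a) l (n + m)"
    using lS mem by (intro corr_cong 2) auto
  then show ?thesis using 1[OF lS] by (simp add: tH2_def)
qed

text \<open>Two eliminations. The diagonal entry \<open>(i, i)\<close> is tested alone, and as a
  pivot it removes \<open>i\<close>. If it gains a power, the \<open>card F - 1\<close> entries
  \<open>(i, j)\<close> are tested; a pivot among them removes \<open>i\<close> and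
  \<open>j\<close>. Testing the diagonal beforehand makes the 2 by 2 block
  \<open>\<pi> [^] k\<close> times an invertible one.\<close>

lemma EH_rec:
  assumes sub: "A \<union> F \<subseteq> {1..n}" and disj: "A \<inter> F = {}" and i: "i \<in> F" and k: "k < N"
    and h: "!!j. j \<in> F ==> j \<noteq> i ==> EH \<tau> n k A (F - {i, j}) = h"
  shows "EH \<tau> n k A F = Xq * (Xq ^ (card F - 1) * EH \<tau> n k (insert i A) (F - {i})
      + (1 - Xq ^ (card F - 1)) * (Qt \<tau> ^ (4 * k) * h))
    + (1 - Xq) * (Qt \<tau> ^ (2 * k) * EH \<tau> n k A (F - {i}))"
proof -
  let ?D = "A \<union> F" and ?T = "HType"
  let ?S = "SG n ?D ?D"
  \<comment> \<open>Levels between the two eliminations, with only the entry \<open>(i, i)\<close>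
    raised.\<close>
  let ?lev = "\<lambda>y. if y \<in> {(i, i)} then Suc k else touch k A y"
  let ?M = "avg (box (YH ?D) ?lev) (wt \<tau> ?T n ?S)"
  have finD: "finite ?D" using sub finite_subset by auto
  have iD: "i \<in> ?D" "i \<notin> A" using i disj by auto
  have kN: "k \<le> N" using k by simp
  have row0: "w (mm a c) \<in> J (touch k A (mm a c))" if "w \<in> box (YH ?D) (touch k A)" "a \<in> ?D" "c \<in> ?D" for w a c
    using boxD[OF that(1), of "mm a c"] that(2,3) by (simp only: mm_YH)
  have wJ0: "w y \<in> J k" if "w \<in> box (YH ?D) (touch k A)" "y \<in> YH ?D" for w y
    using boxD[OF that] J_Suc_sub[of k] by (auto simp: touch_def split: if_splits)
  have one: "avg (box (YH ?D) (touch k A)) (wt \<tau> ?T n ?S) = Xq ^ card {(i, i)} * ?M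
    + (1 - Xq ^ card {(i, i)}) * (Qt \<tau> ^ (2 * k) * EH \<tau> n k A (F - {i}))"
  proof (rule elimination[where ?Y2.0 = "\<lambda>e. YH (?D - {i})" and ?f2.0 = "\<lambda>e. wt \<tau> ?T n (SG n (?D - {i}) (?D - {i}))"
        and t = "\<lambda>e w y. tH1 n k w i (fst y) (snd y)"])
    show "finite (YH ?D)" by (rule finite_YH[OF finD])
    show "{(i, i)} \<subseteq> YH ?D" using i by (auto simp: YH_def)
    show "touch k A y = k" if "y \<in> {(i, i)}" for y using that iD by (auto simp: touch_def)
    show "k < N" by (rule k)
    show "YH (?D - {i}) \<subseteq> YH ?D - {(i, i)}" by (auto simp: YH_def)
    show "tH1 n k w i (fst y) (snd y) = tH1 n k w' i (fst y) (snd y)"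
      if eq: "!!y. y \<in> YH ?D - YH (?D - {i}) ==> w y = w' y" and y: "y \<in> YH (?D - {i})" for w w' y
    proof (rule tH1_cong[where w = w and w' = w', OF sub _ iD(1)])
      fix c assume "c \<in> ?D"
      then have "mm c i \<in> YH ?D - YH (?D - {i})" using iD by (simp only: mm_YH Diff_iff) blast
      then show "w (mm c i) = w' (mm c i)" by (rule eq)
    qed (use y in \<open>auto simp: YH_def\<close>)
    show "tH1 n k w i (fst y) (snd y) \<in> J (touch k A y)"
      if e: "e \<in> {(i, i)}" and w: "w \<in> box (YH ?D) (touch k A)" and we: "w e \<notin> J (Suc k)" and y: "y \<in> YH (?D - {i})" for e w y
    proof -
      have yD: "fst y \<in> ?D" "snd y \<in> ?D" using y by (auto simp: YH_def)
      have nJ: "w (mm i i) \<notin> J (Suc k)" using we e by (simp add: mm_def)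
      show ?thesis using tH1_J[where w = w and k = k, OF sub wJ0[OF w] kN iD(1) nJ yD touch_row[where w = w and k = k and A = A, OF row0[OF w] yD]] by simp
    qed
    show "wt \<tau> ?T n ?S w = Qt \<tau> ^ (2 * k) * wt \<tau> ?T n (SG n (?D - {i}) (?D - {i})) (\<lambda>y\<in>YH (?D - {i}). w y \<oplus> tH1 n k w i (fst y) (snd y))"
      if e: "e \<in> {(i, i)}" and w: "w \<in> box (YH ?D) (touch k A)" and we: "w e \<notin> J (Suc k)" for e w
    proof -
      have nJ: "w (mm i i) \<notin> J (Suc k)" using we e by (simp add: mm_def)
      show ?thesis by (rule tH1_wt[where w = w and k = k, OF sub wJ0[OF w] kN iD(1) nJ])
    qed
    have D: "A \<union> (F - {i}) = ?D - {i}" using iD by auto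
    show "avg (box (YH (?D - {i})) (touch k A)) (wt \<tau> ?T n (SG n (?D - {i}) (?D - {i}))) = EH \<tau> n k A (F - {i})"
      unfolding EH_def D ..
  qed
  let ?L = "(\<lambda>j. mm i j) ` (F - {i})"
  have cL: "card ?L = card F - 1"
  proof -
    have "inj_on (\<lambda>j. mm i j) (F - {i})" by (auto simp: inj_on_def mm_def min_def max_def split: if_splits)
    then show ?thesis using i by (simp add: card_image)
  qed
  have Ld: "\<exists>j\<in>F. j \<noteq> i \<and> {fst e, snd e} = {i, j} \<and> e = mm i j" if "e \<in> ?L" for e
    using that by (auto simp: mm_def min_def max_def)
  have Ld': "fst e \<in> ?D" "snd e \<in> ?D" "fst e \<noteq> snd e" "fst e = i \<or> snd e = i" "e = mm (fst e) (snd e)"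
    "fst e \<notin> A" "snd e \<notin> A" if e: "e \<in> ?L" for e
  proof -
    obtain j where j: "j \<in> F" "j \<noteq> i" "e = mm i j" using e by blast
    show "fst e \<in> ?D" "snd e \<in> ?D" "fst e \<noteq> snd e" "fst e = i \<or> snd e = i" "e = mm (fst e) (snd e)"
      "fst e \<notin> A" "snd e \<notin> A"
      using j i disj by (cases "i < j"; auto simp: mm_def)+
  qed
  have row1: "w (mm a c) \<in> J (touch k A (mm a c))" if "w \<in> box (YH ?D) ?lev" "a \<in> ?D" "c \<in> ?D" for w a c
  proof -
    have "w (mm a c) \<in> J (?lev (mm a c))" using boxD[OF that(1), of "mm a c"] that(2,3) by (simp only: mm_YH)
    moreover have "touch k A (i, i) = k" using iD by (simp add: touch_def)
    ultimately show ?thesis using J_Suc_sub[of k] by (cases "mm a c = (i, i)") auto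
  qed
  have wJ1: "w y \<in> J k" if "w \<in> box (YH ?D) ?lev" "y \<in> YH ?D" for w y
    using boxD[OF that] J_Suc_sub[of k] by (auto simp: touch_def split: if_splits)
  have two: "?M = Xq ^ card ?L * avg (box (YH ?D) (\<lambda>y. if y \<in> ?L then Suc k else ?lev y)) (wt \<tau> ?T n ?S)
    + (1 - Xq ^ card ?L) * (Qt \<tau> ^ (4 * k) * h)"
  proof (rule elimination[where ?Y2.0 = "\<lambda>e. YH (?D - {fst e, snd e})"
        and ?f2.0 = "\<lambda>e. wt \<tau> ?T n (SG n (?D - {fst e, snd e}) (?D - {fst e, snd e}))"
        and t = "\<lambda>e w y. tH2 n k w (fst e) (snd e) (fst y) (snd y)"])
    show "finite (YH ?D)" by (rule finite_YH[OF finD])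
    show "?L \<subseteq> YH ?D" using i by (auto simp: mm_YH)
    show "?lev y = k" if "y \<in> ?L" for y using Ld'[OF that] by (cases y) (auto simp: touch_def)
    show "k < N" by (rule k)
    show "YH (?D - {fst e, snd e}) \<subseteq> YH ?D - ?L" if "e \<in> ?L" for e
    proof
      fix y assume y: "y \<in> YH (?D - {fst e, snd e})"
      have "fst y \<noteq> i" "snd y \<noteq> i" "y \<in> YH ?D" using y Ld'(4)[OF that] by (auto simp: YH_def)
      then show "y \<in> YH ?D - ?L" using Ld'(4)[of y] by blast
    qed
    show "tH2 n k w (fst e) (snd e) (fst y) (snd y) = tH2 n k w' (fst e) (snd e) (fst y) (snd y)"
      if e: "e \<in> ?L" and eq: "!!y. y \<in> YH ?D - YH (?D - {fst e, snd e}) ==> w y = w' y" and y: "y \<in> YH (?D - {fst e, snd e})" for e w w' y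
    proof -
      have eq': "w (mm c p) = w' (mm c p)" if "c \<in> ?D" "p \<in> {fst e, snd e}" for c p
      proof (rule eq)
        show "mm c p \<in> YH ?D - YH (?D - {fst e, snd e})" using that Ld'(1,2)[OF e] by (simp only: mm_YH Diff_iff) blast
      qed
      show ?thesis by (rule tH2_cong[where w = w and w' = w', OF sub eq' eq' Ld'(1,2)[OF e]]) (use y in \<open>auto simp: YH_def\<close>)
    qed
    \<comment> \<open>One of the two pivot indices is \<open>i\<close>, whose diagonal entry was
      raised by the first elimination.\<close>
    have diag: "w (mm (fst e) (fst e)) \<in> J (Suc k) \<or> w (mm (snd e) (snd e)) \<in> J (Suc k)"
      if e: "e \<in> ?L" and w: "w \<in> box (YH ?D) ?lev" for e w
    proof -
      have "w (mm i i) \<in> J (Suc k)" using boxD[OF w, of "(i, i)"] iD by (simp add: mm_def YH_def)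
      then show ?thesis using Ld'(4)[OF e] by blast
    qed
    have nJ: "w (mm (fst e) (snd e)) \<notin> J (Suc k)" if "e \<in> ?L" "w e \<notin> J (Suc k)" for e w
      using that(2) Ld'(5)[OF that(1)] by metis
    show "tH2 n k w (fst e) (snd e) (fst y) (snd y) \<in> J (?lev y)"
      if e: "e \<in> ?L" and w: "w \<in> box (YH ?D) ?lev" and we: "w e \<notin> J (Suc k)" and y: "y \<in> YH (?D - {fst e, snd e})" for e w y
    proof -
      have yD: "fst y \<in> ?D - {fst e, snd e}" "snd y \<in> ?D - {fst e, snd e}" using y by (auto simp: YH_def)
      then have yD': "fst y \<in> ?D" "snd y \<in> ?D" "y \<noteq> (i, i)" using Ld'(4)[OF e] by auto
      show ?thesis
        using tH2_J[where w = w and k = k, OF sub wJ1[OF w] kN Ld'(1-3)[OF e] nJ[of e w, OF e we] diag[OF e w] yD touch_row[where w = w and k = k and A = A, OF row1[OF w] yD'(1,2)]] yD'(3) by simp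
    qed
    show "wt \<tau> ?T n ?S w = Qt \<tau> ^ (4 * k) * wt \<tau> ?T n (SG n (?D - {fst e, snd e}) (?D - {fst e, snd e}))
        (\<lambda>y\<in>YH (?D - {fst e, snd e}). w y \<oplus> tH2 n k w (fst e) (snd e) (fst y) (snd y))"
      if e: "e \<in> ?L" and w: "w \<in> box (YH ?D) ?lev" and we: "w e \<notin> J (Suc k)" for e w
      by (rule tH2_wt[where w = w and k = k, OF sub wJ1[OF w] kN Ld'(1-3)[OF e] nJ[of e w, OF e we] diag[OF e w]])
    show "avg (box (YH (?D - {fst e, snd e})) ?lev) (wt \<tau> ?T n (SG n (?D - {fst e, snd e}) (?D - {fst e, snd e}))) = h" if e: "e \<in> ?L" for e
    proof -
      obtain j where j: "j \<in> F" "j \<noteq> i" "{fst e, snd e} = {i, j}" using Ld[OF e] by blast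
      have D: "?D - {fst e, snd e} = A \<union> (F - {i, j})" unfolding j(3) using disj i j by auto
      have b: "box (YH (A \<union> (F - {i, j}))) ?lev = box (YH (A \<union> (F - {i, j}))) (touch k A)"
        by (rule box_cong) (use iD in \<open>auto simp: YH_def\<close>)
      show ?thesis unfolding D b using h[OF j(1,2)] by (simp only: EH_def)
    qed
  qed
  have b: "box (YH ?D) (\<lambda>y. if y \<in> ?L then Suc k else ?lev y) = box (YH ?D) (touch k (insert i A))"
  proof (rule box_cong)
    fix y assume y: "y \<in> YH ?D"
    show "(if y \<in> ?L then Suc k else ?lev y) = touch k (insert i A) y"
    proof (cases "fst y = i \<or> snd y = i")
      case True
      have "fst y \<in> ?D" "snd y \<in> ?D" using y by (auto simp: YH_def)
      then obtain j where j: "j \<in> ?D" "y = mm i j" using True YH_mm[OF y] mm_swap by metis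
      have "touch k (insert i A) y = Suc k" using True by (auto simp: touch_def)
      moreover have "(if y \<in> ?L then Suc k else ?lev y) = Suc k"
      proof (cases "j \<in> A")
        case True then show ?thesis unfolding j(2) by (simp add: touch_mm)
      next
        case False then show ?thesis using j by (cases "j = i") (auto simp: mm_def)
      qed
      ultimately show ?thesis by simp
    next
      case False
      then have "y \<notin> ?L" "y \<noteq> (i, i)" using Ld'(4)[of y] by auto
      then show ?thesis using False by (auto simp: touch_def)
    qed
  qed
  have D: "insert i A \<union> (F - {i}) = ?D" using i by auto
  have c1: "card {(i, i)} = 1" by simp
  have e: "EH \<tau> n k A F = avg (box (YH ?D) (touch k A)) (wt \<tau> ?T n ?S)" by (simp only: EH_def)
  have M: "?M = Xq ^ (card F - 1) * EH \<tau> n k (insert i A) (F - {i}) + (1 - Xq ^ (card F - 1)) * (Qt \<tau> ^ (4 * k) * h)"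
    using two unfolding b cL by (simp only: EH_def D)
  show ?thesis unfolding e using one unfolding c1 M power_one_right .
qed

lemma EH_shift: "EH \<tau> n k A {} = EH \<tau> n (Suc k) {} A"
proof -
  have "box (YH A) (touch k A) = box (YH A) (touch (Suc k) {})"
    by (rule box_cong) (auto simp: YH_def touch_def)
  then show ?thesis by (simp add: EH_def)
qed

lemma EH_end:
  assumes F: "F \<subseteq> {1..n}"
  shows "EH \<tau> n N {} F = Qt \<tau> ^ (N * (2 * card F))"
proof -
  have fin: "finite F" using F by (blast intro: finite_subset[OF _ finite_atLeastAtMost])
  have ne: "box (YH F) (touch N {}) \<noteq> {}" using card_box_pos[OF finite_YH[OF fin], of "touch N {}"] by force
  show ?thesis unfolding EH_def
  proof (rule avg_const)
    fix w assume "w \<in> box (YH ({} \<union> F)) (touch N {})"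
    then have w: "w y \<in> J N" if "y \<in> YH F" for y using boxD[of w "YH F" "touch N {}" y] that by (simp add: touch_def)
    have "form HType n w l m = \<zero>" if "l \<in> SG n F F" "m \<in> SG n F F" for l m
      using H_Jk[where w = w and k = N, OF F w order_refl that] by (simp add: J_N)
    then show "wt \<tau> HType n (SG n ({} \<union> F) ({} \<union> F)) w = Qt \<tau> ^ (N * (2 * card F))"
      using wt_zero[OF finite_SG[OF fin fin], of n HType n w \<tau>] card_SG[OF F F] by (simp add: mult_2)
  qed (use ne finite_box finite_YH[OF fin] in auto)
qed

end

section \<open>Generating functions of triangular systems and sums over chains\<close>

section \<open>Triangular recursions\<close>

text \<open>Shifting the index bounds a partial sum \<open>S\<close> of norms by
  \<open>norm (u 0) + norm x * S + V\<close>, where \<open>V\<close> is the sum of the norms of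
  \<open>v\<close>; solving for \<open>S\<close> gives absolute convergence. The same shift applied
  to the series gives its value.\<close>

lemma linear_recursion_sums:
  fixes u v :: "nat => complex"
  assumes x: "norm x < 1" and v: "summable (\<lambda>N. norm (v N))"
    and rec: "!!N. u (Suc N) = x * u N + v N"
  shows "summable (\<lambda>N. norm (u N))" "suminf u = (u 0 + suminf v) / (1 - x)"
proof -
  let ?V = "\<Sum>N. norm (v N)"
  have bound: "(\<Sum>N\<le>M. norm (u N)) \<le> (norm (u 0) + ?V) / (1 - norm x)" for M
  proof -
    have "(\<Sum>N\<le>M. norm (u N)) \<le> (\<Sum>N\<le>Suc M. norm (u N))" by simp
    also have "\<dots> = norm (u 0) + (\<Sum>N\<le>M. norm (u (Suc N)))" by (simp only: sum.atMost_Suc_shift)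
    also have "(\<Sum>N\<le>M. norm (u (Suc N))) \<le> (\<Sum>N\<le>M. norm x * norm (u N) + norm (v N))"
      unfolding rec by (intro sum_mono norm_triangle_le) (simp add: norm_mult)
    also have "\<dots> = norm x * (\<Sum>N\<le>M. norm (u N)) + (\<Sum>N\<le>M. norm (v N))"
      by (simp add: sum.distrib sum_distrib_left)
    also have "(\<Sum>N\<le>M. norm (v N)) \<le> ?V" using v by (intro sum_le_suminf) auto
    finally show ?thesis using x by (simp add: field_simps)
  qed
  show s: "summable (\<lambda>N. norm (u N))"
    by (rule bounded_imp_summable[OF _ bound]) simp
  have us: "summable u" and vs: "summable v" using s v by (simp_all add: summable_norm_cancel)
  have "suminf u = u 0 + (\<Sum>N. u (Suc N))" using us by (simp add: suminf_split_head)
  also have "(\<Sum>N. u (Suc N)) = x * suminf u + suminf v"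
    unfolding rec using us vs by (simp add: suminf_add[symmetric] suminf_mult summable_mult)
  finally have a: "suminf u = u 0 + (x * suminf u + suminf v)" .
  have "suminf u * (1 - x) = suminf u - x * suminf u" by (simp add: algebra_simps)
  also have "\<dots> = u 0 + suminf v" by (subst (1) a) simp
  finally have "suminf u * (1 - x) = u 0 + suminf v" .
  moreover have "1 - x \<noteq> 0" using x by auto
  ultimately show "suminf u = (u 0 + suminf v) / (1 - x)" by (simp add: field_simps)
qed

text \<open>Nonempty subsets are sorted by their largest element, as the recursion peels a chain off
  from above.\<close>

lemma sum_Pow_split_Max:
  fixes g :: "nat set => 'a::comm_monoid_add"
  shows "(\<Sum>I\<in>Pow {..<m}. g I) = g {} + (\<Sum>i<m. \<Sum>I\<in>Pow {..<i}. g (insert i I))"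
proof (induction m)
  case (Suc m)
  have inj: "inj_on (insert m) (Pow {..<m})" by (rule inj_onI) (metis PowD insert_ident lessThan_iff less_irrefl subsetD)
  have "(\<Sum>I\<in>Pow {..<Suc m}. g I) = (\<Sum>I\<in>Pow {..<m} \<union> insert m ` Pow {..<m}. g I)"
    by (simp add: lessThan_Suc Pow_insert)
  also have "\<dots> = (\<Sum>I\<in>Pow {..<m}. g I) + (\<Sum>I\<in>Pow {..<m}. g (insert m I))"
    by (subst sum.union_disjoint) (auto simp: sum.reindex[OF inj] o_def)
  finally show ?case using Suc by (simp add: add.assoc)
qed simp

text \<open>Since \<open>e m m = 1\<close>, row \<open>m\<close> is a linear recursion of ratio
  \<open>x m\<close> fed by the smaller rows, which are already summed. \<open>E\<close> is the
  product of the \<open>e\<close> along a chain, and \<open>E1\<close> peels off its largest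
  element.\<close>

lemma chain_recursion_sums:
  fixes u :: "nat => nat => complex"
  assumes x: "!!i. i \<le> n ==> norm (x i) < 1"
    and u0: "!!m. m \<le> n ==> u m 0 = 1"
    and rec: "!!m N. m \<le> n ==> u m (Suc N) = (\<Sum>i\<le>m. e m i * x i * u i N)"
    and e: "!!m. m \<le> n ==> e m m = 1"
    and E0: "!!m. m \<le> n ==> E m {} = 1"
    and E1: "!!m i I. i < m ==> m \<le> n ==> I \<subseteq> {..<i} ==> E m (insert i I) = e m i * E i I"
  shows "m \<le> n ==> summable (\<lambda>N. norm (u m N)) \<and>
    suminf (u m) = 1 / (1 - x m) * (\<Sum>I\<in>Pow {..<m}. E m I * (\<Prod>i\<in>I. x i / (1 - x i)))"
proof (induction m rule: less_induct)
  case (less m)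
  define v where "v N = (\<Sum>i<m. e m i * x i * u i N)" for N
  have IH: "summable (\<lambda>N. norm (u i N))" "suminf (u i) = 1 / (1 - x i) * (\<Sum>I\<in>Pow {..<i}. E i I * (\<Prod>i\<in>I. x i / (1 - x i)))"
    if "i < m" for i using less that by auto
  have sv: "summable (\<lambda>N. norm (v N))"
  proof (rule summable_comparison_test'[of _ 0])
    show "summable (\<lambda>N. \<Sum>i<m. norm (e m i * x i) * norm (u i N))"
      using IH by (intro summable_sum summable_mult) auto
    show "norm (norm (v N)) \<le> (\<Sum>i<m. norm (e m i * x i) * norm (u i N))" for N
      unfolding v_def by (auto intro!: order.trans[OF norm_sum] sum_mono simp: norm_mult)
  qed
  have rec': "u m (Suc N) = x m * u m N + v N" for N
    using rec[OF less.prems, of N] e[OF less.prems] by (simp add: v_def lessThan_Suc_atMost[symmetric])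
  note S = linear_recursion_sums[OF x[OF less.prems] sv, of "u m", OF rec']
  have su: "summable (u i)" if "i < m" for i using IH(1)[OF that] by (rule summable_norm_cancel)
  have "suminf v = (\<Sum>i<m. \<Sum>N. e m i * x i * u i N)"
    unfolding v_def by (rule suminf_sum) (simp add: summable_mult su)
  also have "\<dots> = (\<Sum>i<m. e m i * x i * suminf (u i))"
    by (intro sum.cong refl suminf_mult su) simp
  also have "\<dots> = (\<Sum>i<m. \<Sum>I\<in>Pow {..<i}. E m (insert i I) * (\<Prod>i\<in>insert i I. x i / (1 - x i)))"
  proof (rule sum.cong[OF refl])
    fix i assume "i \<in> {..<m}"
    then have i: "i < m" by simp
    have "(\<Sum>I\<in>Pow {..<i}. E m (insert i I) * (\<Prod>i\<in>insert i I. x i / (1 - x i)))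
      = (\<Sum>I\<in>Pow {..<i}. e m i * (x i / (1 - x i)) * (E i I * (\<Prod>i\<in>I. x i / (1 - x i))))"
    proof (rule sum.cong[OF refl])
      fix I assume "I \<in> Pow {..<i}"
      then have I: "I \<subseteq> {..<i}" by simp
      then have "finite I" "i \<notin> I" using finite_subset by auto
      then show "E m (insert i I) * (\<Prod>i\<in>insert i I. x i / (1 - x i)) = e m i * (x i / (1 - x i)) * (E i I * (\<Prod>i\<in>I. x i / (1 - x i)))"
        using E1[OF i less.prems I] by simp
    qed
    then show "e m i * x i * suminf (u i) = (\<Sum>I\<in>Pow {..<i}. E m (insert i I) * (\<Prod>i\<in>insert i I. x i / (1 - x i)))"
      using IH(2)[OF i] by (simp add: sum_distrib_left mult.assoc)
  qed
  finally have "u m 0 + suminf v = (\<Sum>I\<in>Pow {..<m}. E m I * (\<Prod>i\<in>I. x i / (1 - x i)))"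
    using u0[OF less.prems] E0[OF less.prems] by (simp add: sum_Pow_split_Max[of _ m])
  then show ?case using S by simp
qed

lemma sorted_list_of_set_insert_greatest:
  fixes i :: nat
  assumes "I \<subseteq> {..<i}"
  shows "sorted_list_of_set (insert i I) = sorted_list_of_set I @ [i]"
proof -
  have f: "finite I" using assms finite_subset by auto
  have "sorted (sorted_list_of_set I @ [i])" "distinct (sorted_list_of_set I @ [i])"
    using f assms by (auto simp: sorted_append)
  from sorted_list_of_set.idem_if_sorted_distinct[OF this] f show ?thesis by simp
qed

lemma idx_insert:
  assumes I: "I \<subseteq> {..<i}"
  shows "j \<le> Suc (card I) ==> idx m (insert i I) j = idx i I j"
    "j = Suc (Suc (card I)) ==> idx m (insert i I) j = m" "card (insert i I) = Suc (card I)"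
    "idx i I 1 \<le> i" "idx i I (Suc (card I)) = i"
proof -
  have f: "finite I" "i \<notin> I" using I finite_subset by auto
  show c: "card (insert i I) = Suc (card I)" using f by simp
  have l: "length (sorted_list_of_set I) = card I" by simp
  show "j \<le> Suc (card I) ==> idx m (insert i I) j = idx i I j"
    by (auto simp: idx_def c sorted_list_of_set_insert_greatest[OF I] nth_append)
  show "j = Suc (Suc (card I)) ==> idx m (insert i I) j = m"
    by (simp add: idx_def c)
  show "idx i I (Suc (card I)) = i" by (simp add: idx_def)
  show "idx i I 1 \<le> i"
  proof (cases "I = {}")
    case False
    then have "sorted_list_of_set I ! 0 \<in> set (sorted_list_of_set I)" using f l by (intro nth_mem) (auto simp: card_gt_0_iff)
    then have "sorted_list_of_set I ! 0 \<in> I" using f by simp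
    then show ?thesis using I False f by (auto simp: idx_def)
  qed (simp add: idx_def)
qed

lemma qpoch_add: "qpoch y z (r + s) = qpoch y z r * qpoch (y * z ^ r) z s"
proof (induction s)
  case (Suc s)
  then show ?case by (simp add: qpoch_def power_add mult.assoc)
qed (simp add: qpoch_def)

text \<open>For \<open>i < m\<close> this is \<open>f_poly\<close> of the one-element chain at
  \<open>i\<close>, the factor that a new largest element contributes.\<close>

fun step_poly :: "lattice_type => nat => nat => 'a::field => 'a" where
  "step_poly (FType d) m i x = gauss_binom m i (x\<^sup>2) * qpoch (x ^ (2 * (i + d) + 1)) (x\<^sup>2) (m - i)"
| "step_poly GType m i x = gauss_binom m i x * qpoch (x ^ (i + 1)) x (m - i)"
| "step_poly HType m i x = inverse (qpoch (x\<^sup>2) (x\<^sup>2) ((m - i) div 2)) * qpoch (x ^ (i + 1)) x (m - i)"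

lemma f_poly_empty: "f_poly T m {} x = 1"
  by (cases T) (auto simp: gauss_multinom_def qpoch_def idx_def)

text \<open>The Pochhammer factor runs from the smallest element of the chain up to \<open>m\<close>
  and splits at \<open>i\<close>; the other factors belong to consecutive pairs, of which only the
  last involves \<open>m\<close>.\<close>

lemma f_poly_insert:
  assumes i: "i < m" and I: "I \<subseteq> {..<i}"
  shows "f_poly T m (insert i I) x = step_poly T m i x * f_poly T i I x"
proof -
  note ii = idx_insert[OF I]
  define a where "a = idx i I 1"
  have a: "idx m (insert i I) 1 = a" "a \<le> i" using ii(1)[of 1 m] ii(4) by (auto simp: a_def)
  have mult: "(\<Prod>j=1..card (insert i I). h (idx m (insert i I) (j + 1)) (idx m (insert i I) j))
    = h m i * (\<Prod>j=1..card I. h (idx i I (j + 1)) (idx i I j))" for h :: "nat => nat => 'a"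
  proof -
    have "(\<Prod>j=1..card I. h (idx m (insert i I) (j + 1)) (idx m (insert i I) j))
      = (\<Prod>j=1..card I. h (idx i I (j + 1)) (idx i I j))"
      by (rule prod.cong[OF refl]) (simp add: ii(1))
    then show ?thesis using ii(1)[of "Suc (card I)" m] ii(2)[of _ m] by (simp add: ii(3,5))
  qed
  have q1: "qpoch (x ^ (a + 1)) x (m - a) = qpoch (x ^ (a + 1)) x (i - a) * qpoch (x ^ (i + 1)) x (m - i)"
  proof -
    have "m - a = (i - a) + (m - i)" "x ^ (a + 1) * x ^ (i - a) = x ^ (i + 1)"
      using a i by (auto simp: power_add[symmetric])
    then show ?thesis using qpoch_add[of "x ^ (a + 1)" x "i - a" "m - i"] by (simp only:)
  qed
  have q2: "qpoch (x ^ (2 * (a + d) + 1)) (x\<^sup>2) (m - a) = qpoch (x ^ (2 * (a + d) + 1)) (x\<^sup>2) (i - a) * qpoch (x ^ (2 * (i + d) + 1)) (x\<^sup>2) (m - i)" for d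
  proof -
    have e: "2 * (a + d) + 1 + 2 * (i - a) = 2 * (i + d) + 1" using a by simp
    have "m - a = (i - a) + (m - i)" "x ^ (2 * (a + d) + 1) * (x\<^sup>2) ^ (i - a) = x ^ (2 * (i + d) + 1)"
      using a i by (simp_all only: power_mult[symmetric] power_add[symmetric] e)
    then show ?thesis using qpoch_add[of "x ^ (2 * (a + d) + 1)" "x\<^sup>2" "i - a" "m - i"] by (simp only:)
  qed
  show ?thesis
  proof (cases T)
    case (FType d)
    then show ?thesis using mult[of "\<lambda>b c. gauss_binom b c (x\<^sup>2)"] q2[of d] a
      by (simp add: gauss_multinom_def a_def)
  next
    case GType
    then show ?thesis using mult[of "\<lambda>b c. gauss_binom b c x"] q1 a
      by (simp add: gauss_multinom_def a_def)
  next
    case HType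
    then show ?thesis using mult[of "\<lambda>b c. inverse (qpoch (x\<^sup>2) (x\<^sup>2) ((b - c) div 2))"] q1 a
      by (simp add: gap_def a_def)
  qed
qed

section \<open>Integral elements of a number field and finiteness of residues modulo a rational
  prime\<close>

section \<open>Completions of rings of integers\<close>

definition int_span :: "'s set => ('s => 'k::field_char_0) => 'k set" where
  "int_span S v = {\<Sum>t\<in>S. of_int (c t) * v t | c. True}"

lemma int_spanI: "(\<Sum>t\<in>S. of_int (c t) * v t) \<in> int_span S v"
  by (auto simp: int_span_def)

lemma int_span_add: "x \<in> int_span S v ==> y \<in> int_span S v ==> x + y \<in> int_span S v"
proof -
  assume "x \<in> int_span S v" "y \<in> int_span S v"
  then obtain c d where "x = (\<Sum>t\<in>S. of_int (c t) * v t)" "y = (\<Sum>t\<in>S. of_int (d t) * v t)"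
    by (auto simp: int_span_def)
  then have "x + y = (\<Sum>t\<in>S. of_int (c t + d t) * v t)" by (simp add: sum.distrib distrib_right)
  then show ?thesis by (metis int_spanI)
qed

lemma int_span_mult: "x \<in> int_span S v ==> of_int n * x \<in> int_span S v"
proof -
  assume "x \<in> int_span S v"
  then obtain c where "x = (\<Sum>t\<in>S. of_int (c t) * v t)" by (auto simp: int_span_def)
  then have "of_int n * x = (\<Sum>t\<in>S. of_int (n * c t) * v t)" by (simp add: sum_distrib_left mult.assoc)
  then show ?thesis by (metis int_spanI)
qed

lemma int_span_0: "0 \<in> int_span S v"
  using int_spanI[of "\<lambda>_. 0" v S] by simp

lemma int_span_sum:
  assumes "!!i. i \<in> I ==> f i \<in> int_span S v"
  shows "(\<Sum>i\<in>I. of_int (c i) * f i) \<in> int_span S v"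
  using assms
  by (induction I rule: infinite_finite_induct) (auto intro!: int_span_add int_span_mult int_span_0)

lemma int_span_base: "finite S ==> s \<in> S ==> v s \<in> int_span S v"
proof -
  assume f: "finite S" "s \<in> S"
  have "(\<Sum>t\<in>S. of_int (if t = s then 1 else 0) * v t) = (\<Sum>t\<in>S. if t = s then v t else 0)"
    by (intro sum.cong) auto
  also have "\<dots> = v s" using f by simp
  finally show ?thesis using int_spanI[of "\<lambda>t. if t = s then 1 else 0" v S] by simp
qed

lemma int_span_closed:
  assumes "!!s. s \<in> S ==> x * v s \<in> int_span S v" "w \<in> int_span S v"
  shows "x * w \<in> int_span S v"
proof -
  obtain c where "w = (\<Sum>t\<in>S. of_int (c t) * v t)" using assms by (auto simp: int_span_def)
  then have "x * w = (\<Sum>t\<in>S. of_int (c t) * (x * v t))" by (simp add: sum_distrib_left mult.left_commute)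
  then show ?thesis using int_span_sum[OF assms(1)] by simp
qed

text \<open>Determinant trick: multiplication by \<open>x\<close> acts on the spanning family
  through an integer matrix, so \<open>x\<close> is an eigenvalue of it and a root of its monic
  characteristic polynomial.\<close>

lemma algebraic_int_of_stable_span:
  fixes v :: "'s => 'k::field_char_0"
  assumes S: "finite S" "s0 \<in> S" "v s0 \<noteq> 0"
    and x: "!!s. s \<in> S ==> x * v s \<in> int_span S v"
  shows "algebraic_int x"
proof -
  define n where "n = card S"
  obtain h where h: "bij_betw h {0..<n} S" using ex_bij_betw_nat_finite[OF S(1)] by (auto simp: n_def)
  have hS: "h i \<in> S" if "i < n" for i using bij_betwE[OF h] that by auto
  have "\<exists>c. x * v s = (\<Sum>t\<in>S. of_int (c t) * v t)" if "s \<in> S" for s using x[OF that] by (auto simp: int_span_def)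
  then obtain c where c: "!!s. s \<in> S ==> x * v s = (\<Sum>t\<in>S. of_int (c s t) * v t)" by metis
  define A0 :: "int mat" where "A0 = mat n n (\<lambda>(i, j). c (h i) (h j))"
  define A :: "'k mat" where "A = map_mat of_int A0"
  define w where "w = Matrix.vec n (\<lambda>i. v (h i))"
  have A0: "A0 \<in> carrier_mat n n" and A: "A \<in> carrier_mat n n" by (auto simp: A0_def A_def)
  have "A *\<^sub>v w = x \<cdot>\<^sub>v w"
  proof (rule eq_vecI)
    fix i assume "i < dim_vec (x \<cdot>\<^sub>v w)"
    then have i: "i < n" by (simp add: w_def)
    have "(A *\<^sub>v w) $ i = (\<Sum>j=0..<n. of_int (c (h i) (h j)) * v (h j))"
      using i by (simp add: A_def A0_def w_def scalar_prod_def)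
    also have "\<dots> = (\<Sum>t\<in>S. of_int (c (h i) t) * v t)"
      by (rule sum.reindex_bij_betw[OF h])
    also have "\<dots> = x * v (h i)" using c[OF hS[OF i]] by simp
    finally show "(A *\<^sub>v w) $ i = (x \<cdot>\<^sub>v w) $ i" using i by (simp add: w_def)
  qed (simp add: A_def A0_def w_def)
  moreover have "w \<noteq> 0\<^sub>v n"
  proof
    assume w0: "w = 0\<^sub>v n"
    obtain i where i: "i < n" "h i = s0" using S(2) bij_betw_imp_surj_on[OF h] by (metis atLeastLessThan_iff imageE)
    have "w $ i = 0" using w0 i by simp
    then show False using i S by (simp add: w_def)
  qed
  moreover have "w \<in> carrier_vec n" by (simp add: w_def)
  ultimately have "eigenvalue A x" using A by (auto simp: eigenvalue_def eigenvector_def)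
  then have root: "poly (char_poly A) x = 0" using eigenvalue_root_char_poly[OF A] by simp
  have cp: "char_poly A = map_poly of_int (char_poly A0)"
    unfolding A_def using A0 by (rule of_int_hom.char_poly_hom)
  show ?thesis
  proof (rule algebraic_int.intros[OF _ _ root])
    show "lead_coeff (char_poly A) = 1" using degree_monic_char_poly[OF A] by simp
    show "\<forall>i. Polynomial.coeff (char_poly A) i \<in> \<int>" unfolding cp by (simp add: coeff_map_poly)
  qed
qed

context
  fixes x y :: "'k::field_char_0" and m k :: nat and p :: "int poly"
  assumes m: "m > 0" and k: "k > 0"
    and p: "lead_coeff p = 1" "degree p = k" "poly (map_poly of_int p) y = 0"
    and red: "!!b. b < k ==> x ^ m * y ^ b \<in> int_span ({..<m} \<times> {..<k}) (\<lambda>(i, j). x ^ i * y ^ j)"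
begin

text \<open>Monomials of bounded exponents. The relation that lowers the exponent of
  \<open>x\<close> is kept abstract in \<open>red\<close>, so that its coefficients may be integers
  or involve \<open>y\<close>.\<close>

abbreviation "SP \<equiv> int_span ({..<m} \<times> {..<k}) (\<lambda>(i, j). x ^ i * y ^ j)"

lemma SP_base: "i < m ==> j < k ==> x ^ i * y ^ j \<in> SP"
  using int_span_base[of "{..<m} \<times> {..<k}" "(i, j)" "\<lambda>(i, j). x ^ i * y ^ j"] by simp

lemma y_pow: "y ^ k = (\<Sum>i<k. of_int (- Polynomial.coeff p i) * y ^ i)"
proof -
  have "degree (map_poly of_int p :: 'k poly) = k" using p(2) by (simp add: degree_map_poly)
  then have "0 = (\<Sum>i\<le>k. of_int (Polynomial.coeff p i) * y ^ i)" using p(3) by (simp add: poly_altdef coeff_map_poly)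
  also have "\<dots> = (\<Sum>i<k. of_int (Polynomial.coeff p i) * y ^ i) + y ^ k" using p(1,2) by (simp add: lessThan_Suc_atMost[symmetric])
  finally have "y ^ k = - (\<Sum>i<k. of_int (Polynomial.coeff p i) * y ^ i)" by (simp add: eq_neg_iff_add_eq_0 add.commute)
  then show ?thesis by (simp add: sum_negf)
qed

lemma SP_x: "w \<in> SP ==> x * w \<in> SP"
proof (rule int_span_closed)
  fix s assume "s \<in> {..<m} \<times> {..<k}"
  then obtain i j where s: "s = (i, j)" "i < m" "j < k" by auto
  show "x * (case s of (i, j) => x ^ i * y ^ j) \<in> SP"
  proof (cases "Suc i < m")
    case True
    then show ?thesis using SP_base[of "Suc i" j] s by (simp add: mult.assoc)
  next
    case False
    then have "m = Suc i" using s by simp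
    then show ?thesis using red[of j] s by (simp add: mult.assoc)
  qed
qed

lemma SP_y: "w \<in> SP ==> y * w \<in> SP"
proof (rule int_span_closed)
  fix s assume "s \<in> {..<m} \<times> {..<k}"
  then obtain i j where s: "s = (i, j)" "i < m" "j < k" by auto
  show "y * (case s of (i, j) => x ^ i * y ^ j) \<in> SP"
  proof (cases "Suc j < k")
    case True
    then show ?thesis using SP_base[of i "Suc j"] s by (simp add: ac_simps)
  next
    case False
    then have k': "k = Suc j" using s by simp
    have "y * (x ^ i * y ^ j) = x ^ i * y ^ k" using k' by (simp add: ac_simps)
    also have "\<dots> = (\<Sum>l<k. of_int (- Polynomial.coeff p l) * (x ^ i * y ^ l))"
      unfolding y_pow by (simp add: sum_distrib_left sum_negf ac_simps)
    also have "\<dots> \<in> SP" using SP_base s by (intro int_span_sum) auto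
    finally show ?thesis using s by simp
  qed
qed

lemma SP_algebraic_int:
  assumes "!!w. w \<in> SP ==> z * w \<in> SP"
  shows "algebraic_int z"
proof (rule algebraic_int_of_stable_span[of "{..<m} \<times> {..<k}" "(0, 0)" "\<lambda>(i, j). x ^ i * y ^ j"])
  fix s assume "s \<in> {..<m} \<times> {..<k}"
  then show "z * (case s of (i, j) => x ^ i * y ^ j) \<in> SP"
    using assms[OF int_span_base[of "{..<m} \<times> {..<k}" s "\<lambda>(i, j). x ^ i * y ^ j"]] by simp
qed (use m k in auto)

lemma SP_conclusions: "algebraic_int x" "algebraic_int (x + y)" "algebraic_int (x * y)"
proof -
  show "algebraic_int x" by (rule SP_algebraic_int[OF SP_x])
  show "algebraic_int (x + y)" by (rule SP_algebraic_int) (simp add: distrib_right int_span_add SP_x SP_y)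
  show "algebraic_int (x * y)" by (rule SP_algebraic_int) (simp add: mult.assoc SP_x SP_y)
qed

end

lemma algebraic_int_obtain:
  fixes y :: "'k::field_char_0"
  assumes "algebraic_int y"
  obtains p where "lead_coeff p = (1::int)" "degree p > 0" "poly (map_poly of_int p) y = 0"
proof -
  obtain p where p: "poly (map_poly of_int p) y = 0" "lead_coeff p = 1"
    using assms by (auto simp: algebraic_int_altdef_ipoly)
  have "degree p \<noteq> 0"
  proof
    assume "degree p = 0"
    then obtain c where "p = [:c:]" by (metis degree_eq_zeroE)
    then show False using p by simp
  qed
  then show thesis using that p by blast
qed

lemma algebraic_int_add_mult:
  fixes x y :: "'k::field_char_0"
  assumes "algebraic_int x" "algebraic_int y"
  shows "algebraic_int (x + y)" "algebraic_int (x * y)"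
proof -
  obtain p where p: "lead_coeff p = (1::int)" "degree p > 0" "poly (map_poly of_int p) x = 0"
    using algebraic_int_obtain[OF assms(1)] .
  obtain r where r: "lead_coeff r = (1::int)" "degree r > 0" "poly (map_poly of_int r) y = 0"
    using algebraic_int_obtain[OF assms(2)] .
  let ?S = "int_span ({..<degree p} \<times> {..<degree r}) (\<lambda>(i, j). x ^ i * y ^ j)"
  have red: "x ^ degree p * y ^ b \<in> ?S" if b: "b < degree r" for b
  proof -
    have "degree (map_poly of_int p :: 'k poly) = degree p" by (simp add: degree_map_poly)
    then have "0 = (\<Sum>i\<le>degree p. of_int (Polynomial.coeff p i) * x ^ i)" using p(3) by (simp add: poly_altdef coeff_map_poly)
    also have "\<dots> = (\<Sum>i<degree p. of_int (Polynomial.coeff p i) * x ^ i) + x ^ degree p" using p(1) by (simp add: lessThan_Suc_atMost[symmetric])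
    finally have e: "x ^ degree p = - (\<Sum>i<degree p. of_int (Polynomial.coeff p i) * x ^ i)" by (simp add: eq_neg_iff_add_eq_0 add.commute)
    have "x ^ degree p * y ^ b = (\<Sum>i<degree p. of_int (- Polynomial.coeff p i) * (x ^ i * y ^ b))"
      unfolding e by (simp add: sum_distrib_left sum_distrib_right sum_negf ac_simps)
    also have "\<dots> \<in> ?S"
    proof (rule int_span_sum)
      fix i assume "i \<in> {..<degree p}"
      then show "x ^ i * y ^ b \<in> ?S"
        using int_span_base[of "{..<degree p} \<times> {..<degree r}" "(i, b)" "\<lambda>(i, j). x ^ i * y ^ j"] b by simp
    qed
    finally show ?thesis .
  qed
  show "algebraic_int (x + y)" "algebraic_int (x * y)"
    using SP_conclusions[OF p(2) r(2,1) refl r(3) red] by auto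
qed

text \<open>With \<open>y = x ^ j - x ^ i\<close> the relation \<open>x ^ j = x ^ i + y\<close> is
  monic in \<open>x\<close>, so the monomials in \<open>x\<close> and \<open>y\<close> span a stable
  lattice.\<close>

lemma algebraic_int_of_power_diff:
  fixes x :: "'k::field_char_0"
  assumes y: "algebraic_int (x ^ j - x ^ i)" and ij: "i < j"
  shows "algebraic_int x"
proof -
  let ?y = "x ^ j - x ^ i"
  obtain r where r: "lead_coeff r = (1::int)" "degree r > 0" "poly (map_poly of_int r) ?y = 0"
    using algebraic_int_obtain[OF y] .
  let ?k = "degree r"
  let ?S = "int_span ({..<j} \<times> {..<?k}) (\<lambda>(a, b). x ^ a * ?y ^ b)"
  have base: "x ^ a * ?y ^ b \<in> ?S" if "a < j" "b < ?k" for a b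
    using int_span_base[of "{..<j} \<times> {..<?k}" "(a, b)" "\<lambda>(a, b). x ^ a * ?y ^ b"] that by simp
  have red: "x ^ j * ?y ^ b \<in> ?S" if b: "b < ?k" for b
  proof -
    have "x ^ j * ?y ^ b = x ^ i * ?y ^ b + ?y ^ Suc b" by (simp add: algebra_simps)
    moreover have "?y ^ Suc b \<in> ?S"
    proof (cases "Suc b < ?k")
      case True
      then show ?thesis using base[of 0 "Suc b"] ij by simp
    next
      case False
      then have kb: "?k = Suc b" using b by simp
      have "degree (map_poly of_int r :: 'k poly) = ?k" by (simp add: degree_map_poly)
      then have "0 = (\<Sum>i\<le>?k. of_int (Polynomial.coeff r i) * ?y ^ i)" using r(3) by (simp add: poly_altdef coeff_map_poly)
      also have "\<dots> = (\<Sum>i<?k. of_int (Polynomial.coeff r i) * ?y ^ i) + ?y ^ ?k" using r(1) by (simp add: lessThan_Suc_atMost[symmetric])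
      finally have "?y ^ ?k = (\<Sum>i<?k. of_int (- Polynomial.coeff r i) * (x ^ 0 * ?y ^ i))"
        by (simp add: eq_neg_iff_add_eq_0 add.commute sum_negf)
      moreover have "(\<Sum>i<?k. of_int (- Polynomial.coeff r i) * (x ^ 0 * ?y ^ i)) \<in> ?S" using ij by (intro int_span_sum base) auto
      ultimately show ?thesis using kb by simp
    qed
    moreover have "x ^ i * ?y ^ b \<in> ?S" using base[OF ij b] .
    ultimately show ?thesis using int_span_add by simp
  qed
  have j: "j > 0" using ij by simp
  show ?thesis using SP_conclusions(1)[OF j r(2,1) refl r(3) red] .
qed

lemma algebraic_int_of_int: "algebraic_int (of_int n :: 'k::field_char_0)"
  by (rule int_imp_algebraic_int) simp

lemma algebraic_int_of_nat: "algebraic_int (of_nat n :: 'k::field_char_0)"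
  by (rule int_imp_algebraic_int) simp

lemma algebraic_int_1': "algebraic_int (1 :: 'k::field_char_0)"
  by (rule int_imp_algebraic_int) simp

lemma algebraic_int_diff:
  fixes x y :: "'k::field_char_0"
  shows "algebraic_int x ==> algebraic_int y ==> algebraic_int (x - y)"
  using algebraic_int_add_mult(1)[of x "- y"] by simp

lemma algebraic_int_pow:
  fixes x :: "'k::field_char_0"
  shows "algebraic_int x ==> algebraic_int (x ^ n)"
  by (induction n) (auto intro: algebraic_int_add_mult algebraic_int_1')

lemma algebraic_int_sum_of_int:
  fixes f :: "'s => 'k::field_char_0"
  shows "(!!i. i \<in> I ==> algebraic_int (f i)) ==> algebraic_int (\<Sum>i\<in>I. of_int (c i) * f i)"
  by (induction I rule: infinite_finite_induct) (auto intro!: algebraic_int_add_mult algebraic_int_of_int)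

lemmas algint = algebraic_int_add_mult algebraic_int_diff algebraic_int_pow algebraic_int_of_int
  algebraic_int_of_nat algebraic_int_1' algebraic_int_sum_of_int

lemma integer_ring_simps [simp]:
  "carrier (integer_ring :: 'k::field_char_0 ring) = {x. algebraic_int x}"
  "x \<otimes>\<^bsub>integer_ring\<^esub> y = x * y" "x \<oplus>\<^bsub>integer_ring\<^esub> y = x + y"
  "\<one>\<^bsub>integer_ring\<^esub> = 1" "\<zero>\<^bsub>integer_ring\<^esub> = (0 :: 'k)"
  by (simp_all add: integer_ring_def)

lemma integer_ring_domain: "domain (integer_ring :: 'k::field_char_0 ring)"
proof (rule domain.intro)
  show c: "cring (integer_ring :: 'k ring)"
  proof (rule cringI)
    show "abelian_group (integer_ring :: 'k ring)"
      by (rule abelian_groupI) (auto intro: algint exI[of _ "- x" for x] simp: add.assoc add.commute add_eq_0_iff)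
    show "comm_monoid (integer_ring :: 'k ring)"
      by (rule comm_monoidI) (auto intro: algint simp: mult.assoc mult.commute)
  qed (simp add: distrib_right)
  show "domain_axioms (integer_ring :: 'k ring)" by unfold_locales auto
qed

definition mod_cls :: "nat => 'k::field_char_0 => 'k set" where
  "mod_cls p x = {y. algebraic_int ((x - y) / of_nat p)}"

context
  fixes B :: "'k::field_char_0 set" and p :: nat
  assumes B: "finite B" "Modules.module.span (\<lambda>r x. of_rat r * x) B = (UNIV :: 'k set)"
    and p: "prime p"
begin

text \<open>Linear independence over the field with \<open>p\<close> elements in the ring of
  integers modulo \<open>p\<close>, expressed with integer coefficients.\<close>

definition p_indep :: "'k set => bool" where
  "p_indep X \<longleftrightarrow> finite X \<and> (\<forall>x\<in>X. algebraic_int x) \<and>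
     (\<forall>n. algebraic_int ((\<Sum>x\<in>X. of_int (n x) * x) / of_nat p) --> (\<forall>x\<in>X. int p dvd n x))"

text \<open>Independence modulo \<open>p\<close> implies rational independence by descent: in an
  integral relation with least nonzero coefficient at \<open>v\<close> all coefficients are
  divisible by \<open>p\<close>, and dividing gives a smaller one.\<close>

lemma p_indep_card:
  assumes X: "p_indep X"
  shows "card X \<le> card B"
proof -
  interpret Q: Vector_Spaces.vector_space "\<lambda>r (x::'k). of_rat r * x"
    by unfold_locales (auto simp: of_rat_add of_rat_mult algebra_simps)
  have fX: "finite X" using X by (simp add: p_indep_def)
  have p0: "of_nat p \<noteq> (0::'k)" using p by auto
  have "Q.independent X"
  proof
    assume "Q.dependent X"
    then obtain u v where u: "v \<in> X" "u v \<noteq> 0" "(\<Sum>x\<in>X. of_rat (u x) * x) = 0"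
      using Q.dependent_finite[OF fX] by auto
    have q: "\<exists>a b. u x = of_int a / of_int b \<and> b > 0" for x
      by (metis quotient_of_div quotient_of_denom_pos surj_pair)
    then obtain a b where ab: "!!x. u x = of_int (a x) / of_int (b x)" "!!x. b x > (0::int)" by metis
    define N where "N = (\<Prod>x\<in>X. b x)"
    have N: "N > 0" unfolding N_def using ab by (simp add: prod_pos)
    have "\<exists>m. of_int N * u x = of_int m" if "x \<in> X" for x
    proof -
      have "b x dvd N" unfolding N_def using fX that by (rule dvd_prodI)
      then obtain k where "N = b x * k" by auto
      then have "of_int N * u x = of_int (k * a x)" using ab[of x] by simp
      then show ?thesis by blast
    qed
    then obtain m where m: "!!x. x \<in> X ==> of_int N * u x = of_int (m x)" by metis
    define rel where "rel n \<longleftrightarrow> (\<Sum>x\<in>X. of_int (n x) * x) = 0 \<and> n v \<noteq> 0" for n :: "'k => int"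
    have "(\<Sum>x\<in>X. of_int (m x) * x) = (\<Sum>x\<in>X. of_rat (of_int N) * (of_rat (u x) * x))"
    proof (rule sum.cong[OF refl])
      fix x assume "x \<in> X"
      then have "(of_rat (of_int (m x)) :: 'k) = of_rat (of_int N) * of_rat (u x)"
        using m[of x] by (metis of_rat_mult)
      then show "of_int (m x) * x = of_rat (of_int N) * (of_rat (u x) * x)" by (simp add: mult.assoc)
    qed
    also have "\<dots> = 0" using u(3) by (simp add: sum_distrib_left[symmetric])
    finally have "rel m" using m[OF u(1)] u(2) N by (auto simp: rel_def)
    then obtain n where n: "rel n" and mn: "!!n'. rel n' ==> nat \<bar>n v\<bar> \<le> nat \<bar>n' v\<bar>"
      using ex_has_least_nat[of rel m "\<lambda>n. nat \<bar>n v\<bar>"] by auto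
    have dv: "int p dvd n x" if "x \<in> X" for x
      using X that n by (auto simp: p_indep_def rel_def)
    have e: "n x = int p * (n x div int p)" if "x \<in> X" for x using dv[OF that] by simp
    have "(\<Sum>x\<in>X. of_int (n x) * x) = of_nat p * (\<Sum>x\<in>X. of_int (n x div int p) * x)"
      unfolding sum_distrib_left
    proof (rule sum.cong[OF refl])
      fix x assume "x \<in> X"
      show "of_int (n x) * x = of_nat p * (of_int (n x div int p) * x)"
        by (subst e[OF \<open>x \<in> X\<close>]) simp
    qed
    then have "rel (\<lambda>x. n x div int p)" using n p0 e[OF u(1)] by (auto simp: rel_def)
    from mn[OF this] have le: "\<bar>n v\<bar> \<le> \<bar>n v div int p\<bar>" by simp
    have "\<bar>n v\<bar> = int p * \<bar>n v div int p\<bar>" by (subst e[OF u(1)]) (simp add: abs_mult)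
    moreover have "\<bar>n v div int p\<bar> > 0" using n e[OF u(1)] by (auto simp: rel_def)
    moreover have "int p \<ge> 2" using prime_ge_2_nat[OF p] by simp
    ultimately have "\<bar>n v\<bar> \<ge> 2 * \<bar>n v div int p\<bar>" by (metis mult_right_mono abs_ge_zero)
    then show False using le \<open>\<bar>n v div int p\<bar> > 0\<close> by linarith
  qed
  moreover have "X \<subseteq> Q.span B" using B by simp
  ultimately show ?thesis using Q.independent_span_bound[OF B(1)] by blast
qed

text \<open>An independent set \<open>X\<close> of maximal size spans modulo \<open>p\<close>, so
  combinations of \<open>X\<close> with coefficients from 0 to \<open>p - 1\<close> represent all
  residues.\<close>

lemma finite_mod_p:
  obtains F :: "'k set" where "finite F" "!!f. f \<in> F ==> algebraic_int f"
    "!!x. algebraic_int x ==> \<exists>f\<in>F. algebraic_int ((x - f) / of_nat p)"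
proof -
  have p0: "of_nat p \<noteq> (0::'k)" using p by auto
  have "p_indep {}" by (simp add: p_indep_def)
  then obtain X where X: "p_indep X" and mx: "!!Y. p_indep Y ==> card Y \<le> card X"
    using ex_has_greatest_nat[of p_indep "{}" card "Suc (card B)"] p_indep_card by (auto simp: less_Suc_eq_le)
  have fX: "finite X" and XO: "!!x. x \<in> X ==> algebraic_int x" using X by (auto simp: p_indep_def)
  define F where "F = (\<lambda>c. \<Sum>t\<in>X. of_int (c t) * t) ` (X \<rightarrow>\<^sub>E {0..<int p})"
  show thesis
  proof (rule that)
    show "finite F" unfolding F_def using fX by (intro finite_imageI finite_PiE) auto
    show "algebraic_int f" if "f \<in> F" for f using that XO by (auto simp: F_def intro!: algint)
    fix x :: 'k assume x: "algebraic_int x"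
    have "\<exists>c. algebraic_int ((x - (\<Sum>t\<in>X. of_int (c t) * t)) / of_nat p)"
    proof (cases "x \<in> X")
      case True
      have "(\<Sum>t\<in>X. of_int (if t = x then 1 else 0) * t) = (\<Sum>t\<in>X. if t = x then t else 0)"
        by (intro sum.cong) auto
      also have "\<dots> = x" using True fX by simp
      finally show ?thesis by (intro exI[of _ "\<lambda>t. if t = x then 1 else 0"]) simp
    next
      case False
      have "\<not> p_indep (insert x X)" using mx[of "insert x X"] False fX by auto
      then obtain n y where n: "algebraic_int ((\<Sum>t\<in>insert x X. of_int (n t) * t) / of_nat p)"
        "y \<in> insert x X" "\<not> int p dvd n y"
        using fX XO x by (auto simp: p_indep_def)
      have nx: "\<not> int p dvd n x"
      proof
        assume d: "int p dvd n x"
        then have "of_int (n x) * x / of_nat p = of_int (n x div int p) * x"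
          using p0 by (auto elim!: dvdE)
        then have "(\<Sum>t\<in>X. of_int (n t) * t) / of_nat p = (\<Sum>t\<in>insert x X. of_int (n t) * t) / of_nat p - of_int (n x div int p) * x"
          using False fX by (simp add: add_divide_distrib)
        then have "algebraic_int ((\<Sum>t\<in>X. of_int (n t) * t) / of_nat p)"
          using n(1) x by (auto intro!: algint)
        then have "\<forall>t\<in>X. int p dvd n t" using X by (auto simp: p_indep_def)
        then show False using n d by auto
      qed
      \<comment> \<open>The coefficient of \<open>x\<close> is invertible modulo \<open>p\<close>,
        so the relation can be solved for \<open>x\<close>.\<close>
      have "coprime (n x) (int p)" using nx p by (metis coprime_commute prime_imp_coprime prime_nat_int_transfer)
      then have "gcd (n x) (int p) = 1" by (rule coprime_imp_gcd_eq_1)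
      then obtain m k where mk: "m * n x + k * int p = 1" using bezout_int[of "n x" "int p"] by auto
      have mk': "of_int m * of_int (n x) + of_int k * of_nat p = (1 :: 'k)"
        using arg_cong[OF mk, of "of_int :: int => 'k"] by simp
      have "x - (\<Sum>t\<in>X. of_int (- (m * n t)) * t) = of_int m * (\<Sum>t\<in>insert x X. of_int (n t) * t) + of_nat p * (of_int k * x)"
      proof -
        have "x = (of_int m * of_int (n x) + of_int k * of_nat p) * x" by (simp add: mk')
        then show ?thesis using False fX by (simp add: sum_distrib_left sum_negf algebra_simps)
      qed
      then have "(x - (\<Sum>t\<in>X. of_int (- (m * n t)) * t)) / of_nat p
        = of_int m * ((\<Sum>t\<in>insert x X. of_int (n t) * t) / of_nat p) + of_int k * x"
        using p0 by (simp add: add_divide_distrib)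
      then have "algebraic_int ((x - (\<Sum>t\<in>X. of_int (- (m * n t)) * t)) / of_nat p)"
        by (simp only:) (intro algebraic_int_add_mult algebraic_int_of_int n(1) x)
      then show ?thesis by (intro exI[of _ "\<lambda>t. - (m * n t)"])
    qed
    then obtain c where c: "algebraic_int ((x - (\<Sum>t\<in>X. of_int (c t) * t)) / of_nat p)" by blast
    let ?f = "\<Sum>t\<in>X. of_int (restrict (\<lambda>t. c t mod int p) X t) * t"
    have "(\<Sum>t\<in>X. of_int (c t) * t) = ?f + of_nat p * (\<Sum>t\<in>X. of_int (c t div int p) * t)"
      unfolding sum_distrib_left sum.distrib[symmetric]
    proof (rule sum.cong[OF refl])
      fix t assume t: "t \<in> X"
      have "(of_int (c t) :: 'k) = of_int (c t mod int p) + of_nat p * of_int (c t div int p)"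
        by (metis mod_mult_div_eq of_int_add of_int_mult of_int_of_nat_eq)
      then show "of_int (c t) * t = of_int (restrict (\<lambda>t. c t mod int p) X t) * t + of_nat p * (of_int (c t div int p) * t)"
        using t by (simp add: distrib_right mult.assoc)
    qed
    then have "(x - ?f) / of_nat p = (x - (\<Sum>t\<in>X. of_int (c t) * t)) / of_nat p + (\<Sum>t\<in>X. of_int (c t div int p) * t)"
      using p0 by (simp add: field_simps)
    then have "algebraic_int ((x - ?f) / of_nat p)" using c XO by (auto intro!: algint)
    moreover have "?f \<in> F" unfolding F_def using p prime_gt_0_nat[OF p]
      by (intro imageI) auto
    ultimately show "\<exists>f\<in>F. algebraic_int ((x - f) / of_nat p)" by blast
  qed
qed

lemma finite_mod_cls: "finite (mod_cls p ` {x :: 'k. algebraic_int x})"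
proof -
  obtain F :: "'k set" where F: "finite F" "!!f. f \<in> F ==> algebraic_int f"
    "!!x. algebraic_int x ==> \<exists>f\<in>F. algebraic_int ((x - f) / of_nat p)" using finite_mod_p by blast
  have "mod_cls p x \<in> mod_cls p ` F" if x: "algebraic_int x" for x :: 'k
  proof -
    obtain f where f: "f \<in> F" "algebraic_int ((x - f) / of_nat p)" using F(3)[OF x] by blast
    have "mod_cls p x = mod_cls p f"
    proof (intro equalityI subsetI)
      fix y assume "y \<in> mod_cls p x"
      then have "algebraic_int ((x - y) / of_nat p - (x - f) / of_nat p)" using f by (auto simp: mod_cls_def intro: algint)
      then show "y \<in> mod_cls p f" by (simp add: mod_cls_def diff_divide_distrib)
    next
      fix y assume "y \<in> mod_cls p f"
      then have "algebraic_int ((f - y) / of_nat p + (x - f) / of_nat p)" using f by (auto simp: mod_cls_def intro: algint)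
      then show "y \<in> mod_cls p x" by (simp add: mod_cls_def diff_divide_distrib)
    qed
    then show ?thesis using f by blast
  qed
  then have "mod_cls p ` {x :: 'k. algebraic_int x} \<subseteq> mod_cls p ` F" by auto
  then show ?thesis by (rule finite_subset) (simp add: F(1))
qed

end

lemma mod_cls_eqD:
  fixes x y :: "'k::field_char_0"
  assumes "mod_cls p x = mod_cls p y"
  shows "algebraic_int ((x - y) / of_nat p)"
proof -
  have "y \<in> mod_cls p y" by (simp add: mod_cls_def)
  then have "y \<in> mod_cls p x" using assms by simp
  then show ?thesis by (simp add: mod_cls_def)
qed

section \<open>A nonzero prime ideal and a uniformizer for it\<close>

locale number_field_prime =
  fixes P :: "'k::field_char_0 set"
  assumes nf: "number_field TYPE('k)" and prime: "primeideal P (integer_ring :: 'k ring)" and nz: "P \<noteq> {0}"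
begin

lemma P_ideal: "ideal P (integer_ring :: 'k ring)"
  using prime by (rule primeideal.axioms(1))

lemma P_sub: "x \<in> P ==> algebraic_int x"
  using ideal.Icarr[OF P_ideal] by simp

lemma P_0: "0 \<in> P"
  using additive_subgroup.zero_closed[OF ideal.axioms(1)[OF P_ideal]] by simp

lemma P_add: "x \<in> P ==> y \<in> P ==> x + y \<in> P"
  using additive_subgroup.a_closed[OF ideal.axioms(1)[OF P_ideal], of x y] by simp

lemma P_mult: "x \<in> P ==> algebraic_int y ==> x * y \<in> P"
  using ideal.I_r_closed[OF P_ideal, of x y] by simp

lemma P_mult': "x \<in> P ==> algebraic_int y ==> y * x \<in> P"
  using ideal.I_l_closed[OF P_ideal, of x y] by simp

lemma P_diff: "x \<in> P ==> y \<in> P ==> x - y \<in> P"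
  using P_add[of x "y * (- 1)"] P_mult[of y "- 1"] algebraic_int_1' by simp

lemma P_prime: "algebraic_int x ==> algebraic_int y ==> x * y \<in> P ==> x \<in> P \<or> y \<in> P"
  using primeideal.I_prime[OF prime, of x y] by simp

lemma P_1: "1 \<notin> P"
proof
  assume "1 \<in> P"
  then have "carrier (integer_ring :: 'k ring) = P" using P_mult[of 1] P_sub by auto
  then show False using primeideal.I_notcarr[OF prime] by simp
qed

lemma P_pow: "algebraic_int x ==> x ^ n \<in> P ==> x \<in> P"
  by (induction n) (use P_1 P_prime algebraic_int_pow in auto)

lemma P_prod: "finite I ==> (!!i. i \<in> I ==> algebraic_int (f i) \<and> f i \<notin> P) ==> algebraic_int (prod f I) \<and> prod f I \<notin> P"
proof (induction I rule: finite_induct)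
  case empty
  show ?case using P_1 algebraic_int_1' by simp
next
  case (insert x F)
  have "algebraic_int (f x)" "f x \<notin> P" "algebraic_int (prod f F)" "prod f F \<notin> P" using insert by auto
  then show ?case using insert P_prime[of "f x" "prod f F"] algebraic_int_add_mult(2)[of "f x" "prod f F"] by auto
qed

text \<open>The constant coefficient of an integer polynomial vanishing at a nonzero
  \<open>a\<close> in \<open>P\<close> is a multiple of \<open>a\<close>; zero constant coefficients
  are cancelled first.\<close>

lemma P_of_int: "\<exists>c::int. c \<noteq> 0 \<and> of_int c \<in> P"
proof -
  obtain a where a: "a \<in> P" "a \<noteq> 0" using nz P_0 by auto
  have *: "p \<noteq> 0 ==> poly (map_poly of_int p) a = 0 ==> ?thesis" for p :: "int poly"
  proof (induction p)
    case (pCons c p)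
    show ?case
    proof (cases "c = 0")
      case True
      then show ?thesis using pCons a by (simp add: map_poly_pCons)
    next
      case False
      have "of_int c + a * poly (map_poly of_int p) a = 0"
        using pCons(4) by (simp only: of_int_hom.map_poly_pCons_hom poly_pCons)
      then have e: "of_int c = 0 - a * poly (map_poly of_int p) a" by (simp add: eq_neg_iff_add_eq_0)
      have "algebraic_int (poly (map_poly of_int p) a)"
        unfolding poly_altdef by (simp add: coeff_map_poly) (intro algint P_sub[OF a(1)])
      then have "of_int c \<in> P" unfolding e by (intro P_diff P_0 P_mult[OF a(1)])
      then show ?thesis using False by blast
    qed
  qed simp
  obtain p :: "int poly" where p: "degree p > 0" "poly (map_poly of_int p) a = 0"
    using algebraic_int_obtain[OF P_sub[OF a(1)]] by blast
  have "p \<noteq> 0" using p(1) by auto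
  from *[OF this p(2)] show ?thesis .
qed

text \<open>The least positive integer in \<open>P\<close> has no proper factorization, because
  \<open>P\<close> is prime.\<close>

lemma P_prime_nat: "\<exists>p::nat. Factorial_Ring.prime p \<and> of_nat p \<in> P"
proof -
  obtain c :: int where c: "c \<noteq> 0" "of_int c \<in> P" using P_of_int by blast
  have "of_nat (nat \<bar>c\<bar>) \<in> P \<and> nat \<bar>c\<bar> > 0"
    using c P_diff[OF P_0 c(2)] by (cases "c \<ge> 0") auto
  then obtain m where m: "of_nat m \<in> P" "m > 0" and mn: "!!m'. of_nat m' \<in> P ==> m' > 0 ==> m \<le> m'"
    using ex_has_least_nat[of "\<lambda>m. of_nat m \<in> P \<and> m > 0" _ "\<lambda>m. m"] by blast
  have "Factorial_Ring.prime m"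
  proof (rule ccontr)
    assume np: "\<not> Factorial_Ring.prime m"
    have "m \<noteq> 1" using m P_1 by auto
    then have "m \<ge> 2" using m by simp
    then obtain a where a: "Factorial_Ring.prime a" "a dvd m" using prime_factor_nat[of m] \<open>m \<noteq> 1\<close> by auto
    then obtain b where b: "m = a * b" by (auto elim: dvdE)
    have "a \<noteq> m" using a(1) np by auto
    then have ab: "m = a * b" "a < m" "b < m" "a > 0" "b > 0"
      using m(2) b prime_ge_2_nat[OF a(1)] dvd_imp_le[OF a(2) m(2)] by auto
    have "of_nat a \<in> P \<or> of_nat b \<in> P" using P_prime[of "of_nat a" "of_nat b"] m(1) ab(1) algint by simp
    then show False using mn[of a] mn[of b] ab by auto
  qed
  then show ?thesis using m by blast
qed

text \<open>Constructs a nonintegral \<open>g\<close> that multiplies \<open>P\<close> into the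
  integers. Among the \<open>b\<close> that are nonzero in the ring modulo \<open>p\<close>
  localized at \<open>P\<close>, one with fewest multiples is killed there by \<open>P\<close>. A
  product \<open>S\<close> of denominators outside \<open>P\<close>, one for each residue, clears
  the localization and gives \<open>g = S * b / p\<close>.\<close>

lemma annihilator_mod_p:
  assumes p: "Factorial_Ring.prime p" "of_nat p \<in> P"
  obtains g where "\<not> algebraic_int g" "!!x. x \<in> P ==> algebraic_int (g * x)"
proof -
  have p0: "of_nat p \<noteq> (0::'k)" using p by auto
  obtain B where B: "finite B" "Modules.module.span (\<lambda>r x. of_rat r * x) B = (UNIV :: 'k set)"
    using nf by (auto simp: number_field_def)
  obtain F :: "'k set" where F: "finite F" "!!f. f \<in> F ==> algebraic_int f"
    "!!x. algebraic_int x ==> \<exists>f\<in>F. algebraic_int ((x - f) / of_nat p)" using finite_mod_p[OF B p(1)] by blast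
  \<comment> \<open>\<open>b\<close> is nonzero modulo \<open>p\<close> after localization at
    \<open>P\<close>.\<close>
  define good where "good b \<longleftrightarrow> algebraic_int b \<and> (\<forall>s. algebraic_int s --> s \<notin> P --> \<not> algebraic_int (s * b / of_nat p))" for b :: 'k
  define cls where "cls b = (\<lambda>y. mod_cls p (b * y)) ` {y. algebraic_int y}" for b :: 'k
  have fin_cls: "finite (cls b)" if "algebraic_int b" for b
    using finite_subset[OF _ finite_mod_cls[OF B p(1)], of "cls b"] that by (auto simp: cls_def intro: algint)
  have "good 1"
  proof -
    have "s \<in> P" if "algebraic_int s" "algebraic_int (s / of_nat p)" for s
      using P_mult[OF p(2) that(2)] p0 by simp
    then show ?thesis by (auto simp: good_def algebraic_int_1')
  qed
  then obtain b where b: "good b" and mn: "!!b'. good b' ==> card (cls b) \<le> card (cls b')"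
    using ex_has_least_nat[of good 1 "\<lambda>b. card (cls b)"] by blast
  have bO: "algebraic_int b" using b by (simp add: good_def)
  have ex: "\<exists>s. algebraic_int s \<and> s \<notin> P \<and> algebraic_int (s * (b * t) / of_nat p)" if t: "t \<in> P" for t
  proof (rule ccontr)
    have tO: "algebraic_int t" using t by (rule P_sub)
    assume "\<not> ?thesis"
    then have "good (b * t)" using bO tO by (auto simp: good_def intro: algint)
    from mn[OF this] have le: "card (cls b) \<le> card (cls (b * t))" .
    have sub: "cls (b * t) \<subseteq> cls b"
      unfolding cls_def
    proof (rule image_subsetI)
      fix y :: 'k assume "y \<in> {y. algebraic_int y}"
      then have "algebraic_int (t * y)" using tO by (auto intro: algint)
      then show "mod_cls p (b * t * y) \<in> (\<lambda>y. mod_cls p (b * y)) ` {y. algebraic_int y}"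
        by (intro image_eqI[of _ _ "t * y"]) (auto simp: mult.assoc)
    qed
    have "cls (b * t) = cls b" using card_seteq[OF fin_cls[OF bO] sub le] .
    moreover have "mod_cls p (b * 1) \<in> cls b" unfolding cls_def using algebraic_int_1' by blast
    ultimately have "mod_cls p (b * 1) \<in> cls (b * t)" by simp
    then obtain y where y: "algebraic_int y" "mod_cls p (b * 1) = mod_cls p (b * t * y)" by (auto simp: cls_def)
    \<comment> \<open>Equality of the classes makes \<open>b\<close> congruent to
      \<open>b * t * y\<close>, so \<open>1 - t * y\<close> kills \<open>b\<close> modulo
      \<open>p\<close>, although it lies outside \<open>P\<close>.\<close>
    have "algebraic_int ((1 - t * y) * b / of_nat p)" using mod_cls_eqD[OF y(2)] by (simp add: algebra_simps)
    moreover have "algebraic_int (1 - t * y)" using y tO by (intro algint)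
    moreover have "1 - t * y \<notin> P"
    proof
      assume "1 - t * y \<in> P"
      then have "1 - t * y + t * y \<in> P" using P_mult[OF t y(1)] by (rule P_add)
      then show False using P_1 by simp
    qed
    ultimately show False using b by (auto simp: good_def)
  qed
  obtain s where s: "!!t. t \<in> P ==> algebraic_int (s t) \<and> s t \<notin> P \<and> algebraic_int (s t * (b * t) / of_nat p)"
    using ex by metis
  define S where "S = (\<Prod>t\<in>F \<inter> P. s t)"
  have S: "algebraic_int S \<and> S \<notin> P" unfolding S_def using F(1) s by (intro P_prod) auto
  have S': "algebraic_int (S * (b * t) / of_nat p)" if t: "t \<in> P" for t
  proof -
    obtain f where f: "f \<in> F" "algebraic_int ((t - f) / of_nat p)" using F(3)[OF P_sub[OF t]] by blast
    have "t - f \<in> P" using P_mult[OF p(2) f(2)] p0 by simp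
    then have "f \<in> P" using P_diff[OF t] by fastforce
    then have fFP: "f \<in> F \<inter> P" using f by simp
    have "S = s f * (\<Prod>t\<in>F \<inter> P - {f}. s t)" unfolding S_def using F(1) fFP by (simp add: prod.remove)
    then have e: "S * (b * f) / of_nat p = (s f * (b * f) / of_nat p) * (\<Prod>t\<in>F \<inter> P - {f}. s t)" by simp
    have "algebraic_int (\<Prod>t\<in>F \<inter> P - {f}. s t)" using P_prod[of "F \<inter> P - {f}" s] F(1) s by auto
    moreover have "algebraic_int (s f * (b * f) / of_nat p)" using s fFP by blast
    ultimately have 1: "algebraic_int (S * (b * f) / of_nat p)" unfolding e by (intro algebraic_int_add_mult(2))
    have "S * (b * t) / of_nat p = S * (b * f) / of_nat p + S * b * ((t - f) / of_nat p)"
      using p0 by (simp add: field_simps)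
    moreover have "algebraic_int (S * b * ((t - f) / of_nat p))"
      using S bO f(2) by (intro algebraic_int_add_mult(2)) auto
    ultimately show ?thesis using algebraic_int_add_mult(1)[OF 1] by simp
  qed
  show thesis
  proof (rule that)
    show "\<not> algebraic_int (S * b / of_nat p)" using b S by (auto simp: good_def)
    show "algebraic_int (S * b / of_nat p * x)" if "x \<in> P" for x using S'[OF that] by (simp add: mult.assoc)
  qed
qed

lemma pow_repeat:
  assumes p: "Factorial_Ring.prime p" and f: "!!i::nat. algebraic_int (f i :: 'k)"
  obtains i j where "i < j" "algebraic_int ((f j - f i) / of_nat p)"
proof -
  obtain B where B: "finite B" "Modules.module.span (\<lambda>r x. of_rat r * x) B = (UNIV :: 'k set)"
    using nf by (auto simp: number_field_def)
  have "\<not> inj_on (\<lambda>i. mod_cls p (f i)) UNIV"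
  proof
    assume "inj_on (\<lambda>i. mod_cls p (f i)) UNIV"
    moreover have "range (\<lambda>i. mod_cls p (f i)) \<subseteq> mod_cls p ` {x. algebraic_int x}" using f by auto
    ultimately have "finite (UNIV :: nat set)"
      using finite_mod_cls[OF B p] by (meson finite_imageD finite_subset)
    then show False by simp
  qed
  then obtain i j where "i \<noteq> j" "mod_cls p (f i) = mod_cls p (f j)" by (auto simp: inj_on_def)
  then obtain i j where "i < j" "mod_cls p (f j) = mod_cls p (f i)" by (metis linorder_neqE_nat)
  then show thesis using that mod_cls_eqD by blast
qed

text \<open>Two powers of \<open>x\<close> agree modulo \<open>p\<close>, hence modulo
  \<open>P\<close>; cancelling the lower power leaves an inverse.\<close>

lemma P_inverse:
  assumes x: "algebraic_int x" "x \<notin> P"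
  shows "\<exists>v. algebraic_int v \<and> 1 - x * v \<in> P"
proof -
  obtain p where p: "Factorial_Ring.prime p" "of_nat p \<in> P" using P_prime_nat by blast
  have p0: "of_nat p \<noteq> (0::'k)" using p by auto
  obtain i j where ij: "i < j" "algebraic_int ((x ^ j - x ^ i) / of_nat p)"
    using pow_repeat[OF p(1), of "\<lambda>i. x ^ i"] algebraic_int_pow[OF x(1)] by blast
  have "x ^ j - x ^ i \<in> P" using P_mult[OF p(2) ij(2)] p0 by simp
  then have 1: "x ^ i - x ^ j \<in> P" using P_diff[OF P_0] by fastforce
  have e: "x ^ i - x ^ j = x ^ i * (1 - x * x ^ (j - i - 1))"
  proof -
    have "j = i + Suc (j - i - 1)" using ij(1) by simp
    then have "x ^ j = x ^ (i + Suc (j - i - 1))" by (rule arg_cong)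
    then have "x ^ j = x ^ i * (x * x ^ (j - i - 1))" unfolding power_add power_Suc .
    then show ?thesis by (simp add: algebra_simps)
  qed
  have "algebraic_int (1 - x * x ^ (j - i - 1))" by (intro algint x)
  then have "1 - x * x ^ (j - i - 1) \<in> P"
    using P_prime[of "x ^ i" "1 - x * x ^ (j - i - 1)"] 1 P_pow[OF x(1), of i] x algebraic_int_pow[OF x(1)] by (auto simp: e)
  then show ?thesis using algebraic_int_pow[OF x(1)] by blast
qed

text \<open>If \<open>g\<close> mapped \<open>P\<close> into itself, all \<open>g ^ i * p\<close>
  would be integral and two of them would agree modulo \<open>p\<close>; then
  \<open>g ^ j - g ^ i\<close>, and with it \<open>g\<close>, would be integral. At
  \<open>P\<close>, \<open>g\<close> is the inverse of \<open>\<pi>\<close> up to a unit.\<close>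

lemma uniformizer:
  obtains g \<pi> where "\<pi> \<in> P" "!!x. x \<in> P ==> algebraic_int (g * x)" "g * \<pi> \<notin> P"
proof -
  obtain p where p: "Factorial_Ring.prime p" "of_nat p \<in> P" using P_prime_nat by blast
  have p0: "of_nat p \<noteq> (0::'k)" using p by auto
  obtain g where g: "\<not> algebraic_int g" "!!x. x \<in> P ==> algebraic_int (g * x)" using annihilator_mod_p[OF p] by blast
  have "\<exists>\<pi>\<in>P. g * \<pi> \<notin> P"
  proof (rule ccontr)
    assume "\<not> ?thesis"
    then have st: "!!x. x \<in> P ==> g * x \<in> P" by blast
    have "g ^ i * of_nat p \<in> P" for i by (induction i) (use st p in \<open>auto simp: mult.assoc\<close>)
    then have "algebraic_int (g ^ i * of_nat p)" for i using P_sub by blast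
    then obtain i j where ij: "i < j" "algebraic_int ((g ^ j * of_nat p - g ^ i * of_nat p) / of_nat p)"
      using pow_repeat[OF p(1), of "\<lambda>i. g ^ i * of_nat p"] by blast
    have "(g ^ j * of_nat p - g ^ i * of_nat p) / of_nat p = g ^ j - g ^ i" using p0 by (simp add: field_simps)
    then have "algebraic_int g" using ij algebraic_int_of_power_diff[of g j i] by simp
    then show False using g by simp
  qed
  then show thesis using that g by blast
qed

end

lemma ideal_pow_0: "ideal_pow R I 0 = carrier R"
  by (simp add: ideal_pow_def nat_pow_def ideals_set_def)

lemma ideal_pow_Suc: "ideal_pow R I (Suc N) = ideal_prod R (ideal_pow R I N) I"
  by (simp add: ideal_pow_def nat_pow_def ideals_set_def)

lemma (in cring) ideal_pow_is_ideal: "ideal I R ==> ideal (ideal_pow R I N) R"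
  by (induction N) (auto simp: ideal_pow_0 ideal_pow_Suc oneideal intro: ideal_prod_is_ideal)

lemma (in cring) ideal_pow_1: "ideal I R ==> ideal_pow R I 1 = I"
  using ideal_prod_one[of I] ideal_prod_commute[OF oneideal, of I]
  by (simp add: ideal_pow_Suc ideal_pow_0)

lemma (in cring) ideal_pow_subset: "ideal I R ==> ideal_pow R I (Suc N) \<subseteq> ideal_pow R I N"
  unfolding ideal_pow_Suc using ideal_prod_inter[OF ideal_pow_is_ideal, of I I N] by blast

section \<open>Powers of \<open>P\<close> and coherent sequences in the completion\<close>

locale uniformized_prime = number_field_prime P for P :: "'k::field_char_0 set" +
  fixes g \<pi> :: 'k
  assumes pi_P: "\<pi> \<in> P" and g_mult: "!!x. x \<in> P ==> algebraic_int (g * x)" and g_pi: "g * \<pi> \<notin> P"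
begin

abbreviation "Ok \<equiv> integer_ring :: 'k ring"

sublocale Ok: domain Ok by (rule integer_ring_domain)

definition Pp :: "nat => 'k set" where "Pp N = ideal_pow Ok P N"

lemma Pp_ideal: "ideal (Pp N) Ok" unfolding Pp_def by (rule Ok.ideal_pow_is_ideal[OF P_ideal])

lemma Pp_0: "Pp 0 = {x. algebraic_int x}" by (simp add: Pp_def ideal_pow_0)
lemma Pp_1: "Pp 1 = P" unfolding Pp_def by (rule Ok.ideal_pow_1[OF P_ideal])
lemma Pp_Suc_sub: "x \<in> Pp (Suc N) ==> x \<in> Pp N" unfolding Pp_def using Ok.ideal_pow_subset[OF P_ideal] by blast
lemma Pp_zero: "0 \<in> Pp N" using additive_subgroup.zero_closed[OF ideal.axioms(1)[OF Pp_ideal]] by simp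
lemma Pp_add: "x \<in> Pp N ==> y \<in> Pp N ==> x + y \<in> Pp N"
  using additive_subgroup.a_closed[OF ideal.axioms(1)[OF Pp_ideal], of x N y] by simp
lemma Pp_mult: "x \<in> Pp N ==> algebraic_int y ==> x * y \<in> Pp N"
  using ideal.I_r_closed[OF Pp_ideal, of x N y] by simp
lemma Pp_mult': "x \<in> Pp N ==> algebraic_int y ==> y * x \<in> Pp N"
  using Pp_mult by (simp add: mult.commute)
lemma Pp_diff: "x \<in> Pp N ==> y \<in> Pp N ==> x - y \<in> Pp N"
  using Pp_add[of x N "y * (- 1)"] Pp_mult[of y N "- 1"] algebraic_int_1' by simp
lemma Pp_prod: "x \<in> Pp N ==> y \<in> P ==> x * y \<in> Pp (Suc N)"
  using ideal_prod.prod[of x "Pp N" y P Ok] by (simp add: Pp_def ideal_pow_Suc)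

lemma Pp_pow: "x \<in> P ==> x ^ N \<in> Pp N"
proof (induction N)
  case (Suc N)
  then show ?case using Pp_prod[of "x ^ N" N x] by (simp add: mult.commute)
qed (simp add: Pp_0 algebraic_int_1')

text \<open>In a product of elements of \<open>P\<close> the multiplier \<open>g\<close> can be
  absorbed by the last factor, at the cost of one power.\<close>

lemma Pp_g: "x \<in> Pp (Suc N) ==> g * x \<in> Pp N"
proof -
  have "x \<in> ideal_prod Ok (Pp N) P ==> g * x \<in> Pp N"
  proof (induction x rule: ideal_prod.induct)
    case (prod a b)
    then have "a * (g * b) \<in> Pp N" using Pp_mult g_mult by blast
    then show ?case by (simp add: ac_simps)
  next
    case (sum a b)
    then show ?case using Pp_add by (simp add: distrib_left)
  qed
  then show "x \<in> Pp (Suc N) ==> g * x \<in> Pp N" by (simp add: Pp_def ideal_pow_Suc)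
qed

lemma pi_O: "algebraic_int \<pi>" using P_sub[OF pi_P] .

text \<open>An inverse of \<open>g * \<pi>\<close> modulo \<open>P\<close> is improved by a
  geometric sum to one modulo \<open>Pp N\<close>.\<close>

lemma unit_mod: "\<exists>w. algebraic_int w \<and> 1 - g * \<pi> * w \<in> Pp N"
proof -
  let ?u = "g * \<pi>"
  have u: "algebraic_int ?u" using g_mult pi_P by blast
  obtain v where v: "algebraic_int v" "1 - ?u * v \<in> P" using P_inverse[OF u g_pi] by blast
  let ?x = "1 - ?u * v"
  define s where "s = (\<Sum>i<N. ?x ^ i)"
  have s: "algebraic_int s" unfolding s_def
    using algebraic_int_sum_of_int[of "{..<N}" "\<lambda>i. ?x ^ i" "\<lambda>_. 1"] algebraic_int_pow[OF P_sub[OF v(2)]] by simp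
  have "1 - ?x ^ N = (1 - ?x) * s" unfolding s_def by (rule one_diff_power_eq)
  then have e: "1 - ?u * (v * s) = ?x ^ N" by (simp add: algebra_simps)
  have "algebraic_int (v * s)" using v s by (intro algint)
  then show ?thesis using Pp_pow[OF v(2), of N] e by auto
qed

text \<open>\<open>g * x * w\<close> serves as the quotient of \<open>x\<close> by
  \<open>\<pi>\<close> modulo \<open>Pp N\<close>.\<close>

lemma pi_approx:
  assumes x: "x \<in> P"
  shows "\<exists>y. algebraic_int y \<and> x - \<pi> * y \<in> Pp N"
proof -
  obtain w where w: "algebraic_int w" "1 - g * \<pi> * w \<in> Pp N" using unit_mod by blast
  have "(1 - g * \<pi> * w) * x \<in> Pp N" using Pp_mult w x P_sub by blast
  then have "x - \<pi> * (g * x * w) \<in> Pp N" by (simp add: algebra_simps)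
  moreover have "algebraic_int (g * x * w)" using algebraic_int_add_mult(2)[OF g_mult[OF x] w(1)] .
  ultimately show ?thesis by blast
qed

lemma pi_cancel:
  assumes a: "algebraic_int a" "\<pi> * a \<in> Pp (Suc N)"
  shows "a \<in> Pp N"
proof -
  obtain w where w: "algebraic_int w" "1 - g * \<pi> * w \<in> Pp N" using unit_mod by blast
  have "(1 - g * \<pi> * w) * a \<in> Pp N" using Pp_mult w a by blast
  moreover have "(g * (\<pi> * a)) * w \<in> Pp N" using Pp_mult Pp_g a w by blast
  ultimately have "(1 - g * \<pi> * w) * a + (g * (\<pi> * a)) * w \<in> Pp N" by (rule Pp_add)
  then show ?thesis by (simp add: algebra_simps)
qed

lemma pi_pow_notin: "\<pi> ^ k \<notin> Pp (Suc k)"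
proof (induction k)
  case 0 then show ?case using Pp_1 P_1 by simp
next
  case (Suc k) then show ?case using pi_cancel[of "\<pi> ^ k" "Suc k"] algebraic_int_pow[OF pi_O] by auto
qed

lemma pi_pow_notin': "k < N ==> \<pi> ^ k \<notin> Pp N"
proof -
  have "x \<in> Pp N ==> Suc k \<le> N ==> x \<in> Pp (Suc k)" for x
    by (induction N) (auto simp: le_Suc_eq dest: Pp_Suc_sub)
  then show "k < N ==> \<pi> ^ k \<notin> Pp N" using pi_pow_notin by auto
qed

definition cs :: "nat => 'k => 'k set" where "cs N x = {y. y - x \<in> Pp N}"

lemma cs_coset: "a_r_coset Ok (Pp N) x = cs N x"
proof -
  have "y \<in> cs N x ==> \<exists>h\<in>Pp N. y = h + x" for y by (auto simp: cs_def intro: bexI[of _ "y - x"])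
  then show ?thesis by (auto simp: a_r_coset_def' cs_def)
qed

lemma cs_eq_iff: "cs N x = cs N y \<longleftrightarrow> x - y \<in> Pp N"
proof
  assume "cs N x = cs N y"
  then have "x \<in> cs N y" using Pp_zero by (auto simp: cs_def)
  then show "x - y \<in> Pp N" by (simp add: cs_def)
next
  assume a: "x - y \<in> Pp N"
  show "cs N x = cs N y"
  proof (intro equalityI subsetI)
    fix z assume "z \<in> cs N x"
    then have "(z - x) + (x - y) \<in> Pp N" using a Pp_add[of "z - x" N "x - y"] by (simp add: cs_def)
    then show "z \<in> cs N y" by (simp add: cs_def)
  next
    fix z assume "z \<in> cs N y"
    then have "(z - y) - (x - y) \<in> Pp N" using a Pp_diff[of "z - y" N "x - y"] by (auto simp: cs_def)
    then show "z \<in> cs N x" by (simp add: cs_def)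
  qed
qed

lemma cs_Suc_sub: "cs (Suc N) x \<subseteq> cs N y \<longleftrightarrow> x - y \<in> Pp N"
proof
  assume "cs (Suc N) x \<subseteq> cs N y"
  moreover have "x \<in> cs (Suc N) x" using Pp_zero by (simp add: cs_def)
  ultimately have "x \<in> cs N y" by blast
  then show "x - y \<in> Pp N" by (simp add: cs_def)
next
  assume a: "x - y \<in> Pp N"
  then have "cs N x = cs N y" by (simp add: cs_eq_iff)
  moreover have "cs (Suc N) x \<subseteq> cs N x" using Pp_Suc_sub by (auto simp: cs_def)
  ultimately show "cs (Suc N) x \<subseteq> cs N y" by simp
qed

lemma residue_simps:
  "carrier (residue_pow Ok P N) = cs N ` {x. algebraic_int x}"
  "algebraic_int x ==> algebraic_int y ==> cs N x \<otimes>\<^bsub>residue_pow Ok P N\<^esub> cs N y = cs N (x * y)"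
  "algebraic_int x ==> algebraic_int y ==> cs N x \<oplus>\<^bsub>residue_pow Ok P N\<^esub> cs N y = cs N (x + y)"
  "\<one>\<^bsub>residue_pow Ok P N\<^esub> = cs N 1" "\<zero>\<^bsub>residue_pow Ok P N\<^esub> = cs N 0"
proof -
  show "carrier (residue_pow Ok P N) = cs N ` {x. algebraic_int x}"
    by (auto simp: residue_pow_def Pp_def[symmetric] FactRing_def A_RCOSETS_def' cs_coset)
  show "cs N x \<otimes>\<^bsub>residue_pow Ok P N\<^esub> cs N y = cs N (x * y)" if "algebraic_int x" "algebraic_int y"
    using ideal.rcoset_mult_add[OF Pp_ideal, of x y N] that
    by (simp add: residue_pow_def Pp_def[symmetric] FactRing_def cs_coset)
  show "cs N x \<oplus>\<^bsub>residue_pow Ok P N\<^esub> cs N y = cs N (x + y)" if "algebraic_int x" "algebraic_int y"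
    using abelian_subgroup.a_rcos_sum[OF ideal.axioms(1)[OF Pp_ideal, THEN abelian_subgroupI3], of x y N] that Ok.is_abelian_group
    by (simp add: residue_pow_def Pp_def[symmetric] FactRing_def cs_coset)
  show "\<one>\<^bsub>residue_pow Ok P N\<^esub> = cs N 1"
    by (simp add: residue_pow_def Pp_def[symmetric] FactRing_def cs_coset)
  show "\<zero>\<^bsub>residue_pow Ok P N\<^esub> = cs N 0"
    by (simp add: residue_pow_def Pp_def[symmetric] FactRing_def cs_def)
qed

text \<open>Coherent sequences of representatives; through \<open>sq\<close> they turn arithmetic in
  the completion into arithmetic with algebraic integers.\<close>

definition Seq :: "(nat => 'k) set" where
  "Seq = {x. \<forall>N. algebraic_int (x N) \<and> x (Suc N) - x N \<in> Pp N}"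

definition sq :: "(nat => 'k) => nat => 'k set" where "sq x = (\<lambda>N. cs N (x N))"

abbreviation "Ah \<equiv> adic_completion Ok P"

lemma carrier_Ah: "carrier Ah = sq ` Seq"
proof (intro equalityI subsetI)
  fix f assume "f \<in> carrier Ah"
  then have f: "!!N. f N \<in> cs N ` {x. algebraic_int x}" "!!N. f (Suc N) \<subseteq> f N"
    by (auto simp: adic_completion_def residue_simps)
  have "\<exists>x. algebraic_int x \<and> f N = cs N x" for N using f(1)[of N] by auto
  then obtain x where x: "!!N. algebraic_int (x N) \<and> f N = cs N (x N)" by metis
  have "x \<in> Seq" using f(2) x by (auto simp: Seq_def cs_Suc_sub[symmetric])
  then show "f \<in> sq ` Seq" using x by (auto simp: sq_def)
next
  fix f assume "f \<in> sq ` Seq"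
  then obtain x where x: "f = sq x" "x \<in> Seq" by blast
  have "f (Suc N) \<subseteq> f N" for N unfolding x(1) sq_def cs_Suc_sub using x(2) by (simp add: Seq_def)
  moreover have "f N \<in> cs N ` {x. algebraic_int x}" for N using x by (simp add: Seq_def sq_def)
  ultimately show "f \<in> carrier Ah" by (simp add: adic_completion_def residue_simps)
qed

lemma Ah_simps:
  "x \<in> Seq ==> y \<in> Seq ==> sq x \<otimes>\<^bsub>Ah\<^esub> sq y = sq (\<lambda>N. x N * y N)"
  "x \<in> Seq ==> y \<in> Seq ==> sq x \<oplus>\<^bsub>Ah\<^esub> sq y = sq (\<lambda>N. x N + y N)"
  "\<one>\<^bsub>Ah\<^esub> = sq (\<lambda>N. 1)" "\<zero>\<^bsub>Ah\<^esub> = sq (\<lambda>N. 0)"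
  by (auto simp: adic_completion_def sq_def Seq_def residue_simps)

lemma SeqD: "x \<in> Seq ==> algebraic_int (x N)" "x \<in> Seq ==> x (Suc N) - x N \<in> Pp N"
  by (auto simp: Seq_def)

lemma Seq_mult: "x \<in> Seq ==> y \<in> Seq ==> (\<lambda>N. x N * y N) \<in> Seq"
proof -
  assume xy: "x \<in> Seq" "y \<in> Seq"
  have "x (Suc N) * y (Suc N) - x N * y N \<in> Pp N" for N
  proof -
    have "(x (Suc N) - x N) * y (Suc N) + x N * (y (Suc N) - y N) \<in> Pp N"
      by (intro Pp_add Pp_mult[OF SeqD(2) SeqD(1)] Pp_mult'[OF SeqD(2) SeqD(1)] xy)
    then show ?thesis by (simp add: algebra_simps)
  qed
  then show ?thesis using algebraic_int_add_mult[OF SeqD(1)[OF xy(1)] SeqD(1)[OF xy(2)]] by (simp add: Seq_def)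
qed

lemma Seq_add: "x \<in> Seq ==> y \<in> Seq ==> (\<lambda>N. x N + y N) \<in> Seq"
proof -
  assume xy: "x \<in> Seq" "y \<in> Seq"
  have "x (Suc N) + y (Suc N) - (x N + y N) \<in> Pp N" for N
  proof -
    have "(x (Suc N) - x N) + (y (Suc N) - y N) \<in> Pp N"
      by (intro Pp_add SeqD(2) xy)
    then show ?thesis by (simp add: algebra_simps)
  qed
  then show ?thesis using algebraic_int_add_mult[OF SeqD(1)[OF xy(1)] SeqD(1)[OF xy(2)]] by (simp add: Seq_def)
qed

lemma Seq_const: "algebraic_int a ==> (\<lambda>N. a) \<in> Seq"
  using Pp_zero by (simp add: Seq_def)

lemma Seq_uminus: "x \<in> Seq ==> (\<lambda>N. - x N) \<in> Seq"
  using Seq_mult[OF Seq_const[of "- 1"]] algebraic_int_1' by simp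

lemma Ah_cring: "cring Ah"
proof (rule cringI)
  show "abelian_group Ah"
  proof (rule abelian_groupI)
    fix f assume "f \<in> carrier Ah"
    then obtain x where x: "x \<in> Seq" "f = sq x" by (auto simp: carrier_Ah)
    have "sq (\<lambda>N. - x N) \<oplus>\<^bsub>Ah\<^esub> f = \<zero>\<^bsub>Ah\<^esub>" using Seq_uminus[OF x(1)] x by (simp add: Ah_simps)
    then show "\<exists>y\<in>carrier Ah. y \<oplus>\<^bsub>Ah\<^esub> f = \<zero>\<^bsub>Ah\<^esub>" using Seq_uminus[OF x(1)] by (auto simp: carrier_Ah)
  qed (auto simp: carrier_Ah Ah_simps Seq_add Seq_const algebraic_int_1' ac_simps)
  show "comm_monoid Ah"
    by (rule comm_monoidI) (auto simp: carrier_Ah Ah_simps Seq_mult Seq_const algebraic_int_1' ac_simps)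
qed (auto simp: carrier_Ah Ah_simps Seq_add Seq_mult distrib_right)

sublocale Ah: cring Ah by (rule Ah_cring)

definition ph :: "nat => 'k set" where "ph = sq (\<lambda>N. \<pi>)"

abbreviation "Mh \<equiv> completion_ideal Ok P"

lemma Mh_iff: "x \<in> Seq ==> sq x \<in> Mh \<longleftrightarrow> x 1 \<in> P"
  using cs_eq_iff[of 1 "x 1" 0] Pp_1 by (auto simp: completion_ideal_def carrier_Ah residue_simps sq_def)

lemma ph_carrier: "ph \<in> carrier Ah" by (simp add: ph_def carrier_Ah Seq_const pi_O)

lemma Seq_P:
  assumes x: "x \<in> Seq" "x 1 \<in> P"
  shows "x (Suc N) \<in> P"
proof (induction N)
  case (Suc N)
  have a: "x (Suc (Suc N)) - x (Suc N) \<in> Pp (Suc N)" using x by (auto simp: Seq_def)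
  have "y \<in> Pp (Suc k) ==> y \<in> P" for y k
  proof (induction k)
    case (Suc k) then show ?case using Pp_Suc_sub[of y "Suc k"] by simp
  qed (use Pp_1 in simp)
  from P_add[OF this[OF a] Suc] have "(x (Suc (Suc N)) - x (Suc N)) + x (Suc N) \<in> P" .
  then show ?case by simp
qed (use x in simp)

text \<open>A coherent sequence in the ideal is divided by \<open>\<pi>\<close> term by term.
  Cancelling \<open>\<pi>\<close> loses one level, so the quotient at \<open>N\<close> is taken from
  the term at \<open>N + 1\<close>.\<close>

lemma Mh_principal: "Mh = cgenideal Ah ph"
proof (intro equalityI subsetI)
  fix f assume f: "f \<in> Mh"
  then obtain x where x: "x \<in> Seq" "f = sq x" by (auto simp: completion_ideal_def carrier_Ah)
  have x1: "x 1 \<in> P" using Mh_iff[OF x(1)] f x by simp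
  have "\<exists>y. algebraic_int y \<and> x (Suc N) - \<pi> * y \<in> Pp (Suc N)" for N
    using pi_approx[OF Seq_P[OF x(1) x1]] by blast
  then obtain y where y: "!!N. algebraic_int (y N) \<and> x (Suc N) - \<pi> * y N \<in> Pp (Suc N)" by metis
  have yS: "y \<in> Seq"
    unfolding Seq_def
  proof (intro CollectI allI conjI)
    fix N show "algebraic_int (y N)" using y by blast
    have a: "x (Suc (Suc N)) - x (Suc N) \<in> Pp (Suc N)" using x(1) by (auto simp: Seq_def)
    have b: "x (Suc (Suc N)) - \<pi> * y (Suc N) \<in> Pp (Suc N)" using y[of "Suc N"] Pp_Suc_sub by blast
    have c: "x (Suc N) - \<pi> * y N \<in> Pp (Suc N)" using y by blast
    have "(x (Suc N) - \<pi> * y N) - (x (Suc (Suc N)) - \<pi> * y (Suc N)) + (x (Suc (Suc N)) - x (Suc N)) \<in> Pp (Suc N)"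
      by (intro Pp_add Pp_diff a b c)
    then have "\<pi> * (y (Suc N) - y N) \<in> Pp (Suc N)" by (simp add: algebra_simps)
    then show "y (Suc N) - y N \<in> Pp N"
      by (rule pi_cancel[OF algebraic_int_diff[OF y[THEN conjunct1] y[THEN conjunct1]]])
  qed
  have "sq x = sq (\<lambda>N. y N * \<pi>)"
    unfolding sq_def
  proof (rule ext)
    fix N
    have "x (Suc N) - \<pi> * y N \<in> Pp N" using y[of N] Pp_Suc_sub by blast
    moreover have "x (Suc N) - x N \<in> Pp N" using x(1) by (auto simp: Seq_def)
    ultimately have "(x (Suc N) - \<pi> * y N) - (x (Suc N) - x N) \<in> Pp N" by (rule Pp_diff)
    then show "cs N (x N) = cs N (y N * \<pi>)" by (simp add: cs_eq_iff algebra_simps)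
  qed
  then have "f = sq y \<otimes>\<^bsub>Ah\<^esub> ph" by (simp add: ph_def Ah_simps yS Seq_const pi_O x(2))
  then show "f \<in> cgenideal Ah ph" using yS by (auto simp: cgenideal_def carrier_Ah)
next
  fix f assume "f \<in> cgenideal Ah ph"
  then obtain y where y: "y \<in> Seq" "f = sq y \<otimes>\<^bsub>Ah\<^esub> ph" by (auto simp: cgenideal_def carrier_Ah)
  then have "f = sq (\<lambda>N. y N * \<pi>)" by (simp add: ph_def Ah_simps Seq_const pi_O)
  moreover have "y 1 * \<pi> \<in> P" using P_mult'[OF pi_P] y by (auto simp: Seq_def)
  ultimately show "f \<in> Mh" using Mh_iff[OF Seq_mult[OF y(1) Seq_const[OF pi_O]]] by simp
qed

lemma Mh_ideal: "ideal Mh Ah"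
  unfolding Mh_principal by (rule Ah.cgenideal_ideal[OF ph_carrier])

definition Mp :: "nat => (nat => 'k set) set" where "Mp N = ideal_pow Ah Mh N"

lemma Mp_ideal: "ideal (Mp N) Ah" unfolding Mp_def by (rule Ah.ideal_pow_is_ideal[OF Mh_ideal])

text \<open>Only the component at level \<open>N\<close> of the \<open>N\<close>-th power is
  controlled; this already separates it from the lower powers of \<open>ph\<close>.\<close>

lemma Mp_sub: "f \<in> Mp N ==> \<exists>x\<in>Seq. f = sq x \<and> x N \<in> Pp N"
proof (induction N arbitrary: f)
  case 0
  then show ?case by (auto simp: Mp_def ideal_pow_0 carrier_Ah Pp_0 Seq_def)
next
  case (Suc N)
  have "f \<in> ideal_prod Ah (Mp N) Mh" using Suc(2) by (simp add: Mp_def ideal_pow_Suc)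
  then show ?case
  proof (induction f rule: ideal_prod.induct)
    case (prod a b)
    obtain x where x: "x \<in> Seq" "a = sq x" "x N \<in> Pp N" using Suc(1) prod(1) by blast
    obtain y where y: "y \<in> Seq" "b = sq y" using prod(2) by (auto simp: completion_ideal_def carrier_Ah)
    have y1: "y (Suc N) \<in> P" using Seq_P[OF y(1)] Mh_iff[OF y(1)] prod(2) y(2) by simp
    have "x (Suc N) - x N + x N \<in> Pp N" using x Pp_add[of "x (Suc N) - x N" N "x N"] by (auto simp: Seq_def)
    then have "x (Suc N) * y (Suc N) \<in> Pp (Suc N)" using Pp_prod[OF _ y1] by simp
    then show ?case using x(1,2) y Seq_mult[OF x(1) y(1)]
      by (intro bexI[of _ "\<lambda>N. x N * y N"]) (simp_all add: Ah_simps)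
  next
    case (sum a b)
    then obtain x y where x: "x \<in> Seq" "a = sq x" "x (Suc N) \<in> Pp (Suc N)"
      and y: "y \<in> Seq" "b = sq y" "y (Suc N) \<in> Pp (Suc N)" by auto
    then show ?case using Seq_add[OF x(1) y(1)] Pp_add[OF x(3) y(3)]
      by (intro bexI[of _ "\<lambda>N. x N + y N"]) (simp_all add: Ah_simps)
  qed
qed

lemma ph_pow: "ph [^]\<^bsub>Ah\<^esub> N = sq (\<lambda>_. \<pi> ^ N)"
proof (induction N)
  case (Suc N)
  then have "ph [^]\<^bsub>Ah\<^esub> Suc N = sq (\<lambda>_. \<pi> ^ N) \<otimes>\<^bsub>Ah\<^esub> ph" by (simp add: nat_pow_def)
  then show ?case by (simp add: ph_def Ah_simps Seq_const algebraic_int_pow pi_O mult.commute)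
qed (simp add: nat_pow_def Ah_simps)

lemma ph_pow_Mp: "ph [^]\<^bsub>Ah\<^esub> N \<in> Mp N"
proof (induction N)
  case (Suc N)
  have "ph \<in> Mh" unfolding Mh_principal by (rule Ah.cgenideal_self[OF ph_carrier])
  then have "ph [^]\<^bsub>Ah\<^esub> N \<otimes>\<^bsub>Ah\<^esub> ph \<in> ideal_prod Ah (Mp N) Mh" using Suc by (intro ideal_prod.prod)
  then show ?case by (simp add: Mp_def ideal_pow_Suc nat_pow_def)
qed (simp add: Mp_def ideal_pow_0 nat_pow_def)

lemma ph_pow_notin:
  assumes "k < N" shows "ph [^]\<^bsub>Ah\<^esub> k \<notin> Mp N"
proof
  assume "ph [^]\<^bsub>Ah\<^esub> k \<in> Mp N"
  then obtain x where x: "x \<in> Seq" "sq (\<lambda>_. \<pi> ^ k) = sq x" "x N \<in> Pp N" using Mp_sub ph_pow by metis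
  have "cs N (\<pi> ^ k) = cs N (x N)" using fun_cong[OF x(2), of N] by (simp add: sq_def)
  then have "\<pi> ^ k - x N \<in> Pp N" by (simp add: cs_eq_iff)
  then have "\<pi> ^ k - x N + x N \<in> Pp N" using x(3) Pp_add by blast
  then show False using pi_pow_notin'[OF assms] by simp
qed

end

section \<open>The quotients of the completion as chain rings\<close>

context uniformized_prime
begin

definition qq :: nat where "qq = card (carrier (Ok Quot P))"

lemma carrier_quot_P: "carrier (Ok Quot P) = cs 1 ` {x. algebraic_int x}"
  using residue_simps(1)[of 1] by (simp only: residue_pow_def Pp_def[symmetric] Pp_1)

lemma cs1: "cs 1 x = cs 1 y \<longleftrightarrow> x - y \<in> P"
  unfolding cs_eq_iff Pp_1 ..

lemma finite_quot_P: "finite (carrier (Ok Quot P))"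
proof -
  obtain p where p: "Factorial_Ring.prime p" "of_nat p \<in> P" using P_prime_nat by blast
  have p0: "of_nat p \<noteq> (0::'k)" using p by auto
  obtain B where B: "finite B" "Modules.module.span (\<lambda>r x. of_rat r * x) B = (UNIV :: 'k set)"
    using nf by (auto simp: number_field_def)
  obtain F :: "'k set" where F: "finite F" "!!f. f \<in> F ==> algebraic_int f"
    "!!x. algebraic_int x ==> \<exists>f\<in>F. algebraic_int ((x - f) / of_nat p)" using finite_mod_p[OF B p(1)] by blast
  have "cs 1 x \<in> cs 1 ` F" if x: "algebraic_int x" for x
  proof -
    obtain f where f: "f \<in> F" "algebraic_int ((x - f) / of_nat p)" using F(3)[OF x] by blast
    have "x - f \<in> P" using P_mult[OF p(2) f(2)] p0 by simp
    then show ?thesis using f cs1 by blast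
  qed
  then have "carrier (Ok Quot P) \<subseteq> cs 1 ` F" unfolding carrier_quot_P by blast
  then show ?thesis by (rule finite_subset) (simp add: F(1))
qed

lemma qq_ge_2: "qq \<ge> 2"
proof -
  have "cs 1 0 \<noteq> cs 1 1" using P_1 P_diff[of "0 - 1" 0] cs1[of 0 1] P_diff[OF P_0, of "0 - 1"] by auto
  then have "card {cs 1 0, cs 1 1} = 2" by simp
  moreover have "{cs 1 0, cs 1 1} \<subseteq> carrier (Ok Quot P)" unfolding carrier_quot_P using algebraic_int_1' by auto
  ultimately show ?thesis unfolding qq_def using card_mono[OF finite_quot_P] by metis
qed

definition rc :: "nat => (nat => 'k set) => (nat => 'k set) set" where
  "rc N f = a_r_coset Ah (Mp N) f"

abbreviation "RN N \<equiv> residue_pow Ah Mh N"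

lemma RN_quot: "RN N = Ah Quot Mp N" by (simp add: residue_pow_def Mp_def)

lemma RN_cring: "cring (RN N)"
  unfolding RN_quot by (rule ideal.quotient_is_cring[OF Mp_ideal Ah_cring])

lemma rc_hom: "rc N \<in> Ring.ring_hom Ah (RN N)"
  using ideal.rcos_ring_hom[OF Mp_ideal, of N] by (simp add: rc_def[abs_def] RN_quot)

lemma rc_hom_cring: "ring_hom_cring Ah (RN N) (rc N)"
  by (rule RingHom.ring_hom_cringI[OF ring_hom_ringI2[OF Ah.ring_axioms cring.axioms(1)[OF RN_cring] rc_hom] Ah_cring RN_cring])

lemma carrier_RN: "carrier (RN N) = rc N ` carrier Ah"
  by (auto simp: RN_quot FactRing_def A_RCOSETS_def' rc_def)

lemma rc_eq_iff: "f \<in> carrier Ah ==> f' \<in> carrier Ah ==> rc N f = rc N f' \<longleftrightarrow> f \<ominus>\<^bsub>Ah\<^esub> f' \<in> Mp N"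
  unfolding rc_def using Ah.quotient_eq_iff_same_a_r_cos[OF Mp_ideal] by blast

lemma sq_minus:
  assumes "x \<in> Seq" "y \<in> Seq"
  shows "sq x \<ominus>\<^bsub>Ah\<^esub> sq y = sq (\<lambda>N. x N - y N)"
proof -
  have "\<ominus>\<^bsub>Ah\<^esub> sq y = sq (\<lambda>N. - y N)"
    by (rule Ah.minus_equality) (use assms Seq_uminus[OF assms(2)] in \<open>auto simp: Ah_simps carrier_Ah\<close>)
  then show ?thesis using Ah_simps(2)[OF assms(1) Seq_uminus[OF assms(2)]] by (simp add: a_minus_def)
qed

lemma Mh_iff_multiple: "f \<in> Mh \<longleftrightarrow> (\<exists>y\<in>carrier Ah. f = ph \<otimes>\<^bsub>Ah\<^esub> y)"
  unfolding Mh_principal cgenideal_def using Ah.m_comm[OF ph_carrier] by auto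

lemma Mp_sub_Mh:
  assumes N: "N > 0" shows "Mp N \<subseteq> Mh"
proof -
  have "Mp (Suc k) \<subseteq> Mh" for k
  proof (induction k)
    case 0
    show ?case using Ah.ideal_pow_1[OF Mh_ideal] by (simp add: Mp_def)
  next
    case (Suc k)
    then show ?case using Ah.ideal_pow_subset[OF Mh_ideal, of "Suc k"] by (auto simp: Mp_def)
  qed
  then show ?thesis using N by (metis gr0_implies_Suc)
qed

text \<open>Invertibility modulo \<open>ph\<close> is tested on the component at level 1, where
  \<open>P_inverse\<close> applies. Constant sequences, one for each class modulo \<open>P\<close>,
  serve as residue representatives.\<close>

lemma chain_ring_RN: "chain_ring (RN N) (rc N ph) N qq"
proof -
  interpret h: ring_hom_cring Ah "RN N" "rc N" by (rule rc_hom_cring)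
  have cst: "sq (\<lambda>_. a) \<in> carrier Ah" if "algebraic_int a" for a using Seq_const[OF that] by (auto simp: carrier_Ah)
  show ?thesis
  proof (intro chain_ring.intro RN_cring chain_ring_axioms.intro)
    show "rc N ph \<in> carrier (RN N)" using ph_carrier by (auto simp: carrier_RN)
    show "qq \<ge> 2" by (rule qq_ge_2)
    fix x assume x: "x \<in> carrier (RN N)" and nx: "!!y. y \<in> carrier (RN N) ==> x \<noteq> rc N ph \<otimes>\<^bsub>RN N\<^esub> y"
    obtain f where f: "f \<in> carrier Ah" "x = rc N f" using x by (auto simp: carrier_RN)
    obtain s where s: "s \<in> Seq" "f = sq s" using f by (auto simp: carrier_Ah)
    have "f \<notin> Mh"
    proof
      assume "f \<in> Mh"
      then obtain y where y: "y \<in> carrier Ah" "f = ph \<otimes>\<^bsub>Ah\<^esub> y" using Mh_iff_multiple by blast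
      then have "x = rc N ph \<otimes>\<^bsub>RN N\<^esub> rc N y" using f ph_carrier by simp
      then show False using nx[of "rc N y"] y by simp
    qed
    then have "s 1 \<notin> P" using Mh_iff s by simp
    then obtain v where v: "algebraic_int v" "1 - s 1 * v \<in> P" using P_inverse SeqD(1)[OF s(1)] by blast
    have sv: "(\<lambda>N. s N * v) \<in> Seq" using Seq_mult[OF s(1) Seq_const[OF v(1)]] .
    have "s 1 * v - 1 \<in> P" using P_diff[OF P_0 v(2)] by simp
    then have "sq (\<lambda>N. s N * v - 1) \<in> Mh"
      using Mh_iff[of "\<lambda>N. s N * v - 1"] Seq_add[OF sv Seq_const[of "- 1"]] algebraic_int_1' by simp
    then obtain z where z: "z \<in> carrier Ah" "sq (\<lambda>N. s N * v - 1) = ph \<otimes>\<^bsub>Ah\<^esub> z" using Mh_iff_multiple by blast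
    have "f \<otimes>\<^bsub>Ah\<^esub> sq (\<lambda>_. v) = \<one>\<^bsub>Ah\<^esub> \<oplus>\<^bsub>Ah\<^esub> ph \<otimes>\<^bsub>Ah\<^esub> z"
      unfolding z(2)[symmetric] s(2)
      using Seq_add[OF sv Seq_const[of "- 1"]] algebraic_int_1' by (simp add: Ah_simps s Seq_const v)
    then have "rc N (f \<otimes>\<^bsub>Ah\<^esub> sq (\<lambda>_. v)) = rc N (\<one>\<^bsub>Ah\<^esub> \<oplus>\<^bsub>Ah\<^esub> ph \<otimes>\<^bsub>Ah\<^esub> z)" by simp
    then have "x \<otimes>\<^bsub>RN N\<^esub> rc N (sq (\<lambda>_. v)) = \<one>\<^bsub>RN N\<^esub> \<oplus>\<^bsub>RN N\<^esub> rc N ph \<otimes>\<^bsub>RN N\<^esub> rc N z"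
      using f z(1) ph_carrier cst[OF v(1)] by simp
    then show "\<exists>y\<in>carrier (RN N). \<exists>z\<in>carrier (RN N). x \<otimes>\<^bsub>RN N\<^esub> y = \<one>\<^bsub>RN N\<^esub> \<oplus>\<^bsub>RN N\<^esub> rc N ph \<otimes>\<^bsub>RN N\<^esub> z"
      using h.hom_closed[OF cst[OF v(1)]] h.hom_closed[OF z(1)] by blast
  next
    have pw: "rc N ph [^]\<^bsub>RN N\<^esub> k = rc N (ph [^]\<^bsub>Ah\<^esub> k)" for k :: nat
      by (induction k) (use ph_carrier in simp_all)
    have zero: "rc N f = \<zero>\<^bsub>RN N\<^esub> \<longleftrightarrow> f \<in> Mp N" if "f \<in> carrier Ah" for f
      using rc_eq_iff[OF that Ah.zero_closed, of N] that by (simp add: a_minus_def)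
    show "rc N ph [^]\<^bsub>RN N\<^esub> N = \<zero>\<^bsub>RN N\<^esub>"
      unfolding pw using zero[of "ph [^]\<^bsub>Ah\<^esub> N"] ph_carrier ph_pow_Mp by simp
    show "rc N ph [^]\<^bsub>RN N\<^esub> k \<noteq> \<zero>\<^bsub>RN N\<^esub>" if "k < N" for k
      unfolding pw using zero[of "ph [^]\<^bsub>Ah\<^esub> k"] ph_carrier ph_pow_notin[OF that] by simp
    assume N: "0 < N"
    have "\<exists>a. algebraic_int a \<and> c = cs 1 a" if "c \<in> carrier (Ok Quot P)" for c
      using that unfolding carrier_quot_P by auto
    then obtain r where r: "!!c. c \<in> carrier (Ok Quot P) ==> algebraic_int (r c) \<and> c = cs 1 (r c)" by metis
    define e where "e c = rc N (sq (\<lambda>_. r c))" for c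
    have uniq: "c = c'" if c: "c \<in> carrier (Ok Quot P)" "c' \<in> carrier (Ok Quot P)" and y: "y \<in> carrier (RN N)"
      and eq: "e c \<ominus>\<^bsub>RN N\<^esub> e c' = rc N ph \<otimes>\<^bsub>RN N\<^esub> y" for c c' y
    proof -
      obtain w where w: "w \<in> carrier Ah" "y = rc N w" using y by (auto simp: carrier_RN)
      have rr: "algebraic_int (r c)" "algebraic_int (r c')" using r c by auto
      let ?d = "sq (\<lambda>_. r c) \<ominus>\<^bsub>Ah\<^esub> sq (\<lambda>_. r c')"
      have dc: "?d \<in> carrier Ah" using cst[OF rr(1)] cst[OF rr(2)] by simp
      have "rc N ?d = rc N (ph \<otimes>\<^bsub>Ah\<^esub> w)"
        using eq w cst[OF rr(1)] cst[OF rr(2)] ph_carrier by (simp add: e_def a_minus_def)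
      then have m: "?d \<ominus>\<^bsub>Ah\<^esub> ph \<otimes>\<^bsub>Ah\<^esub> w \<in> Mh"
        using rc_eq_iff[OF dc, of "ph \<otimes>\<^bsub>Ah\<^esub> w" N] ph_carrier w Mp_sub_Mh[OF N] by auto
      have pm: "ph \<otimes>\<^bsub>Ah\<^esub> w \<in> Mh" using Mh_iff_multiple w by blast
      have "(?d \<ominus>\<^bsub>Ah\<^esub> ph \<otimes>\<^bsub>Ah\<^esub> w) \<oplus>\<^bsub>Ah\<^esub> ph \<otimes>\<^bsub>Ah\<^esub> w \<in> Mh"
        using additive_subgroup.a_closed[OF ideal.axioms(1)[OF Mh_ideal] m pm] .
      moreover have "(?d \<ominus>\<^bsub>Ah\<^esub> ph \<otimes>\<^bsub>Ah\<^esub> w) \<oplus>\<^bsub>Ah\<^esub> ph \<otimes>\<^bsub>Ah\<^esub> w = ?d"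
        using dc ph_carrier w by (simp add: a_minus_def Ah.a_assoc Ah.l_neg)
      ultimately have "?d \<in> Mh" by simp
      then have "r c - r c' \<in> P"
        using Mh_iff[of "\<lambda>_. r c - r c'"] Seq_const[OF algebraic_int_diff[OF rr]]
        by (simp add: sq_minus[OF Seq_const[OF rr(1)] Seq_const[OF rr(2)]])
      then show "c = c'" using r c cs1 by metis
    qed
    show "\<exists>F\<subseteq>carrier (RN N). finite F \<and> card F = qq \<and>
      (\<forall>x\<in>carrier (RN N). \<exists>f\<in>F. \<exists>y\<in>carrier (RN N). x = f \<oplus>\<^bsub>RN N\<^esub> rc N ph \<otimes>\<^bsub>RN N\<^esub> y) \<and>
      (\<forall>f\<in>F. \<forall>f'\<in>F. \<forall>y\<in>carrier (RN N). f \<ominus>\<^bsub>RN N\<^esub> f' = rc N ph \<otimes>\<^bsub>RN N\<^esub> y --> f = f')"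
    proof (intro exI[of _ "e ` carrier (Ok Quot P)"] conjI ballI impI)
      show sub: "e ` carrier (Ok Quot P) \<subseteq> carrier (RN N)" using r cst by (auto simp: e_def carrier_RN)
      show "finite (e ` carrier (Ok Quot P))" using finite_quot_P by simp
      have "inj_on e (carrier (Ok Quot P))"
      proof (rule inj_onI)
        fix c c' assume c: "c \<in> carrier (Ok Quot P)" "c' \<in> carrier (Ok Quot P)" "e c = e c'"
        have "e c' \<in> carrier (RN N)" using sub c by blast
        then have "e c \<ominus>\<^bsub>RN N\<^esub> e c' = rc N ph \<otimes>\<^bsub>RN N\<^esub> \<zero>\<^bsub>RN N\<^esub>"
          using c(3) ph_carrier by (simp add: a_minus_def h.S.r_neg)
        then show "c = c'" by (rule uniq[OF c(1,2) h.S.zero_closed])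
      qed
      then show "card (e ` carrier (Ok Quot P)) = qq" by (simp add: card_image qq_def)
    next
      fix x assume "x \<in> carrier (RN N)"
      then obtain s where s: "s \<in> Seq" "x = rc N (sq s)" by (auto simp: carrier_RN carrier_Ah)
      have s1: "algebraic_int (s 1)" using SeqD(1)[OF s(1)] .
      define c where "c = cs 1 (s 1)"
      have c: "c \<in> carrier (Ok Quot P)" using s1 by (auto simp: carrier_quot_P c_def)
      have rr: "algebraic_int (r c)" "s 1 - r c \<in> P" using r[OF c] cs1 by (auto simp: c_def)
      have sS: "(\<lambda>N. s N - r c) \<in> Seq" using Seq_add[OF s(1) Seq_const[of "- r c"]] rr by simp
      then have "sq (\<lambda>N. s N - r c) \<in> Mh" using Mh_iff rr by simp
      then obtain y where y: "y \<in> carrier Ah" "sq (\<lambda>N. s N - r c) = ph \<otimes>\<^bsub>Ah\<^esub> y" using Mh_iff_multiple by blast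
      have "sq s = sq (\<lambda>_. r c) \<oplus>\<^bsub>Ah\<^esub> ph \<otimes>\<^bsub>Ah\<^esub> y"
        unfolding y(2)[symmetric] using sS rr by (simp add: Ah_simps Seq_const)
      then have "x = e c \<oplus>\<^bsub>RN N\<^esub> rc N ph \<otimes>\<^bsub>RN N\<^esub> rc N y"
        using s(2) cst[OF rr(1)] y(1) ph_carrier by (simp add: e_def)
      then show "\<exists>f\<in>e ` carrier (Ok Quot P). \<exists>y\<in>carrier (RN N). x = f \<oplus>\<^bsub>RN N\<^esub> rc N ph \<otimes>\<^bsub>RN N\<^esub> y"
        using c h.hom_closed[OF y(1)] by blast
    next
      fix f f' y assume "f \<in> e ` carrier (Ok Quot P)" "f' \<in> e ` carrier (Ok Quot P)" "y \<in> carrier (RN N)"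
        "f \<ominus>\<^bsub>RN N\<^esub> f' = rc N ph \<otimes>\<^bsub>RN N\<^esub> y"
      then show "f = f'" using uniq by blast
    qed
  qed
qed

end

theorem completion_chain_ring:
  fixes P :: "'k::field_char_0 set"
  assumes "number_field TYPE('k)" "primeideal P integer_ring" "P \<noteq> {0}"
  shows "\<exists>p. chain_ring (residue_pow (adic_completion integer_ring P) (completion_ideal integer_ring P) N) p N
    (card (carrier (integer_ring Quot P)))"
proof -
  interpret number_field_prime P using assms by (rule number_field_prime.intro)
  obtain g \<pi> where gp: "\<pi> \<in> P" "!!x. x \<in> P ==> algebraic_int (g * x)" "g * \<pi> \<notin> P" using uniformizer by blast
  interpret uniformized_prime P g \<pi> using gp by (intro uniformized_prime.intro uniformized_prime_axioms.intro number_field_prime_axioms)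
  show ?thesis using chain_ring_RN[of N] by (auto simp: qq_def)
qed

section \<open>Corank weights over the residue field as solutions of the elimination
  recursions\<close>

section \<open>Closed forms\<close>

lemma gauss_fact_Suc: "gauss_fact (Suc m) x = gauss_fact m x * (1 - x ^ Suc m)"
  by (simp add: gauss_fact_def gauss_def)

lemma gauss_fact_0 [simp]: "gauss_fact 0 x = 1"
  by (simp add: gauss_fact_def)

lemma gauss_fact_neq_0: "(!!k. k > 0 ==> x ^ k \<noteq> 1) ==> gauss_fact m x \<noteq> 0"
  by (auto simp: gauss_fact_def gauss_def)

lemma gauss_fact_qpoch: "i \<le> m ==> gauss_fact i x * qpoch (x ^ (i + 1)) x (m - i) = gauss_fact m x"
proof (induction m)
  case (Suc m)
  show ?case
  proof (cases "i = Suc m")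
    case False
    then have "i \<le> m" using Suc.prems by simp
    then have "x ^ (i + 1) * x ^ (m - i) = x ^ Suc m" by (metis add_Suc_right le_add_diff_inverse plus_1_eq_Suc power_add add.commute)
    then have "qpoch (x ^ (i + 1)) x (Suc m - i) = qpoch (x ^ (i + 1)) x (m - i) * (1 - x ^ Suc m)"
      using \<open>i \<le> m\<close> by (simp only: Suc_diff_le qpoch_def prod.lessThan_Suc)
    then show ?thesis using Suc.IH[OF \<open>i \<le> m\<close>] by (simp only: gauss_fact_Suc mult.assoc[symmetric])
  qed (simp add: qpoch_def)
qed (simp add: qpoch_def)

text \<open>Separates even from odd exponents. For \<open>d = 1\<close> the exponent 1 is split off,
  and the odd ones start at 3.\<close>

lemma gauss_fact_double:
  assumes "d \<in> {0, 1}"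
  shows "gauss_fact (2 * m + d) x = gauss_fact d x * gauss_fact m (x\<^sup>2) * qpoch (x ^ (2 * d + 1)) (x\<^sup>2) m"
proof (induction m)
  case (Suc m)
  have 1: "(1 - x ^ (2 * m + d + 1)) * (1 - x ^ (2 * m + d + 2)) = (1 - (x\<^sup>2) ^ Suc m) * (1 - x ^ (2 * d + 1) * (x\<^sup>2) ^ m)"
    using assms by (elim insertE; simp add: mult_2 mult_2_right power_add power_mult_distrib power2_eq_square power3_eq_cube algebra_simps)
  have "gauss_fact (2 * Suc m + d) x = gauss_fact (2 * m + d) x * ((1 - x ^ (2 * m + d + 1)) * (1 - x ^ (2 * m + d + 2)))"
    by (simp add: gauss_fact_Suc mult.assoc)
  then show ?case unfolding 1 Suc by (simp add: gauss_fact_Suc qpoch_def mult_ac)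
qed (simp add: qpoch_def)

text \<open>In the two applications, with \<open>X = 1 / q\<close>, the proportion of alternating or
  symmetric matrices of size \<open>f\<close> over the residue field that have corank
  \<open>i\<close>.\<close>

definition wp :: "complex => complex => (nat => complex) => nat => nat => complex" where
  "wp X \<alpha> M f i = (if i \<le> f then \<alpha> ^ i * (\<Prod>j<i. X ^ j) * (gauss_fact f X / gauss_fact i X) * M (f - i) else 0)"

text \<open>Iterates the weights over the levels: \<open>i\<close> is the number of indices
  surviving to the next level, each bringing a factor \<open>Q\<close>.\<close>

fun itsum :: "(nat => nat => complex) => complex => nat => nat => complex" where
  "itsum p Q 0 f = 1"
| "itsum p Q (Suc j) f = (\<Sum>i\<le>f. p f i * Q ^ i * itsum p Q j i)"

lemma sum_extend:
  fixes h :: "nat => complex"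
  shows "(!!i. i > f ==> h i = 0) ==> f \<le> f' ==> (\<Sum>i\<le>f'. h i) = (\<Sum>i\<le>f. h i)"
  by (rule sum.mono_neutral_right) (auto simp: not_le)

context
  fixes X :: complex
  assumes nz: "!!k. k > 0 ==> X ^ k \<noteq> 1"
begin

text \<open>The three terms are the fates of one row: it is processed, removed by a diagonal pivot,
  or removed with a partner. After common factors are extracted, with \<open>d = f - i\<close>, the
  recursion of \<open>M\<close> and \<open>(1 - X^i) X^(d+1) + (1 - X^(d+1)) = 1 - X^(f+1)\<close>
  remain.\<close>

lemma wp_Suc:
  assumes M: "M 0 = 1" "!!d. c1 * M d + (if d = 0 then 0 else c2 * M (d - 1)) = (1 - X ^ Suc d) * M (Suc d)"
  shows "wp X \<alpha> M (Suc f) i = \<alpha> * X ^ f * (if i = 0 then 0 else wp X \<alpha> M f (i - 1)) + c1 * wp X \<alpha> M f i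
    + c2 * (1 - X ^ f) * (if f = 0 then 0 else wp X \<alpha> M (f - 1) i)"
proof -
  consider "i > Suc f" | "i = Suc f" | "i \<le> f" by linarith
  then show ?thesis
  proof cases
    case 1 then show ?thesis by (auto simp: wp_def)
  next
    case 2 then show ?thesis using M(1) gauss_fact_neq_0[OF nz] by (auto simp: wp_def)
  next
    case 3
    define d where "d = f - i"
    have f: "f = i + d" using 3 by (simp add: d_def)
    define C where "C = \<alpha> ^ i * (gauss_fact f X / gauss_fact i X)"
    define W where "W i = (\<Prod>j<i. X ^ j)" for i
    have a: "wp X \<alpha> M (Suc f) i = C * W i * (1 - X ^ Suc f) * M (Suc d)"
      using 3 f by (simp add: wp_def C_def W_def gauss_fact_Suc)
    have b: "wp X \<alpha> M f i = C * W i * M d" using f by (simp add: wp_def C_def W_def)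
    have c: "(1 - X ^ f) * (if f = 0 then 0 else wp X \<alpha> M (f - 1) i) = C * W i * (if d = 0 then 0 else M (d - 1))"
    proof (cases "d = 0")
      case True then show ?thesis using f by (cases i) (auto simp: wp_def)
    next
      case False
      then obtain e where e: "d = Suc e" by (cases d) auto
      then have "f = Suc (i + e)" using f by simp
      then show ?thesis using e by (simp add: wp_def C_def W_def gauss_fact_Suc)
    qed
    have g: "\<alpha> * X ^ f * (if i = 0 then 0 else wp X \<alpha> M f (i - 1)) = C * W i * X ^ Suc d * (1 - X ^ i) * M (Suc d)"
    proof (cases i)
      case (Suc i')
      have "f - i' = Suc d" using f Suc by simp
      moreover have "1 - X ^ i \<noteq> 0" using nz[of i] Suc by auto
      ultimately show ?thesis using Suc f by (simp add: wp_def C_def W_def gauss_fact_Suc power_add)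
    qed simp
    have "\<alpha> * X ^ f * (if i = 0 then 0 else wp X \<alpha> M f (i - 1)) + c1 * wp X \<alpha> M f i + c2 * (1 - X ^ f) * (if f = 0 then 0 else wp X \<alpha> M (f - 1) i)
      = C * W i * X ^ Suc d * (1 - X ^ i) * M (Suc d) + C * W i * (c1 * M d + (if d = 0 then 0 else c2 * M (d - 1)))"
      unfolding g b mult.assoc[of c2 "1 - X ^ f"] c by (cases "d = 0") (simp_all add: algebra_simps)
    also have "\<dots> = C * W i * (1 - X ^ Suc f) * M (Suc d)"
      unfolding M(2) f by (simp add: algebra_simps power_add)
    finally show ?thesis unfolding a by simp
  qed
qed

lemma wp_sum:
  assumes M: "M 0 = 1" "!!d. c1 * M d + (if d = 0 then 0 else c2 * M (d - 1)) = (1 - X ^ Suc d) * M (Suc d)"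
  shows "(\<Sum>i\<le>Suc f. wp X \<alpha> M (Suc f) i * g i) = \<alpha> * X ^ f * (\<Sum>i\<le>f. wp X \<alpha> M f i * g (Suc i))
    + c1 * (\<Sum>i\<le>f. wp X \<alpha> M f i * g i) + c2 * (1 - X ^ f) * (\<Sum>i\<le>f - 1. wp X \<alpha> M (f - 1) i * g i)"
proof -
  have 1: "(\<Sum>i\<le>Suc f. (if i = 0 then 0 else wp X \<alpha> M f (i - 1)) * g i) = (\<Sum>i\<le>f. wp X \<alpha> M f i * g (Suc i))"
    unfolding sum.atMost_Suc_shift by simp
  have 2: "(\<Sum>i\<le>Suc f. wp X \<alpha> M f i * g i) = (\<Sum>i\<le>f. wp X \<alpha> M f i * g i)"
    by (rule sum_extend) (auto simp: wp_def)
  have 3: "(1 - X ^ f) * (\<Sum>i\<le>Suc f. (if f = 0 then 0 else wp X \<alpha> M (f - 1) i) * g i) = (1 - X ^ f) * (\<Sum>i\<le>f - 1. wp X \<alpha> M (f - 1) i * g i)"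
  proof (cases f)
    case (Suc f')
    have "(\<Sum>i\<le>Suc f. wp X \<alpha> M f' i * g i) = (\<Sum>i\<le>f'. wp X \<alpha> M f' i * g i)"
      by (rule sum_extend) (auto simp: wp_def Suc)
    then show ?thesis using Suc by simp
  qed simp
  have "(\<Sum>i\<le>Suc f. wp X \<alpha> M (Suc f) i * g i) = \<alpha> * X ^ f * (\<Sum>i\<le>Suc f. (if i = 0 then 0 else wp X \<alpha> M f (i - 1)) * g i)
    + c1 * (\<Sum>i\<le>Suc f. wp X \<alpha> M f i * g i) + c2 * ((1 - X ^ f) * (\<Sum>i\<le>Suc f. (if f = 0 then 0 else wp X \<alpha> M (f - 1) i) * g i))"
    unfolding wp_Suc[where M = M, OF M] sum_distrib_left by (simp only: sum.distrib[symmetric]) (simp add: algebra_simps)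
  then show ?thesis unfolding 1 2 3 by (simp add: mult.assoc)
qed

text \<open>The level descends from \<open>N\<close> in an outer induction, and the fresh indices
  are counted in an inner one. The value depends on cardinalities alone, which supplies the common
  \<open>h\<close> demanded by \<open>rec\<close>.\<close>

lemma elimination_closed_form:
  fixes E :: "nat => nat set => nat set => complex"
  assumes U: "finite U"
    and M: "M 0 = 1" "!!d. c1 * M d + (if d = 0 then 0 else c2 * M (d - 1)) = (1 - X ^ Suc d) * M (Suc d)"
    and rec: "!!k A F i h. k < N ==> A \<union> F \<subseteq> U ==> A \<inter> F = {} ==> i \<in> F ==>
      (!!j. j \<in> F ==> j \<noteq> i ==> E k A (F - {i, j}) = h) ==>
      E k A F = \<alpha> * X ^ (card F - 1) * E k (insert i A) (F - {i}) + c1 * Q ^ k * E k A (F - {i})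
        + c2 * (1 - X ^ (card F - 1)) * (Q ^ (2 * k) * h)"
    and shift: "!!k A. E k A {} = E (Suc k) {} A"
    and last: "!!S. S \<subseteq> U ==> E N {} S = Q ^ (N * card S)"
  shows "k \<le> N ==> S \<subseteq> U ==> E k {} S = Q ^ (k * card S) * itsum (wp X \<alpha> M) Q (N - k) (card S)"
proof (induction "N - k" arbitrary: k S)
  case 0
  then show ?case using last[of S] by simp
next
  case (Suc j)
  let ?p = "wp X \<alpha> M"
  have k: "k < N" "Suc k \<le> N" "j = N - Suc k" "N - k = Suc j" using Suc by auto
  have IH: "E (Suc k) {} A = Q ^ (Suc k * card A) * itsum ?p Q j (card A)" if "A \<subseteq> U" for A
    using Suc.hyps(1)[OF k(3) k(2) that] k(3) by simp
  \<comment> \<open>What remains after passing to level \<open>k + 1\<close> with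
    \<open>a + i\<close> indices, apart from the powers of \<open>Q\<close> belonging to level
    \<open>k\<close>.\<close>
  define g where "g a i = Q ^ (a + i) * itsum ?p Q j (a + i)" for a i
  have main: "E k A F = Q ^ (k * (card A + card F)) * (\<Sum>i\<le>card F. ?p (card F) i * g (card A) i)"
    if "A \<union> F \<subseteq> U" "A \<inter> F = {}" for A F
    using that
  proof (induction "card F" arbitrary: A F rule: less_induct)
    case less
    have fin: "finite A" "finite F" using less.prems U finite_subset by auto
    show ?case
    proof (cases "F = {}")
      case True
      then show ?thesis using IH[of A] less.prems shift[of k A] M(1) by (simp add: g_def wp_def power_add)
    next
      case False
      then obtain i where i: "i \<in> F" by blast
      define a f where "a = card A" and "f = card F - 1"
      have "card F > 0" using i fin by (auto simp: card_gt_0_iff)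
      then have cF: "card F = Suc f" by (simp add: f_def)
      have cFi: "card (F - {i}) = f" using i by (simp add: f_def)
      have "i \<notin> A" using i less.prems(2) by blast
      then have cA: "card (insert i A) = Suc a" using fin by (simp add: a_def)
      \<comment> \<open>For \<open>f = 0\<close> there is no partner \<open>j\<close>, and the
        coefficient \<open>1 - X ^ f\<close> vanishes; 0 is a placeholder.\<close>
      define h where "h = (if f = 0 then 0 else Q ^ (k * (a + (f - 1))) * (\<Sum>i\<le>f - 1. ?p (f - 1) i * g a i))"
      have 1: "E k (insert i A) (F - {i}) = Q ^ (k * (Suc a + f)) * (\<Sum>i\<le>f. ?p f i * g (Suc a) i)"
        using less.hyps[of "F - {i}" "insert i A"] less.prems i cF unfolding cFi cA by auto
      have 2: "E k A (F - {i}) = Q ^ (k * (a + f)) * (\<Sum>i\<le>f. ?p f i * g a i)"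
        using less.hyps[of "F - {i}" A] less.prems i cF unfolding cFi a_def by auto
      have 3: "E k A (F - {i, j}) = h" if j: "j \<in> F" "j \<noteq> i" for j
      proof -
        have "card (F - {i, j}) = card (F - {i} - {j})" by (metis Diff_insert2)
        then have c: "card (F - {i, j}) = f - 1" using j cFi by simp
        have "F - {i} \<noteq> {}" using j by blast
        then have "f \<noteq> 0" using cFi fin by (metis card_eq_0_iff finite_Diff)
        moreover have "card (F - {i, j}) < card F" unfolding c cF by simp
        moreover have "A \<union> (F - {i, j}) \<subseteq> U" "A \<inter> (F - {i, j}) = {}" using less.prems by auto
        ultimately show ?thesis using less.hyps[of "F - {i, j}" A] unfolding c a_def h_def by simp
      qed
      have 4: "(1 - X ^ f) * (Q ^ (2 * k) * h) = (1 - X ^ f) * (Q ^ (k * (a + Suc f)) * (\<Sum>i\<le>f - 1. ?p (f - 1) i * g a i))"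
      proof (cases f)
        case (Suc f')
        have "Q ^ (2 * k) * Q ^ (k * (a + f')) = Q ^ (k * (a + Suc f))" using Suc by (simp add: power_add[symmetric] algebra_simps mult_2_right)
        then show ?thesis using Suc by (simp add: h_def mult.assoc[symmetric])
      qed simp
      have gS: "g (Suc a) i = g a (Suc i)" for i by (simp add: g_def)
      have "E k A F = \<alpha> * X ^ f * E k (insert i A) (F - {i}) + c1 * Q ^ k * E k A (F - {i}) + c2 * ((1 - X ^ f) * (Q ^ (2 * k) * h))"
        using rec[OF k(1) less.prems i 3] cF by (simp add: mult.assoc)
      also have "\<dots> = Q ^ (k * (a + Suc f)) * (\<alpha> * X ^ f * (\<Sum>i\<le>f. ?p f i * g a (Suc i)) + c1 * (\<Sum>i\<le>f. ?p f i * g a i)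
          + c2 * (1 - X ^ f) * (\<Sum>i\<le>f - 1. ?p (f - 1) i * g a i))"
        unfolding 1 2 4 gS by (simp add: power_add algebra_simps)
      also have "\<dots> = Q ^ (k * (a + Suc f)) * (\<Sum>i\<le>Suc f. ?p (Suc f) i * g a i)"
        unfolding wp_sum[where M = M, OF M] ..
      finally show ?thesis unfolding cF a_def .
    qed
  qed
  have "E k {} S = Q ^ (k * card S) * (\<Sum>i\<le>card S. ?p (card S) i * g 0 i)" using main[of "{}" S] Suc.prems by simp
  then show ?case unfolding k(4) by (simp add: g_def mult.assoc)
qed

text \<open>For \<open>X = 1 / q\<close>, the proportion of matrices over the residue field with
  \<open>f\<close> rows, \<open>a + f\<close> columns and rank \<open>f - i\<close>.\<close>

definition gp :: "nat => nat => nat => complex" where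
  "gp a f i = (if i \<le> f then X ^ (i * (a + i)) * gauss_fact (a + f) X * gauss_fact f X
     / (gauss_fact i X * gauss_fact (f - i) X * gauss_fact (a + i) X) else 0)"

text \<open>A row is either zero, which leaves \<open>f\<close> rows with one more surplus column,
  or it is pivoted away together with a column.\<close>

lemma gp_Suc: "gp a (Suc f) i = X ^ (a + Suc f) * (if i = 0 then 0 else gp (Suc a) f (i - 1)) + (1 - X ^ (a + Suc f)) * gp a f i"
proof -
  note D0 = gauss_fact_neq_0[OF nz]
  consider "i > Suc f" | "i = Suc f" | "i \<le> f" by linarith
  then show ?thesis
  proof cases
    case 1 then show ?thesis by (auto simp: gp_def)
  next
    case 2 then show ?thesis using D0 by (simp add: gp_def power_add power2_eq_square algebra_simps)
  next
    case 3
    define d where "d = f - i"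
    have f: "f = i + d" using 3 by (simp add: d_def)
    define C where "C = X ^ (i * (a + i)) * gauss_fact (a + f) X * gauss_fact f X / (gauss_fact i X * gauss_fact (Suc d) X * gauss_fact (a + i) X)"
    have n0: "1 - X ^ Suc d \<noteq> 0" "i > 0 ==> 1 - X ^ i \<noteq> 0" using nz[of "Suc d"] nz[of i] by auto
    have a: "gp a (Suc f) i = C * (1 - X ^ (a + Suc f)) * (1 - X ^ Suc f)"
      using 3 f by (simp add: gp_def C_def gauss_fact_Suc)
    have b: "gp a f i = C * (1 - X ^ Suc d)" using f n0 D0 by (simp add: gp_def C_def gauss_fact_Suc mult.assoc)
    have g: "X ^ (a + Suc f) * (if i = 0 then 0 else gp (Suc a) f (i - 1)) = C * (1 - X ^ (a + Suc f)) * X ^ Suc d * (1 - X ^ i)"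
    proof (cases i)
      case (Suc i')
      have "f - i' = Suc d" using f Suc by simp
      moreover have "X ^ (a + Suc f) * X ^ (i' * (Suc a + i')) = X ^ (i * (a + i)) * X ^ Suc d"
        unfolding power_add[symmetric] f Suc by (simp add: algebra_simps)
      then have e: "X ^ (a + Suc f) * (X ^ (i' * (Suc a + i')) * z) = X ^ (i * (a + i)) * (X ^ Suc d * z)" for z
        by (metis mult.assoc)
      ultimately have "X ^ (a + Suc f) * gp (Suc a) f i' = X ^ (i * (a + i)) * (X ^ Suc d * (gauss_fact (a + f) X * (1 - X ^ (a + Suc f)) * gauss_fact f X
        / (gauss_fact i' X * gauss_fact (Suc d) X * gauss_fact (a + i) X)))"
        using Suc f unfolding e[symmetric] by (simp add: gp_def gauss_fact_Suc)
      also have "\<dots> = C * (1 - X ^ (a + Suc f)) * X ^ Suc d * (1 - X ^ i)"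
      proof -
        have "gauss_fact i X = gauss_fact i' X * (1 - X ^ i)" unfolding Suc by (rule gauss_fact_Suc)
        moreover have "P * (S * (D1 * y * D2 / (G * H * K))) = P * D1 * D2 / (G * w * H * K) * y * S * w"
          if "w \<noteq> 0" "G \<noteq> 0" "H \<noteq> 0" "K \<noteq> 0" for P S D1 y D2 G H K w :: complex
          using that by (simp add: field_simps)
        ultimately show ?thesis using n0(2) D0 Suc unfolding C_def by (simp only:) blast
      qed
      finally show ?thesis using Suc by simp
    qed simp
    have "C * (1 - X ^ (a + Suc f)) * X ^ Suc d * (1 - X ^ i) + (1 - X ^ (a + Suc f)) * (C * (1 - X ^ Suc d))
      = C * (1 - X ^ (a + Suc f)) * (1 - X ^ Suc f)"
      unfolding f by (simp add: algebra_simps power_add)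
    then show ?thesis unfolding a b g by simp
  qed
qed

lemma gp_sum: "(\<Sum>i\<le>Suc f. gp a (Suc f) i * g i) = X ^ (a + Suc f) * (\<Sum>i\<le>f. gp (Suc a) f i * g (Suc i))
    + (1 - X ^ (a + Suc f)) * (\<Sum>i\<le>f. gp a f i * g i)"
proof -
  have 1: "(\<Sum>i\<le>Suc f. (if i = 0 then 0 else gp (Suc a) f (i - 1)) * g i) = (\<Sum>i\<le>f. gp (Suc a) f i * g (Suc i))"
    unfolding sum.atMost_Suc_shift by simp
  have 2: "(\<Sum>i\<le>Suc f. gp a f i * g i) = (\<Sum>i\<le>f. gp a f i * g i)"
    by (rule sum_extend) (auto simp: gp_def)
  have "(\<Sum>i\<le>Suc f. gp a (Suc f) i * g i) = X ^ (a + Suc f) * (\<Sum>i\<le>Suc f. (if i = 0 then 0 else gp (Suc a) f (i - 1)) * g i)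
    + (1 - X ^ (a + Suc f)) * (\<Sum>i\<le>Suc f. gp a f i * g i)"
    unfolding gp_Suc sum_distrib_left by (simp only: sum.distrib[symmetric]) (simp add: algebra_simps)
  then show ?thesis unfolding 1 2 .
qed

text \<open>As \<open>card C = card A + card F\<close> throughout, the surplus \<open>a\<close> of
  columns over fresh rows is the number of processed rows.\<close>

lemma elimination_closed_form_G:
  fixes E :: "nat => nat set => nat set => nat set => complex"
  assumes U: "finite U"
    and rec: "!!k A F C i h. k < N ==> A \<union> F \<subseteq> U ==> C \<subseteq> U ==> A \<inter> F = {} ==> i \<in> F ==>
      (!!c. c \<in> C ==> E k A (F - {i}) (C - {c}) = h) ==>
      E k A F C = X ^ card C * E k (insert i A) (F - {i}) C + (1 - X ^ card C) * (Q ^ k * h)"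
    and shift: "!!k A C. E k A {} C = E (Suc k) {} A C"
    and last: "!!S C. S \<subseteq> U ==> C \<subseteq> U ==> card C = card S ==> E N {} S C = Q ^ (N * card S)"
  shows "k \<le> N ==> S \<subseteq> U ==> C \<subseteq> U ==> card C = card S ==> E k {} S C = Q ^ (k * card S) * itsum (gp 0) Q (N - k) (card S)"
proof (induction "N - k" arbitrary: k S C)
  case 0
  then show ?case using last[of S C] by simp
next
  case (Suc j)
  let ?p = "gp 0"
  have k: "k < N" "Suc k \<le> N" "j = N - Suc k" "N - k = Suc j" using Suc by auto
  have IH: "E (Suc k) {} A C = Q ^ (Suc k * card A) * itsum ?p Q j (card A)" if "A \<subseteq> U" "C \<subseteq> U" "card C = card A" for A C
    using Suc.hyps(1)[OF k(3) k(2) that] k(3) by simp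
  define g where "g a i = Q ^ (a + i) * itsum ?p Q j (a + i)" for a i
  have main: "E k A F C = Q ^ (k * (card A + card F)) * (\<Sum>i\<le>card F. gp (card A) (card F) i * g (card A) i)"
    if "A \<union> F \<subseteq> U" "A \<inter> F = {}" "C \<subseteq> U" "card C = card A + card F" for A F C
    using that
  proof (induction "card F" arbitrary: A F C)
    case 0
    then have "finite F" using U finite_subset by auto
    then have "F = {}" using 0 by simp
    then show ?case using IH[of A C] 0 shift[of k A C] gauss_fact_neq_0[OF nz] by (simp add: g_def gp_def power_add)
  next
    case (Suc f)
    have fin: "finite A" "finite F" using Suc.prems U finite_subset by auto
    obtain i where i: "i \<in> F" using Suc.hyps(2) by fastforce
    define a where "a = card A"
    have cFi: "f = card (F - {i})" using i Suc.hyps(2) by simp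
    have "i \<notin> A" using i Suc.prems(2) by blast
    then have cA: "card (insert i A) = Suc a" using fin by (simp add: a_def)
    have cC: "card C = a + Suc f" using Suc.prems(4) Suc.hyps(2) by (simp add: a_def)
    have h: "insert i A \<union> (F - {i}) \<subseteq> U" "insert i A \<inter> (F - {i}) = {}" "A \<union> (F - {i}) \<subseteq> U" "A \<inter> (F - {i}) = {}"
      using Suc.prems i by auto
    have "card C = card (insert i A) + card (F - {i})" using cC cA cFi by simp
    then have 1: "E k (insert i A) (F - {i}) C = Q ^ (k * (Suc a + f)) * (\<Sum>i\<le>f. gp (Suc a) f i * g (Suc a) i)"
      using Suc.hyps(1)[OF cFi h(1,2) Suc.prems(3)] unfolding cA cFi[symmetric] by blast
    have 2: "E k A (F - {i}) (C - {c}) = Q ^ (k * (a + f)) * (\<Sum>i\<le>f. gp a f i * g a i)" if c: "c \<in> C" for c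
    proof -
      have "card (C - {c}) = card A + card (F - {i})" "C - {c} \<subseteq> U" using cC c cFi Suc.prems(3) by (auto simp: a_def)
      then show ?thesis
        using Suc.hyps(1)[OF cFi h(3,4)] unfolding cFi[symmetric] a_def by blast
    qed
    have gS: "g (Suc a) i = g a (Suc i)" for i by (simp add: g_def)
    have "E k A F C = X ^ card C * E k (insert i A) (F - {i}) C + (1 - X ^ card C) * (Q ^ k * (Q ^ (k * (a + f)) * (\<Sum>i\<le>f. gp a f i * g a i)))"
      by (rule rec[OF k(1) Suc.prems(1,3,2) i 2])
    also have "\<dots> = Q ^ (k * (a + Suc f)) * (X ^ (a + Suc f) * (\<Sum>i\<le>f. gp (Suc a) f i * g a (Suc i)) + (1 - X ^ (a + Suc f)) * (\<Sum>i\<le>f. gp a f i * g a i))"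
      unfolding 1 cC gS by (simp add: power_add algebra_simps)
    also have "\<dots> = Q ^ (k * (a + Suc f)) * (\<Sum>i\<le>Suc f. gp a (Suc f) i * g a i)" unfolding gp_sum ..
    finally show ?case unfolding Suc.hyps(2)[symmetric] a_def .
  qed
  have "E k {} S C = Q ^ (k * card S) * (\<Sum>i\<le>card S. gp 0 (card S) i * g 0 i)" using main[of "{}" S C] Suc.prems by simp
  then show ?case unfolding k(4) by (simp add: g_def mult.assoc)
qed

text \<open>For \<open>X = 1 / q\<close>, multiplication by \<open>gauss_fact d X\<close> turns
  \<open>MF d\<close> and \<open>MH d\<close> into the proportions of invertible matrices among the
  alternating and the symmetric ones of size \<open>d\<close>.\<close>

definition MF :: "nat => complex" where "MF d = (if even d then 1 / gauss_fact (d div 2) (X\<^sup>2) else 0)"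

definition MH :: "nat => complex" where "MH d = 1 / gauss_fact (d div 2) (X\<^sup>2)"

lemma MF_odd: "odd d ==> MF d = 0"
  by (simp add: MF_def)

lemma nz2: "k > 0 ==> (X\<^sup>2) ^ k \<noteq> 1"
  using nz[of "2 * k"] by (simp add: power_mult)

lemma gauss_fact_2: "1 / gauss_fact c (X\<^sup>2) = (1 - X ^ (2 * Suc c)) * (1 / gauss_fact (Suc c) (X\<^sup>2))"
proof -
  have "X ^ (2 * Suc c) = (X\<^sup>2) ^ Suc c" by (rule power_mult)
  then show ?thesis using nz2[of "Suc c"] by (simp only: gauss_fact_Suc) simp
qed

text \<open>The recursion required of \<open>M\<close> with \<open>c1 = 0\<close> and
  \<open>c2 = 1\<close>: an alternating matrix has no diagonal pivot.\<close>

lemma MF: "MF 0 = 1" "0 * MF d + (if d = 0 then 0 else 1 * MF (d - 1)) = (1 - X ^ Suc d) * MF (Suc d)"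
proof -
  show "MF 0 = 1" by (simp add: MF_def)
  show "0 * MF d + (if d = 0 then 0 else 1 * MF (d - 1)) = (1 - X ^ Suc d) * MF (Suc d)"
  proof (cases "even d")
    case False
    then obtain c where c: "d = Suc (2 * c)" by (elim oddE) simp
    then show ?thesis using gauss_fact_2[of c] by (simp add: MF_def)
  qed (auto simp: MF_def)
qed

text \<open>The recursion required of \<open>M\<close> with \<open>c1 = 1 - X\<close>, the
  proportion of unit diagonal entries, and \<open>c2 = X\<close>.\<close>

lemma MH: "MH 0 = 1" "(1 - X) * MH d + (if d = 0 then 0 else X * MH (d - 1)) = (1 - X ^ Suc d) * MH (Suc d)"
proof -
  show "MH 0 = 1" by (simp add: MH_def)
  show "(1 - X) * MH d + (if d = 0 then 0 else X * MH (d - 1)) = (1 - X ^ Suc d) * MH (Suc d)"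
  proof (cases "even d")
    case True
    then obtain c where c: "d = 2 * c" by blast
    show ?thesis
    proof (cases c)
      case (Suc e)
      have "d - 1 = Suc (2 * e)" using c Suc by simp
      then have m: "MH (d - 1) = (1 - X ^ d) * MH d" "MH (Suc d) = MH d"
        using gauss_fact_2[of e] c Suc by (simp_all add: MH_def)
      show ?thesis using c Suc unfolding m by (simp add: algebra_simps)
    qed (use c in \<open>simp add: MH_def\<close>)
  next
    case False
    then obtain c where c: "d = Suc (2 * c)" by (elim oddE) simp
    then have "MH (d - 1) = MH d" "MH d = (1 - X ^ Suc d) * MH (Suc d)" using gauss_fact_2[of c] by (simp_all add: MH_def)
    then show ?thesis using c by (simp add: algebra_simps)
  qed
qed

text \<open>Coranks have the parity of the size, so both are indexed by half. Even exponents of the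
  two factorials form the Gaussian binomial in \<open>X^2\<close>, odd ones the Pochhammer
  factor.\<close>

lemma step_F:
  assumes d: "d \<in> {0, 1}" and i: "i \<le> m"
  shows "wp X 1 MF (2 * m + d) (2 * i + d) = (\<Prod>j<2 * i + d. X ^ j) * step_poly (FType d) m i X"
proof -
  have D0: "gauss_fact (2 * i + d) X \<noteq> 0" by (rule gauss_fact_neq_0[OF nz])
  have e: "qpoch (X ^ (2 * d + 1)) (X\<^sup>2) m = qpoch (X ^ (2 * d + 1)) (X\<^sup>2) i * qpoch (X ^ (2 * (i + d) + 1)) (X\<^sup>2) (m - i)"
  proof -
    have "X ^ (2 * d + 1) * (X\<^sup>2) ^ i = X ^ (2 * d + 1 + 2 * i)" by (simp only: power_mult[symmetric] power_add)
    also have "2 * d + 1 + 2 * i = 2 * (i + d) + 1" by simp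
    finally have h: "X ^ (2 * d + 1) * (X\<^sup>2) ^ i = X ^ (2 * (i + d) + 1)" .
    show ?thesis using qpoch_add[of "X ^ (2 * d + 1)" "X\<^sup>2" i "m - i"] unfolding h le_add_diff_inverse[OF i] .
  qed
  have "2 * m + d - (2 * i + d) = 2 * (m - i)" using i by simp
  then have "wp X 1 MF (2 * m + d) (2 * i + d) = (\<Prod>j<2 * i + d. X ^ j) * (gauss_fact (2 * m + d) X / gauss_fact (2 * i + d) X * (1 / gauss_fact (m - i) (X\<^sup>2)))"
    using i by (simp add: wp_def MF_def)
  also have "gauss_fact (2 * m + d) X / gauss_fact (2 * i + d) X * (1 / gauss_fact (m - i) (X\<^sup>2)) = step_poly (FType d) m i X"
    using D0 unfolding gauss_fact_double[OF d] e by (simp add: gauss_binom_def)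
  finally show ?thesis .
qed

lemma step_G:
  assumes i: "i \<le> m"
  shows "gp 0 m i = X ^ (i * i) * step_poly GType m i X"
  using i gauss_fact_neq_0[OF nz] unfolding step_poly.simps gauss_binom_def gp_def
  by (simp add: gauss_fact_qpoch[OF i, of X, symmetric] del: power_Suc)

lemma step_H:
  assumes i: "i \<le> m"
  shows "wp X X MH m i = X ^ i * (\<Prod>j<i. X ^ j) * step_poly HType m i X"
proof -
  have "qpoch (X\<^sup>2) (X\<^sup>2) c = gauss_fact c (X\<^sup>2)" for c using gauss_fact_qpoch[of 0 c "X\<^sup>2"] by simp
  then show ?thesis using i gauss_fact_neq_0[OF nz] unfolding step_poly.simps wp_def MH_def
    by (simp add: gauss_fact_qpoch[OF i, of X, symmetric] inverse_eq_divide del: power_Suc)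
qed

end

lemma prod_power_choose: "(\<Prod>j<i. X ^ j) = (X :: complex) ^ (i choose 2)"
  by (induction i) (simp_all add: power_add numeral_2_eq_2)

section \<open>From average kernel sizes to the bivariate series\<close>

section \<open>The bivariate zeta function\<close>

lemma card_pairs_less: "card {(i, j). 1 \<le> i \<and> i < j \<and> j \<le> m} = m choose 2"
  and finite_pairs_less: "finite {(i, j). 1 \<le> i \<and> i < j \<and> j \<le> (m :: nat)}"
proof -
  have fin: "finite {(i, j). 1 \<le> i \<and> i < j \<and> j \<le> (m :: nat)}" for m
    by (rule finite_subset[of _ "{1..m} \<times> {1..m}"]) auto
  show "finite {(i, j). 1 \<le> i \<and> i < j \<and> j \<le> (m :: nat)}" by (rule fin)
  show "card {(i, j). 1 \<le> i \<and> i < j \<and> j \<le> m} = m choose 2"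
  proof (induction m)
    case 0
    have "{(i, j). 1 \<le> i \<and> i < j \<and> j \<le> (0 :: nat)} = {}" by auto
    then show ?case by (simp only: card.empty) simp
  next
    case (Suc m)
    have e: "{(i, j). 1 \<le> i \<and> i < j \<and> j \<le> Suc m} = {(i, j). 1 \<le> i \<and> i < j \<and> j \<le> m} \<union> {1..m} \<times> {Suc m}"
      by (auto simp: le_Suc_eq)
    have "card ({(i, j). 1 \<le> i \<and> i < j \<and> j \<le> m} \<union> {1..m} \<times> {Suc m}) = (m choose 2) + card ({1..m} \<times> {Suc m})"
      unfolding Suc[symmetric] by (rule card_Un_disjoint[OF fin]) auto
    then show ?case unfolding e by (simp add: card_cartesian_product numeral_2_eq_2)
  qed
qed

lemma card_pairs_le: "card {(i, j). 1 \<le> i \<and> i \<le> j \<and> j \<le> m} = (m + 1) choose 2"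
  and finite_pairs_le: "finite {(i, j). 1 \<le> i \<and> i \<le> j \<and> j \<le> (m :: nat)}"
proof -
  have e: "{(i, j). 1 \<le> i \<and> i \<le> j \<and> j \<le> m} = (\<lambda>(i, j). (i, j - 1)) ` {(i, j). 1 \<le> i \<and> i < j \<and> j \<le> m + 1}"
  proof (intro equalityI subsetI)
    fix y assume "y \<in> {(i, j). 1 \<le> i \<and> i \<le> j \<and> j \<le> m}"
    then have "(fst y, Suc (snd y)) \<in> {(i, j). 1 \<le> i \<and> i < j \<and> j \<le> m + 1}" "y = (\<lambda>(i, j). (i, j - 1)) (fst y, Suc (snd y))" by auto
    then show "y \<in> (\<lambda>(i, j). (i, j - 1)) ` {(i, j). 1 \<le> i \<and> i < j \<and> j \<le> m + 1}" by blast
  qed auto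
  show "finite {(i, j). 1 \<le> i \<and> i \<le> j \<and> j \<le> (m :: nat)}" unfolding e by (rule finite_imageI[OF finite_pairs_less])
  have "inj_on (\<lambda>(i, j). (i, j - 1)) {(i, j). 1 \<le> i \<and> i < j \<and> j \<le> m + 1}" by (auto simp: inj_on_def)
  then show "card {(i, j). 1 \<le> i \<and> i \<le> j \<and> j \<le> m} = (m + 1) choose 2" unfolding e by (simp only: card_image card_pairs_less)
qed

context chain_ring
begin

lemma Xq_power_neq_1: "k > 0 ==> Xq ^ k \<noteq> 1"
proof
  assume k: "k > 0" and "Xq ^ k = 1"
  then have "(of_nat (q ^ k) :: complex) = of_nat 1" by (simp add: power_one_over)
  then have "q ^ k = 1" by (simp only: of_nat_eq_iff)
  moreover have "1 < q ^ k" using one_less_power[of q k] q2 k by simp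
  ultimately show False by linarith
qed

text \<open>The factor \<open>r\<close> counts the extensions of a central character to its radical
  and the power encodes their degree; combined they give the exponent \<open>1 + s / 2\<close> of
  \<open>r\<close>.\<close>

lemma radical_term:
  "of_nat r * (of_nat (q ^ m) / of_nat r) powr (- s / 2) = (Qt (- s / 2)) ^ m * of_nat r powr (1 + s / 2)"
proof (cases "r = 0")
  case False
  let ?z = "- s / 2" and ?y = "complex_of_real (real (q ^ m) / real r)"
  have "Qt ?z ^ m = of_nat (q ^ m) powr ?z" using powr_scale[of m 1 ?z] by simp
  also have "(of_nat (q ^ m) :: complex) = of_nat r * ?y" using False by simp
  also have "(of_nat r * ?y) powr ?z = of_nat r powr ?z * ?y powr ?z" by (rule powr_times_real) simp_all
  also have "?y = of_nat (q ^ m) / of_nat r" by simp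
  finally have 1: "Qt ?z ^ m = of_nat r powr ?z * (of_nat (q ^ m) / of_nat r) powr ?z" .
  have "(of_nat r :: complex) powr (1 + s / 2) * of_nat r powr ?z = of_nat r powr (1 + s / 2 + ?z)" by (simp only: powr_add)
  also have "\<dots> = of_nat r" using False by simp
  finally show ?thesis unfolding 1 by (simp add: mult_ac)
qed simp

lemma zeta_irr_average:
  assumes fin: "finite (y_indices T n)"
  shows "zeta_irr (point_group T n R) s = of_nat q ^ (N * card (y_indices T n)) * Qt (- s / 2) ^ (N * num_x T n) *
    avg (box (y_indices T n) (\<lambda>_. 0)) (wt (1 + s / 2) T n {1..num_x T n})"
proof -
  let ?Y = "y_indices T n" and ?S = "{1..num_x T n}"
  have b: "?Y \<rightarrow>\<^sub>E carrier R = box ?Y (\<lambda>_. 0)" by (simp add: box_def J_0)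
  have "card (box ?Y (\<lambda>_. 0)) = q ^ (N * card ?Y)" by (simp add: card_box[OF fin] J_0 card_R power_mult)
  then have a: "(\<Sum>w\<in>box ?Y (\<lambda>_. 0). wt (1 + s / 2) T n ?S w) = of_nat q ^ (N * card ?Y) * avg (box ?Y (\<lambda>_. 0)) (wt (1 + s / 2) T n ?S)"
    using q2 by (simp add: avg_def)
  have "of_nat (card (Rad ?S (form T n w))) * (of_nat (card (carrier R) ^ num_x T n) / of_nat (card (Rad ?S (form T n w)))) powr (- s / 2)
    = Qt (- s / 2) ^ (N * num_x T n) * wt (1 + s / 2) T n ?S w" for w
    using radical_term[of "card (Rad ?S (form T n w))" "N * num_x T n" s] by (simp only: wt_def card_R power_mult)
  then show ?thesis unfolding zeta_irr_point_group b by (simp only: sum_distrib_left[symmetric] a) (simp only: mult_ac)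
qed

lemma zeta_irr_F:
  "zeta_irr (point_group (FType d) n R) s = of_nat q ^ (N * ((2 * n + d) choose 2)) * Qt (- s / 2) ^ (N * (2 * n + d)) *
    itsum (wp Xq 1 (MF Xq)) (Qt (1 + s / 2)) N (2 * n + d)"
proof -
  let ?U = "{1..2 * n + d}" and ?\<tau> = "1 + s / 2"
  have Y: "y_indices (FType d) n = {(i, j). 1 \<le> i \<and> i < j \<and> j \<le> 2 * n + d}" by simp
  have "EF ?\<tau> d n 0 {} ?U = Qt ?\<tau> ^ (0 * card ?U) * itsum (wp Xq 1 (MF Xq)) (Qt ?\<tau>) (N - 0) (card ?U)"
  proof (rule elimination_closed_form[where U = ?U and ?c1.0 = 0 and ?c2.0 = 1 and E = "EF ?\<tau> d n", OF Xq_power_neq_1 _ MF(1)[OF Xq_power_neq_1] MF(2)[OF Xq_power_neq_1]])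
    fix k A F i h
    assume k: "k < N" and sub: "A \<union> F \<subseteq> ?U" and d: "A \<inter> F = {}" and i: "i \<in> F"
      and h: "!!j. j \<in> F ==> j \<noteq> i ==> EF ?\<tau> d n k A (F - {i, j}) = h"
    have fin: "finite A" "finite F" using sub by (blast intro: finite_subset[OF _ finite_atLeastAtMost])+
    show "EF ?\<tau> d n k A F = 1 * Xq ^ (card F - 1) * EF ?\<tau> d n k (insert i A) (F - {i}) + 0 * Qt ?\<tau> ^ k * EF ?\<tau> d n k A (F - {i})
      + 1 * (1 - Xq ^ (card F - 1)) * (Qt ?\<tau> ^ (2 * k) * h)"
      using EF_rec[OF fin d i k h] by simp
  qed (auto simp: EF_shift intro: EF_end finite_subset)
  moreover have "box (YF ?U) (touch 0 {}) = box (y_indices (FType d) n) (\<lambda>_. 0)"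
  proof -
    have "YF ?U = y_indices (FType d) n" by (auto simp: YF_def)
    then show ?thesis by (simp only:) (rule box_cong, simp add: touch_def)
  qed
  ultimately have "avg (box (y_indices (FType d) n) (\<lambda>_. 0)) (wt ?\<tau> (FType d) n ?U) = itsum (wp Xq 1 (MF Xq)) (Qt ?\<tau>) N (2 * n + d)"
    by (simp add: EF_def del: y_indices.simps)
  moreover have "finite (y_indices (FType d) n)" unfolding Y by (rule finite_pairs_less)
  moreover have "card (y_indices (FType d) n) = (2 * n + d) choose 2" unfolding Y by (rule card_pairs_less)
  ultimately show ?thesis using zeta_irr_average[of "FType d" n s] by (simp del: y_indices.simps)
qed

text \<open>\<open>Q\<close> is a square because an index surviving in \<open>W\<close> stands for a
  row and a column of the alternating matrix, and both enlarge the kernel.\<close>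

lemma zeta_irr_G:
  "zeta_irr (point_group GType n R) s = of_nat q ^ (N * n\<^sup>2) * Qt (- s / 2) ^ (N * (2 * n)) *
    itsum (gp Xq 0) (Qt (1 + s / 2) ^ 2) N n"
proof -
  let ?U = "{1..n}" and ?\<tau> = "1 + s / 2"
  have Y: "y_indices GType n = ?U \<times> ?U" by auto
  have "EG ?\<tau> n 0 {} ?U ?U = (Qt ?\<tau> ^ 2) ^ (0 * card ?U) * itsum (gp Xq 0) (Qt ?\<tau> ^ 2) (N - 0) (card ?U)"
  proof (rule elimination_closed_form_G[where U = ?U and E = "EG ?\<tau> n", OF Xq_power_neq_1])
    fix k A F C i h
    assume k: "k < N" and sub: "A \<union> F \<subseteq> ?U" "C \<subseteq> ?U" and d: "A \<inter> F = {}" and i: "i \<in> F"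
      and h: "!!c. c \<in> C ==> EG ?\<tau> n k A (F - {i}) (C - {c}) = h"
    show "EG ?\<tau> n k A F C = Xq ^ card C * EG ?\<tau> n k (insert i A) (F - {i}) C + (1 - Xq ^ card C) * ((Qt ?\<tau> ^ 2) ^ k * h)"
      using EG_rec[OF sub d i k h] by (simp add: power_mult)
  next
    fix S C :: "nat set" assume "S \<subseteq> ?U" "C \<subseteq> ?U" "card C = card S"
    then show "EG ?\<tau> n N {} S C = (Qt ?\<tau> ^ 2) ^ (N * card S)"
      using EG_end[of S n C ?\<tau>] by (simp add: power_mult[symmetric] mult_2[symmetric] mult_ac)
  qed (auto simp: EG_shift)
  moreover have "box (?U \<times> ?U) (touch1 0 {}) = box (y_indices GType n) (\<lambda>_. 0)"
    unfolding Y by (rule box_cong) (simp add: touch1_def)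
  moreover have "SG n ?U ?U = {1..2 * n}"
  proof (intro equalityI subsetI)
    fix l assume l: "l \<in> {1..2 * n}"
    show "l \<in> SG n ?U ?U"
    proof (cases "l \<le> n")
      case False
      then have "l = n + (l - n)" "l - n \<in> ?U" using l by auto
      then show ?thesis unfolding SG_def by blast
    qed (use l in \<open>auto simp: SG_def\<close>)
  qed (auto simp: SG_def)
  ultimately have "avg (box (y_indices GType n) (\<lambda>_. 0)) (wt ?\<tau> GType n {1..2 * n}) = itsum (gp Xq 0) (Qt ?\<tau> ^ 2) N n"
    by (simp add: EG_def del: y_indices.simps)
  moreover have "finite (y_indices GType n)" "card (y_indices GType n) = n\<^sup>2" unfolding Y by (simp_all add: power2_eq_square)
  ultimately show ?thesis using zeta_irr_average[of GType n s] by (simp del: y_indices.simps)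
qed

lemma zeta_irr_H:
  "zeta_irr (point_group HType n R) s = of_nat q ^ (N * ((n + 1) choose 2)) * Qt (- s / 2) ^ (N * (2 * n)) *
    itsum (wp Xq Xq (MH Xq)) (Qt (1 + s / 2) ^ 2) N n"
proof -
  let ?U = "{1..n}" and ?\<tau> = "1 + s / 2"
  have Y: "y_indices HType n = {(i, j). 1 \<le> i \<and> i \<le> j \<and> j \<le> n}" by simp
  have "EH ?\<tau> n 0 {} ?U = (Qt ?\<tau> ^ 2) ^ (0 * card ?U) * itsum (wp Xq Xq (MH Xq)) (Qt ?\<tau> ^ 2) (N - 0) (card ?U)"
  proof (rule elimination_closed_form[where U = ?U and ?c1.0 = "1 - Xq" and ?c2.0 = Xq and E = "EH ?\<tau> n", OF Xq_power_neq_1 _ MH(1)[OF Xq_power_neq_1] MH(2)[OF Xq_power_neq_1]])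
    fix k A F i h
    assume k: "k < N" and sub: "A \<union> F \<subseteq> ?U" and d: "A \<inter> F = {}" and i: "i \<in> F"
      and h: "!!j. j \<in> F ==> j \<noteq> i ==> EH ?\<tau> n k A (F - {i, j}) = h"
    have "(Qt ?\<tau> ^ 2) ^ k = Qt ?\<tau> ^ (2 * k)" "(Qt ?\<tau> ^ 2) ^ (2 * k) = Qt ?\<tau> ^ (4 * k)" by (simp_all add: power_mult[symmetric])
    moreover have "x * (y * a + (1 - y) * (z * h)) + (1 - x) * (w * b) = x * y * a + (1 - x) * w * b + x * (1 - y) * (z * h)"
      for x y z w a b h :: complex by (simp add: algebra_simps)
    moreover have "EH ?\<tau> n k A F = Xq * (Xq ^ (card F - 1) * EH ?\<tau> n k (insert i A) (F - {i})
        + (1 - Xq ^ (card F - 1)) * (Qt ?\<tau> ^ (4 * k) * h)) + (1 - Xq) * (Qt ?\<tau> ^ (2 * k) * EH ?\<tau> n k A (F - {i}))"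
      by (rule EH_rec[OF sub d i k]) (rule h)
    ultimately show "EH ?\<tau> n k A F = Xq * Xq ^ (card F - 1) * EH ?\<tau> n k (insert i A) (F - {i}) + (1 - Xq) * (Qt ?\<tau> ^ 2) ^ k * EH ?\<tau> n k A (F - {i})
      + Xq * (1 - Xq ^ (card F - 1)) * ((Qt ?\<tau> ^ 2) ^ (2 * k) * h)"
      by (simp only:)
  next
    fix S assume "S \<subseteq> ?U"
    then show "EH ?\<tau> n N {} S = (Qt ?\<tau> ^ 2) ^ (N * card S)"
      using EH_end[of S n ?\<tau>] by (simp add: power_mult[symmetric] mult_ac)
  qed (auto simp: EH_shift)
  moreover have "box (YH ?U) (touch 0 {}) = box (y_indices HType n) (\<lambda>_. 0)"
  proof -
    have "YH ?U = y_indices HType n" by (auto simp: YH_def)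
    then show ?thesis by (simp only:) (rule box_cong, simp add: touch_def)
  qed
  moreover have "SG n ?U ?U = {1..2 * n}"
  proof (intro equalityI subsetI)
    fix l assume l: "l \<in> {1..2 * n}"
    show "l \<in> SG n ?U ?U"
    proof (cases "l \<le> n")
      case False
      then have "l = n + (l - n)" "l - n \<in> ?U" using l by auto
      then show ?thesis unfolding SG_def by blast
    qed (use l in \<open>auto simp: SG_def\<close>)
  qed (auto simp: SG_def)
  ultimately have "avg (box (y_indices HType n) (\<lambda>_. 0)) (wt ?\<tau> HType n {1..2 * n}) = itsum (wp Xq Xq (MH Xq)) (Qt ?\<tau> ^ 2) N n"
    by (simp add: EH_def del: y_indices.simps)
  moreover have "finite (y_indices HType n)" unfolding Y by (rule finite_pairs_le)
  moreover have "card (y_indices HType n) = (n + 1) choose 2" unfolding Y by (rule card_pairs_le)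
  ultimately show ?thesis using zeta_irr_average[of HType n s] by (simp del: y_indices.simps)
qed

end

lemma step_poly_diag: "(!!k. k > 0 ==> X ^ k \<noteq> 1) ==> step_poly T m m X = 1"
proof -
  assume X: "!!k. k > 0 ==> X ^ k \<noteq> 1"
  then have "gauss_fact m X \<noteq> 0" by (rule gauss_fact_neq_0)
  moreover have "gauss_fact m (X\<^sup>2) \<noteq> 0"
    by (rule gauss_fact_neq_0) (use X in \<open>simp add: power_mult[symmetric]\<close>)
  ultimately show ?thesis by (cases T) (simp_all add: gauss_binom_def qpoch_def)
qed

text \<open>The scale \<open>t\<close> belongs to \<open>n\<close>, while sizes \<open>m\<close> up
  to \<open>n\<close> run through auxiliary series; the zeta function is the one for
  \<open>m = n\<close>. \<open>fi\<close> translates \<open>m\<close> into a matrix size and skips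
  sizes that the weights cannot reach.\<close>

lemma bivariate_zeta_recursion:
  fixes X :: complex
  assumes bt: "!!N. bivariate_term T n R M q s1 s2 N = t ^ N * itsum p Q N (fi n)"
    and x: "!!i. i \<le> n ==> norm (qmonomial T n q s1 s2 i) < 1"
    and X: "!!k. k > 0 ==> X ^ k \<noteq> 1"
    and step: "!!m i. m \<le> n ==> i \<le> m ==> p (fi m) (fi i) * (Q ^ fi i * t) = step_poly T m i X * qmonomial T n q s1 s2 i"
    and supp: "!!m j. m \<le> n ==> j \<le> fi m ==> j \<notin> fi ` {..m} ==> p (fi m) j = 0"
    and fi: "strict_mono fi"
  shows "summable (bivariate_term T n R M q s1 s2) \<and>
    bivariate_zeta T n R M q s1 s2 = 1 / (1 - qmonomial T n q s1 s2 n) * (\<Sum>I\<in>Pow {..<n}. f_poly T n I X *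
      (\<Prod>i\<in>I. qmonomial T n q s1 s2 i / (1 - qmonomial T n q s1 s2 i)))"
proof -
  define u where "u m N = t ^ N * itsum p Q N (fi m)" for m N
  let ?x = "qmonomial T n q s1 s2"
  have rec: "u m (Suc N) = (\<Sum>i\<le>m. step_poly T m i X * ?x i * u i N)" if m: "m \<le> n" for m N
  proof -
    have "(\<Sum>j\<le>fi m. p (fi m) j * Q ^ j * itsum p Q N j) = (\<Sum>j\<in>fi ` {..m}. p (fi m) j * Q ^ j * itsum p Q N j)"
      by (rule sum.mono_neutral_right) (use supp[OF m] strict_mono_less_eq[OF fi] in auto)
    also have "\<dots> = (\<Sum>i\<le>m. p (fi m) (fi i) * Q ^ fi i * itsum p Q N (fi i))"
      using sum.reindex[OF strict_mono_imp_inj_on[OF fi, of "{..m}"], of "\<lambda>j. p (fi m) j * Q ^ j * itsum p Q N j"] by (simp add: o_def)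
    finally have "u m (Suc N) = (\<Sum>i\<le>m. (p (fi m) (fi i) * (Q ^ fi i * t)) * (t ^ N * itsum p Q N (fi i)))"
      by (simp add: u_def sum_distrib_left mult_ac)
    also have "\<dots> = (\<Sum>i\<le>m. step_poly T m i X * ?x i * u i N)" using step[OF m] by (intro sum.cong) (simp_all add: u_def)
    finally show ?thesis .
  qed
  have "summable (\<lambda>N. norm (u n N)) \<and>
    suminf (u n) = 1 / (1 - ?x n) * (\<Sum>I\<in>Pow {..<n}. f_poly T n I X * (\<Prod>i\<in>I. ?x i / (1 - ?x i)))"
    by (rule chain_recursion_sums[where n = n and u = u and x = ?x and e = "\<lambda>m i. step_poly T m i X" and E = "\<lambda>m I. f_poly T m I X", OF x _ rec])
      (auto simp: step_poly_diag[OF X] f_poly_empty f_poly_insert u_def)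
  moreover have "u n = bivariate_term T n R M q s1 s2" by (intro ext) (simp add: u_def bt)
  ultimately show ?thesis unfolding bivariate_zeta_def by (auto dest: summable_norm_cancel)
qed

text \<open>Collects the powers of \<open>q\<close> of one transition into a single exponent, to be
  compared with \<open>qmonomial\<close>.\<close>

lemma powr_monomial:
  assumes "q > 0"
  shows "(1 / of_nat q) ^ c * ((of_nat q powr z) ^ e * (of_nat q ^ y * (of_nat q powr a) ^ b * of_nat q powr w))
    = (of_nat q :: complex) powr (of_nat e * z + of_nat y + of_nat b * a + w - of_nat c)"
  using assms by (simp add: powr_add powr_diff powr_power powr_nat' power_one_over mult_ac)

text \<open>\<open>Re s2\<close> exceeds the constant part of the exponent, and
  \<open>Re s1 > 0\<close> makes the remaining term nonpositive.\<close>

lemma norm_qmonomial_less_1: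
  assumes q: "q \<ge> 2" and s: "Re s1 > \<sigma>" "Re s2 > \<sigma>" and \<sigma>: "\<sigma> \<ge> 0" "real_of_int (abar T n i) \<le> \<sigma>"
  shows "norm (qmonomial T n q s1 s2 i) < 1"
proof -
  let ?z = "of_int (abar T n i) - of_nat (n - i) * s1 - s2"
  have "0 \<le> real (n - i) * Re s1" using s \<sigma> by (intro mult_nonneg_nonneg) auto
  moreover have "Re ?z = real_of_int (abar T n i) - real (n - i) * Re s1 - Re s2" by simp
  ultimately have "Re ?z < 0" using s \<sigma> by linarith
  then have "real q powr Re ?z < real q powr 0" using q by (intro powr_less_mono) auto
  moreover have "norm (qmonomial T n q s1 s2 i) = real q powr Re ?z"
    unfolding qmonomial_def using norm_powr_real_powr[of "of_nat q" ?z] by simp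
  ultimately show ?thesis using q by simp
qed

theorem theorem1p6:
  fixes P :: "'k::field_char_0 set"
    and T :: lattice_type
    and n d q :: nat
  assumes "number_field TYPE('k)"
    and "n \<ge> 1"
    and "d \<in> {0, 1}"
    and "T \<in> {FType d, GType, HType}"
    and "primeideal P integer_ring"
    and "P \<noteq> {0}"
    and "q = card (carrier (integer_ring Quot P))"
  shows "\<exists>\<sigma>::real. \<forall>s1 s2 :: complex. Re s1 > \<sigma> \<longrightarrow> Re s2 > \<sigma> \<longrightarrow>
           summable (bivariate_term T n (adic_completion integer_ring P) (completion_ideal integer_ring P) q s1 s2) \<and>
           bivariate_zeta T n (adic_completion integer_ring P) (completion_ideal integer_ring P) q s1 s2 =
             1 / (1 - of_nat q powr (of_int (abar T n n) - s2)) *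
             (\<Sum>I\<in>Pow {0..n-1}. f_poly T n I (inverse (of_nat q)) *
                (\<Prod>i\<in>I. qmonomial T n q s1 s2 i / (1 - qmonomial T n q s1 s2 i)))"
proof -
  let ?R = "adic_completion integer_ring P" and ?M = "completion_ideal integer_ring P"
  obtain p where cr: "chain_ring (residue_pow ?R ?M N) (p N) N q" for N
    using completion_chain_ring[OF assms(1,5,6)] unfolding assms(7) by metis
  interpret c0: chain_ring "residue_pow ?R ?M 0" "p 0" 0 q by (rule cr)
  have q: "q \<ge> 2" "q > 0" using c0.q2 by auto
  define X where "X = (1 / of_nat q :: complex)"
  have X: "X ^ k \<noteq> 1" if "k > 0" for k unfolding X_def by (rule c0.Xq_power_neq_1[OF that])
  \<comment> \<open>Bounds 0 and all exponents \<open>abar T n i\<close>, so that beyond it every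
    ratio of the recursion has norm below 1.\<close>
  define \<sigma> where "\<sigma> = real_of_int (Max (insert 0 (abar T n ` {..n})))"
  have \<sigma>: "\<sigma> \<ge> 0" "real_of_int (abar T n i) \<le> \<sigma>" if "i \<le> n" for i
    using Max_ge[of "insert 0 (abar T n ` {..n})" 0] Max_ge[of "insert 0 (abar T n ` {..n})" "abar T n i"] that
    unfolding \<sigma>_def by (simp_all del: Max_insert)
  show ?thesis
  proof (intro exI[of _ \<sigma>] allI impI)
    fix s1 s2 :: complex assume s: "Re s1 > \<sigma>" "Re s2 > \<sigma>"
    have x: "norm (qmonomial T n q s1 s2 i) < 1" if "i \<le> n" for i
      by (rule norm_qmonomial_less_1[OF q(1) s \<sigma>[OF that]])
    let ?Q = "of_nat q powr (1 + s1 / 2) :: complex"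
    \<comment> \<open>The factor that a term gains, apart from \<open>itsum\<close>, when the level
      grows by one: \<open>y\<close> counts central coordinates, \<open>b\<close> the
      \<open>x\<close> coordinates.\<close>
    define tt where "tt y b = (of_nat q ^ y * (of_nat q powr (- s1 / 2)) ^ b * of_nat q powr (- s2) :: complex)" for y b :: nat
    have bt: "bivariate_term T n ?R ?M q s1 s2 N = tt y b ^ N * z"
      if "zeta_irr (point_group T n (residue_pow ?R ?M N)) s1 = of_nat q ^ (N * y) * (of_nat q powr (- s1 / 2)) ^ (N * b) * z" for N y b z
      using that q unfolding bivariate_term_def tt_def
      by (simp add: power_mult_distrib power_mult[symmetric] powr_power mult_ac)
    have "summable (bivariate_term T n ?R ?M q s1 s2) \<and>
      bivariate_zeta T n ?R ?M q s1 s2 = 1 / (1 - qmonomial T n q s1 s2 n) * (\<Sum>I\<in>Pow {..<n}. f_poly T n I X *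
        (\<Prod>i\<in>I. qmonomial T n q s1 s2 i / (1 - qmonomial T n q s1 s2 i)))"
    proof -
      consider "T = FType d" | "T = GType" | "T = HType" using assms(4) by blast
      then show ?thesis
      proof cases
        case 1
        let ?y = "(2 * n + d) choose 2" and ?b = "2 * n + d"
        show ?thesis
        proof (rule bivariate_zeta_recursion[where fi = "\<lambda>m. 2 * m + d" and p = "wp X 1 (MF X)" and t = "tt ?y ?b" and Q = ?Q, OF _ x X])
          show "bivariate_term T n ?R ?M q s1 s2 N = tt ?y ?b ^ N * itsum (wp X 1 (MF X)) ?Q N (2 * n + d)" for N
            using chain_ring.zeta_irr_F[OF cr, where s = s1 and N = N] unfolding 1 X_def by (intro bt[unfolded 1]) blast
          show "wp X 1 (MF X) (2 * m + d) (2 * i + d) * (?Q ^ (2 * i + d) * tt ?y ?b) = step_poly T m i X * qmonomial T n q s1 s2 i"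
            if mi: "m \<le> n" "i \<le> m" for m i
          proof -
            \<comment> \<open>The origin of \<open>abar\<close>: the binomial of the full size
              counts the coordinates of \<open>w\<close>, the summand \<open>2 * i + d\<close> comes
              from \<open>\<tau>\<close>, and the subtracted binomial from the corank
              weight.\<close>
            have e: "of_nat (2 * i + d) * (1 + s1 / 2) + of_nat ?y + of_nat ?b * (- s1 / 2) + - s2 - of_nat ((2 * i + d) choose 2)
              = of_int (abar T n i) - of_nat (n - i) * s1 - s2"
              using mi unfolding 1 by (simp add: of_nat_diff field_simps)
            have h: "X ^ ((2 * i + d) choose 2) * (?Q ^ (2 * i + d) * tt ?y ?b) = qmonomial T n q s1 s2 i"
              using powr_monomial[OF q(2), of "(2 * i + d) choose 2" "1 + s1 / 2" "2 * i + d" ?y "- s1 / 2" ?b "- s2"]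
              unfolding qmonomial_def X_def tt_def e .
            have w: "wp X 1 (MF X) (2 * m + d) (2 * i + d) = X ^ ((2 * i + d) choose 2) * step_poly (FType d) m i X"
              using step_F[OF X assms(3) mi(2)] by (simp only: prod_power_choose)
            show ?thesis unfolding w h[symmetric] unfolding 1 by (simp only: mult_ac)
          qed
          show "wp X 1 (MF X) (2 * m + d) j = 0" if j: "j \<le> 2 * m + d" "j \<notin> (\<lambda>m. 2 * m + d) ` {..m}" for m j
          proof -
            \<comment> \<open>A size missed by \<open>fi\<close> differs from
              \<open>2 * m + d\<close> by an odd number, and no alternating matrix of odd size is
              invertible.\<close>
            have "odd (2 * m + d - j)"
            proof
              assume "even (2 * m + d - j)"
              then obtain c where c: "2 * m + d - j = 2 * c" by blast
              then have "c \<le> m" using assms(3) by auto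
              then have "j = 2 * (m - c) + d" using c j(1) by auto
              then show False using j(2) by auto
            qed
            then have "MF X (2 * m + d - j) = 0" using MF_odd[of X "2 * m + d - j"] X by blast
            then show ?thesis by (simp add: wp_def)
          qed
        qed (auto intro: strict_monoI)
      next
        case 2
        let ?y = "n\<^sup>2" and ?b = "2 * n"
        show ?thesis
        proof (rule bivariate_zeta_recursion[where fi = "\<lambda>m. m" and p = "gp X 0" and t = "tt ?y ?b" and Q = "?Q ^ 2", OF _ x X])
          show "bivariate_term T n ?R ?M q s1 s2 N = tt ?y ?b ^ N * itsum (gp X 0) (?Q ^ 2) N n" for N
            using chain_ring.zeta_irr_G[OF cr, where s = s1 and N = N] unfolding 2 X_def by (intro bt[unfolded 2]) blast
          show "gp X 0 m i * ((?Q ^ 2) ^ i * tt ?y ?b) = step_poly T m i X * qmonomial T n q s1 s2 i"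
            if mi: "m \<le> n" "i \<le> m" for m i
          proof -
            have e: "of_nat (2 * i) * (1 + s1 / 2) + of_nat ?y + of_nat ?b * (- s1 / 2) + - s2 - of_nat (i * i)
              = of_int (abar T n i) - of_nat (n - i) * s1 - s2"
              using mi unfolding 2 by (simp add: of_nat_diff field_simps power2_eq_square)
            have h: "X ^ (i * i) * (?Q ^ (2 * i) * tt ?y ?b) = qmonomial T n q s1 s2 i"
              using powr_monomial[OF q(2), of "i * i" "1 + s1 / 2" "2 * i" ?y "- s1 / 2" ?b "- s2"]
              unfolding qmonomial_def X_def tt_def e .
            have w: "gp X 0 m i = X ^ (i * i) * step_poly GType m i X" using step_G[OF X mi(2)] .
            have p: "(?Q ^ 2) ^ i = ?Q ^ (2 * i)" by (simp only: power_mult)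
            show ?thesis unfolding w p h[symmetric] unfolding 2 by (simp only: mult_ac)
          qed
        qed (auto intro: strict_monoI)
      next
        case 3
        let ?y = "(n + 1) choose 2" and ?b = "2 * n"
        show ?thesis
        proof (rule bivariate_zeta_recursion[where fi = "\<lambda>m. m" and p = "wp X X (MH X)" and t = "tt ?y ?b" and Q = "?Q ^ 2", OF _ x X])
          show "bivariate_term T n ?R ?M q s1 s2 N = tt ?y ?b ^ N * itsum (wp X X (MH X)) (?Q ^ 2) N n" for N
            using chain_ring.zeta_irr_H[OF cr, where s = s1 and N = N] unfolding 3 X_def by (intro bt[unfolded 3]) blast
          show "wp X X (MH X) m i * ((?Q ^ 2) ^ i * tt ?y ?b) = step_poly T m i X * qmonomial T n q s1 s2 i"
            if mi: "m \<le> n" "i \<le> m" for m i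
          proof -
            have e: "of_nat (2 * i) * (1 + s1 / 2) + of_nat ?y + of_nat ?b * (- s1 / 2) + - s2 - of_nat ((i + 1) choose 2)
              = of_int (abar T n i) - of_nat (n - i) * s1 - s2"
              using mi unfolding 3 by (simp add: of_nat_diff field_simps)
            have h: "X ^ ((i + 1) choose 2) * (?Q ^ (2 * i) * tt ?y ?b) = qmonomial T n q s1 s2 i"
              using powr_monomial[OF q(2), of "(i + 1) choose 2" "1 + s1 / 2" "2 * i" ?y "- s1 / 2" ?b "- s2"]
              unfolding qmonomial_def X_def tt_def e .
            \<comment> \<open>The factor from \<open>\<alpha> = X\<close> turns
              \<open>i choose 2\<close> into the number of independent entries of a symmetric matrix
              of size \<open>i\<close>.\<close>
            have "X ^ i * X ^ (i choose 2) = X ^ ((i + 1) choose 2)" by (simp add: power_add numeral_2_eq_2)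
            then have w: "wp X X (MH X) m i = X ^ ((i + 1) choose 2) * step_poly HType m i X"
              using step_H[OF X mi(2)] by (simp only: prod_power_choose)
            have p: "(?Q ^ 2) ^ i = ?Q ^ (2 * i)" by (simp only: power_mult)
            show ?thesis unfolding w p h[symmetric] unfolding 3 by (simp only: mult_ac)
          qed
        qed (auto intro: strict_monoI)
      qed
    qed
    moreover have "qmonomial T n q s1 s2 n = of_nat q powr (of_int (abar T n n) - s2)" by (simp add: qmonomial_def)
    moreover have "{..<n} = {0..n-1}" using assms(2) by auto
    moreover have "X = inverse (of_nat q)" by (simp add: X_def inverse_eq_divide)
    ultimately show "summable (bivariate_term T n ?R ?M q s1 s2) \<and>
           bivariate_zeta T n ?R ?M q s1 s2 =
             1 / (1 - of_nat q powr (of_int (abar T n n) - s2)) *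
             (\<Sum>I\<in>Pow {0..n-1}. f_poly T n I (inverse (of_nat q)) *
                (\<Prod>i\<in>I. qmonomial T n q s1 s2 i / (1 - qmonomial T n q s1 s2 i)))"
      by (simp only:)
  qed
qed

end
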